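(* Let $n\ge 1$ be the number of replicas. Suppose that $(\beta,h)$ satisfies the high temperature condition: there is $C_0>0$ with $\mathbb E[\langle (R_{1,2}-q_2)^6\rangle]\le C_0/N^3$ for all $N$. Let $\beta$ be small enough so that $\mathrm{Id}-\beta^2\mathfrak A$ is invertible, $\mathfrak A$ being the replica matrix defined in the context. Then there exists a positive semi-definite covariance matrix $\mathfrak C:\mathbb R^{2n}\to\mathbb R^{2n}$ so that, for every $F\in\mathcal F_{2n}$, every multivariable polynomial $G:\mathbb R^{2n}\to\mathbb R$ and every $1\le i\le n$, $$\nu\left(\mathcal E^i_N\,GF(\mathcal X^n_N)\right)=\Big[\mathfrak C\cdot\nu\big(\nabla (GF)(\mathcal X^n_N)\big)\Big]_i+Er(F,G),$$ $$\nu\left(\mathcal M^i_N\,GF(\mathcal X^n_N)\right)=\Big[\mathfrak C\cdot\nu\big(\nabla (GF)(\mathcal X^n_N)\big)\Big]_{n+i}+Er(F,G).$$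
   Context: Let $\beta\ge 0$ be the inverse temperature and $h\in\mathbb R$ the external field. For each $N$ let $(g_{i,j})_{1\le i<j\le N}$ be i.i.d. standard Gaussian random variables, with expectation $\mathbb E$ over them. For $\sigma\in\{-1,1\}^N$ let $E_N(\sigma)=\sum_{i<j}\frac{1}{\sqrt N}g_{i,j}\sigma_i\sigma_j$, $M_N(\sigma)=\frac1N\sum_i\sigma_i$, $H_N=E_N+NhM_N$. The quenched Gibbs measure gives $\sigma$ probability proportional to $e^{\beta H_N(\sigma)}$; $\langle\cdot\rangle$ is expectation over replicas $\sigma^1,\sigma^2,\dots$, i.i.d. from this measure given the couplings, and $\nu(\cdot)=\mathbb E[\langle\cdot\rangle]$. Let $z$ be standard Gaussian, $q_2$ the solution of $q_2=\mathbb E[\tanh^2(\beta\sqrt{q_2}\,z+h)]$, and $q_p=\mathbb E[\tanh^p(\beta\sqrt{q_2}\,z+h)]$. Let $R_{1,2}=\frac1N\sum_i\sigma_i^1\sigma_i^2$, $\mathcal E_N=\frac1{\sqrt N}E_N-\frac{\beta\sqrt N}{2}(1-q_2^2)$, $\mathcal M_N=\sqrt N(M_N-q_1)$; $\mathcal E^i_N,\mathcal M^i_N$ are these quantities evaluated at replica $\sigma^i$, and $\mathcal X^n_N=(\mathcal E_N^1,\dots,\mathcal E_N^n,\mathcal M_N^1,\dots,\mathcal M_N^n)\in\mathbb R^{2n}$. $\mathcal F_{2n}$ is the set of bounded $C^1$ functions $F:\mathbb R^{2n}\to\mathbb R$ with $\nabla F$ globally Lipschitz. $GF(x)=G(x)F(x)$.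 For a polynomial $G$ of total degree $d$, $C_G>0$ is a constant with $|\partial_{x_{i_1}}\cdots\partial_{x_{i_m}}G(x)|\le C_G(1+\|x\|_2)^d$ for each $m$-tuple of indices, uniformly in $m$. $Er(F,G)$ denotes any term satisfying $$|Er(F,G)|\le\{1+\|F\|_\infty+\|\nabla F\|_\infty+\mathrm{Lip}(\nabla F)\}\Big\{1+C_G\,\nu\big((1+\|\mathcal X^n_N\|_2)^{2d}\big)^{1/2}\Big\}\frac{C}{\sqrt N},$$ where $C>0$ may depend on $n,\beta,h$ but not on $F,G,N$. Replica matrix. For two pairs of distinct indices put $\tilde{\mathfrak A}^{k,k'}_{r,r'}=1-q_2^2$, $q_2-q_2^2$, or $q_4-q_2^2$ according to whether $\{k,k'\}$ and $\{r,r'\}$ have two, one or no indices in common. $\mathfrak A$ is the $\binom{n+2}{2}\times\binom{n+2}{2}$ matrix indexed by the ordered pairs $1\le r<r'\le n+2$, $1\le k<k'\le n+2$ with entries $\mathfrak A^{k,k'}_{r,r'}$ equal to: - $\tilde{\mathfrak A}^{k,k'}_{r,r'}$ if $r'\le k'\le n$ or $r'<k'=n+1$; - $-n\tilde{\mathfrak A}^{k,k'}_{r,r'}$ if $k'\le n$, $r'=n+1$; - $\binom{n+1}{2}\tilde{\mathfrak A}^{k,k'}_{r,r'}$ if $k'\le n$, $r=n+1$; - $\tilde{\mathfrak A}^{k,n+1}_{r,n+1}-(n+1)\tilde{\mathfrak A}^{k,n+1}_{r,n+2}$ if $k'=n+1$, $r'=n+1$; - $-(n+1)\tilde{\mathfrak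 A}^{k,n+1}_{n+1,n+2}+\binom{n+2}{2}(q_4-q_2^2)$ if $k'=n+1$, $r=n+1$, $r'=n+2$; - $1-q_2^2-2(n+2)(q_2-q_2^2)+\binom{n+3}{2}(q_4-q_2^2)$ if both pairs are $\{n+1,n+2\}$; - $0$ otherwise (a case glossed as "i.e. $r\le n$, $r'=n+2$"). *)

theory Defs
  imports "HOL-Probability.Probability"
begin

section \<open>The Sherrington--Kirkpatrick model\<close>

definition std_gauss :: "real measure" where
  "std_gauss = density lborel (\<lambda>x. ennreal (std_normal_density x))"

definition site_pairs :: "nat \<Rightarrow> (nat \<times> nat) set" where
  "site_pairs N = {(i, j). 1 \<le> i \<and> i < j \<and> j \<le> N}"

text \<open>Everything below depends on the couplings only through their law, so they are taken to be
  the coordinate functions on the product Gaussian space.\<close>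

definition couplings :: "nat \<Rightarrow> (nat \<times> nat \<Rightarrow> real) measure" where
  "couplings N = PiM (site_pairs N) (\<lambda>_. std_gauss)"

definition configs :: "nat \<Rightarrow> (nat \<Rightarrow> real) set" where
  "configs N = PiE {1..N} (\<lambda>_. {-1, 1})"

definition energy :: "nat \<Rightarrow> (nat \<times> nat \<Rightarrow> real) \<Rightarrow> (nat \<Rightarrow> real) \<Rightarrow> real" where
  "energy N g \<sigma> = (\<Sum>(i, j)\<in>site_pairs N. 1 / sqrt (real N) * g (i, j) * \<sigma> i * \<sigma> j)"

definition magnetization :: "nat \<Rightarrow> (nat \<Rightarrow> real) \<Rightarrow> real" where
  "magnetization N \<sigma> = 1 / real N * (\<Sum>i = 1..N. \<sigma> i)"

definition overlap :: "nat \<Rightarrow> (nat \<Rightarrow> real) \<Rightarrow> (nat \<Rightarrow> real) \<Rightarrow> real" where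
  "overlap N \<sigma> \<tau> = 1 / real N * (\<Sum>i = 1..N. \<sigma> i * \<tau> i)"

definition hamiltonian :: "nat \<Rightarrow> real \<Rightarrow> (nat \<times> nat \<Rightarrow> real) \<Rightarrow> (nat \<Rightarrow> real) \<Rightarrow> real" where
  "hamiltonian N h g \<sigma> = energy N g \<sigma> + real N * h * magnetization N \<sigma>"

definition gibbs :: "nat \<Rightarrow> real \<Rightarrow> real \<Rightarrow> (nat \<times> nat \<Rightarrow> real) \<Rightarrow> (nat \<Rightarrow> real) \<Rightarrow> real" where
  "gibbs N \<beta> h g \<sigma> =
     exp (\<beta> * hamiltonian N h g \<sigma>) / (\<Sum>\<tau>\<in>configs N. exp (\<beta> * hamiltonian N h g \<tau>))"

text \<open>Quenched and averaged expectation of a function of the couplings and of the replicas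
  labelled by a finite set \<open>I\<close>.\<close>

definition replica_avg ::
  "nat \<Rightarrow> real \<Rightarrow> real \<Rightarrow> (nat \<times> nat \<Rightarrow> real) \<Rightarrow> 'r set \<Rightarrow>
    (('r \<Rightarrow> nat \<Rightarrow> real) \<Rightarrow> 'v::real_vector) \<Rightarrow> 'v" where
  "replica_avg N \<beta> h g I f =
     (\<Sum>s\<in>PiE I (\<lambda>_. configs N). (\<Prod>r\<in>I. gibbs N \<beta> h g (s r)) *\<^sub>R f s)"

definition nu ::
  "nat \<Rightarrow> real \<Rightarrow> real \<Rightarrow> 'r set \<Rightarrow>
    ((nat \<times> nat \<Rightarrow> real) \<Rightarrow> ('r \<Rightarrow> nat \<Rightarrow> real) \<Rightarrow> 'v::{banach, second_countable_topology}) \<Rightarrow> 'v" where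
  "nu N \<beta> h I f = (\<integral>g. replica_avg N \<beta> h g I (f g) \<partial>couplings N)"

text \<open>With \<open>h'\<close> in the place of the field, \<open>q_moment \<beta> h' q2 p\<close> is the \<open>p\<close>-th moment of
  \<open>tanh (\<beta> sqrt q2 z + h')\<close>. These moments are usually written with \<open>h' = h\<close>, which is the
  convention of the Gibbs weight \<open>exp (\<beta> E + N h M)\<close>. For the weight \<open>exp (\<beta> (E + N h M))\<close> used
  in \<open>gibbs\<close>, overlaps concentrate at the fixed point with \<open>h' = \<beta> h\<close>. The two
  agree if \<open>\<beta> = 1\<close> or \<open>h = 0\<close>; otherwise \<open>h' = h\<close> is at odds with the high temperature
  condition. Hence \<open>h'\<close> is kept as a parameter, so that both readings can be stated.\<close>

definition q_moment :: "real \<Rightarrow> real \<Rightarrow> real \<Rightarrow> nat \<Rightarrow> real" where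
  "q_moment \<beta> h' q2 p = (\<integral>z. tanh (\<beta> * sqrt q2 * z + h') ^ p \<partial>std_gauss)"

definition high_temperature :: "real \<Rightarrow> real \<Rightarrow> real \<Rightarrow> bool" where
  "high_temperature \<beta> h q2 \<longleftrightarrow>
     (\<exists>C0>0. \<forall>N\<ge>1. nu N \<beta> h {1, 2 :: nat} (\<lambda>g s. (overlap N (s 1) (s 2) - q2) ^ 6)
                     \<le> C0 / real N ^ 3)"

text \<open>The replicas are labelled by a finite type \<open>'n\<close> with \<open>CARD('n) = n\<close>. In
  \<open>real ^ ('n + 'n)\<close>, coordinate \<open>Inl i\<close> is the energy of replica \<open>i\<close> (the \<open>i\<close>-th
  coordinate) and \<open>Inr i\<close> its magnetization (the \<open>(n + i)\<close>-th coordinate).\<close>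

definition energy_fluct ::
  "nat \<Rightarrow> real \<Rightarrow> real \<Rightarrow> (nat \<times> nat \<Rightarrow> real) \<Rightarrow> (nat \<Rightarrow> real) \<Rightarrow> real" where
  "energy_fluct N \<beta> q2 g \<sigma> =
     1 / sqrt (real N) * energy N g \<sigma> - \<beta> * sqrt (real N) / 2 * (1 - q2\<^sup>2)"

definition magn_fluct :: "nat \<Rightarrow> real \<Rightarrow> (nat \<Rightarrow> real) \<Rightarrow> real" where
  "magn_fluct N q1 \<sigma> = sqrt (real N) * (magnetization N \<sigma> - q1)"

definition fluct ::
  "nat \<Rightarrow> real \<Rightarrow> real \<Rightarrow> real \<Rightarrow> (nat \<times> nat \<Rightarrow> real) \<Rightarrow> ('n::finite \<Rightarrow> nat \<Rightarrow> real) \<Rightarrow>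
    real ^ ('n + 'n)" where
  "fluct N \<beta> q1 q2 g s =
     (\<chi> k. case k of Inl i \<Rightarrow> energy_fluct N \<beta> q2 g (s i) | Inr i \<Rightarrow> magn_fluct N q1 (s i))"


section \<open>Test functions and polynomials\<close>

definition partial_deriv :: "'m::finite \<Rightarrow> (real ^ 'm \<Rightarrow> real) \<Rightarrow> real ^ 'm \<Rightarrow> real" where
  "partial_deriv j f x = frechet_derivative f (at x) (axis j 1)"

definition grad :: "(real ^ 'm::finite \<Rightarrow> real) \<Rightarrow> real ^ 'm \<Rightarrow> real ^ 'm" where
  "grad f x = (\<chi> j. partial_deriv j f x)"

definition test_functions :: "(real ^ 'm::finite \<Rightarrow> real) set" where
  "test_functions = {F. bounded (range F) \<and> (\<forall>x. F differentiable (at x)) \<and>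
     continuous_on UNIV (grad F) \<and> (\<exists>L. lipschitz_on L UNIV (grad F))}"

definition sup_norm :: "('a \<Rightarrow> 'b::real_normed_vector) \<Rightarrow> real" where
  "sup_norm f = (SUP x. norm (f x))"

definition lip_const :: "('a::metric_space \<Rightarrow> 'b::metric_space) \<Rightarrow> real" where
  "lip_const f = Inf {L. lipschitz_on L UNIV f}"

text \<open>A polynomial is given by its coefficients \<open>c\<close>, indexed by the exponents of the monomials
  and of finite support. The zero polynomial gets degree 0.\<close>

definition poly_fun :: "(('m::finite \<Rightarrow> nat) \<Rightarrow> real) \<Rightarrow> real ^ 'm \<Rightarrow> real" where
  "poly_fun c x = (\<Sum>a\<in>{a. c a \<noteq> 0}. c a * (\<Prod>j\<in>UNIV. (x $ j) ^ a j))"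

definition total_degree :: "(('m::finite \<Rightarrow> nat) \<Rightarrow> real) \<Rightarrow> nat" where
  "total_degree c = Max (insert 0 ((\<lambda>a. \<Sum>j\<in>UNIV. a j) ` {a. c a \<noteq> 0}))"

text \<open>The list \<open>js\<close> ranges over tuples of all lengths, including the empty tuple: without it
  the constant would not control the size of \<open>G\<close> itself.\<close>

definition growth_const :: "(real ^ 'm::finite \<Rightarrow> real) \<Rightarrow> nat \<Rightarrow> real \<Rightarrow> bool" where
  "growth_const G d CG \<longleftrightarrow>
     CG > 0 \<and> (\<forall>js x. \<bar>foldr partial_deriv js G x\<bar> \<le> CG * (1 + norm x) ^ d)"

text \<open>\<open>X\<close> is the fluctuation vector at system size \<open>N\<close>, and \<open>err\<close> the candidate error term.\<close>

definition is_Er ::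
  "real \<Rightarrow> nat \<Rightarrow> real \<Rightarrow> real \<Rightarrow>
    ((nat \<times> nat \<Rightarrow> real) \<Rightarrow> ('n::finite \<Rightarrow> nat \<Rightarrow> real) \<Rightarrow> real ^ ('n + 'n)) \<Rightarrow>
    (real ^ ('n + 'n) \<Rightarrow> real) \<Rightarrow> nat \<Rightarrow> real \<Rightarrow> real \<Rightarrow> bool" where
  "is_Er C N \<beta> h X F d CG err \<longleftrightarrow>
     \<bar>err\<bar> \<le> (1 + sup_norm F + sup_norm (grad F) + lip_const (grad F))
            * (1 + CG * sqrt (nu N \<beta> h UNIV (\<lambda>g s. (1 + norm (X g s)) ^ (2 * d))))
            * (C / sqrt (real N))"


section \<open>The replica matrix\<close>

definition replica_pairs :: "nat \<Rightarrow> (nat \<times> nat) set" where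
  "replica_pairs n = {(r, r'). 1 \<le> r \<and> r < r' \<and> r' \<le> n + 2}"

definition tilde_A :: "real \<Rightarrow> real \<Rightarrow> nat \<times> nat \<Rightarrow> nat \<times> nat \<Rightarrow> real" where
  "tilde_A q2 q4 = (\<lambda>(k, k') (r, r').
     let m = card ({k, k'} \<inter> {r, r'}) in
     if m = 2 then 1 - q2\<^sup>2 else if m = 1 then q2 - q2\<^sup>2 else q4 - q2\<^sup>2)"

text \<open>First argument pair: upper indices \<open>k < k'\<close>; second: lower indices \<open>r < r'\<close>. All entries
  outside the listed cases are 0; besides \<open>r \<le> n, r' = n + 2\<close> this includes \<open>k' < r' \<le> n\<close>, and
  \<open>k' = n + 2\<close> off the last diagonal entry.\<close>

definition replica_matrix :: "nat \<Rightarrow> real \<Rightarrow> real \<Rightarrow> nat \<times> nat \<Rightarrow> nat \<times> nat \<Rightarrow> real" where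
  "replica_matrix n q2 q4 = (\<lambda>(k, k') (r, r').
     if (r' \<le> k' \<and> k' \<le> n) \<or> (r' < k' \<and> k' = n + 1) then
       tilde_A q2 q4 (k, k') (r, r')
     else if k' \<le> n \<and> r' = n + 1 then
       - real n * tilde_A q2 q4 (k, k') (r, r')
     else if k' \<le> n \<and> r = n + 1 then
       real ((n + 1) choose 2) * tilde_A q2 q4 (k, k') (r, r')
     else if k' = n + 1 \<and> r' = n + 1 then
       tilde_A q2 q4 (k, n + 1) (r, n + 1) - real (n + 1) * tilde_A q2 q4 (k, n + 1) (r, n + 2)
     else if k' = n + 1 \<and> r = n + 1 \<and> r' = n + 2 then
       - real (n + 1) * tilde_A q2 q4 (k, n + 1) (n + 1, n + 2)
         + real ((n + 2) choose 2) * (q4 - q2\<^sup>2)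
     else if k = n + 1 \<and> k' = n + 2 \<and> r = n + 1 \<and> r' = n + 2 then
       1 - q2\<^sup>2 - 2 * real (n + 2) * (q2 - q2\<^sup>2) + real ((n + 3) choose 2) * (q4 - q2\<^sup>2)
     else 0)"

definition id_matrix :: "'i \<Rightarrow> 'i \<Rightarrow> real" where
  "id_matrix a b = (if a = b then 1 else 0)"

definition invertible_on :: "'i set \<Rightarrow> ('i \<Rightarrow> 'i \<Rightarrow> real) \<Rightarrow> bool" where
  "invertible_on I A \<longleftrightarrow> (\<exists>B. \<forall>a\<in>I. \<forall>c\<in>I.
     (\<Sum>b\<in>I. A a b * B b c) = id_matrix a c \<and> (\<Sum>b\<in>I. B a b * A b c) = id_matrix a c)"

definition pos_semidef :: "real ^ 'm ^ 'm::finite \<Rightarrow> bool" where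
  "pos_semidef A \<longleftrightarrow> transpose A = A \<and> (\<forall>v. 0 \<le> v \<bullet> (A *v v))"

end

theory Submission
  imports Defs "HOL-Real_Asymp.Real_Asymp"
begin

text \<open>The proof is a cavity argument. Single out a site \<open>p\<close>. Given the couplings that avoid
\<open>p\<close>, the spin at \<open>p\<close> feels the field \<open>beta (ell + h)\<close>, where \<open>ell\<close> is Gaussian and its covariance
between two replicas is the overlap of their remaining spins. Rotating \<open>ell\<close> into \<open>sqrt q z\<close>, with one Gaussian
\<open>z\<close> common to all replicas, decouples the spin at \<open>p\<close> from the rest (locale \<open>cavity\<close>). Gaussian integration by parts
writes the derivative along this rotation as a sum, over pairs of replicas, of overlap minus \<open>q\<close>. The high
temperature condition makes each such factor of order \<open>N powr (-1/2)\<close>. Hence the zeroth order expansion has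
error \<open>N powr (-1/2)\<close> (\<open>first_order\<close>) and the next one \<open>1/N\<close> (\<open>second_order\<close>), in both cases times an \<open>L2\<close> norm of
the test function.

Products \<open>G F\<close> enter only through the property \<open>tame\<close>: the function and its first derivatives are bounded
by multiples of a weight \<open>K\<close> which changes at most exponentially between two points. For \<open>K\<close> one can take the
supremum of all derivatives of \<open>G\<close>. So \<open>X\<close> can be replaced by the fluctuation vector without the spin at \<open>p\<close>,
and the errors are multiples of \<open>sqrt (nu (K(X)^2) / N)\<close>.

Call a functional of \<open>f\<close> approximable (\<open>appr\<close>) if up to such an error it is a fixed linear combination of the
numbers \<open>nu (d_k f(X))\<close>. The theorem says that \<open>nu (X_r f(X))\<close> is approximable. Expand the product of
two spins at \<open>p\<close> and average over \<open>p\<close>: this gives linear equations, modulo approximable terms, for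
\<open>rho_kl = sqrt N nu ((R_kl - q) f(X))\<close>. They can be solved by hand. First \<open>rho_kl\<close> splits as \<open>v_k + v_l\<close> after
division by \<open>1 - beta^2 (1 - 2 q2 + q4)\<close>. Inserting this, the \<open>v_k\<close> solve a system which decouples after
division by \<open>1 - beta^2 (1 - 4 q2 + 3 q4)\<close> (\<open>rho_appr\<close>). The first number is positive: its product with
\<open>N nu ((R_02 - R_03 - R_12 + R_13)^2)\<close> tends to \<open>4 (1 - 2 q2 + q4) > 0\<close> (\<open>stability\<close>). The second is at least as
large. For the magnetization the expansion of one spin suffices (\<open>magn_appr\<close>). For the energy, integration
by parts in the couplings produces squares of overlaps, which linearize (\<open>energy_appr\<close>).

The resulting matrix is the limit of the second moments of \<open>X\<close>, so it is symmetric and positive semidefinite.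
Finally, \<open>h' = beta h\<close> in all cases: the high temperature condition forces \<open>q2\<close> to be the mean of
\<open>tanh^2 (beta sqrt q2 z + beta h)\<close>, and this mean is strictly increasing in the modulus of the field.

Several Greek letters are spelled out in two letters: \<open>be\<close>, \<open>ga\<close>, \<open>th\<close>, \<open>ph\<close>.\<close>

abbreviation pd :: "'m::finite => (real ^ 'm => real) => real ^ 'm => real" where
 "pd == partial_deriv"

abbreviation rtN :: "nat => real" where
 "rtN N == sqrt (real N)"

abbreviation gpr :: "'j set => ('j => real) measure" where
 "gpr S \<equiv> PiM S (%_. std_gauss)"

lemma sets_std_gauss [simp, measurable_cong]: "sets std_gauss = sets borel"
 by (simp add: std_gauss_def)

lemma space_std_gauss [simp]: "space std_gauss = UNIV"
 by (simp add: std_gauss_def)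

lemma prob_space_std_gauss: "prob_space std_gauss"
 unfolding std_gauss_def by (rule prob_space_normal_density) simp

interpretation std_gauss: prob_space std_gauss
 by (rule prob_space_std_gauss)

interpretation gp: product_sigma_finite "%_. std_gauss"
 by (intro product_sigma_finite.intro) unfold_locales

lemma prob_space_gpr: "prob_space (gpr S)"
 by (intro prob_space_PiM prob_space_std_gauss)

lemma std_normal_density_exp_shift:
 "std_normal_density x * exp (t * x) = exp (t^2 / 2) * normal_density t 1 x"
proof -
 have "- x\<^sup>2 / 2 + t * x = t^2 / 2 + - (x - t)\<^sup>2 / 2"
  by (simp add: power2_eq_square field_simps)
 then show ?thesis
  unfolding normal_density_def by (simp add: exp_add[symmetric])
qed

lemma std_gauss_exp_linear:
 shows "integrable std_gauss (%x. exp (t * x))"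
  and "(\<integral>x. exp (t * x) \<partial>std_gauss) = exp (t^2 / 2)"
proof -
 have eq: "(%x. std_normal_density x * exp (t * x)) = (%x. exp (t^2 / 2) * normal_density t 1 x)"
  by (simp add: fun_eq_iff std_normal_density_exp_shift)
 show "integrable std_gauss (%x. exp (t * x))"
  unfolding std_gauss_def by (subst integrable_density) (auto simp: eq)
 show "(\<integral>x. exp (t * x) \<partial>std_gauss) = exp (t^2 / 2)"
  unfolding std_gauss_def by (subst integral_density) (auto simp: eq)
qed

lemma exp_abs_le: "exp (c * \<bar>x\<bar>) <= exp (c * x) + exp (- c * x)" for c x :: real
 by (cases "x >= 0") (auto simp: add_increasing add_increasing2)

lemma integrable_std_gauss_exp_abs: "integrable std_gauss (%x. exp (c * \<bar>x\<bar>))"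
 by (rule Bochner_Integration.integrable_bound
    [OF Bochner_Integration.integrable_add[OF std_gauss_exp_linear(1)[of c] std_gauss_exp_linear(1)[of "-c"]]])
   (auto simp: add_nonneg_nonneg intro!: AE_I2 order_trans[OF exp_abs_le])

subsection \<open>Functions of exponential growth\<close>

text \<open>Energies are linear in the couplings and Gibbs weights are bounded, so every integrand below lies in this
class, which is closed under the algebra operations and integrable.\<close>

definition expgr :: "'j set => (('j => real) => real) => bool" where
 "expgr S f \<longleftrightarrow> f \<in> borel_measurable (gpr S) &
   (\<exists>C\<ge>0. \<forall>g. \<bar>f g\<bar> <= C * exp (C * (\<Sum>j\<in>S. \<bar>g j\<bar>)))"

lemma expgrI:
 assumes "f \<in> borel_measurable (gpr S)"
  and "!!g. \<bar>f g\<bar> <= a * exp (b * (\<Sum>j\<in>S. \<bar>g j\<bar>))"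
 shows "expgr S f"
 unfolding expgr_def
proof (intro conjI exI[of _ "max 0 (max a b)"] allI)
 fix g :: "'a => real"
 have s: "0 <= (\<Sum>j\<in>S. \<bar>g j\<bar>)" by (simp add: sum_nonneg)
 have "\<bar>f g\<bar> <= a * exp (b * (\<Sum>j\<in>S. \<bar>g j\<bar>))" by (rule assms)
 also have "... <= max 0 (max a b) * exp (max 0 (max a b) * (\<Sum>j\<in>S. \<bar>g j\<bar>))"
  by (intro mult_mono) (auto intro!: mult_right_mono s)
 finally show "\<bar>f g\<bar> <= ..." .
qed (use assms in auto)

lemma expgr_measurable [measurable_dest]:
 "expgr S f ==> f \<in> borel_measurable (gpr S)"
 by (simp add: expgr_def)

lemma integrable_exp_sum:
 assumes "finite S"
 shows "integrable (gpr S) (%g. exp (c * (\<Sum>j\<in>S. \<bar>g j\<bar>)))"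
proof -
 have "integrable (gpr S) (%g. \<Prod>j\<in>S. exp (c * \<bar>g j\<bar>))"
  using assms integrable_std_gauss_exp_abs by (rule gp.product_integrable_prod)
 then show ?thesis
  using assms by (simp add: exp_sum sum_distrib_left)
qed

lemma expgr_integrable:
 assumes "finite S" "expgr S f"
 shows "integrable (gpr S) f"
proof -
 obtain C where C: "C >= 0" "!!g. \<bar>f g\<bar> <= C * exp (C * (\<Sum>j\<in>S. \<bar>g j\<bar>))"
  using assms by (auto simp: expgr_def)
 show ?thesis
  by (rule Bochner_Integration.integrable_bound[OF integrable_mult_right[OF integrable_exp_sum[OF assms(1)], of C C]])
    (use assms C in \<open>auto simp: expgr_def intro!: AE_I2\<close>)
qed

lemma expgr_mult:
 assumes "expgr S f" "expgr S f'"
 shows "expgr S (%g. f g * f' g)"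
proof -
 obtain C where C: "C >= 0" "!!g. \<bar>f g\<bar> <= C * exp (C * (\<Sum>j\<in>S. \<bar>g j\<bar>))"
  using assms(1) by (auto simp: expgr_def)
 obtain D where D: "D >= 0" "!!g. \<bar>f' g\<bar> <= D * exp (D * (\<Sum>j\<in>S. \<bar>g j\<bar>))"
  using assms(2) by (auto simp: expgr_def)
 show ?thesis
 proof (rule expgrI)
  show "(%g. f g * f' g) \<in> borel_measurable (gpr S)"
   using assms by (intro borel_measurable_times expgr_measurable)
  fix g :: "'a => real"
  let ?s = "\<Sum>j\<in>S. \<bar>g j\<bar>"
  have "\<bar>f g * f' g\<bar> <= (C * exp (C * ?s)) * (D * exp (D * ?s))"
   unfolding abs_mult by (intro mult_mono C D) (auto intro!: mult_nonneg_nonneg C)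
  also have "... = (C * D) * exp ((C + D) * ?s)"
   by (simp add: exp_add distrib_right)
  finally show "\<bar>f g * f' g\<bar> <= (C * D) * exp ((C + D) * ?s)" .
 qed
qed

lemma expgr_add:
 assumes "expgr S f" "expgr S f'"
 shows "expgr S (%g. f g + f' g)"
proof -
 obtain C where C: "C >= 0" "!!g. \<bar>f g\<bar> <= C * exp (C * (\<Sum>j\<in>S. \<bar>g j\<bar>))"
  using assms(1) by (auto simp: expgr_def)
 obtain D where D: "D >= 0" "!!g. \<bar>f' g\<bar> <= D * exp (D * (\<Sum>j\<in>S. \<bar>g j\<bar>))"
  using assms(2) by (auto simp: expgr_def)
 show ?thesis
 proof (rule expgrI)
  show "(%g. f g + f' g) \<in> borel_measurable (gpr S)"
   using assms by (intro borel_measurable_add expgr_measurable)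
  fix g :: "'a => real"
  let ?s = "\<Sum>j\<in>S. \<bar>g j\<bar>"
  have s: "0 <= ?s" by (simp add: sum_nonneg)
  have "\<bar>f g + f' g\<bar> <= C * exp (C * ?s) + D * exp (D * ?s)"
   using C(2)[of g] D(2)[of g] by linarith
  also have "... <= C * exp ((C + D) * ?s) + D * exp ((C + D) * ?s)"
   using C(1) D(1) s by (intro add_mono mult_left_mono) (auto intro!: mult_right_mono)
  finally show "\<bar>f g + f' g\<bar> <= (C + D) * exp ((C + D) * ?s)"
   by (simp add: distrib_right)
 qed
qed

lemma expgr_const [simp, intro]: "expgr S (%_. c)"
 by (rule expgrI[of _ _ "\<bar>c\<bar>" 0]) auto

lemma expgr_bounded:
 assumes "f \<in> borel_measurable (gpr S)" "!!g. \<bar>f g\<bar> <= c"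
 shows "expgr S f"
 by (rule expgrI[of _ _ c 0]) (use assms in auto)

lemma expgr_uminus:
 "expgr S f ==> expgr S (%g. - f g)"
 by (auto simp: expgr_def)

lemma expgr_diff:
 "expgr S f ==> expgr S f' ==> expgr S (%g. f g - f' g)"
 using expgr_add[of S f "%g. - f' g"] expgr_uminus[of S f'] by simp

lemma expgr_abs:
 "expgr S f ==> expgr S (%g. \<bar>f g\<bar>)"
 by (auto simp: expgr_def)

lemma expgr_sum:
 "(!!i. i \<in> I ==> expgr S (f i)) ==> expgr S (%g. \<Sum>i\<in>I. f i g)"
 by (induction I rule: infinite_finite_induct) (auto intro: expgr_add)

lemma expgr_prod:
 "(!!i. i \<in> I ==> expgr S (f i)) ==> expgr S (%g. \<Prod>i\<in>I. f i g)"
 by (induction I rule: infinite_finite_induct) (auto intro: expgr_mult)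

lemma expgr_power: "expgr S f ==> expgr S (%g. f g ^ n)"
 by (induction n) (auto intro: expgr_mult)

lemma expgr_coord:
 assumes "finite S" "j \<in> S"
 shows "expgr S (%g. g j)"
proof (rule expgrI[of _ _ 1 1])
 show "(%g. g j) \<in> borel_measurable (gpr S)"
  using assms by measurable
 fix g :: "'a => real"
 have "\<bar>g j\<bar> <= (\<Sum>j\<in>S. \<bar>g j\<bar>)"
  using assms by (intro member_le_sum) auto
 also have "... <= exp (\<Sum>j\<in>S. \<bar>g j\<bar>)"
  using exp_ge_add_one_self[of "\<Sum>j\<in>S. \<bar>g j\<bar>"] by linarith
 finally show "\<bar>g j\<bar> <= 1 * exp (1 * (\<Sum>j\<in>S. \<bar>g j\<bar>))" by simp
qed

lemma expgr_exp:
 assumes "f \<in> borel_measurable (gpr S)"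
  and "!!g. f g <= a + b * (\<Sum>j\<in>S. \<bar>g j\<bar>)"
 shows "expgr S (%g. exp (f g))"
 by (rule expgrI[of _ _ "exp a" b]) (use assms in \<open>auto simp: exp_add[symmetric]\<close>)

lemmas expgr_intros =
 expgr_mult expgr_add expgr_const expgr_uminus expgr_diff expgr_abs
 expgr_sum expgr_prod expgr_power expgr_coord

subsection \<open>Gaussian integration by parts\<close>

lemma exp_bound_gauss_tendsto:
 assumes "!!x. \<bar>f x\<bar> <= C * exp (C * \<bar>x\<bar>)"
 shows "((%x. f x * std_normal_density x) \<longlongrightarrow> 0) at_top"
  and "((%x. f x * std_normal_density x) \<longlongrightarrow> 0) at_bot"
proof -
 have b: "norm (f x * std_normal_density x) <= C * exp (C * \<bar>x\<bar> - x\<^sup>2 / 2)" for x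
 proof -
  have C: "0 <= C" using assms[of 0] by (simp add: abs_le_iff)
  have "norm (f x * std_normal_density x) = \<bar>f x\<bar> * std_normal_density x"
   by (simp add: abs_mult)
  also have "... <= (C * exp (C * \<bar>x\<bar>)) * exp (- x\<^sup>2 / 2)"
  proof (intro mult_mono assms)
   have "1 <= sqrt (2 * pi)" using pi_gt3 by simp
   then have "1 / sqrt (2 * pi) * exp (- x\<^sup>2 / 2) <= 1 * exp (- x\<^sup>2 / 2)"
    by (intro mult_right_mono) auto
   then show "std_normal_density x <= exp (- x\<^sup>2 / 2)"
    by (simp add: std_normal_density_def)
  qed (use C in auto)
  also have "... = C * exp (C * \<bar>x\<bar> - x\<^sup>2 / 2)"
   by (simp add: mult.assoc flip: exp_add)
  finally show ?thesis .
 qed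
 have l: "filterlim (%x. C * x - x\<^sup>2 / 2) at_bot at_top" by real_asymp
 then have lim: "((%x. C * exp (C * x - x\<^sup>2 / 2)) \<longlongrightarrow> C * 0) at_top"
  by (intro tendsto_mult tendsto_const filterlim_compose[OF exp_at_bot])
 have "\<forall>\<^sub>F x in at_top. norm (f x * std_normal_density x) <= C * exp (C * x - x\<^sup>2 / 2)"
  using eventually_ge_at_top[of 0]
 proof eventually_elim
  case (elim x)
  then have "\<bar>x\<bar> = x" by simp
  then show ?case using b[of x] by simp
 qed
 then show "((%x. f x * std_normal_density x) \<longlongrightarrow> 0) at_top"
  by (rule Lim_null_comparison[OF _ lim[unfolded mult_zero_right]])
 have l: "filterlim (%x. - C * x - x\<^sup>2 / 2) at_bot at_bot" by real_asymp
 then have lim: "((%x. C * exp (- C * x - x\<^sup>2 / 2)) \<longlongrightarrow> C * 0) at_bot"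
  by (intro tendsto_mult tendsto_const filterlim_compose[OF exp_at_bot])
 have "\<forall>\<^sub>F x in at_bot. norm (f x * std_normal_density x) <= C * exp (- C * x - x\<^sup>2 / 2)"
  using eventually_le_at_bot[of 0]
 proof eventually_elim
  case (elim x)
  then have "\<bar>x\<bar> = - x" by simp
  then show ?case using b[of x] by simp
 qed
 then show "((%x. f x * std_normal_density x) \<longlongrightarrow> 0) at_bot"
  by (rule Lim_null_comparison[OF _ lim[unfolded mult_zero_right]])
qed

lemma integrable_std_gauss_exp_bound:
 assumes "f \<in> borel_measurable borel" "!!x. \<bar>f x\<bar> <= C * exp (C * \<bar>x\<bar>)"
 shows "integrable std_gauss f"
proof (rule Bochner_Integration.integrable_bound[OF integrable_mult_right[OF integrable_std_gauss_exp_abs, of C C]])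
 have "f \<in> borel_measurable std_gauss" using assms by (simp cong: measurable_cong_sets)
 then show "f \<in> borel_measurable std_gauss" .
 show "AE x in std_gauss. norm (f x) <= norm (C * exp (C * \<bar>x\<bar>))"
  by (rule AE_I2) (metis abs_ge_self assms(2) order_trans real_norm_def)
qed

lemma std_gauss_by_parts:
 assumes der: "!!x. (f has_real_derivative f' x) (at x)"
  and cont: "continuous_on UNIV f'"
  and bf: "!!x. \<bar>f x\<bar> <= C * exp (C * \<bar>x\<bar>)"
  and bf': "!!x. \<bar>f' x\<bar> <= C * exp (C * \<bar>x\<bar>)"
 shows "(\<integral>x. x * f x \<partial>std_gauss) = (\<integral>x. f' x \<partial>std_gauss)"
proof -
 let ?ph = std_normal_density
 have cf: "continuous_on UNIV f"
  using der by (meson DERIV_isCont continuous_at_imp_continuous_on)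
 have m [measurable]: "f \<in> borel_measurable borel" "f' \<in> borel_measurable borel"
  using cf cont by (auto intro: borel_measurable_continuous_onI)
 have C: "0 <= C" using bf[of 0] by (simp add: abs_le_iff)
 have x_le: "\<bar>x\<bar> <= exp \<bar>x\<bar>" for x :: real using exp_ge_add_one_self[of "\<bar>x\<bar>"] by linarith
 have i1: "integrable std_gauss (%x. x * f x)"
 proof (rule integrable_std_gauss_exp_bound[where C = "C + 1"])
  fix x
  have "\<bar>x * f x\<bar> <= exp \<bar>x\<bar> * (C * exp (C * \<bar>x\<bar>))"
   unfolding abs_mult by (intro mult_mono x_le bf) auto
  also have "... = C * exp ((C + 1) * \<bar>x\<bar>)"
   by (simp add: algebra_simps flip: exp_add)
  also have "... <= (C + 1) * exp ((C + 1) * \<bar>x\<bar>)"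
   by (intro mult_right_mono) auto
  finally show "\<bar>x * f x\<bar> <= (C + 1) * exp ((C + 1) * \<bar>x\<bar>)" .
 qed simp
 have i2: "integrable std_gauss f'"
  by (rule integrable_std_gauss_exp_bound[OF _ bf']) simp
 have j1: "integrable lborel (%x. ?ph x * (x * f x))"
  using i1 unfolding std_gauss_def by (subst (asm) integrable_density) auto
 have j2: "integrable lborel (%x. ?ph x * f' x)"
  using i2 unfolding std_gauss_def by (subst (asm) integrable_density) auto
 define h where "h = (%x. f' x * ?ph x - x * f x * ?ph x)"
 have jh: "integrable lborel h"
  unfolding h_def using j1 j2 by (auto simp: mult_ac)
 have "(LBINT x=-\<infinity>..\<infinity>. h x) = 0 - 0"
 proof (rule interval_integral_FTC_integrable[where F = "%x. f x * ?ph x"])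
  fix x :: real
  have phi': "(?ph has_real_derivative - x * ?ph x) (at x)"
  proof -
   have "((%x. exp (- x\<^sup>2 / 2)) has_real_derivative - x * exp (- x\<^sup>2 / 2)) (at x)"
    by (auto intro!: derivative_eq_intros)
   from DERIV_cmult[OF this, of "1 / sqrt (2 * pi)"] show ?thesis
    unfolding std_normal_density_def by (simp add: mult_ac)
  qed
  show "((%x. f x * ?ph x) has_vector_derivative h x) (at x)"
   unfolding has_real_derivative_iff_has_vector_derivative[symmetric] h_def
   by (rule DERIV_cong[OF DERIV_mult[OF der phi']]) (simp add: algebra_simps)
  have "continuous_on UNIV ?ph"
   unfolding std_normal_density_def by (intro continuous_intros) auto
  then have "continuous_on UNIV h"
   unfolding h_def using cf cont by (intro continuous_intros) auto
  then show "isCont h x"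
   by (simp add: continuous_on_eq_continuous_at)
 next
  show "set_integrable lborel (einterval (- \<infinity>) \<infinity>) h"
   using jh by (simp add: set_integrable_def einterval_def)
  show "(((%x. f x * ?ph x) \<circ> real_of_ereal) \<longlongrightarrow> 0) (at_right (- \<infinity>))"
   using exp_bound_gauss_tendsto(2)[OF bf]
   by (simp only: ereal_tendsto_simps1)
  show "(((%x. f x * ?ph x) \<circ> real_of_ereal) \<longlongrightarrow> 0) (at_left \<infinity>)"
   using exp_bound_gauss_tendsto(1)[OF bf]
   by (simp only: ereal_tendsto_simps1)
 qed auto
 then have "integral\<^sup>L lborel h = 0"
  by (simp add: interval_lebesgue_integral_def set_lebesgue_integral_def einterval_def)
 then have "(\<integral>x. ?ph x * f' x \<partial>lborel) - (\<integral>x. ?ph x * (x * f x) \<partial>lborel) = 0"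
  unfolding h_def using j1 j2
  by (subst Bochner_Integration.integral_diff[symmetric]) (auto simp: mult_ac)
 then show ?thesis
  unfolding std_gauss_def by (subst (1 2) integral_density) auto
qed

text \<open>Fubini reduces this to one coordinate.\<close>

lemma gpr_by_parts:
 assumes S: "finite S" "j \<in> S"
  and der: "!!g x. ((%y. f (g(j := y))) has_real_derivative f' (g(j := x))) (at x)"
  and cont: "!!g. continuous_on UNIV (%y. f' (g(j := y)))"
  and gr: "expgr S f" "expgr S f'"
 shows "(\<integral>g. g j * f g \<partial>gpr S) = (\<integral>g. f' g \<partial>gpr S)"
proof -
 define T where "T = S - {j}"
 have T: "finite T" "j \<notin> T" "S = insert j T" using S by (auto simp: T_def)
 obtain C where C: "C >= 0" "!!g. \<bar>f g\<bar> <= C * exp (C * (\<Sum>j\<in>S. \<bar>g j\<bar>))"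
  using gr(1) by (auto simp: expgr_def)
 obtain D where D: "D >= 0" "!!g. \<bar>f' g\<bar> <= D * exp (D * (\<Sum>j\<in>S. \<bar>g j\<bar>))"
  using gr(2) by (auto simp: expgr_def)
 have sum: "(\<Sum>i\<in>S. \<bar>(g(j := y)) i\<bar>) = \<bar>y\<bar> + (\<Sum>i\<in>T. \<bar>g i\<bar>)" for g y
 proof -
  have "(\<Sum>i\<in>T. \<bar>(g(j := y)) i\<bar>) = (\<Sum>i\<in>T. \<bar>g i\<bar>)"
   using T by (intro sum.cong) auto
  then show ?thesis using T by simp
 qed
 have "(\<integral>g. g j * f g \<partial>gpr S) = (\<integral>g. (\<integral>y. y * f (g(j := y)) \<partial>std_gauss) \<partial>gpr T)"
  unfolding T(3) using T S
  by (subst gp.product_integral_insert)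
    (auto intro!: expgr_integrable expgr_intros gr simp flip: T(3))
 also have "... = (\<integral>g. (\<integral>y. f' (g(j := y)) \<partial>std_gauss) \<partial>gpr T)"
 proof (rule Bochner_Integration.integral_cong[OF refl])
  fix g :: "'a => real"
  define s where "s = (\<Sum>i\<in>T. \<bar>g i\<bar>)"
  have s: "s >= 0" by (simp add: s_def sum_nonneg)
  define B where "B = (C + D) * exp ((C + D) * s) + (C + D)"
  have key: "c * exp (c * (\<bar>y\<bar> + s)) <= B * exp (B * \<bar>y\<bar>)" if "0 <= c" "c <= C + D" for c y
  proof -
   have "c * exp (c * (\<bar>y\<bar> + s)) = (c * exp (c * s)) * exp (c * \<bar>y\<bar>)"
    by (simp add: exp_add distrib_left)
   also have "... <= B * exp (B * \<bar>y\<bar>)"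
   proof (intro mult_mono)
    have "c * exp (c * s) <= (C + D) * exp ((C + D) * s)"
     using that s by (intro mult_mono) (auto intro: mult_right_mono)
    then show "c * exp (c * s) <= B" unfolding B_def using C(1) D(1) by linarith
    have "c <= B" unfolding B_def using that C(1) D(1) by (simp add: add_increasing)
    then show "exp (c * \<bar>y\<bar>) <= exp (B * \<bar>y\<bar>)" by (simp add: mult_right_mono)
   qed (use C(1) D(1) in \<open>auto simp: B_def\<close>)
   finally show ?thesis .
  qed
  show "(\<integral>y. y * f (g(j := y)) \<partial>std_gauss) = (\<integral>y. f' (g(j := y)) \<partial>std_gauss)"
  proof (rule std_gauss_by_parts[OF der cont])
   fix y
   show "\<bar>f (g(j := y))\<bar> <= B * exp (B * \<bar>y\<bar>)"
    using C(2)[of "g(j := y)"] key[of C y] C(1) D(1) unfolding sum s_def[symmetric] by linarith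
   show "\<bar>f' (g(j := y))\<bar> <= B * exp (B * \<bar>y\<bar>)"
    using D(2)[of "g(j := y)"] key[of D y] C(1) D(1) unfolding sum s_def[symmetric] by linarith
  qed
 qed
 also have "... = (\<integral>g. f' g \<partial>gpr S)"
  unfolding T(3) using T S gr
  by (subst gp.product_integral_insert)
    (auto intro!: expgr_integrable simp flip: T(3))
 finally show ?thesis .
qed

lemma has_real_derivative_integral:
 fixes f :: "real => 'a => real"
 assumes int: "!!t. integrable M (f t)"
  and der: "!!t x. x \<in> space M ==> ((%t. f t x) has_real_derivative f' t x) (at t)"
  and bound: "!!t x. x \<in> space M ==> \<bar>f' t x\<bar> <= H x"
  and H: "integrable M H"
  and meas: "!!t. f' t \<in> borel_measurable M"
 shows "((%t. \<integral>x. f t x \<partial>M) has_real_derivative (\<integral>x. f' t x \<partial>M)) (at t)"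
 unfolding has_field_derivative_iff
proof (rule tendsto_at_iff_sequentially[THEN iffD2], intro allI impI)
 fix X :: "nat => real" assume X: "\<forall>i. X i \<in> UNIV - {t}" "X \<longlonglongrightarrow> t"
 have eq: "((\<integral>x. f (X i) x \<partial>M) - (\<integral>x. f t x \<partial>M)) / (X i - t) =
   (\<integral>x. (f (X i) x - f t x) / (X i - t) \<partial>M)" for i
  using int by simp
 have "(%i. \<integral>x. (f (X i) x - f t x) / (X i - t) \<partial>M) \<longlonglongrightarrow> (\<integral>x. f' t x \<partial>M)"
 proof (rule integral_dominated_convergence[OF _ _ H])
  show "f' t \<in> borel_measurable M" by (rule meas)
  show "(%x. (f (X i) x - f t x) / (X i - t)) \<in> borel_measurable M" for i
   using int[THEN borel_measurable_integrable] by (intro borel_measurable_divide borel_measurable_diff) auto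
  show "AE x in M. (%i. (f (X i) x - f t x) / (X i - t)) \<longlonglongrightarrow> f' t x"
  proof (rule AE_I2)
   fix x assume "x \<in> space M"
   from der[OF this, of t] have "((%y. (f y x - f t x) / (y - t)) \<longlongrightarrow> f' t x) (at t)"
    by (simp add: has_field_derivative_iff)
   then show "(%i. (f (X i) x - f t x) / (X i - t)) \<longlonglongrightarrow> f' t x"
    using X unfolding tendsto_at_iff_sequentially comp_def by auto
  qed
  show "AE x in M. norm ((f (X i) x - f t x) / (X i - t)) <= H x" for i
  proof (rule AE_I2)
   fix x assume x: "x \<in> space M"
   have "\<bar>f (X i) x - f t x\<bar> <= H x * \<bar>X i - t\<bar>"
    using field_differentiable_bound[of UNIV "%t. f t x" "%t. f' t x" "H x" t "X i"]
     der[OF x] bound[OF x] by (auto simp: abs_minus_commute)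
   moreover have "X i - t ~= 0" using X by auto
   ultimately show "norm ((f (X i) x - f t x) / (X i - t)) <= H x"
    by (simp add: abs_divide divide_le_eq)
  qed
 qed
 then show "((%y. ((\<integral>x. f y x \<partial>M) - (\<integral>x. f t x \<partial>M)) / (y - t)) \<circ> X) \<longlonglongrightarrow> (\<integral>x. f' t x \<partial>M)"
  by (simp add: comp_def eq)
qed

section \<open>Replica averages over a finite space\<close>

definition gavg :: "'a set => ('a => real) => 'r set => (('r => 'a) => real) => real" where
 "gavg A p I F = (\<Sum>s\<in>PiE I (%_. A). (\<Prod>r\<in>I. p (s r)) * F s)"

text \<open>Replica functions live on total functions; this says which labels matter, so that unused replicas can be added or renamed.\<close>

definition dep :: "'r set => (('r => 'a) => 'b) => bool" where
 "dep I F \<longleftrightarrow> (\<forall>s s'. (\<forall>i\<in>I. s i = s' i) --> F s = F s')"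

lemma depI: "(!!s s'. (!!i. i \<in> I ==> s i = s' i) ==> F s = F s') ==> dep I F"
 unfolding dep_def by blast

lemma depD: "dep I F ==> (!!i. i \<in> I ==> s i = s' i) ==> F s = F s'"
 unfolding dep_def by blast

lemma dep_mono: "dep I F ==> I \<subseteq> I' ==> dep I' F"
 by (auto simp: dep_def)

lemma dep_coord: "r \<in> I ==> dep I (%s. ph (s r))"
 by (rule depI) simp

lemma dep_coord2: "r \<in> I ==> r' \<in> I ==> dep I (%s. ph (s r) (s r'))"
 by (rule depI) simp

lemma dep_mult: "dep I F ==> dep I G ==> dep I (%s. F s * G s :: real)"
 unfolding dep_def by metis

lemma dep_add: "dep I F ==> dep I G ==> dep I (%s. F s + G s :: real)"
 unfolding dep_def by metis

lemma dep_diff: "dep I F ==> dep I G ==> dep I (%s. F s - G s :: real)"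
 unfolding dep_def by metis

lemma dep_abs: "dep I F ==> dep I (%s. \<bar>F s :: real\<bar>)"
 unfolding dep_def by metis

lemma dep_power: "dep I F ==> dep I (%s. F s ^ n :: real)"
 unfolding dep_def by metis

lemma dep_const: "dep I (%s. c)"
 by (rule depI) simp

lemma dep_sum: "(!!i. i \<in> X ==> dep I (F i)) ==> dep I (%s. \<Sum>i\<in>X. F i s :: real)"
 by (rule depI) (auto intro!: sum.cong dest: depD)

lemma dep_prod: "(!!i. i \<in> X ==> dep I (F i)) ==> dep I (%s. \<Prod>i\<in>X. F i s :: real)"
 by (rule depI) (auto intro!: prod.cong dest: depD)

lemma gavg_add: "gavg A p I (%s. F s + G s) = gavg A p I F + gavg A p I G"
 by (simp add: gavg_def distrib_left sum.distrib)

lemma gavg_diff: "gavg A p I (%s. F s - G s) = gavg A p I F - gavg A p I G"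
 by (simp add: gavg_def right_diff_distrib sum_subtractf)

lemma gavg_cmult: "gavg A p I (%s. c * F s) = c * gavg A p I F"
 by (simp add: gavg_def sum_distrib_left mult_ac)

lemma gavg_sum: "gavg A p I (%s. \<Sum>x\<in>X. F x s) = (\<Sum>x\<in>X. gavg A p I (F x))"
 unfolding gavg_def sum_distrib_left by (rule sum.swap)

lemma gavg_cong:
 "(!!s. s \<in> PiE I (%_. A) ==> F s = G s) ==> gavg A p I F = gavg A p I G"
 by (simp add: gavg_def)

lemma gavg_mono:
 assumes "!!a. a \<in> A ==> 0 <= p a" "!!s. s \<in> PiE I (%_. A) ==> F s <= G s"
 shows "gavg A p I F <= gavg A p I G"
 unfolding gavg_def
 by (intro sum_mono mult_left_mono assms prod_nonneg) (auto intro: assms dest: PiE_mem)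

lemma gavg_nonneg:
 assumes "!!a. a \<in> A ==> 0 <= p a" "!!s. s \<in> PiE I (%_. A) ==> 0 <= F s"
 shows "0 <= gavg A p I F"
 using gavg_mono[of A p I "%_. 0" F] assms by (simp add: gavg_def)

lemma gavg_abs_le:
 assumes "!!a. a \<in> A ==> 0 <= p a"
 shows "\<bar>gavg A p I F\<bar> <= gavg A p I (%s. \<bar>F s\<bar>)"
proof -
 have "\<bar>gavg A p I F\<bar> <= (\<Sum>s\<in>PiE I (%_. A). \<bar>(\<Prod>r\<in>I. p (s r)) * F s\<bar>)"
  unfolding gavg_def by (rule sum_abs)
 also have "... = gavg A p I (%s. \<bar>F s\<bar>)"
  unfolding gavg_def abs_mult
  by (intro sum.cong refl arg_cong2[where f="(*)"] abs_of_nonneg prod_nonneg)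
    (auto intro: assms dest: PiE_mem)
 finally show ?thesis .
qed

lemma gavg_const:
 assumes "finite I" "finite A" "(\<Sum>a\<in>A. p a) = 1"
 shows "gavg A p I (%_. c) = c"
proof -
 have "(\<Sum>s\<in>PiE I (%_. A). \<Prod>r\<in>I. p (s r)) = (\<Prod>r\<in>I. \<Sum>a\<in>A. p a)"
  using assms by (subst prod_sum_PiE) auto
 then show ?thesis
  using assms by (simp add: gavg_def flip: sum_distrib_right)
qed

lemma gavg_insert:
 assumes "finite I" "e \<notin> I"
 shows "gavg A p (insert e I) F = (\<Sum>b\<in>A. p b * gavg A p I (%s. F (s(e := b))))"
proof -
 have "gavg A p (insert e I) F =
   (\<Sum>(b, s)\<in>A \<times> PiE I (%_. A). (\<Prod>r\<in>insert e I. p ((s(e := b)) r)) * F (s(e := b)))"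
  unfolding gavg_def
 proof (rule sum.reindex_bij_witness[where j = "%s. (s e, s(e := undefined))" and i = "%(b, s). s(e := b)"])
  fix s assume "s \<in> insert e I \<rightarrow>\<^sub>E A"
  then show "(s e, s(e := undefined)) \<in> A \<times> (I \<rightarrow>\<^sub>E A)"
   using assms by (auto simp: PiE_iff extensional_def)
  show "(case (s e, s(e := undefined)) of (b, s) => (\<Prod>r\<in>insert e I. p ((s(e := b)) r)) * F (s(e := b))) =
    (\<Prod>r\<in>insert e I. p (s r)) * F s"
   by (simp only: prod.case fun_upd_upd fun_upd_triv)
 next
  fix bs assume "bs \<in> A \<times> (I \<rightarrow>\<^sub>E A)"
  then show "(case bs of (b, s) => s(e := b)) \<in> insert e I \<rightarrow>\<^sub>E A"
   using assms by (auto simp: PiE_iff extensional_def)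
  have "(snd bs) e = undefined" using \<open>bs \<in> _\<close> assms by (auto simp: PiE_iff extensional_def)
  then show "((case bs of (b, s) => s(e := b)) e, (case bs of (b, s) => s(e := b))(e := undefined)) = bs"
   by (cases bs) (auto simp: fun_upd_idem)
 qed auto
 also have "... = (\<Sum>b\<in>A. \<Sum>s\<in>PiE I (%_. A). p b * ((\<Prod>r\<in>I. p (s r)) * F (s(e := b))))"
  unfolding sum.cartesian_product[symmetric]
 proof (intro sum.cong refl)
  fix b s
  have "(\<Prod>r\<in>I. p ((s(e := b)) r)) = (\<Prod>r\<in>I. p (s r))"
   using assms by (intro prod.cong) auto
  then show "(\<Prod>r\<in>insert e I. p ((s(e := b)) r)) * F (s(e := b)) = p b * ((\<Prod>r\<in>I. p (s r)) * F (s(e := b)))"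
   using assms by simp
 qed
 finally show ?thesis
  by (simp add: gavg_def sum_distrib_left)
qed

lemma gavg_insert_mult:
 assumes "finite I" "e \<notin> I" "dep I F"
 shows "gavg A p (insert e I) (%s. ph (s e) * F s) = (\<Sum>b\<in>A. p b * ph b) * gavg A p I F"
proof -
 have "F (s(e := b)) = F s" for s b
  using assms by (intro depD[OF assms(3)]) auto
 then show ?thesis
  using assms by (simp add: gavg_insert gavg_cmult sum_distrib_right mult.assoc)
qed

text \<open>The average over an unused replica is 1, the total mass of \<open>p\<close>.\<close>

lemma gavg_superset:
 assumes "finite I'" "I \<subseteq> I'" "dep I F" "(\<Sum>a\<in>A. p a) = 1"
 shows "gavg A p I' F = gavg A p I F"
proof -
 have I: "finite I" using assms(1,2) finite_subset by auto
 have "gavg A p (X \<union> I) F = gavg A p I F" if "finite X" "X \<inter> I = {}" for X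
  using that
 proof (induction X rule: finite_induct)
  case (insert e X)
  have "gavg A p (insert e (X \<union> I)) (%s. 1 * F s) = (\<Sum>b\<in>A. p b * 1) * gavg A p (X \<union> I) F"
   using insert I by (intro gavg_insert_mult dep_mono[OF assms(3)]) auto
  then show ?case using insert assms(4) by simp
 qed simp
 from this[of "I' - I"] show ?thesis using assms(1,2) by (simp add: Un_absorb2 Diff_Int_distrib2)
qed

lemma gavg_reindex:
 fixes \<pi> :: "'q => 'r"
 assumes "finite I" "inj_on \<pi> J" "\<pi> ` J \<subseteq> I" "dep J F" "(\<Sum>a\<in>A. p a) = 1"
 shows "gavg A p I (%s. F (%j. s (\<pi> j))) = gavg A p J F"
proof -
 have d: "dep (\<pi> ` J) (%s. F (%j. s (\<pi> j)))"
  by (rule depI) (auto intro: depD[OF assms(4)])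
 have "gavg A p I (%s. F (%j. s (\<pi> j))) = gavg A p (\<pi> ` J) (%s. F (%j. s (\<pi> j)))"
  by (rule gavg_superset[OF assms(1,3) d assms(5)])
 also have "... = gavg A p J F"
  unfolding gavg_def
 proof (rule sum.reindex_bij_witness[where j = "%s. \<lambda>j\<in>J. s (\<pi> j)" and
    i = "%s. \<lambda>r\<in>\<pi> ` J. s (the_inv_into J \<pi> r)"])
  fix s assume s: "s \<in> \<pi> ` J \<rightarrow>\<^sub>E A"
  show "(\<lambda>r\<in>\<pi> ` J. (\<lambda>j\<in>J. s (\<pi> j)) (the_inv_into J \<pi> r)) = s"
  proof
   fix r
   show "(\<lambda>r\<in>\<pi> ` J. (\<lambda>j\<in>J. s (\<pi> j)) (the_inv_into J \<pi> r)) r = s r"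
   proof (cases "r \<in> \<pi> ` J")
    case True
    then obtain j where "j \<in> J" "r = \<pi> j" by auto
    then show ?thesis using assms(2) by (simp add: the_inv_into_f_f)
   next
    case False
    then show ?thesis using PiE_arb[OF s False] by simp
   qed
  qed
  show "(\<lambda>j\<in>J. s (\<pi> j)) \<in> J \<rightarrow>\<^sub>E A" using s by auto
  have "F (\<lambda>j\<in>J. s (\<pi> j)) = F (%j. s (\<pi> j))" by (rule depD[OF assms(4)]) auto
  then show "(\<Prod>r\<in>J. p ((\<lambda>j\<in>J. s (\<pi> j)) r)) * F (\<lambda>j\<in>J. s (\<pi> j)) =
     (\<Prod>r\<in>\<pi> ` J. p (s r)) * F (%j. s (\<pi> j))"
   using assms(2) by (simp add: prod.reindex)
 next
  fix s assume s: "s \<in> J \<rightarrow>\<^sub>E A"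
  show "(\<lambda>r\<in>\<pi> ` J. s (the_inv_into J \<pi> r)) \<in> \<pi> ` J \<rightarrow>\<^sub>E A"
   using s assms(2) by (auto simp: the_inv_into_f_f)
  show "(\<lambda>j\<in>J. (\<lambda>r\<in>\<pi> ` J. s (the_inv_into J \<pi> r)) (\<pi> j)) = s"
  proof
   fix j
   show "(\<lambda>j\<in>J. (\<lambda>r\<in>\<pi> ` J. s (the_inv_into J \<pi> r)) (\<pi> j)) j = s j"
    using assms(2) PiE_arb[OF s, of j] by (cases "j \<in> J") (simp_all add: the_inv_into_f_f)
  qed
 qed
 finally show ?thesis .
qed

section \<open>Gibbs weights\<close>

definition gb :: "'a set => ('a => real) => 'a => real" where
 "gb A L a = exp (L a) / (\<Sum>b\<in>A. exp (L b))"

lemma sum_exp_pos: "finite A ==> A ~= {} ==> 0 < (\<Sum>b\<in>A. exp (L b :: real))"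
 by (intro sum_pos) auto

lemma gb_nonneg: "0 <= gb A L a"
 by (auto simp: gb_def intro!: divide_nonneg_nonneg sum_nonneg)

lemma gb_le_1: "finite A ==> a \<in> A ==> gb A L a <= 1"
 using sum_exp_pos[of A L] member_le_sum[of a A "%b. exp (L b)"]
 by (force simp: gb_def divide_le_eq)

lemma gb_sum: "finite A ==> A ~= {} ==> (\<Sum>a\<in>A. gb A L a) = 1"
 using sum_exp_pos[of A L] by (simp add: gb_def flip: sum_divide_distrib)

lemma prod_gb:
 "finite I ==> (\<Prod>r\<in>I. gb A L (s r)) = exp (\<Sum>r\<in>I. L (s r)) / (\<Sum>b\<in>A. exp (L b)) ^ card I"
 by (simp add: gb_def prod_dividef exp_sum)

lemma gavg_gb_has_derivative:
 fixes L' :: "'a => real" and F :: "real => ('r => 'a) => real"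
 assumes A: "finite A" "A ~= {}" and I: "finite I"
  and L: "!!a. a \<in> A ==> ((%t. L t a) has_real_derivative L' a) (at t)"
  and F: "!!s. s \<in> PiE I (%_. A) ==> ((%t. F t s) has_real_derivative F' s) (at t)"
 shows "((%t. gavg A (gb A (L t)) I (F t)) has_real_derivative
   gavg A (gb A (L t)) I F' + gavg A (gb A (L t)) I (%s. (\<Sum>r\<in>I. L' (s r)) * F t s)
   - card I * (\<Sum>a\<in>A. gb A (L t) a * L' a) * gavg A (gb A (L t)) I (F t)) (at t)"
proof -
 define Z where "Z = (%t. \<Sum>b\<in>A. exp (L t b))"
 define m where "m = card I"
 define Z' where "Z' = (\<Sum>b\<in>A. exp (L t b) * L' b)"
 have Z: "Z t > 0" unfolding Z_def by (rule sum_exp_pos[OF A])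
 have dZ: "(Z has_real_derivative Z') (at t)"
  unfolding Z_def Z'_def by (intro DERIV_sum DERIV_fun_exp L)
 have mean: "(\<Sum>a\<in>A. gb A (L t) a * L' a) = Z' / Z t"
  by (simp add: gb_def Z_def Z'_def sum_divide_distrib)
 have dterm: "((%t. (\<Prod>r\<in>I. gb A (L t) (s r)) * F t s) has_real_derivative
   (\<Prod>r\<in>I. gb A (L t) (s r)) * (F' s + (\<Sum>r\<in>I. L' (s r)) * F t s - m * (Z' / Z t) * F t s)) (at t)"
  if s: "s \<in> PiE I (%_. A)" for s
 proof -
  define U where "U = (%t. \<Sum>r\<in>I. L t (s r))"
  define U' where "U' = (\<Sum>r\<in>I. L' (s r))"
  have dU: "(U has_real_derivative U') (at t)"
   unfolding U_def U'_def using s by (intro DERIV_sum L) auto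
  have ddiv: "((%t. exp (U t) / Z t ^ m) has_real_derivative
    exp (U t) / Z t ^ m * (U' - m * (Z' / Z t))) (at t)"
  proof -
   have "((%t. exp (U t) / Z t ^ m) has_real_derivative
    (exp (U t) * U' * Z t ^ m - exp (U t) * (real m * Z t ^ (m - 1) * Z')) / (Z t ^ m * Z t ^ m)) (at t)"
    using Z by (auto intro!: derivative_eq_intros dU dZ)
   moreover have "(exp (U t) * U' * Z t ^ m - exp (U t) * (real m * Z t ^ (m - 1) * Z')) / (Z t ^ m * Z t ^ m)
     = exp (U t) / Z t ^ m * (U' - m * (Z' / Z t))"
   proof (cases m)
    case 0 then show ?thesis by simp
   next
    case (Suc k)
    have "Z t ~= 0" using Z by simp
    then show ?thesis unfolding Suc by (simp add: field_simps)
   qed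
   ultimately show ?thesis by simp
  qed
  have "((%t. exp (U t) / Z t ^ m * F t s) has_real_derivative
    exp (U t) / Z t ^ m * (U' - m * (Z' / Z t)) * F t s + F' s * (exp (U t) / Z t ^ m)) (at t)"
   by (rule DERIV_mult[OF ddiv F[OF s]])
  then show ?thesis
   using I by (simp add: prod_gb U_def Z_def m_def U'_def algebra_simps add_divide_distrib)
 qed
 have "((%t. gavg A (gb A (L t)) I (F t)) has_real_derivative
   (\<Sum>s\<in>PiE I (%_. A). (\<Prod>r\<in>I. gb A (L t) (s r)) * (F' s + (\<Sum>r\<in>I. L' (s r)) * F t s - m * (Z' / Z t) * F t s))) (at t)"
  unfolding gavg_def by (intro DERIV_sum dterm)
 also have "(\<Sum>s\<in>PiE I (%_. A). (\<Prod>r\<in>I. gb A (L t) (s r)) * (F' s + (\<Sum>r\<in>I. L' (s r)) * F t s - m * (Z' / Z t) * F t s))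
   = gavg A (gb A (L t)) I (%s. (F' s + (\<Sum>r\<in>I. L' (s r)) * F t s) - (m * (Z' / Z t)) * F t s)"
  by (simp add: gavg_def)
 finally show ?thesis
  unfolding gavg_diff gavg_add gavg_cmult mean m_def by simp
qed

lemma gavg_gb_has_derivative_replica:
 fixes L' :: "'a => real" and F :: "real => ('r => 'a) => real"
 assumes A: "finite A" "A ~= {}" and I: "finite I" "e \<notin> I"
  and L: "!!a. a \<in> A ==> ((%t. L t a) has_real_derivative L' a) (at t)"
  and F: "!!s. s \<in> PiE I (%_. A) ==> ((%t. F t s) has_real_derivative F' s) (at t)"
  and d: "dep I (F t)"
 shows "((%t. gavg A (gb A (L t)) I (F t)) has_real_derivative
   gavg A (gb A (L t)) I F' +
   gavg A (gb A (L t)) (insert e I) (%s. ((\<Sum>r\<in>I. L' (s r)) - card I * L' (s e)) * F t s)) (at t)"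
proof -
 let ?p = "gb A (L t)"
 have d': "dep I (%s. (\<Sum>r\<in>I. L' (s r)) * F t s)"
  using d by (intro dep_mult dep_sum dep_coord) auto
 have "gavg A ?p (insert e I) (%s. ((\<Sum>r\<in>I. L' (s r)) - card I * L' (s e)) * F t s) =
   gavg A ?p (insert e I) (%s. (\<Sum>r\<in>I. L' (s r)) * F t s) - card I * gavg A ?p (insert e I) (%s. L' (s e) * F t s)"
  by (simp add: left_diff_distrib gavg_diff gavg_cmult mult.assoc)
 also have "... = gavg A ?p I (%s. (\<Sum>r\<in>I. L' (s r)) * F t s) - card I * ((\<Sum>a\<in>A. ?p a * L' a) * gavg A ?p I (F t))"
  using I gavg_insert_mult[OF I d, where A = A and p = ?p and ph = L']
   gavg_superset[OF _ _ d', where I' = "insert e I" and A = A and p = ?p] gb_sum[OF A]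
  by auto
 finally show ?thesis
  using gavg_gb_has_derivative[where L=L and F=F and L'=L' and F'=F' and t=t and A=A and I=I, OF A I(1) L F] by (simp add: mult.assoc add_diff_eq)
qed

lemma gavg_gb_continuous:
 fixes F :: "real => ('r => 'a) => real"
 assumes A: "finite A" "A ~= {}" and I: "finite I"
  and L: "!!a. a \<in> A ==> continuous_on X (%t. L t a)"
  and F: "!!s. s \<in> PiE I (%_. A) ==> continuous_on X (%t. F t s)"
 shows "continuous_on X (%t. gavg A (gb A (L t)) I (F t))"
 unfolding gavg_def gb_def using sum_exp_pos[OF A]
 by (intro continuous_intros L F) (auto simp: less_le)

lemma borel_measurable_gb:
 assumes A: "finite A" "a \<in> A" and L: "!!a. a \<in> A ==> (%g. L g a) \<in> borel_measurable M"
 shows "(%g. gb A (L g) a) \<in> borel_measurable M"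
 unfolding gb_def using assms by measurable

lemma expgr_gavg:
 assumes A: "finite A" and I: "finite I"
  and L: "!!a. a \<in> A ==> (%g. L g a) \<in> borel_measurable (gpr S)"
  and F: "!!s. s \<in> PiE I (%_. A) ==> expgr S (%g. F g s)"
 shows "expgr S (%g. gavg A (gb A (L g)) I (F g))"
 unfolding gavg_def
proof (intro expgr_intros F)
 fix s r assume "s \<in> PiE I (%_. A)" "r \<in> I"
 then have "s r \<in> A" by auto
 then show "expgr S (%g. gb A (L g) (s r))"
  using A by (intro expgr_bounded[of _ _ 1] borel_measurable_gb L)
   (auto simp: abs_of_nonneg gb_nonneg intro: gb_le_1)
qed

text \<open>Integration by parts against a Gaussian coordinate brings down the derivative of the
 Gibbs weights, and the derivative of the normalisation is what introduces a new replica.\<close>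

lemma gibbs_by_parts:
 fixes c :: "'a => real" and F F' :: "('j => real) => ('r => 'a) => real"
 assumes S: "finite S" "j \<in> S" and A: "finite A" "A ~= {}" and I: "finite I" "e \<notin> I"
  and L: "!!g x a. a \<in> A ==> ((%y. L (g(j := y)) a) has_real_derivative c a) (at x)"
  and Lm: "!!a. a \<in> A ==> (%g. L g a) \<in> borel_measurable (gpr S)"
  and F: "!!g x s. s \<in> PiE I (%_. A) ==>
     ((%y. F (g(j := y)) s) has_real_derivative F' (g(j := x)) s) (at x)"
  and cont: "!!g s. s \<in> PiE I (%_. A) ==> continuous_on UNIV (%y. F' (g(j := y)) s)"
  and gr: "!!s. expgr S (%g. F g s)" "!!s. expgr S (%g. F' g s)"
  and d: "!!g. dep I (F g)"
 shows "(\<integral>g. g j * gavg A (gb A (L g)) I (F g) \<partial>gpr S) =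
   (\<integral>g. gavg A (gb A (L g)) I (F' g) \<partial>gpr S) +
   (\<integral>g. gavg A (gb A (L g)) (insert e I) (%s. ((\<Sum>r\<in>I. c (s r)) - card I * c (s e)) * F g s) \<partial>gpr S)"
proof -
 have gr1: "expgr S (%g. gavg A (gb A (L g)) I (F g))"
  "expgr S (%g. gavg A (gb A (L g)) I (F' g))"
  "expgr S (%g. gavg A (gb A (L g)) (insert e I) (%s. ((\<Sum>r\<in>I. c (s r)) - card I * c (s e)) * F g s))"
  using A I S by (intro expgr_gavg Lm expgr_intros gr; simp)+
 have Lc: "continuous_on UNIV (%y. L (g(j := y)) a)" if "a \<in> A" for g a
  using L[OF that] by (meson DERIV_isCont continuous_at_imp_continuous_on)
 have Fc: "continuous_on UNIV (%y. F (g(j := y)) s)" if s: "s \<in> PiE (insert e I) (%_. A)" for g s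
 proof -
  let ?s = "\<lambda>r\<in>I. s r"
  have s': "?s \<in> PiE I (%_. A)" using s by auto
  have eq: "F g' ?s = F g' s" for g' by (rule depD[OF d]) simp
  have "continuous_on UNIV (%y. F (g(j := y)) ?s)"
   using F[OF s'] by (meson DERIV_isCont continuous_at_imp_continuous_on)
  then show ?thesis by (simp add: eq)
 qed
 have "(\<integral>g. g j * gavg A (gb A (L g)) I (F g) \<partial>gpr S) =
   (\<integral>g. gavg A (gb A (L g)) I (F' g) +
    gavg A (gb A (L g)) (insert e I) (%s. ((\<Sum>r\<in>I. c (s r)) - card I * c (s e)) * F g s) \<partial>gpr S)"
 proof (rule gpr_by_parts[OF S])
  fix g x
  show "((%y. gavg A (gb A (L (g(j := y)))) I (F (g(j := y)))) has_real_derivative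
   gavg A (gb A (L (g(j := x)))) I (F' (g(j := x))) +
   gavg A (gb A (L (g(j := x)))) (insert e I)
    (%s. ((\<Sum>r\<in>I. c (s r)) - real (card I) * c (s e)) * F (g(j := x)) s)) (at x)"
   by (rule gavg_gb_has_derivative_replica[where L = "%y. L (g(j := y))" and F = "%y. F (g(j := y))"])
     (use A I L F d in auto)
 next
  fix g
  show "continuous_on UNIV (%y. gavg A (gb A (L (g(j := y)))) I (F' (g(j := y))) +
   gavg A (gb A (L (g(j := y)))) (insert e I)
    (%s. ((\<Sum>r\<in>I. c (s r)) - real (card I) * c (s e)) * F (g(j := y)) s))"
   using A I by (intro continuous_intros gavg_gb_continuous Lc Fc cont) auto
 qed (intro expgr_add gr1)+
 then show ?thesis
  using expgr_integrable[OF S(1) gr1(2)] expgr_integrable[OF S(1) gr1(3)] by simp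
qed

section \<open>The cavity interpolation\<close>

definition gauss_const :: "nat => real => real" where
 "gauss_const m b = 2 * (m + 1) * exp (((m + 1) * b)^2 / 2)"

text \<open>The weights \<open>cw1\<close> and \<open>cw2\<close> collect the signs of two integrations by parts: replicas \<open>m\<close> and \<open>m + 1\<close> come
from differentiating the normalizing sums. Both weights have total 0.\<close>

definition cw1 :: "nat => nat => real" where
 "cw1 m l = (if l = m + 1 then - real (m + 1) else 1)"

definition cw2 :: "nat => nat => real" where
 "cw2 m l = (if l < m then 1 else if l = m then - real m else 0)"

definition tmom :: "real => real => real => nat => real" where
 "tmom be h q k = (\<integral>z. tanh (be * (sqrt q * z) + be * h) ^ k \<partial>std_gauss)"

text \<open>The sign \<open>ep\<close> is the spin at the chosen site and \<open>fl\<close> reverses it. The Hamiltonian \<open>L0\<close> and the vectors \<open>v j\<close>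
describe the other spins. The coordinate \<open>z0\<close> carries the common Gaussian \<open>z\<close>.\<close>

locale cavity =
 fixes A :: "'a set" and fl :: "'a => 'a" and ep :: "'a => real" and L0 :: "'a => real"
  and J :: "'j set" and z0 :: 'j and v :: "'j => 'a => real" and be h q c :: real
 assumes A: "finite A" "A ~= {}"
  and fl: "!!a. a \<in> A ==> fl a \<in> A" "!!a. a \<in> A ==> fl (fl a) = a"
  and ep: "!!a. a \<in> A ==> ep a * ep a = 1" "!!a. a \<in> A ==> ep (fl a) = - ep a"
  and L0_fl: "!!a. a \<in> A ==> L0 (fl a) = L0 a"
  and v_fl: "!!a j. a \<in> A ==> j \<in> J ==> v j (fl a) = v j a"
  and J: "finite J" "z0 \<notin> J"
  and v_norm: "!!a. a \<in> A ==> (\<Sum>j\<in>J. v j a * v j a) = c"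
  and c: "c <= 1" and q: "0 <= q" "q <= 1" and be: "0 <= be"
begin

abbreviation "S \<equiv> insert z0 J"

definition "ell ga a = (\<Sum>j\<in>J. ga j * v j a)"

text \<open>At \<open>th = pi/2\<close> this is the true field, at \<open>th = 0\<close> the decoupled one.\<close>

definition "U th ga a = be * (sin th * ell ga a + cos th * (sqrt q * ga z0)) + be * h"

definition "L th ga a = L0 a + ep a * U th ga a"

abbreviation "p th ga \<equiv> gb A (L th ga)"
abbreviation "p0 \<equiv> gb A L0"

definition "ov a b = (\<Sum>j\<in>J. v j a * v j b)"

definition "D a b = ep a * ep b * (ov a b - q)"

definition "Ph th m F = (\<integral>ga. gavg A (p th ga) {..<m} F \<partial>gpr S)" for m :: nat

definition "avg0 m F = gavg A p0 {..<m} F" for m :: nat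

definition "eT T s = (\<Prod>r\<in>T. ep (s r))" for T :: "nat set"

definition "flip_inv m F \<longleftrightarrow> (\<forall>s\<in>PiE {..<m} (%_. A). \<forall>r<m. F (s(r := fl (s r))) = F s)"
 for m :: nat and F :: "(nat => 'a) => real"

definition "B m s = (\<Sum>l<m+2. \<Sum>l'\<in>{..<m+2} - {l}. cw1 m l * cw2 m l' * D (s l) (s l'))"

definition "err1 m F = (\<Sum>l<m. \<Sum>l'\<in>{..<m} - {l}. avg0 m (%s. \<bar>F s\<bar> * \<bar>ov (s l) (s l') - q\<bar>))"
 for m :: nat and F :: "(nat => 'a) => real"

definition "err2 m F = (\<Sum>l<m. \<Sum>l'\<in>{..<m} - {l}. \<Sum>k<m. \<Sum>k'\<in>{..<m} - {k}.
  avg0 m (%s. \<bar>F s\<bar> * (\<bar>ov (s l) (s l') - q\<bar> * \<bar>ov (s k) (s k') - q\<bar>)))"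
 for m :: nat and F :: "(nat => 'a) => real"

lemma finS: "finite S" using J by simp

lemma abs_eps: "a \<in> A ==> \<bar>ep a\<bar> = 1"
 using ep(1)[of a] by (metis abs_1 abs_mult abs_ge_zero real_sqrt_abs2 real_sqrt_one)

lemma abs_v: "a \<in> A ==> j \<in> J ==> \<bar>v j a\<bar> <= 1"
proof -
 assume a: "a \<in> A" "j \<in> J"
 have "v j a * v j a <= (\<Sum>j\<in>J. v j a * v j a)"
  using a J by (intro member_le_sum) auto
 also have "... <= 1^2" using v_norm[OF a(1)] c by simp
 finally show ?thesis by (simp only: power2_eq_square[symmetric] abs_le_square_iff[of _ 1, simplified] abs_one)
   (simp add: abs_square_le_1)
qed

lemma abs_ell: "a \<in> A ==> \<bar>ell ga a\<bar> <= (\<Sum>j\<in>J. \<bar>ga j\<bar>)"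
 unfolding ell_def
 by (rule order_trans[OF sum_abs]) (auto simp: abs_mult intro!: sum_mono mult_left_le abs_v)

lemma ell_measurable [measurable]: "(%ga. ell ga a) \<in> borel_measurable (gpr S)"
 unfolding ell_def by measurable

lemma z0_measurable [measurable]: "(%ga. ga z0) \<in> borel_measurable (gpr S)"
 by measurable

lemma U_measurable [measurable]: "(%ga. U th ga a) \<in> borel_measurable (gpr S)"
 unfolding U_def by measurable

lemma L_measurable [measurable]: "(%ga. L th ga a) \<in> borel_measurable (gpr S)"
 unfolding L_def by measurable

lemma gavg_growth:
 assumes "!!s. s \<in> PiE I (%_. A) ==> expgr S (%ga. F ga s)" "finite I"
 shows "expgr S (%ga. gavg A (p th ga) I (F ga))"
 by (rule expgr_gavg) (use A assms in auto)

lemma gavg_integrable: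
 assumes "!!s. s \<in> PiE I (%_. A) ==> expgr S (%ga. F ga s)" "finite I"
 shows "integrable (gpr S) (%ga. gavg A (p th ga) I (F ga))"
 by (rule expgr_integrable[OF finS gavg_growth]) (use assms in auto)

lemma gavg_integrable_const:
 "integrable (gpr S) (%ga. gavg A (p th ga) {..<m} F)" for m :: nat
 by (rule gavg_integrable) auto

lemma Ph_add: "Ph th m (%s. F s + G s) = Ph th m F + Ph th m G"
 by (simp add: Ph_def gavg_add gavg_integrable_const)

lemma Ph_diff: "Ph th m (%s. F s - G s) = Ph th m F - Ph th m G"
 by (simp add: Ph_def gavg_diff gavg_integrable_const)

lemma Ph_cmult: "Ph th m (%s. k * F s) = k * Ph th m F"
 by (simp add: Ph_def gavg_cmult)

lemma Ph_sum: "Ph th m (%s. \<Sum>x\<in>X. F x s) = (\<Sum>x\<in>X. Ph th m (F x))"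
 by (simp add: Ph_def gavg_sum gavg_integrable_const)

lemma Ph_cong: "(!!s. s \<in> PiE {..<m} (%_. A) ==> F s = G s) ==> Ph th m F = Ph th m G"
 unfolding Ph_def by (intro Bochner_Integration.integral_cong refl gavg_cong) auto

lemma avg0_superset: "dep {..<m} F ==> m <= m' ==> avg0 m' F = avg0 m F"
 unfolding avg0_def by (rule gavg_superset) (auto simp: gb_sum A)

lemma avg0_mono: "(!!s. s \<in> PiE {..<m} (%_. A) ==> F s <= G s) ==> avg0 m F <= avg0 m G"
 unfolding avg0_def by (rule gavg_mono) (auto simp: gb_nonneg)

lemma avg0_nonneg: "(!!s. s \<in> PiE {..<m} (%_. A) ==> 0 <= F s) ==> 0 <= avg0 m F"
 unfolding avg0_def by (rule gavg_nonneg) (auto simp: gb_nonneg)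

lemma Ph_abs_le: "\<bar>Ph th m F\<bar> <= Ph th m (%s. \<bar>F s\<bar>)"
proof -
 have "\<bar>Ph th m F\<bar> <= (\<integral>ga. \<bar>gavg A (p th ga) {..<m} F\<bar> \<partial>gpr S)"
  unfolding Ph_def by (rule integral_abs_bound)
 also have "... <= Ph th m (%s. \<bar>F s\<bar>)"
  unfolding Ph_def
  by (intro integral_mono integrable_abs gavg_integrable_const gavg_abs_le gb_nonneg)
 finally show ?thesis .
qed

lemma Ph_mono: "(!!s. s \<in> PiE {..<m} (%_. A) ==> F s <= G s) ==> Ph th m F <= Ph th m G"
 unfolding Ph_def
 by (intro integral_mono gavg_integrable_const gavg_mono gb_nonneg)

subsection \<open>The derivative along the interpolation\<close>

lemma cw_diag: "(\<Sum>l<m+2. cw1 m l * cw2 m l) = 0"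
proof -
 have "(\<Sum>l<m+2. cw1 m l * cw2 m l) = (\<Sum>l<m. cw1 m l * cw2 m l) + cw1 m m * cw2 m m + cw1 m (m+1) * cw2 m (m+1)"
  by simp
 also have "(\<Sum>l<m. cw1 m l * cw2 m l) = (\<Sum>l<m. 1)"
  by (intro sum.cong) (auto simp: cw1_def cw2_def)
 finally show ?thesis by (simp add: cw1_def cw2_def)
qed

lemma sum_split_diag:
 assumes "finite X"
 shows "(\<Sum>l\<in>X. \<Sum>l'\<in>X. f l l') = (\<Sum>l\<in>X. \<Sum>l'\<in>X - {l}. f l l') + (\<Sum>l\<in>X. f l l :: real)"
 unfolding sum.distrib[symmetric] using assms
 by (intro sum.cong refl) (simp add: sum.remove add.commute)

text \<open>Both Gaussian families are integrated by parts. The variances of the two fields enter with the same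
prefactor \<open>sin cos\<close> and opposite signs, so only overlap minus \<open>q\<close> survives. The terms with \<open>l = l'\<close> cancel since \<open>ep^2 = 1\<close>
and \<open>cw_diag\<close>.\<close>

lemma Ph_has_derivative:
 assumes d: "dep {..<m} F"
 shows "((%th. Ph th m F) has_real_derivative
   sin th * cos th * be^2 * Ph th (m + 2) (%s. B m s * F s)) (at th)"
proof -
 define L' where "L' = (%th ga a. ep a * (be * (cos th * ell ga a - sin th * (sqrt q * ga z0))))"
 define f' where "f' = (%th ga. gavg A (p th ga) {..<Suc m} (%s. ((\<Sum>r<m. L' th ga (s r)) - m * L' th ga (s m)) * F s))"
 define sg where "sg = (%ga::'j => real. \<Sum>j\<in>S. \<bar>ga j\<bar>)"
 define MF where "MF = (\<Sum>s\<in>PiE {..<Suc m} (%_. A). \<bar>F s\<bar>)"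
 have L'_bound: "\<bar>L' th ga a\<bar> <= be * sg ga" if "a \<in> A" for th ga a
 proof -
  have sq: "sqrt q <= 1" "0 <= sqrt q" using q by auto
  have "\<bar>cos th * ell ga a - sin th * (sqrt q * ga z0)\<bar> <= \<bar>cos th\<bar> * \<bar>ell ga a\<bar> + \<bar>sin th\<bar> * (sqrt q * \<bar>ga z0\<bar>)"
   using abs_triangle_ineq4[of "cos th * ell ga a" "sin th * (sqrt q * ga z0)"] sq
   unfolding abs_mult by (simp only: abs_of_nonneg)
  also have "... <= 1 * (\<Sum>j\<in>J. \<bar>ga j\<bar>) + 1 * (1 * \<bar>ga z0\<bar>)"
   using that sq by (intro add_mono mult_mono abs_ell) auto
  also have "... = sg ga" unfolding sg_def using J by simp
  finally show ?thesis
   using be abs_eps[OF that] unfolding L'_def by (simp add: abs_mult mult_left_mono)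
 qed
 have LL: "((%th. L th ga a) has_real_derivative L' th ga a) (at th)" for ga a th
  unfolding L_def U_def L'_def by (auto intro!: derivative_eq_intros simp: algebra_simps)
 have der: "((%th. gavg A (p th ga) {..<m} F) has_real_derivative f' th ga) (at th)" for th ga
 proof -
  have "((%th. gavg A (p th ga) {..<m} F) has_real_derivative
   gavg A (p th ga) {..<m} (%_. 0) + gavg A (p th ga) (insert m {..<m})
    (%s. ((\<Sum>r<m. L' th ga (s r)) - card {..<m} * L' th ga (s m)) * F s)) (at th)"
   by (rule gavg_gb_has_derivative_replica[where L = "%th. L th ga" and F = "%_. F"])
     (use A d LL in auto)
  then show ?thesis by (simp add: f'_def lessThan_Suc gavg_def)
 qed
 have L'm: "(%ga. L' th ga a) \<in> borel_measurable (gpr S)" for th a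
  unfolding L'_def by measurable
 have sgg: "expgr S sg" unfolding sg_def using finS by (intro expgr_intros) auto
 have L'g: "expgr S (%ga. L' th ga a)" for th a
  unfolding L'_def ell_def using finS by (intro expgr_intros) auto
 have f'g: "expgr S (f' th)" for th
  unfolding f'_def by (intro gavg_growth expgr_intros L'g) auto
 have bound: "\<bar>f' th ga\<bar> <= (2 * m * be * MF) * sg ga" for th ga
 proof -
  have "\<bar>f' th ga\<bar> <= gavg A (p th ga) {..<Suc m} (%s. \<bar>((\<Sum>r<m. L' th ga (s r)) - m * L' th ga (s m)) * F s\<bar>)"
   unfolding f'_def by (intro gavg_abs_le gb_nonneg)
  also have "... <= gavg A (p th ga) {..<Suc m} (%s. (2 * m * be * MF) * sg ga)"
  proof (intro gavg_mono gb_nonneg)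
   fix s assume s: "s \<in> PiE {..<Suc m} (%_. A)"
   have "\<bar>\<Sum>r<m. L' th ga (s r)\<bar> <= (\<Sum>r<m. be * sg ga)"
    by (rule order_trans[OF sum_abs]) (intro sum_mono L'_bound PiE_mem[OF s], simp)
   moreover have "\<bar>m * L' th ga (s m)\<bar> <= m * (be * sg ga)"
    using L'_bound[OF PiE_mem[OF s], of m] by (simp add: abs_mult mult_left_mono)
   ultimately have "\<bar>(\<Sum>r<m. L' th ga (s r)) - m * L' th ga (s m)\<bar> <= 2 * m * be * sg ga"
    by simp
   moreover have "\<bar>F s\<bar> <= MF"
    unfolding MF_def using s A by (intro member_le_sum finite_PiE) auto
   ultimately have "\<bar>((\<Sum>r<m. L' th ga (s r)) - m * L' th ga (s m)) * F s\<bar> <= (2 * m * be * sg ga) * MF"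
    unfolding abs_mult using be by (intro mult_mono) (simp_all add: sg_def sum_nonneg)
   then show "\<bar>((\<Sum>r<m. L' th ga (s r)) - m * L' th ga (s m)) * F s\<bar> <= (2 * m * be * MF) * sg ga"
    by (simp add: mult_ac)
  qed
  also have "... = (2 * m * be * MF) * sg ga"
   by (rule gavg_const) (auto simp: A gb_sum)
  finally show ?thesis .
 qed
 have main: "((%th. Ph th m F) has_real_derivative (\<integral>ga. f' th ga \<partial>gpr S)) (at th)"
  unfolding Ph_def
  by (rule has_real_derivative_integral[OF gavg_integrable_const der bound])
    (auto intro!: integrable_mult_right expgr_integrable finS sgg expgr_measurable f'g)
 define cj where "cj = (%j a. ep a * be * (if j = z0 then cos th * sqrt q else sin th * v j a))"
 define cj' where "cj' = (%j a. ep a * be * (if j = z0 then - sin th * sqrt q else cos th * v j a))"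
 have sumS: "(\<Sum>j\<in>S. g j) = g z0 + (\<Sum>j\<in>J. g j)" for g :: "'j => real"
  using J by simp
 have cj'_z0: "cj' z0 a = - ep a * be * sin th * sqrt q" for a by (simp add: cj'_def)
 have L'_sum: "L' th ga a = (\<Sum>j\<in>S. ga j * cj' j a)" for ga a
 proof -
  have "(\<Sum>j\<in>J. ga j * cj' j a) = (\<Sum>j\<in>J. ep a * be * cos th * (ga j * v j a))"
   using J(2) by (intro sum.cong) (auto simp: cj'_def mult_ac)
  then show ?thesis
   unfolding sumS L'_def ell_def sum_distrib_left[symmetric]
   by (simp add: cj'_z0 algebra_simps)
 qed
 have cj_z0: "cj z0 a = ep a * be * cos th * sqrt q" for a by (simp add: cj_def)
 have L_sum: "L th ga a = L0 a + ep a * be * h + (\<Sum>j\<in>S. ga j * cj j a)" for ga a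
 proof -
  have "(\<Sum>j\<in>J. ga j * cj j a) = (\<Sum>j\<in>J. ep a * be * sin th * (ga j * v j a))"
   using J(2) by (intro sum.cong) (auto simp: cj_def mult_ac)
  then show ?thesis
   unfolding sumS L_def U_def ell_def sum_distrib_left[symmetric]
   by (simp add: cj_z0 algebra_simps)
 qed
 define H where "H = (%j s. (\<Sum>l'<m+2. cw2 m l' * cj' j (s l')) * F s)"
 define H1 where "H1 = (%j s. ((\<Sum>r<m. cj' j (s r)) - m * cj' j (s m)) * F s)"
 have HH: "H j s = H1 j s" for j s
 proof -
  have "(\<Sum>l'<m. cw2 m l' * cj' j (s l')) = (\<Sum>r<m. cj' j (s r))"
   by (intro sum.cong) (auto simp: cw2_def)
  then show ?thesis unfolding H_def H1_def by (simp add: cw2_def)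
 qed
 have f'_eq: "f' th ga = (\<Sum>j\<in>S. ga j * gavg A (p th ga) {..<Suc m} (H j))" for ga
 proof -
  have "((\<Sum>r<m. L' th ga (s r)) - m * L' th ga (s m)) * F s = (\<Sum>j\<in>S. ga j * H j s)" for s
  proof -
   have "(\<Sum>r<m. \<Sum>j\<in>S. ga j * cj' j (s r)) = (\<Sum>j\<in>S. ga j * (\<Sum>r<m. cj' j (s r)))"
    by (subst sum.swap) (simp add: sum_distrib_left)
   then show ?thesis
    unfolding L'_sum HH H1_def
    by (simp add: sum_distrib_left sum_distrib_right sum_subtractf algebra_simps)
  qed
  then show ?thesis unfolding f'_def by (simp add: gavg_sum gavg_cmult)
 qed
 have depH: "dep {..<Suc m} (H j)" for j
 proof -
  have "dep {..<Suc m} F" using d by (rule dep_mono) auto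
  then have "dep {..<Suc m} (H1 j)"
   unfolding H1_def by (intro dep_mult dep_diff dep_sum dep_coord dep_const) auto
  then show ?thesis unfolding HH[abs_def] .
 qed
 have ibp: "(\<integral>ga. ga j * gavg A (p th ga) {..<Suc m} (H j) \<partial>gpr S) =
   Ph th (m + 2) (%s. (\<Sum>l<m+2. cw1 m l * cj j (s l)) * H j s)" if j: "j \<in> S" for j
 proof -
  have ibp0: "(\<integral>ga. ga j * gavg A (p th ga) {..<Suc m} (H j) \<partial>gpr S) =
   (\<integral>ga. gavg A (p th ga) {..<Suc m} (%_. 0) \<partial>gpr S) +
   (\<integral>ga. gavg A (p th ga) (insert (Suc m) {..<Suc m})
     (%s. ((\<Sum>r<Suc m. cj j (s r)) - card {..<Suc m} * cj j (s (Suc m))) * H j s) \<partial>gpr S)"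
  proof (rule gibbs_by_parts[OF finS j A, where F = "%_. H j"])
   fix g :: "'j => real" and x a
   have "(\<Sum>i\<in>S. (g(j := y)) i * cj i a) = y * cj j a + (\<Sum>i\<in>S-{j}. g i * cj i a)" for y
    using j finS by (subst sum.remove[of _ j]) (auto intro!: sum.cong)
   then show "((%y. L th (g(j := y)) a) has_real_derivative cj j a) (at x)"
    unfolding L_sum by (auto intro!: derivative_eq_intros)
  qed (use depH in auto)
  have ceq: "(\<Sum>r<Suc m. cj j (s r)) - card {..<Suc m} * cj j (s (Suc m)) = (\<Sum>l<m+2. cw1 m l * cj j (s l))" for s
  proof -
   have "(\<Sum>l<Suc m. cw1 m l * cj j (s l)) = (\<Sum>r<Suc m. cj j (s r))"
    by (intro sum.cong) (auto simp: cw1_def)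
   then show ?thesis by (simp add: cw1_def algebra_simps)
  qed
  have zero: "gavg A (p th ga) {..<Suc m} (%_. 0) = 0" for ga by (simp add: gavg_def)
  have "{..<m + 2} = insert (Suc m) {..<Suc m}" by auto
  then show ?thesis unfolding Ph_def ibp0[unfolded ceq zero] by simp
 qed
 have cc: "(\<Sum>j\<in>S. cj j a * cj' j b) = sin th * cos th * be^2 * D a b" for a b
 proof -
  have "(\<Sum>j\<in>J. cj j a * cj' j b) = (\<Sum>j\<in>J. ep a * ep b * (be^2 * sin th * cos th) * (v j a * v j b))"
   using J(2) by (intro sum.cong) (auto simp: cj_def cj'_def power2_eq_square)
  also have "... = ep a * ep b * (be^2 * sin th * cos th) * ov a b"
   by (simp add: ov_def sum_distrib_left)
  finally have e1: "(\<Sum>j\<in>J. cj j a * cj' j b) = ep a * ep b * (be^2 * sin th * cos th) * ov a b" .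
  have e2: "cj z0 a * cj' z0 b = - (ep a * ep b * (be^2 * sin th * cos th) * q)"
  proof -
   have "cj z0 a * cj' z0 b = - (ep a * ep b * (be^2 * sin th * cos th) * (sqrt q * sqrt q))"
    by (simp add: cj_def cj'_def power2_eq_square)
   then show ?thesis using q by simp
  qed
  show ?thesis unfolding sumS e1 e2 D_def by (simp add: algebra_simps)
 qed
 have key: "(\<Sum>j\<in>S. (\<Sum>l<m+2. cw1 m l * cj j (s l)) * H j s) = sin th * cos th * be^2 * (B m s * F s)"
  if s: "s \<in> PiE {..<m+2} (%_. A)" for s
 proof -
  have "(\<Sum>j\<in>S. (\<Sum>l<m+2. cw1 m l * cj j (s l)) * (\<Sum>l'<m+2. cw2 m l' * cj' j (s l'))) =
    (\<Sum>j\<in>S. \<Sum>l<m+2. \<Sum>l'<m+2. cw1 m l * cw2 m l' * (cj j (s l) * cj' j (s l')))"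
   unfolding sum_product by (intro sum.cong refl) (simp add: mult_ac)
  also have "... = (\<Sum>l<m+2. \<Sum>j\<in>S. \<Sum>l'<m+2. cw1 m l * cw2 m l' * (cj j (s l) * cj' j (s l')))"
   by (rule sum.swap)
  also have "... = (\<Sum>l<m+2. \<Sum>l'<m+2. \<Sum>j\<in>S. cw1 m l * cw2 m l' * (cj j (s l) * cj' j (s l')))"
   by (intro sum.cong refl sum.swap)
  also have "... = (\<Sum>l<m+2. \<Sum>l'<m+2. cw1 m l * cw2 m l' * (sin th * cos th * be^2 * D (s l) (s l')))"
   unfolding sum_distrib_left[symmetric] cc ..
  also have "... = sin th * cos th * be^2 * (\<Sum>l<m+2. \<Sum>l'<m+2. cw1 m l * cw2 m l' * D (s l) (s l'))"
   by (simp only: sum_distrib_left mult_ac)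
  also have "(\<Sum>l<m+2. \<Sum>l'<m+2. cw1 m l * cw2 m l' * D (s l) (s l')) =
    B m s + (\<Sum>l<m+2. cw1 m l * cw2 m l * D (s l) (s l))"
   unfolding B_def by (rule sum_split_diag) simp
  also have "(\<Sum>l<m+2. cw1 m l * cw2 m l * D (s l) (s l)) = (\<Sum>l<m+2. cw1 m l * cw2 m l * (c - q))"
   using s by (intro sum.cong refl) (auto simp: D_def ov_def v_norm ep PiE_iff)
  also have "... = 0" unfolding sum_distrib_right[symmetric] cw_diag by simp
  finally have "(\<Sum>j\<in>S. (\<Sum>l<m+2. cw1 m l * cj j (s l)) * (\<Sum>l'<m+2. cw2 m l' * cj' j (s l'))) * F s =
    sin th * cos th * be^2 * B m s * F s" by simp
  then show ?thesis
   unfolding H_def by (simp only: sum_distrib_right mult.assoc)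
 qed
 have "(\<integral>ga. f' th ga \<partial>gpr S) = (\<Sum>j\<in>S. \<integral>ga. ga j * gavg A (p th ga) {..<Suc m} (H j) \<partial>gpr S)"
  unfolding f'_eq
  by (rule Bochner_Integration.integral_sum, rule expgr_integrable[OF finS])
    (use finS in \<open>intro expgr_mult expgr_coord gavg_growth, auto\<close>)
 also have "... = Ph th (m + 2) (%s. \<Sum>j\<in>S. (\<Sum>l<m+2. cw1 m l * cj j (s l)) * H j s)"
  unfolding Ph_sum by (rule sum.cong[OF refl ibp])
 also have "... = Ph th (m + 2) (%s. sin th * cos th * be^2 * (B m s * F s))"
  by (rule Ph_cong[OF key])
 finally show ?thesis using main unfolding Ph_cmult by simp
qed

end

text \<open>A spin squares to 1, so multiplying a product of spins by one more spin toggles its label.\<close>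

definition tog :: "'i => 'i set => 'i set" where
 "tog l T = (if l \<in> T then T - {l} else insert l T)"

definition up_const :: "real => real => nat => real => real" where
 "up_const be h m a = exp (m * (be * \<bar>h\<bar>)) * gauss_const m (be * (real m + 1) + a)"

definition low_const :: "real => real => nat => real => real" where
 "low_const be h m a = exp (2 * (m * (be * \<bar>h\<bar>))) * gauss_const m (2 * (be * (real m + 1) + a)) +
   up_const be h (2 * m) 0"

definition lipcav :: "real => real => nat => real" where
 "lipcav be h m = be^2 * (real (m + 1))^2 * up_const be h (m + 2) 0"

lemma exp_sum_le:
 fixes y :: "'i => real" and b :: real
 assumes X: "finite X" "X ~= {}" and b: "0 <= b"
 shows "exp (b * (\<Sum>i\<in>X. y i)) <= (\<Sum>i\<in>X. exp (card X * b * y i))"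
proof -
 obtain i0 where i0: "i0 \<in> X" "!!i. i \<in> X ==> y i <= y i0"
 proof -
  have "Max (y ` X) \<in> y ` X" using X by (intro Max_in) auto
  then obtain i0 where "i0 \<in> X" "Max (y ` X) = y i0" by blast
  moreover have "y i <= Max (y ` X)" if "i \<in> X" for i using X that by (intro Max_ge) auto
  ultimately show ?thesis using that by metis
 qed
 have sb: "(\<Sum>i\<in>X. y i) <= card X * y i0"
  by (rule sum_bounded_above) (rule i0(2))
 have "exp (b * (\<Sum>i\<in>X. y i)) <= exp (card X * b * y i0)"
  using mult_left_mono[OF sb b] by (simp add: mult_ac)
 also have "... <= (\<Sum>i\<in>X. exp (card X * b * y i))"
  by (rule member_le_sum) (use X i0(1) in simp_all)
 finally show ?thesis .
qed

lemma finite_tog: "finite T ==> finite (tog l T)"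
 by (simp add: tog_def)

lemma tog_subset: "T \<subseteq> X ==> l \<in> X ==> tog l T \<subseteq> X"
 by (auto simp: tog_def)

lemma borel_measurable_tanh_real [measurable]: "(tanh :: real => real) \<in> borel_measurable borel"
 by (intro borel_measurable_continuous_onI continuous_on_tanh continuous_on_id) auto

context cavity
begin

subsection \<open>Flipping the cavity spin\<close>

lemma sum_flip: "(\<Sum>a\<in>A. f (fl a)) = (\<Sum>a\<in>A. f a)"
 by (rule sum.reindex_bij_witness[where i = fl and j = fl]) (auto simp: fl)

lemma p0_fl: "a \<in> A ==> p0 (fl a) = p0 a"
 by (simp add: gb_def L0_fl)

lemma gavg_p0_flip:
 assumes r: "r < m"
 shows "gavg A p0 {..<m} (%s. F (s(r := fl (s r)))) = gavg A p0 {..<m} F"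
 unfolding gavg_def
proof (rule sum.reindex_bij_witness[where i = "%s. s(r := fl (s r))" and j = "%s. s(r := fl (s r))"])
 fix s assume s: "s \<in> PiE {..<m} (%_. A)"
 have sr: "s r \<in> A" using s r by auto
 show "(s(r := fl (s r)))(r := fl ((s(r := fl (s r))) r)) = s"
  using fl(2)[OF sr] by (simp add: fun_eq_iff)
 then show "(s(r := fl (s r)))(r := fl ((s(r := fl (s r))) r)) = s" .
 show "s(r := fl (s r)) \<in> PiE {..<m} (%_. A)"
  using s r fl(1)[OF sr] by (auto simp: PiE_iff extensional_def)
 then show "s(r := fl (s r)) \<in> PiE {..<m} (%_. A)" .
 have "(\<Prod>i<m. p0 ((s(r := fl (s r))) i)) = (\<Prod>i<m. p0 (s i))"
  by (intro prod.cong refl) (simp add: p0_fl sr)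
 then show "(\<Prod>i<m. p0 ((s(r := fl (s r))) i)) * F (s(r := fl (s r))) = (\<Prod>i<m. p0 (s i)) * F (s(r := fl (s r)))"
  by simp
qed

lemma eps_cases: "a \<in> A ==> ep a = 1 \<or> ep a = -1"
 using abs_eps[of a] by linarith

lemma gavg_p0_eps_prod:
 assumes F: "flip_inv m F" and V: "V \<subseteq> {..<m}"
 shows "gavg A p0 {..<m} (%s. (\<Prod>r\<in>V. g r (ep (s r))) * F s) =
   (\<Prod>r\<in>V. (g r 1 + g r (-1)) / 2) * gavg A p0 {..<m} F"
proof -
 have "finite V" using V finite_subset by auto
 then show ?thesis using V
 proof (induction V rule: finite_induct)
  case empty
  then show ?case by simp
 next
  case (insert r V)
  define G where "G = (%s. (\<Prod>r\<in>V. g r (ep (s r))) * F s)"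
  have r: "r < m" using insert by auto
  have "gavg A p0 {..<m} (%s. g r (ep (s r)) * G s) =
    gavg A p0 {..<m} (%s. g r (ep ((s(r := fl (s r))) r)) * G (s(r := fl (s r))))"
   using gavg_p0_flip[OF r, of "%s. g r (ep (s r)) * G s"] by simp
  also have "... = gavg A p0 {..<m} (%s. g r (- ep (s r)) * G s)"
  proof (rule gavg_cong)
   fix s assume s: "s \<in> PiE {..<m} (%_. A)"
   have sr: "s r \<in> A" using s r by auto
   have "(\<Prod>i\<in>V. g i (ep ((s(r := fl (s r))) i))) = (\<Prod>i\<in>V. g i (ep (s i)))"
    using insert by (intro prod.cong) auto
   moreover have "F (s(r := fl (s r))) = F s" using F s r by (auto simp: flip_inv_def)
   ultimately show "g r (ep ((s(r := fl (s r))) r)) * G (s(r := fl (s r))) = g r (- ep (s r)) * G s"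
    by (simp add: G_def ep(2)[OF sr])
  qed
  finally have "2 * gavg A p0 {..<m} (%s. g r (ep (s r)) * G s) =
   gavg A p0 {..<m} (%s. g r (ep (s r)) * G s + g r (- ep (s r)) * G s)"
   unfolding gavg_add by simp
  also have "... = gavg A p0 {..<m} (%s. (g r 1 + g r (-1)) * G s)"
  proof (rule gavg_cong)
   fix s assume s: "s \<in> PiE {..<m} (%_. A)"
   have "s r \<in> A" using s r by auto
   from eps_cases[OF this] show "g r (ep (s r)) * G s + g r (- ep (s r)) * G s = (g r 1 + g r (-1)) * G s"
    by (auto simp: distrib_right)
  qed
  also have "... = (g r 1 + g r (-1)) * ((\<Prod>r\<in>V. (g r 1 + g r (-1)) / 2) * gavg A p0 {..<m} F)"
   unfolding gavg_cmult G_def using insert by simp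
  finally show ?case
   using insert by (simp add: G_def mult.assoc)
 qed
qed

lemma p_eq:
 assumes a: "a \<in> A"
 shows "p th ga a = p0 a * exp (ep a * U th ga a) / (\<Sum>b\<in>A. p0 b * exp (ep b * U th ga b))"
proof -
 have W: "(\<Sum>b\<in>A. exp (L0 b)) > 0" by (rule sum_exp_pos[OF A])
 have "(\<Sum>b\<in>A. p0 b * exp (ep b * U th ga b)) = (\<Sum>b\<in>A. exp (L th ga b)) / (\<Sum>b\<in>A. exp (L0 b))"
  by (simp add: gb_def L_def exp_add sum_divide_distrib)
 then show ?thesis using W by (simp add: gb_def L_def exp_add)
qed

lemma sum_p0: "(\<Sum>b\<in>A. p0 b) = 1" by (rule gb_sum[OF A])

lemma U_fl: "a \<in> A ==> U th ga (fl a) = U th ga a"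
 by (simp add: U_def ell_def v_fl)

lemma R_cosh: "(\<Sum>b\<in>A. p0 b * exp (ep b * U th ga b)) = (\<Sum>b\<in>A. p0 b * cosh (U th ga b))"
proof -
 have "(\<Sum>b\<in>A. p0 b * exp (ep b * U th ga b)) = (\<Sum>b\<in>A. p0 b * exp (- (ep b * U th ga b)))"
  using sum_flip[of "%b. p0 b * exp (ep b * U th ga b)"]
  by (simp add: p0_fl U_fl ep cong: sum.cong)
 then have "2 * (\<Sum>b\<in>A. p0 b * exp (ep b * U th ga b)) =
   (\<Sum>b\<in>A. p0 b * (exp (ep b * U th ga b) + exp (- (ep b * U th ga b))))"
  by (simp add: distrib_left sum.distrib)
 also have "... = (\<Sum>b\<in>A. p0 b * (2 * cosh (U th ga b)))"
 proof (intro sum.cong refl arg_cong2[where f = "(*)"])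
  fix b assume "b \<in> A"
  from eps_cases[OF this] show "exp (ep b * U th ga b) + exp (- (ep b * U th ga b)) = 2 * cosh (U th ga b)"
   by (auto simp: cosh_def)
 qed
 also have "... = 2 * (\<Sum>b\<in>A. p0 b * cosh (U th ga b))" by (simp add: sum_distrib_left mult_ac)
 finally show ?thesis by simp
qed

lemma R_ge_1: "1 <= (\<Sum>b\<in>A. p0 b * exp (ep b * U th ga b))"
proof -
 have "(\<Sum>b\<in>A. p0 b * 1) <= (\<Sum>b\<in>A. p0 b * cosh (U th ga b))"
  by (intro sum_mono mult_left_mono cosh_real_ge_1 gb_nonneg)
 then show ?thesis using sum_p0 by (simp add: R_cosh)
qed

subsection \<open>The decoupled end of the interpolation\<close>

text \<open>At the decoupled end the spins at the site are independent given \<open>z\<close>, each with mean \<open>tanh\<close>.\<close>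

lemma Ph_zero:
 assumes F: "flip_inv m F" and T: "T \<subseteq> {..<m}"
 shows "Ph 0 m (%s. eT T s * F s) = tmom be h q (card T) * avg0 m F"
proof -
 have finT: "finite T" using T finite_subset by auto
 define y where "y = (%ga::'j => real. be * (sqrt q * ga z0) + be * h)"
 have "gavg A (p 0 ga) {..<m} (%s. eT T s * F s) = tanh (y ga) ^ card T * avg0 m F" for ga
 proof -
  have U0: "U 0 ga a = y ga" for a by (simp add: U_def y_def)
  define t where "t = tanh (y ga)"
  have pa: "p 0 ga a = p0 a * (1 + ep a * t)" if a: "a \<in> A" for a
  proof -
   have "p 0 ga a = p0 a * exp (ep a * y ga) / cosh (y ga)"
   proof -
    have "(\<Sum>b\<in>A. p0 b * exp (ep b * U 0 ga b)) = cosh (y ga)"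
     using sum_p0 R_cosh[of 0 ga] by (simp add: U0 flip: sum_distrib_right)
    then show ?thesis using p_eq[OF a, of 0 ga] by (simp add: U0)
   qed
   moreover have "exp (ep a * y ga) = cosh (y ga) * (1 + ep a * t)"
   proof -
    have "cosh (y ga) * (1 + ep a * t) = cosh (y ga) + ep a * sinh (y ga)"
     using cosh_real_pos[of "y ga"] by (simp add: t_def tanh_def distrib_left)
    then show ?thesis using eps_cases[OF a] cosh_plus_sinh[of "y ga"] cosh_minus_sinh[of "y ga"] by auto
   qed
   ultimately show ?thesis using cosh_real_pos[of "y ga"] by simp
  qed
  define g where "g = (%r x. (1 + x * t) * (if r \<in> T then x else 1))"
  have "gavg A (p 0 ga) {..<m} (%s. eT T s * F s) =
    gavg A p0 {..<m} (%s. (\<Prod>r<m. g r (ep (s r))) * F s)"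
   unfolding gavg_def
  proof (intro sum.cong refl)
   fix s assume s: "s \<in> PiE {..<m} (%_. A)"
   have "(\<Prod>r<m. p 0 ga (s r)) = (\<Prod>r<m. p0 (s r) * (1 + ep (s r) * t))"
    using s by (intro prod.cong refl pa) auto
   moreover have "eT T s = (\<Prod>r<m. if r \<in> T then ep (s r) else 1)"
    unfolding eT_def using T by (simp add: prod.If_cases Int_absorb1)
   ultimately show "(\<Prod>r<m. p 0 ga (s r)) * (eT T s * F s) = (\<Prod>r<m. p0 (s r)) * ((\<Prod>r<m. g r (ep (s r))) * F s)"
    unfolding g_def by (simp only: prod.distrib mult_ac)
  qed
  also have "... = (\<Prod>r<m. (g r 1 + g r (-1)) / 2) * gavg A p0 {..<m} F"
   by (rule gavg_p0_eps_prod[OF F]) simp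
  also have "(\<Prod>r<m. (g r 1 + g r (-1)) / 2) = (\<Prod>r<m. if r \<in> T then t else 1)"
   by (intro prod.cong refl) (simp add: g_def)
  also have "... = t ^ card T" using T by (simp add: prod.If_cases Int_absorb1)
  finally show ?thesis by (simp add: avg0_def t_def)
 qed
 then have "Ph 0 m (%s. eT T s * F s) = (\<integral>ga. tanh (y ga) ^ card T \<partial>gpr S) * avg0 m F"
  by (simp add: Ph_def)
 also have "(\<integral>ga. tanh (y ga) ^ card T \<partial>gpr S) =
   (\<integral>z. tanh (be * (sqrt q * z) + be * h) ^ card T \<partial>distr (gpr S) std_gauss (%ga. ga z0))"
  unfolding y_def by (subst integral_distr) (auto simp: measurable_cong_sets[OF sets_std_gauss refl])
 also have "distr (gpr S) std_gauss (%ga. ga z0) = std_gauss"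
  by (rule distr_PiM_component) (auto simp: prob_space_std_gauss)
 finally show ?thesis by (simp add: tmom_def)
qed

lemma eT_tog:
 assumes "finite T" "s l \<in> A"
 shows "eT T s * ep (s l) = eT (tog l T) s"
proof (cases "l \<in> T")
 case True
 then have "eT T s = ep (s l) * eT (T - {l}) s" unfolding eT_def using assms by (simp add: prod.remove)
 then show ?thesis using True ep(1)[OF assms(2)] by (simp add: tog_def mult_ac)
next
 case False
 then show ?thesis using assms by (simp add: tog_def eT_def mult_ac)
qed

lemma abs_eT: "s \<in> PiE {..<m} (%_. A) ==> T \<subseteq> {..<m} ==> \<bar>eT T s\<bar> = 1"
 unfolding eT_def by (subst abs_prod) (auto intro!: prod.neutral abs_eps)

subsection \<open>Comparing the two ends\<close>

lemma abs_U: "\<bar>U th ga a\<bar> <= be * (\<bar>ell ga a\<bar> + \<bar>ga z0\<bar>) + be * \<bar>h\<bar>"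
proof -
 have "\<bar>sin th * ell ga a + cos th * (sqrt q * ga z0)\<bar> <= \<bar>sin th\<bar> * \<bar>ell ga a\<bar> + \<bar>cos th\<bar> * (sqrt q * \<bar>ga z0\<bar>)"
  using abs_triangle_ineq[of "sin th * ell ga a" "cos th * (sqrt q * ga z0)"] q unfolding abs_mult by simp
 also have "... <= 1 * \<bar>ell ga a\<bar> + 1 * (1 * \<bar>ga z0\<bar>)"
  using q by (intro add_mono mult_mono) auto
 finally have "be * \<bar>sin th * ell ga a + cos th * (sqrt q * ga z0)\<bar> <= be * (\<bar>ell ga a\<bar> + \<bar>ga z0\<bar>)"
  using be by (intro mult_left_mono) auto
 moreover have "\<bar>U th ga a\<bar> <= be * \<bar>sin th * ell ga a + cos th * (sqrt q * ga z0)\<bar> + be * \<bar>h\<bar>"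
  unfolding U_def using be by (metis abs_mult abs_of_nonneg abs_triangle_ineq)
 ultimately show ?thesis by linarith
qed

lemma ell_exp:
 assumes a: "a \<in> A"
 shows "integrable (gpr S) (%ga. exp (t * ell ga a))"
  and "(\<integral>ga. exp (t * ell ga a) \<partial>gpr S) <= exp (t^2 / 2)"
proof -
 define w where "w = (%j. if j = z0 then 0 else t * v j a)"
 have eq: "exp (t * ell ga a) = (\<Prod>j\<in>S. exp (w j * ga j))" for ga
 proof -
  have "t * ell ga a = (\<Sum>j\<in>J. w j * ga j)"
   unfolding ell_def sum_distrib_left using J by (intro sum.cong) (auto simp: w_def)
  also have "... = (\<Sum>j\<in>S. w j * ga j)" using J by (simp add: w_def)
  finally show ?thesis using finS by (simp add: exp_sum)
 qed
 show "integrable (gpr S) (%ga. exp (t * ell ga a))"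
  unfolding eq by (intro gp.product_integrable_prod finS std_gauss_exp_linear)
 have "(\<integral>ga. exp (t * ell ga a) \<partial>gpr S) = (\<Prod>j\<in>S. exp ((w j)^2 / 2))"
  unfolding eq using finS by (subst gp.product_integral_prod) (auto simp: std_gauss_exp_linear)
 also have "... = exp (\<Sum>j\<in>S. (w j)^2 / 2)" using finS by (simp add: exp_sum)
 also have "(\<Sum>j\<in>S. (w j)^2 / 2) = (\<Sum>j\<in>J. t^2 / 2 * (v j a * v j a))"
  using J by (auto simp: w_def power2_eq_square intro!: sum.cong)
 also have "... = t^2 / 2 * c" by (simp only: sum_distrib_left[symmetric] v_norm[OF a])
 also have "exp ... <= exp (t^2 / 2)" using c mult_left_mono[of c 1 "t^2/2"] by simp
 finally show "(\<integral>ga. exp (t * ell ga a) \<partial>gpr S) <= exp (t^2 / 2)" .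
qed

lemma exp_abs_integral:
 assumes "!!t. integrable M (%x. exp (t * f x :: real))" "!!t. (\<integral>x. exp (t * f x) \<partial>M) <= exp (t^2 / 2)"
  and "f \<in> borel_measurable M"
 shows "integrable M (%x. exp (t * \<bar>f x\<bar>))" "(\<integral>x. exp (t * \<bar>f x\<bar>) \<partial>M) <= 2 * exp (t^2 / 2)"
proof -
 have i: "integrable M (%x. exp (t * f x) + exp (- t * f x))"
  using assms(1)[of t] assms(1)[of "-t"] by simp
 show j: "integrable M (%x. exp (t * \<bar>f x\<bar>))"
  by (rule Bochner_Integration.integrable_bound[OF i]) (use assms(3) in \<open>auto intro!: AE_I2 order_trans[OF exp_abs_le]\<close>)
 have "(\<integral>x. exp (t * \<bar>f x\<bar>) \<partial>M) <= (\<integral>x. exp (t * f x) + exp (- t * f x) \<partial>M)"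
  by (rule integral_mono[OF j i exp_abs_le])
 also have "... <= 2 * exp (t^2 / 2)"
  using assms(1)[of t] assms(1)[of "-t"] assms(2)[of t] assms(2)[of "-t"] by simp
 finally show "(\<integral>x. exp (t * \<bar>f x\<bar>) \<partial>M) <= 2 * exp (t^2 / 2)" .
qed

lemma z0_exp:
 "integrable (gpr S) (%ga. exp (t * ga z0))"
 "(\<integral>ga. exp (t * ga z0) \<partial>gpr S) <= exp (t^2 / 2)"
proof -
 have d: "distr (gpr S) std_gauss (%ga. ga z0) = std_gauss"
  by (rule distr_PiM_component) (auto simp: prob_space_std_gauss)
 have m: "(%ga. ga z0) \<in> measurable (gpr S) std_gauss" by measurable
 show "integrable (gpr S) (%ga. exp (t * ga z0))"
  using std_gauss_exp_linear(1)[of t] integrable_distr_eq[OF m, of "%x. exp (t * x)"]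
  by (simp add: d measurable_cong_sets[OF sets_std_gauss refl])
 have "(\<integral>ga. exp (t * ga z0) \<partial>gpr S) = (\<integral>x. exp (t * x) \<partial>distr (gpr S) std_gauss (%ga. ga z0))"
  by (subst integral_distr[OF m]) (auto simp: measurable_cong_sets[OF sets_std_gauss refl])
 then show "(\<integral>ga. exp (t * ga z0) \<partial>gpr S) <= exp (t^2 / 2)"
  unfolding d by (simp add: std_gauss_exp_linear)
qed

lemma gauss_const_bound:
 assumes s: "!!l. l < m ==> s l \<in> A" and b: "0 <= b"
 shows "(\<integral>ga. exp (b * ((\<Sum>l<m. \<bar>ell ga (s l)\<bar>) + \<bar>ga z0\<bar>)) \<partial>gpr S) <= gauss_const m b"
  and "integrable (gpr S) (%ga. exp (b * ((\<Sum>l<m. \<bar>ell ga (s l)\<bar>) + \<bar>ga z0\<bar>)))"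
proof -
 define f where "f = (%l ga. if l < m then ell ga (s l) else ga z0)"
 have f: "f l \<in> borel_measurable (gpr S)" "integrable (gpr S) (%ga. exp (t * f l ga))"
  "(\<integral>ga. exp (t * f l ga) \<partial>gpr S) <= exp (t^2 / 2)" for l t
  unfolding f_def by (cases "l < m"; simp add: s ell_exp z0_exp)+
 have split: "(\<Sum>l<m. \<bar>ell ga (s l)\<bar>) + \<bar>ga z0\<bar> = (\<Sum>l<Suc m. \<bar>f l ga\<bar>)" for ga
  by (simp add: f_def)
 have le: "exp (b * (\<Sum>l<Suc m. \<bar>f l ga\<bar>)) <= (\<Sum>l<Suc m. exp ((m + 1) * b * \<bar>f l ga\<bar>))" for ga
  using exp_sum_le[of "{..<Suc m}" b "%l. \<bar>f l ga\<bar>"] b by (simp add: lessThan_empty_iff add.commute)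
 have i: "integrable (gpr S) (%ga. \<Sum>l<Suc m. exp ((m + 1) * b * \<bar>f l ga\<bar>))"
  by (intro Bochner_Integration.integrable_sum exp_abs_integral f)
 show j: "integrable (gpr S) (%ga. exp (b * ((\<Sum>l<m. \<bar>ell ga (s l)\<bar>) + \<bar>ga z0\<bar>)))"
 proof (rule Bochner_Integration.integrable_bound[OF i _ AE_I2])
  fix ga
  show "norm (exp (b * ((\<Sum>l<m. \<bar>ell ga (s l)\<bar>) + \<bar>ga z0\<bar>)))
    <= norm (\<Sum>l<Suc m. exp ((m + 1) * b * \<bar>f l ga\<bar>))"
   unfolding split real_norm_def abs_exp_cancel by (rule order_trans[OF le abs_ge_self])
 qed measurable
 have "(\<integral>ga. exp (b * ((\<Sum>l<m. \<bar>ell ga (s l)\<bar>) + \<bar>ga z0\<bar>)) \<partial>gpr S) <=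
   (\<integral>ga. (\<Sum>l<Suc m. exp ((m + 1) * b * \<bar>f l ga\<bar>)) \<partial>gpr S)"
  by (rule integral_mono[OF j i]) (use le in \<open>simp only: split\<close>)
 also have "... = (\<Sum>l<Suc m. \<integral>ga. exp ((m + 1) * b * \<bar>f l ga\<bar>) \<partial>gpr S)"
  by (intro Bochner_Integration.integral_sum exp_abs_integral f)
 also have "... <= (\<Sum>l<Suc m. 2 * exp (((m + 1) * b)^2 / 2))"
  by (intro sum_mono exp_abs_integral f)
 also have "... = gauss_const m b"
  by (simp add: gauss_const_def algebra_simps)
 finally show "(\<integral>ga. exp (b * ((\<Sum>l<m. \<bar>ell ga (s l)\<bar>) + \<bar>ga z0\<bar>)) \<partial>gpr S) <= gauss_const m b" .
qed

definition "V th m a s ga = (\<Sum>l<m. \<bar>U th ga (s l)\<bar> + a * \<bar>ell ga (s l)\<bar>)" for m :: nat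

lemma V_le:
 assumes "0 <= a"
 shows "V th m a s ga <= m * (be * \<bar>h\<bar>) + (be * (m + 1) + a) * ((\<Sum>l<m. \<bar>ell ga (s l)\<bar>) + \<bar>ga z0\<bar>)"
proof -
 have "V th m a s ga <= (\<Sum>l<m. be * (\<bar>ell ga (s l)\<bar> + \<bar>ga z0\<bar>) + be * \<bar>h\<bar> + a * \<bar>ell ga (s l)\<bar>)"
  unfolding V_def by (intro sum_mono add_mono abs_U order_refl)
 also have "... = m * (be * \<bar>h\<bar>) + (be + a) * (\<Sum>l<m. \<bar>ell ga (s l)\<bar>) + be * m * \<bar>ga z0\<bar>"
  by (simp add: sum.distrib distrib_left distrib_right sum_distrib_left)
 also have "... <= m * (be * \<bar>h\<bar>) + (be * (m + 1) + a) * (\<Sum>l<m. \<bar>ell ga (s l)\<bar>) + (be * (m + 1) + a) * \<bar>ga z0\<bar>"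
  using assms be by (intro add_mono mult_right_mono order_refl) (auto simp: sum_nonneg distrib_left)
 finally show ?thesis by (simp add: algebra_simps)
qed

lemma V_measurable [measurable]: "V th m a s \<in> borel_measurable (gpr S)"
 unfolding V_def by measurable

lemma V_exp:
 assumes s: "!!l. l < m ==> s l \<in> A" and a: "0 <= a" and k: "0 <= k"
 shows "integrable (gpr S) (%ga. exp (k * V th m a s ga))"
  and "(\<integral>ga. exp (k * V th m a s ga) \<partial>gpr S) <= exp (k * (m * (be * \<bar>h\<bar>))) * gauss_const m (k * (be * (real m + 1) + a))"
proof -
 define b where "b = k * (be * (real m + 1) + a)"
 have b: "0 <= b" unfolding b_def using a k be by auto
 have le: "exp (k * V th m a s ga) <= exp (k * (m * (be * \<bar>h\<bar>))) * exp (b * ((\<Sum>l<m. \<bar>ell ga (s l)\<bar>) + \<bar>ga z0\<bar>))" for ga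
  using mult_left_mono[OF V_le[OF a] k, of th m s ga]
  by (simp add: b_def algebra_simps flip: exp_add)
 have i: "integrable (gpr S) (%ga. exp (k * (m * (be * \<bar>h\<bar>))) * exp (b * ((\<Sum>l<m. \<bar>ell ga (s l)\<bar>) + \<bar>ga z0\<bar>)))"
  by (intro integrable_mult_right gauss_const_bound(2) s b)
 show j: "integrable (gpr S) (%ga. exp (k * V th m a s ga))"
  by (rule Bochner_Integration.integrable_bound[OF i]) (use le in \<open>auto intro!: AE_I2\<close>)
 have "(\<integral>ga. exp (k * V th m a s ga) \<partial>gpr S) <=
  (\<integral>ga. exp (k * (m * (be * \<bar>h\<bar>))) * exp (b * ((\<Sum>l<m. \<bar>ell ga (s l)\<bar>) + \<bar>ga z0\<bar>)) \<partial>gpr S)"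
  by (rule integral_mono[OF j i le])
 also have "... <= exp (k * (m * (be * \<bar>h\<bar>))) * gauss_const m b"
  using gauss_const_bound(1)[OF s b, of m] by simp
 finally show "(\<integral>ga. exp (k * V th m a s ga) \<partial>gpr S) <= exp (k * (m * (be * \<bar>h\<bar>))) * gauss_const m (k * (be * (real m + 1) + a))"
  by (simp add: b_def)
qed

end

definition lamE :: "real => real => real => real => nat => nat set => nat => real" where
 "lamE be h q c m T j = be * (c * tmom be h q (card T) +
   q * ((\<Sum>r\<in>{..<m} - {j}. tmom be h q (card (tog r (tog j T))))
    - m * tmom be h q (card (tog m (tog j T)))))"

lemma sum_mono_nested:
 fixes f :: "nat => nat => real"
 assumes "m <= m'" "!!l l'. 0 <= f l l'"
 shows "(\<Sum>l<m. \<Sum>l'\<in>{..<m} - {l}. f l l') <= (\<Sum>l<m'. \<Sum>l'\<in>{..<m'} - {l}. f l l')"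
proof -
 have "(\<Sum>l<m. \<Sum>l'\<in>{..<m} - {l}. f l l') <= (\<Sum>l<m. \<Sum>l'\<in>{..<m'} - {l}. f l l')"
  using assms by (intro sum_mono sum_mono2) auto
 also have "... <= (\<Sum>l<m'. \<Sum>l'\<in>{..<m'} - {l}. f l l')"
  using assms by (intro sum_mono2 sum_nonneg) auto
 finally show ?thesis .
qed

context cavity
begin

text \<open>Gibbs weights at different angles differ by a factor at most exponential in the fields, which have Gaussian
tails. This replaces a Gronwall estimate in the angle.\<close>

lemma up_bound:
 assumes ph: "!!s. s \<in> PiE {..<m} (%_. A) ==> 0 <= ph s" and a: "0 <= a"
 shows "(\<integral>ga. gavg A (p th ga) {..<m} (%s. ph s * exp (a * (\<Sum>l<m. \<bar>ell ga (s l)\<bar>))) \<partial>gpr S)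
   <= up_const be h m a * avg0 m ph"
  and "integrable (gpr S) (%ga. gavg A (p th ga) {..<m} (%s. ph s * exp (a * (\<Sum>l<m. \<bar>ell ga (s l)\<bar>))))"
proof -
 let ?X = "PiE {..<m} (%_. A)"
 have pU: "p th ga b <= p0 b * exp \<bar>U th ga b\<bar>" if b: "b \<in> A" for ga b
 proof -
  have "p th ga b <= p0 b * exp (ep b * U th ga b) / 1"
   unfolding p_eq[OF b] using less_le_trans[OF zero_less_one R_ge_1] R_ge_1
   by (intro divide_left_mono) (auto intro!: mult_nonneg_nonneg gb_nonneg)
  also have "... <= p0 b * exp \<bar>U th ga b\<bar>"
   using eps_cases[OF b] by (auto intro!: mult_left_mono gb_nonneg)
  finally show ?thesis .
 qed
 have le: "gavg A (p th ga) {..<m} (%s. ph s * exp (a * (\<Sum>l<m. \<bar>ell ga (s l)\<bar>))) <=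
   (\<Sum>s\<in>?X. ((\<Prod>r<m. p0 (s r)) * ph s) * exp (1 * V th m a s ga))" for ga
  unfolding gavg_def
 proof (intro sum_mono)
  fix s assume s: "s \<in> ?X"
  have "(\<Prod>r<m. p th ga (s r)) <= (\<Prod>r<m. p0 (s r) * exp \<bar>U th ga (s r)\<bar>)"
   using s by (intro prod_mono conjI gb_nonneg pU) auto
  also have "... = (\<Prod>r<m. p0 (s r)) * exp (\<Sum>r<m. \<bar>U th ga (s r)\<bar>)"
   by (simp add: prod.distrib exp_sum)
  finally have "(\<Prod>r<m. p th ga (s r)) * (ph s * exp (a * (\<Sum>l<m. \<bar>ell ga (s l)\<bar>))) <=
    ((\<Prod>r<m. p0 (s r)) * exp (\<Sum>r<m. \<bar>U th ga (s r)\<bar>)) * (ph s * exp (a * (\<Sum>l<m. \<bar>ell ga (s l)\<bar>)))"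
   using ph[OF s] by (intro mult_right_mono) auto
  also have "... = ((\<Prod>r<m. p0 (s r)) * ph s) * exp (1 * V th m a s ga)"
   by (simp add: V_def sum.distrib sum_distrib_left exp_add mult_ac)
  finally show "(\<Prod>r<m. p th ga (s r)) * (ph s * exp (a * (\<Sum>l<m. \<bar>ell ga (s l)\<bar>))) <=
    ((\<Prod>r<m. p0 (s r)) * ph s) * exp (1 * V th m a s ga)" .
 qed
 have V: "integrable (gpr S) (%ga. exp (1 * V th m a s ga))"
   "(\<integral>ga. exp (1 * V th m a s ga) \<partial>gpr S) <= up_const be h m a" if "s \<in> ?X" for s
  using V_exp[of m s a 1 th] that a unfolding up_const_def by (auto simp: PiE_iff)
 have i: "integrable (gpr S) (%ga. \<Sum>s\<in>?X. ((\<Prod>r<m. p0 (s r)) * ph s) * exp (1 * V th m a s ga))"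
  by (intro Bochner_Integration.integrable_sum integrable_mult_right V)
 have nn: "0 <= gavg A (p th ga) {..<m} (%s. ph s * exp (a * (\<Sum>l<m. \<bar>ell ga (s l)\<bar>)))" for ga
  using ph by (intro gavg_nonneg gb_nonneg) auto
 have meas: "(%ga. gavg A (p th ga) {..<m} (%s. ph s * exp (a * (\<Sum>l<m. \<bar>ell ga (s l)\<bar>)))) \<in> borel_measurable (gpr S)"
  unfolding gavg_def
 proof (intro borel_measurable_sum borel_measurable_times borel_measurable_prod)
  fix s r assume "s \<in> ?X" "r \<in> {..<m}"
  then have "s r \<in> A" by auto
  then show "(%ga. p th ga (s r)) \<in> borel_measurable (gpr S)"
   using A by (intro borel_measurable_gb) auto
 qed measurable
 show j: "integrable (gpr S) (%ga. gavg A (p th ga) {..<m} (%s. ph s * exp (a * (\<Sum>l<m. \<bar>ell ga (s l)\<bar>))))"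
  by (rule Bochner_Integration.integrable_bound[OF i meas AE_I2],
    unfold real_norm_def abs_of_nonneg[OF nn], rule order_trans[OF le abs_ge_self])
 have "(\<integral>ga. gavg A (p th ga) {..<m} (%s. ph s * exp (a * (\<Sum>l<m. \<bar>ell ga (s l)\<bar>))) \<partial>gpr S) <=
   (\<integral>ga. (\<Sum>s\<in>?X. ((\<Prod>r<m. p0 (s r)) * ph s) * exp (1 * V th m a s ga)) \<partial>gpr S)"
  by (rule integral_mono[OF j i le])
 also have "... = (\<Sum>s\<in>?X. ((\<Prod>r<m. p0 (s r)) * ph s) * (\<integral>ga. exp (1 * V th m a s ga) \<partial>gpr S))"
  by (subst Bochner_Integration.integral_sum) (auto intro!: integrable_mult_right V[simplified])
 also have "... <= (\<Sum>s\<in>?X. ((\<Prod>r<m. p0 (s r)) * ph s) * up_const be h m a)"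
  by (intro sum_mono mult_left_mono V mult_nonneg_nonneg prod_nonneg gb_nonneg ballI ph)
 also have "... = up_const be h m a * avg0 m ph"
  by (simp add: avg0_def gavg_def sum_distrib_left mult_ac)
 finally show "(\<integral>ga. gavg A (p th ga) {..<m} (%s. ph s * exp (a * (\<Sum>l<m. \<bar>ell ga (s l)\<bar>))) \<partial>gpr S)
   <= up_const be h m a * avg0 m ph" .
qed

lemma Ph_up:
 assumes "!!s. s \<in> PiE {..<m} (%_. A) ==> 0 <= ph s"
 shows "Ph th m ph <= up_const be h m 0 * avg0 m ph"
 using up_bound(1)[of m ph 0 th, OF assms] by (simp add: Ph_def)

text \<open>The decoupled average is controlled by the coupled one. The normalizing sum sits in a denominator, which
Jensen's inequality moves out of the Gaussian integral.\<close>

lemma low_bound: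
 assumes ph: "!!s. s \<in> PiE {..<m} (%_. A) ==> 0 <= ph s" and a: "0 <= a"
 shows "avg0 m ph <= low_const be h m a *
   (\<integral>ga. gavg A (p th ga) {..<m} (%s. ph s * exp (- a * (\<Sum>l<m. \<bar>ell ga (s l)\<bar>))) \<partial>gpr S)"
proof -
 let ?X = "PiE {..<m} (%_. A)"
 define R where "R = (%ga. \<Sum>b\<in>A. p0 b * exp (ep b * U th ga b))"
 have R1: "1 <= R ga" for ga unfolding R_def by (rule R_ge_1)
 have Rm [measurable]: "R \<in> borel_measurable (gpr S)" unfolding R_def by measurable
 define R2 where "R2 = (%ga. \<Sum>t\<in>PiE {..<2*m} (%_. A). (\<Prod>r<2*m. p0 (t r)) * exp (1 * V th (2*m) 0 t ga))"
 have R_le: "R ga ^ (2 * m) <= R2 ga" for ga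
 proof -
  have "R ga <= (\<Sum>b\<in>A. p0 b * exp \<bar>U th ga b\<bar>)"
   unfolding R_def
   by (intro sum_mono mult_left_mono gb_nonneg) (use eps_cases in fastforce)
  then have "R ga ^ (2 * m) <= (\<Sum>b\<in>A. p0 b * exp \<bar>U th ga b\<bar>) ^ (2 * m)"
   using R1[of ga] by (intro power_mono) auto
  also have "... = (\<Prod>r<2*m. \<Sum>b\<in>A. p0 b * exp \<bar>U th ga b\<bar>)" by simp
  also have "... = (\<Sum>t\<in>PiE {..<2*m} (%_. A). \<Prod>r<2*m. p0 (t r) * exp \<bar>U th ga (t r)\<bar>)"
   using A by (subst prod_sum_PiE) auto
  also have "... = R2 ga"
   unfolding R2_def by (simp add: prod.distrib V_def exp_sum)
  finally show ?thesis .
 qed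
 have R2i: "integrable (gpr S) R2"
  unfolding R2_def using V_exp(1)[of "2*m" _ 0 1 th]
  by (intro Bochner_Integration.integrable_sum integrable_mult_right) (auto simp: PiE_iff)
 have R2_le: "(\<integral>ga. R2 ga \<partial>gpr S) <= up_const be h (2 * m) 0"
 proof -
  have "(\<integral>ga. R2 ga \<partial>gpr S) = (\<Sum>t\<in>PiE {..<2*m} (%_. A). (\<Prod>r<2*m. p0 (t r)) * (\<integral>ga. exp (1 * V th (2*m) 0 t ga) \<partial>gpr S))"
   unfolding R2_def using V_exp(1)[of "2*m" _ 0 1 th]
   by (subst Bochner_Integration.integral_sum) (auto simp: PiE_iff)
  also have "... <= (\<Sum>t\<in>PiE {..<2*m} (%_. A). (\<Prod>r<2*m. p0 (t r)) * up_const be h (2 * m) 0)"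
   using V_exp(2)[of "2*m" _ 0 1 th] unfolding up_const_def
   by (intro sum_mono mult_left_mono prod_nonneg gb_nonneg ballI) (auto simp: PiE_iff)
  also have "... = gavg A p0 {..<2*m} (%_. up_const be h (2 * m) 0)" by (simp add: gavg_def)
  also have "... = up_const be h (2 * m) 0" using A by (intro gavg_const) (auto simp: sum_p0)
  finally show ?thesis .
 qed
 define K where "K = low_const be h m a"
 define X where "X = (%s ga. exp (V th m a s ga) * R ga ^ m)"
 have X0: "0 < X s ga" for s ga unfolding X_def using R1[of ga] by (intro mult_pos_pos zero_less_power) auto
 have Xm [measurable]: "X s \<in> borel_measurable (gpr S)" for s unfolding X_def by measurable
 have X1: "1 <= X s ga" for s ga
 proof -
  have "0 <= V th m a s ga" unfolding V_def using a by (intro sum_nonneg) auto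
  then have "1 * 1 <= exp (V th m a s ga) * R ga ^ m"
   using R1[of ga] by (intro mult_mono one_le_power) auto
  then show ?thesis by (simp add: X_def)
 qed
 have X_le: "X s ga <= exp (2 * V th m a s ga) + R2 ga" for s ga
 proof -
  have "x * y <= x^2 + y^2" for x y :: real
   using zero_le_power2[of "x - y"] zero_le_power2[of x] zero_le_power2[of y]
   unfolding power2_diff by linarith
  then have "X s ga <= (exp (V th m a s ga))^2 + (R ga ^ m)^2" unfolding X_def .
  also have "... = exp (2 * V th m a s ga) + R ga ^ (2 * m)"
   by (simp add: exp_double power_mult[symmetric] mult.commute)
  finally show ?thesis using R_le[of ga] by linarith
 qed
 have EX: "integrable (gpr S) (X s)" "(\<integral>ga. X s ga \<partial>gpr S) <= K" if s: "s \<in> ?X" for s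
 proof -
  have sA: "s l \<in> A" if "l < m" for l using s that by auto
  note V2 = V_exp[of m s a 2 th, OF sA a]
  have i: "integrable (gpr S) (%ga. exp (2 * V th m a s ga) + R2 ga)"
   using V2 R2i by simp
  show j: "integrable (gpr S) (X s)"
   by (rule Bochner_Integration.integrable_bound[OF i _ AE_I2])
     (use X0 X_le in \<open>auto simp: abs_of_pos intro: order_trans[OF _ abs_ge_self]\<close>)
  have "(\<integral>ga. X s ga \<partial>gpr S) <= (\<integral>ga. exp (2 * V th m a s ga) + R2 ga \<partial>gpr S)"
   by (rule integral_mono[OF j i X_le])
  also have "... <= K"
   using V2 R2i R2_le unfolding K_def low_const_def by simp
  finally show "(\<integral>ga. X s ga \<partial>gpr S) <= K" .
 qed
 have inv: "1 <= K * (\<integral>ga. 1 / X s ga \<partial>gpr S)" and invi: "integrable (gpr S) (%ga. 1 / X s ga)"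
  if s: "s \<in> ?X" for s
 proof -
  interpret G: prob_space "gpr S" by (rule prob_space_gpr)
  have i1: "integrable (gpr S) (%ga. 1 / X s ga)"
   by (rule G.integrable_const_bound[of _ 1]) (use X1 X0 in \<open>auto simp: divide_le_eq abs_of_pos\<close>)
  then show "integrable (gpr S) (%ga. 1 / X s ga)" .
  have "1 <= (\<integral>ga. X s ga \<partial>gpr S)"
   using integral_mono[OF _ EX(1)[OF s], of "%_. 1"] X1 by (simp add: G.prob_space)
  then have K1: "1 <= K" using EX(2)[OF s] by linarith
  \<comment> \<open>Jensen in the tangent form \<open>1/x >= 2/K - x/K^2\<close>\<close>
  have "2 / K - 1 / K^2 * X s ga <= 1 / X s ga" for ga
  proof -
   have "0 <= (X s ga - K)^2 / (X s ga * K^2)" using X0[of s ga] by auto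
   also have "... = 1 / X s ga - (2 / K - 1 / K^2 * X s ga)"
    using X0[of s ga] K1 by (simp add: field_simps power2_eq_square)
   finally show ?thesis by simp
  qed
  then have "(\<integral>ga. 2 / K - 1 / K^2 * X s ga \<partial>gpr S) <= (\<integral>ga. 1 / X s ga \<partial>gpr S)"
   using EX(1)[OF s] i1 by (intro integral_mono) auto
  then have "2 / K - 1 / K^2 * (\<integral>ga. X s ga \<partial>gpr S) <= (\<integral>ga. 1 / X s ga \<partial>gpr S)"
   using EX(1)[OF s] by (simp add: G.prob_space)
  moreover have "1 / K^2 * (\<integral>ga. X s ga \<partial>gpr S) <= 1 / K^2 * K"
   using EX(2)[OF s] by (intro mult_left_mono) auto
  moreover have "2 / K - 1 / K^2 * K = 1 / K" using K1 by (simp add: field_simps power2_eq_square)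
  ultimately have "1 / K <= (\<integral>ga. 1 / X s ga \<partial>gpr S)" by linarith
  then show "1 <= K * (\<integral>ga. 1 / X s ga \<partial>gpr S)"
   using K1 by (simp add: divide_le_eq mult.commute)
 qed
 have ge: "(\<Sum>s\<in>?X. ((\<Prod>r<m. p0 (s r)) * ph s) * (1 / X s ga)) <=
   gavg A (p th ga) {..<m} (%s. ph s * exp (- a * (\<Sum>l<m. \<bar>ell ga (s l)\<bar>)))" for ga
  unfolding gavg_def
 proof (intro sum_mono)
  fix s assume s: "s \<in> ?X"
  have "(\<Prod>r<m. p0 (s r) * exp (- \<bar>U th ga (s r)\<bar>) / R ga) <= (\<Prod>r<m. p th ga (s r))"
  proof (intro prod_mono conjI)
   fix r assume "r \<in> {..<m}"
   then have sr: "s r \<in> A" using s by auto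
   show "0 <= p0 (s r) * exp (- \<bar>U th ga (s r)\<bar>) / R ga"
    using R1[of ga] by (intro divide_nonneg_nonneg mult_nonneg_nonneg gb_nonneg) auto
   show "p0 (s r) * exp (- \<bar>U th ga (s r)\<bar>) / R ga <= p th ga (s r)"
   proof -
    have "p th ga (s r) = p0 (s r) * exp (ep (s r) * U th ga (s r)) / R ga"
     by (simp add: p_eq[OF sr] R_def)
    then show ?thesis using R1[of ga] eps_cases[OF sr]
     by (auto intro!: divide_right_mono mult_left_mono gb_nonneg)
   qed
  qed
  moreover have "(\<Prod>r<m. p0 (s r) * exp (- \<bar>U th ga (s r)\<bar>) / R ga) =
    (\<Prod>r<m. p0 (s r)) * (exp (- (\<Sum>r<m. \<bar>U th ga (s r)\<bar>)) / R ga ^ m)"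
   by (simp add: prod.distrib prod_dividef exp_sum flip: sum_negf)
  ultimately have "((\<Prod>r<m. p0 (s r)) * (exp (- (\<Sum>r<m. \<bar>U th ga (s r)\<bar>)) / R ga ^ m)) * (ph s * exp (- a * (\<Sum>l<m. \<bar>ell ga (s l)\<bar>)))
   <= (\<Prod>r<m. p th ga (s r)) * (ph s * exp (- a * (\<Sum>l<m. \<bar>ell ga (s l)\<bar>)))"
   using ph[OF s] by (intro mult_right_mono) auto
  moreover have "1 / X s ga = exp (- (\<Sum>r<m. \<bar>U th ga (s r)\<bar>)) * exp (- a * (\<Sum>l<m. \<bar>ell ga (s l)\<bar>)) / R ga ^ m"
  proof -
   have "V th m a s ga = (\<Sum>r<m. \<bar>U th ga (s r)\<bar>) + a * (\<Sum>l<m. \<bar>ell ga (s l)\<bar>)"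
    by (simp add: V_def sum.distrib sum_distrib_left)
   then show ?thesis by (simp add: X_def exp_add exp_minus field_simps)
  qed
  ultimately show "((\<Prod>r<m. p0 (s r)) * ph s) * (1 / X s ga) <=
    (\<Prod>r<m. p th ga (s r)) * (ph s * exp (- a * (\<Sum>l<m. \<bar>ell ga (s l)\<bar>)))"
   by (simp add: mult_ac)
 qed
 have "avg0 m ph = (\<Sum>s\<in>?X. ((\<Prod>r<m. p0 (s r)) * ph s) * 1)"
  by (simp add: avg0_def gavg_def)
 also have "... <= (\<Sum>s\<in>?X. ((\<Prod>r<m. p0 (s r)) * ph s) * (K * (\<integral>ga. 1 / X s ga \<partial>gpr S)))"
  by (intro sum_mono mult_left_mono inv mult_nonneg_nonneg prod_nonneg gb_nonneg ballI ph)
 also have "... = K * (\<integral>ga. (\<Sum>s\<in>?X. ((\<Prod>r<m. p0 (s r)) * ph s) * (1 / X s ga)) \<partial>gpr S)"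
 proof -
  have "(\<integral>ga. (\<Sum>s\<in>?X. ((\<Prod>r<m. p0 (s r)) * ph s) * (1 / X s ga)) \<partial>gpr S) =
    (\<Sum>s\<in>?X. ((\<Prod>r<m. p0 (s r)) * ph s) * (\<integral>ga. 1 / X s ga \<partial>gpr S))"
   by (simp only: Bochner_Integration.integral_sum[OF integrable_mult_right[OF invi]] integral_mult_right_zero)
  then show ?thesis by (simp only: sum_distrib_left mult_ac)
 qed
 also have "... <= K * (\<integral>ga. gavg A (p th ga) {..<m} (%s. ph s * exp (- a * (\<Sum>l<m. \<bar>ell ga (s l)\<bar>))) \<partial>gpr S)"
 proof (intro mult_left_mono integral_mono ge)
  show "integrable (gpr S) (%ga. \<Sum>s\<in>?X. ((\<Prod>r<m. p0 (s r)) * ph s) * (1 / X s ga))"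
   by (intro Bochner_Integration.integrable_sum integrable_mult_right invi)
  show "integrable (gpr S) (%ga. gavg A (p th ga) {..<m} (%s. ph s * exp (- a * (\<Sum>l<m. \<bar>ell ga (s l)\<bar>))))"
  proof (intro gavg_integrable expgr_mult expgr_const expgr_bounded[of _ _ 1])
   fix s ga
   have "0 <= a * (\<Sum>l<m. \<bar>ell ga (s l)\<bar>)" using a by (intro mult_nonneg_nonneg sum_nonneg) auto
   then show "\<bar>exp (- a * (\<Sum>l<m. \<bar>ell ga (s l)\<bar>))\<bar> <= 1" by simp
  qed auto
  show "0 <= K" unfolding K_def low_const_def up_const_def gauss_const_def by simp
 qed
 finally show ?thesis unfolding K_def .
qed

subsection \<open>Expansions around the decoupled end\<close>

lemma avg0_cmult: "avg0 m (%s. k * F s) = k * avg0 m F"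
 by (simp add: avg0_def gavg_cmult)

lemma avg0_sum: "avg0 m (%s. \<Sum>x\<in>X. F x s) = (\<Sum>x\<in>X. avg0 m (F x))"
 by (simp add: avg0_def gavg_sum)

lemma err1_nonneg: "0 <= err1 m F"
 unfolding err1_def by (intro sum_nonneg avg0_nonneg) auto

lemma err1_mono:
 assumes d: "dep {..<m} F" and m: "m <= m'"
 shows "err1 m F <= err1 m' F"
proof -
 let ?f = "%l l'. avg0 m' (%s. \<bar>F s\<bar> * \<bar>ov (s l) (s l') - q\<bar>)"
 have nn: "0 <= ?f l l'" for l l' by (intro avg0_nonneg) auto
 have "err1 m F = (\<Sum>l<m. \<Sum>l'\<in>{..<m} - {l}. ?f l l')"
  unfolding err1_def
 proof (intro sum.cong refl avg0_superset[symmetric] m)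
  fix l l' assume "l \<in> {..<m}" "l' \<in> {..<m} - {l}"
  then show "dep {..<m} (%s. \<bar>F s\<bar> * \<bar>ov (s l) (s l') - q\<bar>)"
   by (intro dep_mult dep_abs d dep_diff dep_const dep_coord2) auto
 qed
 also have "... <= (\<Sum>l<m'. \<Sum>l'\<in>{..<m'} - {l}. ?f l l')"
  using m by (intro sum_mono_nested nn) auto
 finally show ?thesis by (simp add: err1_def)
qed

lemma abs_cw: "l < m + 2 ==> \<bar>cw1 m l * cw2 m l'\<bar> <= (real (m + 1))^2"
 unfolding abs_mult power2_eq_square
 by (intro mult_mono) (auto simp: cw1_def cw2_def)

lemma abs_D: "a \<in> A ==> b \<in> A ==> \<bar>D a b\<bar> = \<bar>ov a b - q\<bar>"
 by (simp add: D_def abs_mult abs_eps)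

lemma abs_B:
 assumes s: "s \<in> PiE {..<m'} (%_. A)" and m': "m + 2 <= m'"
 shows "\<bar>B m s\<bar> <= (real (m + 1))^2 * (\<Sum>l<m+2. \<Sum>l'\<in>{..<m+2} - {l}. \<bar>ov (s l) (s l') - q\<bar>)"
proof -
 have sA: "s l \<in> A" if "l < m + 2" for l
  by (rule PiE_mem[OF s]) (use that m' in simp)
 have "\<bar>B m s\<bar> <= (\<Sum>l<m+2. \<Sum>l'\<in>{..<m+2} - {l}. \<bar>cw1 m l * cw2 m l' * D (s l) (s l')\<bar>)"
  unfolding B_def by (rule order_trans[OF sum_abs sum_mono[OF sum_abs]])
 also have "... <= (\<Sum>l<m+2. \<Sum>l'\<in>{..<m+2} - {l}. (real (m + 1))^2 * \<bar>ov (s l) (s l') - q\<bar>)"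
 proof (intro sum_mono)
  fix l l' assume l: "l \<in> {..<m+2}" "l' \<in> {..<m+2} - {l}"
  show "\<bar>cw1 m l * cw2 m l' * D (s l) (s l')\<bar> <= (real (m + 1))^2 * \<bar>ov (s l) (s l') - q\<bar>"
   unfolding abs_mult[of "_ * _" "D _ _"] using l sA[of l] sA[of l']
   by (intro mult_mono abs_cw) (auto simp: abs_D)
 qed
 finally show ?thesis by (simp only: sum_distrib_left)
qed

text \<open>The derivative consists of terms linear in overlap minus \<open>q\<close>; the mean value theorem does the rest.\<close>

lemma Ph_lip:
 assumes d: "dep {..<m} F"
 shows "\<bar>Ph th m F - Ph 0 m F\<bar> <= lipcav be h m * err1 (m + 2) F * \<bar>th\<bar>"
proof -
 have "\<bar>sin t * cos t * be^2 * Ph t (m + 2) (%s. B m s * F s)\<bar> <= lipcav be h m * err1 (m + 2) F" for t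
 proof -
  have "\<bar>Ph t (m + 2) (%s. B m s * F s)\<bar> <= Ph t (m + 2) (%s. \<bar>B m s * F s\<bar>)"
   by (rule Ph_abs_le)
  also have "... <= Ph t (m + 2) (%s. (real (m + 1))^2 * (\<Sum>l<m+2. \<Sum>l'\<in>{..<m+2} - {l}. \<bar>F s\<bar> * \<bar>ov (s l) (s l') - q\<bar>))"
  proof (rule Ph_mono)
   fix s assume "s \<in> PiE {..<m+2} (%_. A)"
   from mult_right_mono[OF abs_B[OF this order_refl] abs_ge_zero[of "F s"]]
   show "\<bar>B m s * F s\<bar> <= (real (m + 1))^2 * (\<Sum>l<m+2. \<Sum>l'\<in>{..<m+2} - {l}. \<bar>F s\<bar> * \<bar>ov (s l) (s l') - q\<bar>)"
    unfolding abs_mult by (simp only: sum_distrib_left sum_distrib_right mult_ac)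
  qed
  also have "... = (real (m + 1))^2 * (\<Sum>l<m+2. \<Sum>l'\<in>{..<m+2} - {l}. Ph t (m + 2) (%s. \<bar>F s\<bar> * \<bar>ov (s l) (s l') - q\<bar>))"
   by (simp only: Ph_cmult Ph_sum)
  also have "... <= (real (m + 1))^2 * (\<Sum>l<m+2. \<Sum>l'\<in>{..<m+2} - {l}. up_const be h (m + 2) 0 * avg0 (m + 2) (%s. \<bar>F s\<bar> * \<bar>ov (s l) (s l') - q\<bar>))"
   by (intro mult_left_mono sum_mono Ph_up) auto
  also have "... = (real (m + 1))^2 * up_const be h (m + 2) 0 * err1 (m + 2) F"
   by (simp only: err1_def sum_distrib_left[symmetric] mult.assoc)
  finally have 1: "\<bar>Ph t (m + 2) (%s. B m s * F s)\<bar> <= ..." .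
  have 2: "\<bar>sin t * cos t * be^2\<bar> <= be^2"
   using mult_mono[OF abs_sin_le_one[of t] abs_cos_le_one[of t]]
   by (simp add: abs_mult mult_left_le_one_le)
  have "\<bar>sin t * cos t * be^2 * Ph t (m + 2) (%s. B m s * F s)\<bar> <= be^2 * ((real (m + 1))^2 * up_const be h (m + 2) 0 * err1 (m + 2) F)"
   unfolding abs_mult[of "_ * be^2"] by (intro mult_mono 1 2) auto
  then show ?thesis by (simp add: lipcav_def mult.assoc)
 qed
 then show ?thesis
  using field_differentiable_bound[of UNIV "%th. Ph th m F" "%t. sin t * cos t * be^2 * Ph t (m + 2) (%s. B m s * F s)"
    "lipcav be h m * err1 (m + 2) F" 0 th] Ph_has_derivative[OF d]
  by auto
qed

lemma dep_eT: "T \<subseteq> {..<m} ==> dep {..<m} (eT T)"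
 unfolding eT_def by (intro depI prod.cong) auto

lemma err1_eT:
 assumes "T \<subseteq> {..<m}"
 shows "err1 m (%s. eT T s * F s) = err1 m F"
 unfolding err1_def avg0_def
 by (intro sum.cong refl gavg_cong) (simp add: abs_mult abs_eT[OF _ assms])

lemma pi_half_le_2: "pi / 2 <= 2"
 using pi_less_4 by simp

lemma lipcav_nonneg: "0 <= lipcav be h m"
 by (simp add: lipcav_def up_const_def gauss_const_def)

lemma first_order:
 assumes d: "dep {..<m} F" and F: "flip_inv m F" and T: "T \<subseteq> {..<m}"
 shows "\<bar>Ph (pi/2) m (%s. eT T s * F s) - tmom be h q (card T) * avg0 m F\<bar>
   <= 2 * lipcav be h m * err1 (m + 2) F"
proof -
 have T2: "T \<subseteq> {..<m+2}" using T by auto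
 have "\<bar>Ph (pi/2) m (%s. eT T s * F s) - Ph 0 m (%s. eT T s * F s)\<bar> <=
   lipcav be h m * err1 (m + 2) F * \<bar>pi/2\<bar>"
  using Ph_lip[OF dep_mult[OF dep_eT[OF T] d], of "pi/2"] by (simp only: err1_eT[OF T2])
 also have "... <= lipcav be h m * err1 (m + 2) F * 2"
  using pi_half_le_2 by (intro mult_left_mono mult_nonneg_nonneg err1_nonneg lipcav_nonneg) auto
 finally show ?thesis by (simp add: Ph_zero[OF F T])
qed

lemma flip_inv_superset:
 assumes d: "dep {..<m} F" and F: "flip_inv m F" and m: "m <= m'"
 shows "flip_inv m' F"
 unfolding flip_inv_def
proof (intro ballI allI impI)
 fix s r assume s: "s \<in> PiE {..<m'} (%_. A)" and r: "r < m'"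
 let ?s = "restrict s {..<m}"
 have s': "?s \<in> PiE {..<m} (%_. A)"
 proof (rule PiE_I)
  fix i assume "i \<in> {..<m}"
  then have "i \<in> {..<m'}" using m by simp
  from PiE_mem[OF s this] show "?s i \<in> A" using \<open>i \<in> {..<m}\<close> by simp
 qed simp
 show "F (s(r := fl (s r))) = F s"
 proof (cases "r < m")
  case True
  have "F (s(r := fl (s r))) = F (?s(r := fl (?s r)))" using True by (intro depD[OF d]) auto
  also have "... = F ?s" using F[unfolded flip_inv_def] s' True by blast
  also have "... = F s" by (intro depD[OF d]) auto
  finally show ?thesis .
 next
  case False
  then show ?thesis by (intro depD[OF d]) auto
 qed
qed

lemma ov_fl: "a \<in> A ==> ov (fl a) b = ov a b" "b \<in> A ==> ov a (fl b) = ov a b"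
 by (auto simp: ov_def v_fl)

lemma flip_inv_ov: "l < m ==> l' < m ==> flip_inv m (%s. ov (s l) (s l') - q)"
 unfolding flip_inv_def by (auto simp: ov_fl PiE_iff)

lemma flip_inv_mult: "flip_inv m F ==> flip_inv m G ==> flip_inv m (%s. F s * G s)"
 by (simp add: flip_inv_def)

text \<open>Integrate the derivative of the interpolation, and apply \<open>first_order\<close> to each of its terms. The factor
\<open>sin cos\<close> integrates to 1/2.\<close>

lemma second_order:
 assumes d: "dep {..<m} F" and F: "flip_inv m F" and T: "T \<subseteq> {..<m}"
 shows "\<bar>Ph (pi/2) m (%s. eT T s * F s) - tmom be h q (card T) * avg0 m F
    - be\<^sup>2 / 2 * (\<Sum>l<m+2. \<Sum>l'\<in>{..<m+2} - {l}. cw1 m l * cw2 m l' *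
      (tmom be h q (card (tog l (tog l' T))) * avg0 (m + 2) (%s. (ov (s l) (s l') - q) * F s)))\<bar>
   <= 4 * be^2 * lipcav be h (m + 2) * (real (m + 1))^2 * err2 (m + 4) F"
proof -
 define F' where "F' = (%s. eT T s * F s)"
 have finT: "finite T" using T finite_subset by auto
 have d': "dep {..<m} F'" unfolding F'_def by (intro dep_mult dep_eT T d)
 have dB: "dep {..<m+2} (%s. B m s * F' s)"
  unfolding B_def by (intro dep_mult dep_sum dep_const dep_coord2 dep_mono[OF d']) auto
 define Ph0 where "Ph0 = Ph 0 (m + 2) (%s. B m s * F' s)"
 have Ph0: "Ph0 = (\<Sum>l<m+2. \<Sum>l'\<in>{..<m+2} - {l}. cw1 m l * cw2 m l' *
   (tmom be h q (card (tog l (tog l' T))) * avg0 (m + 2) (%s. (ov (s l) (s l') - q) * F s)))"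
 proof -
  have "Ph0 = Ph 0 (m + 2) (%s. \<Sum>l<m+2. \<Sum>l'\<in>{..<m+2} - {l}. cw1 m l * cw2 m l' * (D (s l) (s l') * F' s))"
   unfolding Ph0_def B_def sum_distrib_right by (simp only: mult.assoc)
  also have "... = (\<Sum>l<m+2. \<Sum>l'\<in>{..<m+2} - {l}. cw1 m l * cw2 m l' * Ph 0 (m + 2) (%s. D (s l) (s l') * F' s))"
   by (simp only: Ph_sum Ph_cmult)
  also have "... = (\<Sum>l<m+2. \<Sum>l'\<in>{..<m+2} - {l}. cw1 m l * cw2 m l' *
   (tmom be h q (card (tog l (tog l' T))) * avg0 (m + 2) (%s. (ov (s l) (s l') - q) * F s)))"
  proof (intro sum.cong refl arg_cong2[where f = "(*)"])
   fix l l' assume l: "l \<in> {..<m+2}" "l' \<in> {..<m+2} - {l}"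
   have "Ph 0 (m + 2) (%s. D (s l) (s l') * F' s) =
     Ph 0 (m + 2) (%s. eT (tog l (tog l' T)) s * ((ov (s l) (s l') - q) * F s))"
   proof (rule Ph_cong)
    fix s assume s: "s \<in> PiE {..<m+2} (%_. A)"
    have sl: "s l \<in> A" "s l' \<in> A" using l by (auto intro!: PiE_mem[OF s])
    have "D (s l) (s l') * F' s = (eT T s * ep (s l')) * ep (s l) * ((ov (s l) (s l') - q) * F s)"
     by (simp add: D_def F'_def mult_ac)
    then show "D (s l) (s l') * F' s = eT (tog l (tog l' T)) s * ((ov (s l) (s l') - q) * F s)"
     by (simp only: eT_tog[where s = s and l = l', OF finT sl(2)] eT_tog[where s = s and l = l, OF finite_tog[OF finT] sl(1)])
   qed
   also have "... = tmom be h q (card (tog l (tog l' T))) * avg0 (m + 2) (%s. (ov (s l) (s l') - q) * F s)"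
   proof (rule Ph_zero)
    show "flip_inv (m + 2) (%s. (ov (s l) (s l') - q) * F s)"
     using l by (intro flip_inv_mult flip_inv_ov flip_inv_superset[OF d F]) auto
    show "tog l (tog l' T) \<subseteq> {..<m+2}"
     using l T by (intro tog_subset) auto
   qed
   finally show "Ph 0 (m + 2) (%s. D (s l) (s l') * F' s) = ..." .
  qed
  finally show ?thesis .
 qed
 define E where "E = lipcav be h (m + 2) * err1 (m + 2 + 2) (%s. B m s * F' s)"
 have E0: "0 <= E" unfolding E_def by (intro mult_nonneg_nonneg lipcav_nonneg err1_nonneg)
 have E_le: "E <= lipcav be h (m + 2) * ((real (m + 1))^2 * err2 (m + 4) F)"
  unfolding E_def
 proof (intro mult_left_mono lipcav_nonneg)
  have m4: "m + 2 + 2 = m + 4" by simp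
  have "err1 (m + 2 + 2) (%s. B m s * F' s) <= (\<Sum>l<m+4. \<Sum>l'\<in>{..<m+4} - {l}.
    avg0 (m + 4) (%s. (real (m + 1))^2 * (\<Sum>k<m+2. \<Sum>k'\<in>{..<m+2} - {k}. \<bar>F s\<bar> * (\<bar>ov (s l) (s l') - q\<bar> * \<bar>ov (s k) (s k') - q\<bar>))))"
   unfolding m4 err1_def
  proof (intro sum_mono avg0_mono)
   fix l l' s assume s: "s \<in> PiE {..<m+4} (%_. A)"
   have Bs: "\<bar>B m s\<bar> <= (real (m + 1))^2 * (\<Sum>k<m+2. \<Sum>k'\<in>{..<m+2} - {k}. \<bar>ov (s k) (s k') - q\<bar>)"
    by (rule abs_B[OF s]) simp
   have Fs: "\<bar>F' s\<bar> = \<bar>F s\<bar>"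
    unfolding F'_def abs_mult using abs_eT[OF s, of T] order_trans[OF T, of "{..<m+4}"] by simp
   have "\<bar>B m s * F' s\<bar> * \<bar>ov (s l) (s l') - q\<bar> <=
     ((real (m + 1))^2 * (\<Sum>k<m+2. \<Sum>k'\<in>{..<m+2} - {k}. \<bar>ov (s k) (s k') - q\<bar>)) * \<bar>F s\<bar> * \<bar>ov (s l) (s l') - q\<bar>"
    unfolding abs_mult Fs by (intro mult_right_mono Bs abs_ge_zero)
   also have "... = (real (m + 1))^2 * ((\<bar>F s\<bar> * \<bar>ov (s l) (s l') - q\<bar>) * (\<Sum>k<m+2. \<Sum>k'\<in>{..<m+2} - {k}. \<bar>ov (s k) (s k') - q\<bar>))"
    by (simp only: mult_ac)
   also have "... = (real (m + 1))^2 * (\<Sum>k<m+2. \<Sum>k'\<in>{..<m+2} - {k}. \<bar>F s\<bar> * (\<bar>ov (s l) (s l') - q\<bar> * \<bar>ov (s k) (s k') - q\<bar>))"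
    by (simp only: sum_distrib_left mult.assoc)
   finally show "\<bar>B m s * F' s\<bar> * \<bar>ov (s l) (s l') - q\<bar> <=
    (real (m + 1))^2 * (\<Sum>k<m+2. \<Sum>k'\<in>{..<m+2} - {k}. \<bar>F s\<bar> * (\<bar>ov (s l) (s l') - q\<bar> * \<bar>ov (s k) (s k') - q\<bar>))" .
  qed
  also have "... = (real (m + 1))^2 * (\<Sum>l<m+4. \<Sum>l'\<in>{..<m+4} - {l}. \<Sum>k<m+2. \<Sum>k'\<in>{..<m+2} - {k}.
    avg0 (m + 4) (%s. \<bar>F s\<bar> * (\<bar>ov (s l) (s l') - q\<bar> * \<bar>ov (s k) (s k') - q\<bar>)))"
   by (simp only: avg0_cmult avg0_sum) (simp only: sum_distrib_left)
  also have "... <= (real (m + 1))^2 * err2 (m + 4) F"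
   unfolding err2_def
   by (intro mult_left_mono sum_mono sum_mono_nested avg0_nonneg) auto
  finally show "err1 (m + 2 + 2) (%s. B m s * F' s) <= (real (m + 1))^2 * err2 (m + 4) F" .
 qed
 have "\<bar>(Ph (pi/2) m F' - be\<^sup>2 / 2 * (sin (pi/2))^2 * Ph0) - (Ph 0 m F' - be\<^sup>2 / 2 * (sin 0)^2 * Ph0)\<bar> <= (be^2 * (E * 2)) * \<bar>pi/2 - 0\<bar>"
 proof -
  have "norm ((Ph (pi/2) m F' - be\<^sup>2 / 2 * (sin (pi/2))^2 * Ph0) - (Ph 0 m F' - be\<^sup>2 / 2 * (sin 0)^2 * Ph0)) <= (be^2 * (E * 2)) * norm (pi/2 - 0)"
  proof (rule field_differentiable_bound[of "{0..pi/2}" "%th. Ph th m F' - be\<^sup>2 / 2 * (sin th)^2 * Ph0"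
    "%th. sin th * cos th * be^2 * (Ph th (m + 2) (%s. B m s * F' s) - Ph0)"])
   fix th :: real assume th: "th \<in> {0..pi/2}"
   have "((%th. Ph th m F' - be\<^sup>2 / 2 * (sin th)^2 * Ph0) has_real_derivative
    sin th * cos th * be^2 * Ph th (m + 2) (%s. B m s * F' s) - be\<^sup>2 / 2 * (2 * sin th * cos th) * Ph0) (at th)"
    by (rule DERIV_diff[OF Ph_has_derivative[OF d']]) (auto intro!: derivative_eq_intros)
   then show "((%th. Ph th m F' - be\<^sup>2 / 2 * (sin th)^2 * Ph0) has_field_derivative
    sin th * cos th * be^2 * (Ph th (m + 2) (%s. B m s * F' s) - Ph0)) (at th within {0..pi/2})"
    by (rule DERIV_subset[OF DERIV_cong]) (auto simp: algebra_simps)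
   have "\<bar>Ph th (m + 2) (%s. B m s * F' s) - Ph0\<bar> <= E * \<bar>th\<bar>"
    unfolding Ph0_def E_def by (rule Ph_lip[OF dB])
   also have "... <= E * 2" using th pi_half_le_2 by (intro mult_left_mono E0) auto
   finally have 1: "\<bar>Ph th (m + 2) (%s. B m s * F' s) - Ph0\<bar> <= E * 2" .
   have 2: "\<bar>sin th * cos th * be^2\<bar> <= be^2"
    using mult_mono[OF abs_sin_le_one[of th] abs_cos_le_one[of th]]
    by (simp add: abs_mult mult_left_le_one_le)
   show "norm (sin th * cos th * be^2 * (Ph th (m + 2) (%s. B m s * F' s) - Ph0)) <= be^2 * (E * 2)"
    unfolding real_norm_def abs_mult[of "_ * be^2"] by (intro mult_mono 1 2) auto
  qed auto
  then show ?thesis by simp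
 qed
 also have "... <= (be^2 * (E * 2)) * 2"
  using pi_half_le_2 E0 by (intro mult_left_mono) auto
 also have "... <= 4 * be^2 * lipcav be h (m + 2) * (real (m + 1))^2 * err2 (m + 4) F"
  using mult_left_mono[OF E_le, of "4 * be^2"] by (simp add: mult_ac)
 finally have fin: "\<bar>(Ph (pi/2) m F' - be\<^sup>2 / 2 * (sin (pi/2))^2 * Ph0) - (Ph 0 m F' - be\<^sup>2 / 2 * (sin 0)^2 * Ph0)\<bar>
   <= 4 * be^2 * lipcav be h (m + 2) * (real (m + 1))^2 * err2 (m + 4) F" .
 have z: "Ph 0 m F' = tmom be h q (card T) * avg0 m F"
  unfolding F'_def by (rule Ph_zero[OF F T])
 show ?thesis using fin
  unfolding Ph0[symmetric] F'_def[symmetric]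
  by (simp add: z algebra_simps)
qed

definition "ell_const m = be * (2 * m) * (2 * lipcav be h (Suc m) + up_const be h (Suc m) 0)" for m :: nat

text \<open>The factor \<open>ell\<close> is Gaussian, so another integration by parts turns it into spins, weighted with \<open>beta\<close>
and overlaps; these are replaced by \<open>q\<close>.\<close>

lemma ell_order:
 assumes d: "dep {..<m} F" and F: "flip_inv m F" and T: "T \<subseteq> {..<m}" and j: "j < m"
 shows "\<bar>(\<integral>ga. gavg A (p (pi/2) ga) {..<m} (%s. eT T s * (ep (s j) * ell ga (s j)) * F s) \<partial>gpr S)
    - lamE be h q c m T j * avg0 m F\<bar> <= ell_const m * err1 (m + 3) F"
proof -
 let ?Q = "tmom be h q"
 have finT: "finite T" using T finite_subset by auto
 define Fi where "Fi = (%i s. eT T s * (ep (s j) * v i (s j)) * F s)"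
 define ci where "ci = (%i a. be * (ep a * v i a))"
 have depFi: "dep {..<m} (Fi i)" for i
  unfolding Fi_def using j by (intro dep_mult dep_eT T d dep_coord) auto
 have ibp: "(\<integral>ga. ga i * gavg A (p (pi/2) ga) {..<m} (Fi i) \<partial>gpr S) =
   Ph (pi/2) (Suc m) (%s. ((\<Sum>r<m. ci i (s r)) - m * ci i (s m)) * Fi i s)" if i: "i \<in> J" for i
 proof -
  have iS: "i \<in> S" using i by simp
  have zi: "z0 ~= i" using i J by auto
  have "(\<integral>ga. ga i * gavg A (p (pi/2) ga) {..<m} (Fi i) \<partial>gpr S) =
   (\<integral>ga. gavg A (p (pi/2) ga) {..<m} (%_. 0) \<partial>gpr S) +
   (\<integral>ga. gavg A (p (pi/2) ga) (insert m {..<m})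
     (%s. ((\<Sum>r<m. ci i (s r)) - card {..<m} * ci i (s m)) * Fi i s) \<partial>gpr S)"
  proof (rule gibbs_by_parts[OF finS iS A, where F = "%_. Fi i"])
   fix g :: "'j => real" and x a
   have "ell (g(i := y)) a = y * v i a + (\<Sum>k\<in>J-{i}. g k * v k a)" for y
    unfolding ell_def using i J by (subst sum.remove[of _ i]) (auto intro!: sum.cong)
   then show "((%y. L (pi/2) (g(i := y)) a) has_real_derivative ci i a) (at x)"
    unfolding L_def U_def ci_def by (auto intro!: derivative_eq_intros)
  qed (use depFi in auto)
  then show ?thesis by (simp add: Ph_def lessThan_Suc gavg_def)
 qed
 define W where "W = (%r. Ph (pi/2) (Suc m) (%s. ep (s r) * ep (s j) * ov (s r) (s j) * (eT T s * F s)))"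
 have total: "(\<integral>ga. gavg A (p (pi/2) ga) {..<m} (%s. eT T s * (ep (s j) * ell ga (s j)) * F s) \<partial>gpr S)
   = be * ((\<Sum>r<m. W r) - m * W m)"
 proof -
  have "gavg A (p (pi/2) ga) {..<m} (%s. eT T s * (ep (s j) * ell ga (s j)) * F s) =
    (\<Sum>i\<in>J. ga i * gavg A (p (pi/2) ga) {..<m} (Fi i))" for ga
  proof -
   have "eT T s * (ep (s j) * ell ga (s j)) * F s = (\<Sum>i\<in>J. ga i * Fi i s)" for s
    unfolding ell_def Fi_def sum_distrib_left sum_distrib_right by (intro sum.cong refl) (simp only: mult_ac)
   then show ?thesis by (simp only: gavg_sum gavg_cmult)
  qed
  then have "(\<integral>ga. gavg A (p (pi/2) ga) {..<m} (%s. eT T s * (ep (s j) * ell ga (s j)) * F s) \<partial>gpr S)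
   = (\<Sum>i\<in>J. \<integral>ga. ga i * gavg A (p (pi/2) ga) {..<m} (Fi i) \<partial>gpr S)"
   using finS by (simp only: , intro Bochner_Integration.integral_sum expgr_integrable expgr_mult
     expgr_coord gavg_growth expgr_const) auto
  also have "... = Ph (pi/2) (Suc m) (%s. \<Sum>i\<in>J. ((\<Sum>r<m. ci i (s r)) - m * ci i (s m)) * Fi i s)"
   unfolding Ph_sum by (rule sum.cong[OF refl ibp])
  also have "... = Ph (pi/2) (Suc m) (%s. be * ((\<Sum>r<m. ep (s r) * ep (s j) * ov (s r) (s j) * (eT T s * F s))
    - m * (ep (s m) * ep (s j) * ov (s m) (s j) * (eT T s * F s))))"
  proof (rule Ph_cong)
   fix s
   have one: "(\<Sum>i\<in>J. ci i a * Fi i s) = be * (ep a * ep (s j) * ov a (s j) * (eT T s * F s))" for a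
    unfolding ci_def Fi_def ov_def sum_distrib_left sum_distrib_right by (intro sum.cong refl) (simp only: mult_ac)
   have "(\<Sum>i\<in>J. ((\<Sum>r<m. ci i (s r)) - m * ci i (s m)) * Fi i s) =
     (\<Sum>i\<in>J. (\<Sum>r<m. ci i (s r) * Fi i s)) - m * (\<Sum>i\<in>J. ci i (s m) * Fi i s)"
    by (simp only: left_diff_distrib sum_subtractf sum_distrib_left sum_distrib_right mult.assoc)
   also have "(\<Sum>i\<in>J. (\<Sum>r<m. ci i (s r) * Fi i s)) = (\<Sum>r<m. \<Sum>i\<in>J. ci i (s r) * Fi i s)"
    by (rule sum.swap)
   finally show "(\<Sum>i\<in>J. ((\<Sum>r<m. ci i (s r)) - m * ci i (s m)) * Fi i s) =
    be * ((\<Sum>r<m. ep (s r) * ep (s j) * ov (s r) (s j) * (eT T s * F s))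
    - m * (ep (s m) * ep (s j) * ov (s m) (s j) * (eT T s * F s)))"
    unfolding one by (simp add: right_diff_distrib sum_distrib_left mult_ac)
  qed
  also have "... = be * ((\<Sum>r<m. W r) - m * W m)"
   unfolding W_def by (simp only: Ph_cmult Ph_diff Ph_sum)
  finally show ?thesis .
 qed
 define w where "w = (%r. (if r = j then c * ?Q (card T) else q * ?Q (card (tog r (tog j T)))) * avg0 m F)"
 define K where "K = 2 * lipcav be h (Suc m) + up_const be h (Suc m) 0"
 have up0: "0 <= up_const be h (Suc m) 0" by (simp add: up_const_def gauss_const_def)
 have dS: "dep {..<Suc m} F" and FS: "flip_inv (Suc m) F"
  using dep_mono[OF d] flip_inv_superset[OF d F] by auto
 have av: "avg0 (Suc m) F = avg0 m F" by (rule avg0_superset[OF d]) simp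
 have c0: "0 <= c"
 proof -
  obtain a where "a \<in> A" using A by auto
  then show ?thesis unfolding v_norm[OF \<open>a \<in> A\<close>, symmetric] by (intro sum_nonneg zero_le_square)
 qed
 have bound: "\<bar>W r - w r\<bar> <= K * err1 (m + 3) F" if r: "r < Suc m" for r
 proof (cases "r = j")
  case True
  have "W r = Ph (pi/2) (Suc m) (%s. c * (eT T s * F s))"
   unfolding W_def True
  proof (rule Ph_cong)
   fix s assume s: "s \<in> PiE {..<Suc m} (%_. A)"
   have "s j \<in> A" using j by (intro PiE_mem[OF s]) simp
   then show "ep (s j) * ep (s j) * ov (s j) (s j) * (eT T s * F s) = c * (eT T s * F s)"
    by (simp add: ep ov_def v_norm)
  qed
  then have "W r - w r = c * (Ph (pi/2) (Suc m) (%s. eT T s * F s) - ?Q (card T) * avg0 (Suc m) F)"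
   unfolding Ph_cmult w_def av using True by (simp add: right_diff_distrib)
  then have "\<bar>W r - w r\<bar> = c * \<bar>Ph (pi/2) (Suc m) (%s. eT T s * F s) - ?Q (card T) * avg0 (Suc m) F\<bar>"
   using c0 by (simp add: abs_mult)
  also have "... <= 1 * (2 * lipcav be h (Suc m) * err1 (Suc m + 2) F)"
   using T c c0 by (intro mult_mono first_order dS FS) auto
  also have "... <= K * err1 (m + 3) F"
   unfolding K_def using up0 by (simp add: distrib_right err1_nonneg numeral_3_eq_3)
  finally show ?thesis .
 next
  case False
  let ?T = "tog r (tog j T)"
  have T': "?T \<subseteq> {..<Suc m}" using T j r by (intro tog_subset) auto
  have "W r = Ph (pi/2) (Suc m) (%s. q * (eT ?T s * F s) + eT ?T s * F s * (ov (s r) (s j) - q))"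
   unfolding W_def
  proof (rule Ph_cong)
   fix s assume s: "s \<in> PiE {..<Suc m} (%_. A)"
   have sj: "s j \<in> A" "s r \<in> A" using j r by (auto intro!: PiE_mem[OF s])
   have eTT: "eT T s * ep (s j) * ep (s r) = eT ?T s"
    by (simp only: eT_tog[where s = s and l = j, OF finT sj(1)] eT_tog[where s = s and l = r, OF finite_tog[OF finT] sj(2)])
   have "ep (s r) * ep (s j) * ov (s r) (s j) * (eT T s * F s) = ov (s r) (s j) * (eT ?T s * F s)"
    unfolding eTT[symmetric] by (simp only: mult_ac)
   then show "ep (s r) * ep (s j) * ov (s r) (s j) * (eT T s * F s) =
     q * (eT ?T s * F s) + eT ?T s * F s * (ov (s r) (s j) - q)"
    by (simp add: algebra_simps)
  qed
  then have "W r - w r = q * (Ph (pi/2) (Suc m) (%s. eT ?T s * F s) - ?Q (card ?T) * avg0 (Suc m) F)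
    + Ph (pi/2) (Suc m) (%s. eT ?T s * F s * (ov (s r) (s j) - q))"
   unfolding Ph_add Ph_cmult w_def av using False by (simp add: right_diff_distrib)
  then have "\<bar>W r - w r\<bar> <= q * \<bar>Ph (pi/2) (Suc m) (%s. eT ?T s * F s) - ?Q (card ?T) * avg0 (Suc m) F\<bar>
    + \<bar>Ph (pi/2) (Suc m) (%s. eT ?T s * F s * (ov (s r) (s j) - q))\<bar>"
  proof -
   have "\<bar>q * x + y\<bar> <= q * \<bar>x\<bar> + \<bar>y\<bar>" for x y
    using abs_triangle_ineq[of "q * x" y] q by (simp add: abs_mult)
   then show ?thesis using \<open>W r - w r = _\<close> by simp
  qed
  also have "... <= 1 * (2 * lipcav be h (Suc m) * err1 (Suc m + 2) F) + up_const be h (Suc m) 0 * err1 (Suc m) F"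
  proof (intro add_mono)
   show "q * \<bar>Ph (pi/2) (Suc m) (%s. eT ?T s * F s) - ?Q (card ?T) * avg0 (Suc m) F\<bar>
     <= 1 * (2 * lipcav be h (Suc m) * err1 (Suc m + 2) F)"
    using q by (intro mult_mono first_order dS FS T') auto
   have "\<bar>Ph (pi/2) (Suc m) (%s. eT ?T s * F s * (ov (s r) (s j) - q))\<bar> <=
     Ph (pi/2) (Suc m) (%s. \<bar>F s\<bar> * \<bar>ov (s r) (s j) - q\<bar>)"
    by (rule order_trans[OF Ph_abs_le Ph_mono]) (simp add: abs_mult abs_eT[OF _ T'])
   also have "... <= up_const be h (Suc m) 0 * avg0 (Suc m) (%s. \<bar>F s\<bar> * \<bar>ov (s r) (s j) - q\<bar>)"
    by (rule Ph_up) auto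
   also have "... <= up_const be h (Suc m) 0 * err1 (Suc m) F"
   proof (rule mult_left_mono[OF _ up0])
    have nn: "0 <= avg0 (Suc m) (%s. \<bar>F s\<bar> * \<bar>ov (s k) (s k') - q\<bar>)" for k k'
     by (intro avg0_nonneg mult_nonneg_nonneg abs_ge_zero)
    have "avg0 (Suc m) (%s. \<bar>F s\<bar> * \<bar>ov (s r) (s j) - q\<bar>)
     <= (\<Sum>l'\<in>{..<Suc m} - {r}. avg0 (Suc m) (%s. \<bar>F s\<bar> * \<bar>ov (s r) (s l') - q\<bar>))"
     by (rule member_le_sum[of j "{..<Suc m} - {r}" "%l'. avg0 (Suc m) (%s. \<bar>F s\<bar> * \<bar>ov (s r) (s l') - q\<bar>)"])
       (use False j nn in simp_all)
    also have "... <= err1 (Suc m) F"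
     unfolding err1_def
     by (rule member_le_sum[of r "{..<Suc m}" "%r. \<Sum>l'\<in>{..<Suc m} - {r}. avg0 (Suc m) (%s. \<bar>F s\<bar> * \<bar>ov (s r) (s l') - q\<bar>)"])
       (use r nn in \<open>simp_all add: sum_nonneg\<close>)
    finally show "avg0 (Suc m) (%s. \<bar>F s\<bar> * \<bar>ov (s r) (s j) - q\<bar>) <= err1 (Suc m) F" .
   qed
   finally show "\<bar>Ph (pi/2) (Suc m) (%s. eT ?T s * F s * (ov (s r) (s j) - q))\<bar> <= up_const be h (Suc m) 0 * err1 (Suc m) F" .
  qed
  also have "... <= 1 * (2 * lipcav be h (Suc m) * err1 (m + 3) F) + up_const be h (Suc m) 0 * err1 (m + 3) F"
  proof -
   have e1: "err1 (Suc m + 2) F = err1 (m + 3) F" by (simp add: numeral_3_eq_3)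
   have e2: "err1 (Suc m) F <= err1 (m + 3) F" by (rule err1_mono[OF dS]) simp
   show ?thesis unfolding e1 by (intro add_mono mult_left_mono e2 up0 order_refl)
  qed
  finally show ?thesis by (simp add: K_def distrib_right)
 qed
 have lam: "lamE be h q c m T j * avg0 m F = be * ((\<Sum>r<m. w r) - m * w m)"
 proof -
  have "(\<Sum>r<m. w r) = w j + (\<Sum>r\<in>{..<m} - {j}. w r)" using j by (simp add: sum.remove)
  also have "(\<Sum>r\<in>{..<m} - {j}. w r) = q * (\<Sum>r\<in>{..<m} - {j}. ?Q (card (tog r (tog j T)))) * avg0 m F"
   by (simp add: w_def sum_distrib_left sum_distrib_right)
  finally show ?thesis using j by (simp add: lamE_def w_def algebra_simps)
 qed
 have "\<bar>be * ((\<Sum>r<m. W r) - m * W m) - be * ((\<Sum>r<m. w r) - m * w m)\<bar> = be * \<bar>(\<Sum>r<m. W r - w r) - m * (W m - w m)\<bar>"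
 proof -
  have "be * ((\<Sum>r<m. W r) - m * W m) - be * ((\<Sum>r<m. w r) - m * w m) =
    be * ((\<Sum>r<m. W r - w r) - m * (W m - w m))"
   by (simp add: sum_subtractf algebra_simps)
  then show ?thesis using be by (simp only: abs_mult abs_of_nonneg)
 qed
 also have "... <= be * ((\<Sum>r<m. K * err1 (m + 3) F) + m * (K * err1 (m + 3) F))"
 proof (intro mult_left_mono be order_trans[OF abs_triangle_ineq4] add_mono)
  show "\<bar>\<Sum>r<m. W r - w r\<bar> <= (\<Sum>r<m. K * err1 (m + 3) F)"
   by (rule order_trans[OF sum_abs]) (intro sum_mono bound, simp)
  show "\<bar>m * (W m - w m)\<bar> <= m * (K * err1 (m + 3) F)"
   unfolding abs_mult by (intro mult_mono bound) auto
 qed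
 also have "... = ell_const m * err1 (m + 3) F"
  by (simp add: ell_const_def K_def algebra_simps)
 finally show ?thesis unfolding total lam .
qed

end

section \<open>Resampling some of the couplings\<close>

definition over :: "'j set => ('j => real) => ('j => real) => 'j => real" where
 "over J ga g = (%e. if e \<in> J then ga e else g e)"

lemma gpr_restrict:
 fixes f :: "('j => real) => real"
 assumes "finite S" "J \<subseteq> S" "f \<in> borel_measurable (gpr J)"
 shows "(\<integral>g. f (restrict g J) \<partial>gpr S) = (\<integral>g. f g \<partial>gpr J)"
proof -
 interpret product_prob_space "%_::'j. std_gauss" S
  by (intro product_prob_spaceI prob_space_std_gauss)
 have "(\<integral>g. f g \<partial>gpr J) = (\<integral>g. f g \<partial>distr (gpr S) (gpr J) (%g. restrict g J))"
  using distr_restrict[OF assms(2,1)] by simp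
 also have "... = (\<integral>g. f (restrict g J) \<partial>gpr S)"
  using assms by (intro integral_distr) (auto intro!: measurable_restrict_subset)
 finally show ?thesis ..
qed

lemma over_measurable:
 assumes "J \<subseteq> S"
 shows "(%(g, ga). over J ga g) \<in> measurable (gpr S \<Otimes>\<^sub>M gpr (insert z0 J)) (gpr S)"
proof (rule measurable_PiM_single')
 fix e assume e: "e \<in> S"
 show "(%x. (case x of (g, ga) => over J ga g) e) \<in> measurable (gpr S \<Otimes>\<^sub>M gpr (insert z0 J)) std_gauss"
 proof (cases "e \<in> J")
  case True
  then have "e \<in> insert z0 J" by simp
  then have "(%x. (snd x) e) \<in> measurable (gpr S \<Otimes>\<^sub>M gpr (insert z0 J)) std_gauss"
   by measurable
  then show ?thesis using True by (simp add: over_def case_prod_beta)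
 next
  case False
  have "(%x. (fst x) e) \<in> measurable (gpr S \<Otimes>\<^sub>M gpr (insert z0 J)) std_gauss"
   using e by measurable
  then show ?thesis using False by (simp add: over_def case_prod_beta)
 qed
qed (use assms in \<open>auto simp: over_def space_pair_measure space_PiM PiE_iff extensional_def\<close>)

lemma resample_growth:
 assumes S: "finite S" "J \<subseteq> S" and f: "expgr S f"
 shows "expgr S (%g. \<integral>ga. f (over J ga g) \<partial>gpr (insert z0 J))"
proof -
 obtain C where C: "C >= 0" "!!g. \<bar>f g\<bar> <= C * exp (C * (\<Sum>j\<in>S. \<bar>g j\<bar>))"
  using f by (auto simp: expgr_def)
 have J: "finite J" using S finite_subset by auto
 interpret P: prob_space "gpr (insert z0 J)" by (rule prob_space_gpr)
 define M where "M = (\<integral>ga. exp (C * (\<Sum>j\<in>insert z0 J. \<bar>ga j\<bar>)) \<partial>gpr (insert z0 J))"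
 have i: "integrable (gpr (insert z0 J)) (%ga. exp (C * (\<Sum>j\<in>insert z0 J. \<bar>ga j\<bar>)))"
  using J by (intro integrable_exp_sum) auto
 show ?thesis
 proof (rule expgrI)
  have "(%(g, ga). f (over J ga g)) \<in> borel_measurable (gpr S \<Otimes>\<^sub>M gpr (insert z0 J))"
   using measurable_compose[OF over_measurable[OF S(2)] expgr_measurable[OF f], of z0]
   by (simp add: case_prod_beta')
  then show "(%g. \<integral>ga. f (over J ga g) \<partial>gpr (insert z0 J)) \<in> borel_measurable (gpr S)"
   by (rule P.borel_measurable_lebesgue_integral)
  fix g :: "'a => real"
  let ?s = "\<Sum>j\<in>S. \<bar>g j\<bar>"
  have le: "\<bar>f (over J ga g)\<bar> <= (C * exp (C * ?s)) * exp (C * (\<Sum>j\<in>insert z0 J. \<bar>ga j\<bar>))" for ga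
  proof -
   have "(\<Sum>j\<in>S. \<bar>over J ga g j\<bar>) <= (\<Sum>j\<in>S. \<bar>g j\<bar> + (if j \<in> J then \<bar>ga j\<bar> else 0))"
    by (intro sum_mono) (auto simp: over_def)
   also have "... = ?s + (\<Sum>j\<in>J. \<bar>ga j\<bar>)"
    using S by (simp add: sum.distrib sum.If_cases Int_absorb1)
   also have "(\<Sum>j\<in>J. \<bar>ga j\<bar>) <= (\<Sum>j\<in>insert z0 J. \<bar>ga j\<bar>)"
    using J by (intro sum_mono2) auto
   finally have "exp (C * (\<Sum>j\<in>S. \<bar>over J ga g j\<bar>)) <= exp (C * (?s + (\<Sum>j\<in>insert z0 J. \<bar>ga j\<bar>)))"
    using C(1) by (simp add: mult_left_mono)
   then have "C * exp (C * (\<Sum>j\<in>S. \<bar>over J ga g j\<bar>)) <= C * exp (C * (?s + (\<Sum>j\<in>insert z0 J. \<bar>ga j\<bar>)))"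
    using C(1) by (rule mult_left_mono)
   then show ?thesis
    using C(2)[of "over J ga g"] by (simp add: distrib_left exp_add mult.assoc)
  qed
  have "\<bar>\<integral>ga. f (over J ga g) \<partial>gpr (insert z0 J)\<bar> <= (\<integral>ga. \<bar>f (over J ga g)\<bar> \<partial>gpr (insert z0 J))"
   by (rule integral_abs_bound)
  also have "... <= (\<integral>ga. (C * exp (C * ?s)) * exp (C * (\<Sum>j\<in>insert z0 J. \<bar>ga j\<bar>)) \<partial>gpr (insert z0 J))"
   using C(1) le by (intro integral_mono' integrable_mult_right i) auto
  also have "... = (C * M) * exp (C * ?s)" by (simp add: M_def mult_ac)
  finally show "\<bar>\<integral>ga. f (over J ga g) \<partial>gpr (insert z0 J)\<bar> <= (C * M) * exp (C * ?s)" .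
 qed
qed

text \<open>A column of couplings can be redrawn independently inside the Gaussian product measure.\<close>

lemma resample:
 fixes f :: "('j => real) => real"
 assumes S: "finite S" "J \<subseteq> S" and z0: "z0 \<notin> J" and f: "expgr S f"
 shows "(\<integral>g. f g \<partial>gpr S) = (\<integral>g. (\<integral>ga. f (over J ga g) \<partial>gpr (insert z0 J)) \<partial>gpr S)"
proof -
 have J: "finite J" using S finite_subset by auto
 interpret P: prob_space "gpr J" by (rule prob_space_gpr)
 define K where "K = S - J"
 have K: "K \<inter> J = {}" "finite K" "K \<union> J = S" "K \<subseteq> S" using S by (auto simp: K_def)
 have fm: "f \<in> borel_measurable (gpr (K \<union> J))" unfolding K by (rule expgr_measurable[OF f])
 have mm: "(%(x, y). f (merge K J (x, y))) \<in> borel_measurable (gpr K \<Otimes>\<^sub>M gpr J)"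
  using measurable_compose[OF measurable_merge fm] by (simp add: case_prod_beta')
 define G where "G = (%x. \<integral>y. f (merge K J (x, y)) \<partial>gpr J)"
 have Gm: "G \<in> borel_measurable (gpr K)"
  unfolding G_def using mm by (rule P.borel_measurable_lebesgue_integral)
 have "(\<integral>g. f g \<partial>gpr S) = (\<integral>x. G x \<partial>gpr K)"
  unfolding G_def
  using gp.product_integral_fold[OF K(1,2) J, of f] expgr_integrable[OF S(1) f] K(3) by simp
 also have "... = (\<integral>g. G (restrict g K) \<partial>gpr S)"
  using gpr_restrict[OF S(1) K(4) Gm] by simp
 also have "... = (\<integral>g. (\<integral>ga. f (over J ga g) \<partial>gpr (insert z0 J)) \<partial>gpr S)"
 proof (intro Bochner_Integration.integral_cong refl)
  fix g assume g: "g \<in> space (gpr S)"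
  have eq: "merge K J (restrict g K, restrict ga J) = over J ga g" for ga
  proof
   fix e
   have "e \<notin> S ==> g e = undefined" using g by (auto simp: space_PiM PiE_iff extensional_def)
   then show "merge K J (restrict g K, restrict ga J) e = over J ga g e"
    using K by (cases "e \<in> J"; cases "e \<in> S") (auto simp: merge_def over_def K_def)
  qed
  have rK: "restrict g K \<in> space (gpr K)" by (simp add: space_PiM)
  have "(%y. f (merge K J (restrict g K, y))) \<in> borel_measurable (gpr J)"
   using measurable_compose[OF measurable_Pair1'[OF rK] mm] by simp
  then have "G (restrict g K) = (\<integral>ga. f (merge K J (restrict g K, restrict ga J)) \<partial>gpr (insert z0 J))"
   unfolding G_def using J by (subst gpr_restrict) auto
  then show "G (restrict g K) = (\<integral>ga. f (over J ga g) \<partial>gpr (insert z0 J))"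
   by (simp only: eq)
 qed
 finally show ?thesis .
qed

section \<open>The SK model as a cavity system\<close>

definition col :: "nat => nat => (nat \<times> nat) set" where
 "col N p = {e \<in> site_pairs N. fst e = p \<or> snd e = p}"

definition oth :: "nat => nat \<times> nat => nat" where
 "oth p e = (if fst e = p then snd e else fst e)"

definition cv :: "nat => nat => nat \<times> nat => (nat => real) => real" where
 "cv N p e sm = sm (oth p e) / rtN N"

definition flp :: "nat => (nat => real) => nat => real" where
 "flp p sm = sm(p := - sm p)"

definition cE :: "nat => nat => (nat \<times> nat => real) => (nat => real) => real" where
 "cE N p g sm = (\<Sum>(i, j)\<in>site_pairs N - col N p. 1 / rtN N * g (i, j) * sm i * sm j)"

definition cM :: "nat => nat => (nat => real) => real" where
 "cM N p sm = (\<Sum>k\<in>{1..N} - {p}. sm k)"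

definition cL :: "nat => nat => real => real => (nat \<times> nat => real) => (nat => real) => real" where
 "cL N p be h g sm = be * cE N p g sm + be * h * cM N p sm"

definition Ham :: "nat => real => real => (nat \<times> nat => real) => (nat => real) => real" where
 "Ham N be h g sm = be * hamiltonian N h g sm"

lemma finite_site_pairs: "finite (site_pairs N)"
 by (rule finite_subset[of _ "{1..N} \<times> {1..N}"]) (auto simp: site_pairs_def)

lemma finite_configs: "finite (configs N)"
 unfolding configs_def by (intro finite_PiE) auto

lemma configs_nonempty: "configs N ~= {}"
 by (auto simp: configs_def PiE_eq_empty_iff)

lemma configs_values: "sm \<in> configs N ==> 1 <= k ==> k <= N ==> sm k = 1 \<or> sm k = -1"
 unfolding configs_def using PiE_mem[of sm "{1..N}" "%_. {-1, 1}" k] by auto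

lemma configs_sq: "sm \<in> configs N ==> 1 <= k ==> k <= N ==> sm k * sm k = 1"
 using configs_values by fastforce

lemma configs_abs: "sm \<in> configs N ==> 1 <= k ==> k <= N ==> \<bar>sm k\<bar> = 1"
 using configs_values by fastforce

lemma bij_oth: "1 <= p ==> p <= N ==> bij_betw (oth p) (col N p) ({1..N} - {p})"
proof (rule bij_betw_byWitness[where f' = "%k. if k < p then (k, p) else (p, k)"])
qed (auto simp: oth_def col_def site_pairs_def split: if_splits)

lemma gibbs_eq_gb: "gibbs N be h g = gb (configs N) (Ham N be h g)"
 by (simp add: fun_eq_iff gibbs_def gb_def Ham_def)

lemma replica_avg_eq_gavg:
 "replica_avg N be h g I f = gavg (configs N) (gb (configs N) (Ham N be h g)) I f" for f :: "_ => real"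
 by (simp add: replica_avg_def gavg_def gibbs_eq_gb)

lemma nu_eq: "nu N be h I f = (\<integral>g. gavg (configs N) (gb (configs N) (Ham N be h g)) I (f g) \<partial>gpr (site_pairs N))"
 for f :: "_ => _ => real"
 by (simp add: nu_def replica_avg_eq_gavg couplings_def)

lemma energy_measurable [measurable]: "(%g. energy N g sm) \<in> borel_measurable (gpr (site_pairs N))"
 unfolding energy_def case_prod_beta by measurable

lemma Ham_measurable [measurable]: "(%g. Ham N be h g sm) \<in> borel_measurable (gpr (site_pairs N))"
 unfolding Ham_def hamiltonian_def by measurable

lemma cE_measurable [measurable]: "(%g. cE N p g sm) \<in> borel_measurable (gpr (site_pairs N))"
 unfolding cE_def case_prod_beta by measurable

lemma cL_measurable [measurable]: "(%g. cL N p be h g sm) \<in> borel_measurable (gpr (site_pairs N))"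
 unfolding cL_def by measurable

text \<open>The SK model seen from site \<open>p\<close>: the coupling column of \<open>p\<close> plays the role of the Gaussian vector.\<close>

locale sk_site =
 fixes N p :: nat and be h q :: real
 assumes p: "1 <= p" "p <= N" and be: "0 <= be" and q: "0 <= q" "q <= 1"
begin

lemma N: "1 <= N" using p by simp

sublocale cav: cavity "configs N" "flp p" "%sm. sm p" "cL N p be h g" "col N p" "(0, 0)" "cv N p"
 be h q "(real N - 1) / real N" for g
proof
 have in_site: "oth p e ~= p" "1 <= oth p e" "oth p e <= N" if "e \<in> col N p" for e
  using that by (auto simp: oth_def col_def site_pairs_def split: if_splits)
 show "finite (configs N)" "configs N ~= {}" by (rule finite_configs configs_nonempty)+
 fix sm assume sm: "sm \<in> configs N"
 show "flp p sm \<in> configs N"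
  using sm p by (auto simp: configs_def flp_def PiE_iff extensional_def)
 show "flp p (flp p sm) = sm" by (simp add: flp_def fun_eq_iff)
 show "sm p * sm p = 1" using configs_sq[OF sm] p by simp
 show "flp p sm p = - sm p" by (simp add: flp_def)
 have "cE N p g (flp p sm) = cE N p g sm"
  unfolding cE_def by (intro sum.cong refl) (auto simp: col_def flp_def)
 moreover have "cM N p (flp p sm) = cM N p sm"
  unfolding cM_def by (intro sum.cong refl) (auto simp: flp_def)
 ultimately show "cL N p be h g (flp p sm) = cL N p be h g sm" by (simp add: cL_def)
 show "cv N p j (flp p sm) = cv N p j sm" if "j \<in> col N p" for j
  using in_site[OF that] by (simp add: cv_def flp_def)
 have "(\<Sum>j\<in>col N p. cv N p j sm * cv N p j sm) = (\<Sum>j\<in>col N p. 1 / real N)"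
  using in_site configs_sq[OF sm] N by (intro sum.cong refl) (simp add: cv_def)
 also have "... = (\<Sum>k\<in>{1..N} - {p}. 1 / real N)"
  by (rule sum.reindex_bij_betw[OF bij_oth[OF p]])
 also have "... = (real N - 1) / real N" using p by (simp add: of_nat_diff)
 finally show "(\<Sum>j\<in>col N p. cv N p j sm * cv N p j sm) = (real N - 1) / real N" .
next
 show "finite (col N p)" by (rule finite_subset[OF _ finite_site_pairs]) (auto simp: col_def)
 show "(0, 0) \<notin> col N p" using p by (auto simp: col_def)
 show "(real N - 1) / real N <= 1" using N by (simp add: divide_le_eq)
qed (use be q in auto)

lemma ov_eq:
 "cav.ov sm \<tau> = overlap N sm \<tau> - sm p * \<tau> p / real N"
proof -
 have "cav.ov sm \<tau> = (\<Sum>j\<in>col N p. sm (oth p j) * \<tau> (oth p j) / real N)"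
  unfolding cav.ov_def cv_def by (intro sum.cong refl) simp
 also have "... = (\<Sum>k\<in>{1..N} - {p}. sm k * \<tau> k / real N)"
  by (rule sum.reindex_bij_betw[OF bij_oth[OF p]])
 also have "... = (\<Sum>k = 1..N. sm k * \<tau> k / real N) - sm p * \<tau> p / real N"
  using p by (simp add: sum_diff1)
 finally show ?thesis by (simp add: overlap_def sum_divide_distrib)
qed

lemma energy_split: "energy N g sm = cE N p g sm + sm p * cav.ell g sm"
proof -
 have sub: "col N p \<subseteq> site_pairs N" by (auto simp: col_def)
 have "energy N g sm = cE N p g sm + (\<Sum>(i, j)\<in>col N p. 1 / rtN N * g (i, j) * sm i * sm j)"
  unfolding energy_def cE_def by (rule sum.subset_diff[OF sub finite_site_pairs])
 also have "(\<Sum>(i, j)\<in>col N p. 1 / rtN N * g (i, j) * sm i * sm j) = sm p * cav.ell g sm"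
  unfolding cav.ell_def sum_distrib_left
  by (intro sum.cong refl) (auto simp: cv_def oth_def col_def)
 finally show ?thesis .
qed

lemma cE_over: "cE N p (over (col N p) ga g) sm = cE N p g sm"
 unfolding cE_def by (intro sum.cong refl) (auto simp: over_def)

lemma ell_over: "cav.ell (over (col N p) ga g) sm = cav.ell ga sm"
 unfolding cav.ell_def by (intro sum.cong refl) (auto simp: over_def)

lemma Ham_eq: "Ham N be h g sm = cL N p be h g sm + sm p * (be * cav.ell g sm + be * h)"
proof -
 have "(\<Sum>k = 1..N. sm k) = sm p + cM N p sm"
  unfolding cM_def using p by (subst sum.remove[of _ p]) auto
 then show ?thesis
  using N by (simp add: Ham_def hamiltonian_def energy_split magnetization_def cL_def algebra_simps)
qed

lemma Ham_over: "Ham N be h (over (col N p) ga g) = cav.L g (pi/2) ga"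
 by (simp add: fun_eq_iff Ham_eq cav.L_def cav.U_def cL_def cE_over ell_over)

end

lemma sqrt_mult_le_of_AM_GM:
 fixes x a b :: real
 assumes le: "!!t. 0 < t ==> x <= (t * a + b / t) / 2" and "0 <= a" "0 <= b"
 shows "x <= sqrt a * sqrt b"
proof (cases "a = 0 \<or> b = 0")
 case False
 then have ab: "0 < sqrt a" "0 < sqrt b" using assms by auto
 have sq: "a = sqrt a * sqrt a" "b = sqrt b * sqrt b" using assms by auto
 have "x <= (sqrt b / sqrt a * a + b / (sqrt b / sqrt a)) / 2"
  using ab by (intro le) auto
 also have "sqrt b / sqrt a * a = sqrt a * sqrt b" using ab by (subst sq(1)) (simp add: field_simps)
 also have "b / (sqrt b / sqrt a) = sqrt a * sqrt b" using ab by (subst sq(2)) (simp add: field_simps)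
 finally show ?thesis by simp
next
 case True
 have "x <= 0"
 proof (rule ccontr)
  assume "\<not> x <= 0"
  then have x: "0 < x" by simp
  show False
  proof (cases "a = 0")
   case True
   have "x <= ((b + 1) / x * a + b / ((b + 1) / x)) / 2"
    using x assms by (intro le) auto
   also have "... = x * (b / (b + 1)) / 2" using True by simp
   also have "... <= x * 1 / 2" using x assms by (intro divide_right_mono mult_left_mono) auto
   finally show False using x by simp
  next
   case False
   then have b: "b = 0" using \<open>a = 0 \<or> b = 0\<close> by simp
   have "x <= (x / (a + 1) * a + b / (x / (a + 1))) / 2"
    using x assms by (intro le) auto
   also have "... = x * (a / (a + 1)) / 2" using b by simp
   also have "... <= x * 1 / 2" using x assms by (intro divide_right_mono mult_left_mono) auto
   finally show False using x by simp
  qed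
 qed
 also have "0 <= sqrt a * sqrt b" using assms by simp
 finally show ?thesis .
qed

section \<open>Averages over couplings and replicas\<close>

text \<open>Integrability is needed only at admissible configurations, since the replica average is a finite sum.\<close>

definition grows :: "nat => nat => ((nat \<times> nat => real) => (nat => nat => real) => real) => bool" where
 "grows N m f \<longleftrightarrow> (\<forall>s\<in>PiE {..<m} (%_. configs N). expgr (site_pairs N) (%g. f g s))"

lemma growsI: "(!!s. s \<in> PiE {..<m} (%_. configs N) ==> expgr (site_pairs N) (%g. f g s)) ==> grows N m f"
 by (auto simp: grows_def)

lemma growsD: "grows N m f ==> s \<in> PiE {..<m} (%_. configs N) ==> expgr (site_pairs N) (%g. f g s)"
 by (auto simp: grows_def)

lemma grows_add: "grows N m f ==> grows N m f' ==> grows N m (%g s. f g s + f' g s)"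
 by (auto simp: grows_def intro: expgr_add)
lemma grows_diff: "grows N m f ==> grows N m f' ==> grows N m (%g s. f g s - f' g s)"
 by (auto simp: grows_def intro: expgr_diff)
lemma grows_mult: "grows N m f ==> grows N m f' ==> grows N m (%g s. f g s * f' g s)"
 by (auto simp: grows_def intro: expgr_mult)
lemma grows_power: "grows N m f ==> grows N m (%g s. f g s ^ k)"
 by (auto simp: grows_def intro: expgr_power)
lemma grows_abs: "grows N m f ==> grows N m (%g s. \<bar>f g s\<bar>)"
 by (auto simp: grows_def intro: expgr_abs)
lemma grows_sum: "(!!x. x \<in> X ==> grows N m (f x)) ==> grows N m (%g s. \<Sum>x\<in>X. f x g s)"
 by (auto simp: grows_def intro: expgr_sum)
lemma grows_const: "grows N m (%g s. w s)"
 by (auto simp: grows_def)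

lemmas grows_intros = grows_add grows_diff grows_mult grows_power grows_abs grows_sum grows_const

lemma grows_superset:
 assumes "grows N m f" "!!g. dep {..<m} (f g)" "m <= m'"
 shows "grows N m' f"
proof (rule growsI)
 fix s assume s: "s \<in> PiE {..<m'} (%_. configs N)"
 have "restrict s {..<m} \<in> PiE {..<m} (%_. configs N)"
 proof (rule PiE_I)
  fix i assume "i \<in> {..<m}"
  then have "i \<in> {..<m'}" using assms(3) by simp
  from PiE_mem[OF s this] show "restrict s {..<m} i \<in> configs N" using \<open>i \<in> {..<m}\<close> by simp
 qed simp
 from growsD[OF assms(1) this] have "expgr (site_pairs N) (%g. f g (restrict s {..<m}))" .
 moreover have "f g (restrict s {..<m}) = f g s" for g by (rule depD[OF assms(2)]) simp
 ultimately show "expgr (site_pairs N) (%g. f g s)" by simp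
qed

locale gibbs_field =
 fixes N :: nat and Lf :: "(nat \<times> nat => real) => (nat => real) => real"
 assumes Lf_measurable: "!!a. (%g. Lf g a) \<in> borel_measurable (gpr (site_pairs N))"
begin

definition "gex m f = (\<integral>g. gavg (configs N) (gb (configs N) (Lf g)) {..<m} (f g) \<partial>gpr (site_pairs N))"
 for m :: nat

lemma gex_growth:
 "grows N m f ==> expgr (site_pairs N) (%g. gavg (configs N) (gb (configs N) (Lf g)) {..<m} (f g))"
 by (intro expgr_gavg finite_configs Lf_measurable growsD) auto

lemma gex_integrable:
 "grows N m f ==> integrable (gpr (site_pairs N)) (%g. gavg (configs N) (gb (configs N) (Lf g)) {..<m} (f g))"
 by (rule expgr_integrable[OF finite_site_pairs gex_growth])

lemma gex_add: "grows N m f ==> grows N m f' ==> gex m (%g s. f g s + f' g s) = gex m f + gex m f'"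
 by (simp add: gex_def gavg_add gex_integrable)

lemma gex_diff: "grows N m f ==> grows N m f' ==> gex m (%g s. f g s - f' g s) = gex m f - gex m f'"
 by (simp add: gex_def gavg_diff gex_integrable)

lemma gex_cmult: "gex m (%g s. k * f g s) = k * gex m f"
 by (simp add: gex_def gavg_cmult)

lemma gex_sum: "(!!x. x \<in> X ==> grows N m (f x)) ==> gex m (%g s. \<Sum>x\<in>X. f x g s) = (\<Sum>x\<in>X. gex m (f x))"
 by (simp add: gex_def gavg_sum gex_integrable)

lemma gex_cong: "(!!g s. s \<in> PiE {..<m} (%_. configs N) ==> f g s = f' g s) ==> gex m f = gex m f'"
 unfolding gex_def by (intro Bochner_Integration.integral_cong refl gavg_cong) auto

lemma gex_mono:
 assumes "grows N m f" "grows N m f'" "!!g s. s \<in> PiE {..<m} (%_. configs N) ==> f g s <= f' g s"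
 shows "gex m f <= gex m f'"
 unfolding gex_def by (intro integral_mono gex_integrable gavg_mono gb_nonneg assms)

lemma gex_nonneg: "(!!g s. s \<in> PiE {..<m} (%_. configs N) ==> 0 <= f g s) ==> 0 <= gex m f"
 unfolding gex_def by (intro Bochner_Integration.integral_nonneg gavg_nonneg gb_nonneg)

lemma gex_const: "gex m (%g s. k) = k"
proof -
 interpret prob_space "gpr (site_pairs N)" by (rule prob_space_gpr)
 show ?thesis
  by (simp add: gex_def gavg_const finite_configs gb_sum configs_nonempty prob_space)
qed

lemma gex_abs_le: "grows N m f ==> \<bar>gex m f\<bar> <= gex m (%g s. \<bar>f g s\<bar>)"
proof -
 assume f: "grows N m f"
 have "\<bar>gex m f\<bar> <= (\<integral>g. \<bar>gavg (configs N) (gb (configs N) (Lf g)) {..<m} (f g)\<bar> \<partial>gpr (site_pairs N))"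
  unfolding gex_def by (rule integral_abs_bound)
 also have "... <= gex m (%g s. \<bar>f g s\<bar>)"
  unfolding gex_def using f
  by (intro integral_mono integrable_abs gex_integrable grows_abs gavg_abs_le gb_nonneg)
 finally show ?thesis .
qed

lemma gex_superset: "(!!g. dep {..<m} (f g)) ==> m <= m' ==> gex m' f = gex m f"
 unfolding gex_def
 by (intro Bochner_Integration.integral_cong refl gavg_superset) (auto simp: gb_sum finite_configs configs_nonempty)

lemma gex_reindex:
 assumes "inj_on \<pi> {..<m}" "\<pi> ` {..<m} \<subseteq> {..<m'}" "!!g. dep {..<m} (f g)"
 shows "gex m' (%g s. f g (%j. s (\<pi> j))) = gex m f"
 unfolding gex_def using assms
 by (intro Bochner_Integration.integral_cong refl gavg_reindex) (auto simp: gb_sum finite_configs configs_nonempty)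

lemma gex_cauchy_schwarz:
 assumes f: "grows N m f" "grows N m f'"
 shows "gex m (%g s. \<bar>f g s\<bar> * \<bar>f' g s\<bar>) <= sqrt (gex m (%g s. (f g s)^2)) * sqrt (gex m (%g s. (f' g s)^2))"
proof (rule sqrt_mult_le_of_AM_GM)
 fix t :: real assume t: "0 < t"
 have "gex m (%g s. \<bar>f g s\<bar> * \<bar>f' g s\<bar>) <= gex m (%g s. t / 2 * (f g s)^2 + 1 / (2 * t) * (f' g s)^2)"
 proof (rule gex_mono)
  fix g s
  have "0 <= (t * \<bar>f g s\<bar> - \<bar>f' g s\<bar>)^2 / (2 * t)" using t by simp
  also have "... = t / 2 * (f g s)^2 + 1 / (2 * t) * (f' g s)^2 - \<bar>f g s\<bar> * \<bar>f' g s\<bar>"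
   using t unfolding power2_diff power_mult_distrib power2_abs by (simp add: field_simps power2_eq_square)
  finally show "\<bar>f g s\<bar> * \<bar>f' g s\<bar> <= t / 2 * (f g s)^2 + 1 / (2 * t) * (f' g s)^2" by simp
 qed (intro grows_intros f)+
 also have "... = t / 2 * gex m (%g s. (f g s)^2) + 1 / (2 * t) * gex m (%g s. (f' g s)^2)"
  by (subst gex_add) (intro grows_intros f | simp only: gex_cmult)+
 finally show "gex m (%g s. \<bar>f g s\<bar> * \<bar>f' g s\<bar>) <= (t * gex m (%g s. (f g s)^2) + gex m (%g s. (f' g s)^2) / t) / 2"
  by (simp add: field_simps)
qed (intro gex_nonneg zero_le_power2)+

end

interpretation sk: gibbs_field N "Ham N be h" for N be h
 by unfold_locales measurable

section \<open>The cavity expansions averaged over the couplings\<close>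

context sk_site
begin

sublocale base: gibbs_field N "cL N p be h"
 by unfold_locales measurable

abbreviation "nuN \<equiv> sk.gex N be h"
abbreviation "n0 \<equiv> base.gex"
abbreviation "MU \<equiv> gpr (site_pairs N)"
abbreviation "PI m \<equiv> PiE {..<m::nat} (%_. configs N)"

text \<open>Functions that see neither the spin at \<open>p\<close> nor its couplings; these factor out of the cavity expansion.\<close>

definition "cavfun m f \<longleftrightarrow> (\<forall>g. dep {..<m} (f g)) & (\<forall>g. cav.flip_inv m (f g)) &
 (\<forall>g ga. f (over (col N p) ga g) = f g) & grows N m f" for m :: nat

definition "e1 m f = (\<Sum>l<m. \<Sum>l'\<in>{..<m} - {l}. n0 m (%g s. \<bar>f g s\<bar> * \<bar>cav.ov (s l) (s l') - q\<bar>))" for m :: nat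

definition "e2 m f = (\<Sum>l<m. \<Sum>l'\<in>{..<m} - {l}. \<Sum>k<m. \<Sum>k'\<in>{..<m} - {k}.
  n0 m (%g s. \<bar>f g s\<bar> * (\<bar>cav.ov (s l) (s l') - q\<bar> * \<bar>cav.ov (s k) (s k') - q\<bar>)))" for m :: nat

lemma col_sub: "col N p \<subseteq> site_pairs N" by (auto simp: col_def)

lemma z0_col: "(0, 0) \<notin> col N p" using p by (auto simp: col_def)

lemma n0_def': "n0 m f = (\<integral>g. cav.avg0 g m (f g) \<partial>MU)"
 by (simp add: base.gex_def cav.avg0_def)

lemma nuN_resample:
 assumes "grows N m f"
 shows "nuN m f = (\<integral>g. (\<integral>ga. gavg (configs N) (cav.p g (pi/2) ga) {..<m} (f (over (col N p) ga g))
   \<partial>gpr (insert (0, 0) (col N p))) \<partial>MU)"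
 unfolding sk.gex_def
 by (subst resample[OF finite_site_pairs col_sub z0_col sk.gex_growth[OF assms]]) (simp only: Ham_over)

lemma nuN_resample_growth:
 assumes "grows N m f"
 shows "expgr (site_pairs N) (%g. \<integral>ga. gavg (configs N) (cav.p g (pi/2) ga) {..<m} (f (over (col N p) ga g))
   \<partial>gpr (insert (0, 0) (col N p)))"
 using resample_growth[OF finite_site_pairs col_sub sk.gex_growth[OF assms, of be h], of "(0,0)"]
 by (simp only: Ham_over)

lemma nuN_resample_diff:
 assumes f: "grows N m f" and R: "expgr (site_pairs N) R" and E: "expgr (site_pairs N) E"
  and le: "!!g. \<bar>(\<integral>ga. gavg (configs N) (cav.p g (pi/2) ga) {..<m} (f (over (col N p) ga g))
   \<partial>gpr (insert (0, 0) (col N p))) - R g\<bar> <= E g"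
 shows "\<bar>nuN m f - (\<integral>g. R g \<partial>MU)\<bar> <= (\<integral>g. E g \<partial>MU)"
proof -
 let ?I = "%g. \<integral>ga. gavg (configs N) (cav.p g (pi/2) ga) {..<m} (f (over (col N p) ga g))
   \<partial>gpr (insert (0, 0) (col N p))"
 note i = expgr_integrable[OF finite_site_pairs]
 have eq: "nuN m f - (\<integral>g. R g \<partial>MU) = (\<integral>g. ?I g - R g \<partial>MU)"
  unfolding nuN_resample[OF f] by (rule Bochner_Integration.integral_diff[symmetric]) (intro i nuN_resample_growth f R)+
 have "\<bar>nuN m f - (\<integral>g. R g \<partial>MU)\<bar> <= (\<integral>g. \<bar>?I g - R g\<bar> \<partial>MU)"
  unfolding eq by (rule integral_abs_bound)
 also have "... <= (\<integral>g. E g \<partial>MU)"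
  by (rule integral_mono) (intro i expgr_abs expgr_diff nuN_resample_growth f R E le)+
 finally show ?thesis .
qed

lemma avg0_growth: "grows N m f ==> expgr (site_pairs N) (%g. cav.avg0 g m (f g))"
 using base.gex_growth by (simp add: cav.avg0_def)

lemma avg0_integrable: "grows N m f ==> integrable MU (%g. cav.avg0 g m (f g))"
 by (rule expgr_integrable[OF finite_site_pairs avg0_growth])

lemma err1_growth: "grows N m f ==> expgr (site_pairs N) (%g. cav.err1 g m (f g))"
 unfolding cav.err1_def by (intro expgr_sum avg0_growth grows_intros)

lemma err1_integral: "grows N m f ==> (\<integral>g. cav.err1 g m (f g) \<partial>MU) = e1 m f"
 unfolding cav.err1_def e1_def n0_def'
 by (subst Bochner_Integration.integral_sum, (intro Bochner_Integration.integrable_sum avg0_integrable grows_intros; assumption)+,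
   intro sum.cong refl, subst Bochner_Integration.integral_sum, (intro avg0_integrable grows_intros; assumption)+, rule refl)

lemma err2_growth: "grows N m f ==> expgr (site_pairs N) (%g. cav.err2 g m (f g))"
 unfolding cav.err2_def by (intro expgr_sum avg0_growth grows_intros)

lemma err2_integral: "grows N m f ==> (\<integral>g. cav.err2 g m (f g) \<partial>MU) = e2 m f"
 unfolding cav.err2_def e2_def n0_def'
 by (simp only: Bochner_Integration.integral_sum Bochner_Integration.integrable_sum avg0_integrable grows_intros)

lemma grows_eT: "grows N m f ==> grows N m (%g s. cav.eT T s * f g s)"
 by (intro grows_intros)

lemma E1:
 assumes f: "cavfun m f" and T: "T \<subseteq> {..<m}"
 shows "\<bar>nuN m (%g s. cav.eT T s * f g s) - tmom be h q (card T) * n0 m f\<bar>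
   <= 2 * lipcav be h m * e1 (m + 2) f"
proof -
 have d: "!!g. dep {..<m} (f g)" and fi: "!!g. cav.flip_inv m (f g)" and ov: "!!g ga. f (over (col N p) ga g) = f g"
  and gr: "grows N m f" using f by (auto simp: cavfun_def)
 have gr2: "grows N (m + 2) f" by (rule grows_superset[OF gr d]) simp
 have "\<bar>nuN m (%g s. cav.eT T s * f g s) - (\<integral>g. tmom be h q (card T) * cav.avg0 g m (f g) \<partial>MU)\<bar>
   <= (\<integral>g. 2 * lipcav be h m * cav.err1 g (m + 2) (f g) \<partial>MU)"
 proof (rule nuN_resample_diff)
  fix g
  show "\<bar>(\<integral>ga. gavg (configs N) (cav.p g (pi/2) ga) {..<m} (%s. cav.eT T s * f (over (col N p) ga g) s)
   \<partial>gpr (insert (0, 0) (col N p))) - tmom be h q (card T) * cav.avg0 g m (f g)\<bar>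
   <= 2 * lipcav be h m * cav.err1 g (m + 2) (f g)"
   using cav.first_order[OF d fi T, of g g] by (simp add: ov cav.Ph_def)
 qed (intro grows_eT gr expgr_mult expgr_const avg0_growth err1_growth gr2)+
 then show ?thesis by (simp only: n0_def' integral_mult_right_zero err1_integral[OF gr2])
qed

lemma E2:
 assumes f: "cavfun m f" and T: "T \<subseteq> {..<m}"
 shows "\<bar>nuN m (%g s. cav.eT T s * f g s) - tmom be h q (card T) * n0 m f
   - be\<^sup>2 / 2 * (\<Sum>l<m+2. \<Sum>l'\<in>{..<m+2} - {l}. cw1 m l * cw2 m l' *
      (tmom be h q (card (tog l (tog l' T))) * n0 (m + 2) (%g s. (cav.ov (s l) (s l') - q) * f g s)))\<bar>
   <= 4 * be^2 * lipcav be h (m + 2) * (real (m + 1))^2 * e2 (m + 4) f"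
proof -
 have d: "!!g. dep {..<m} (f g)" and fi: "!!g. cav.flip_inv m (f g)" and ov: "!!g ga. f (over (col N p) ga g) = f g"
  and gr: "grows N m f" using f by (auto simp: cavfun_def)
 have gr2: "grows N (m + 2) f" "grows N (m + 4) f" by (auto intro: grows_superset[OF gr d])
 let ?S = "%g. \<Sum>l<m+2. \<Sum>l'\<in>{..<m+2} - {l}. cw1 m l * cw2 m l' *
      (tmom be h q (card (tog l (tog l' T))) * cav.avg0 g (m + 2) (%s. (cav.ov (s l) (s l') - q) * f g s))"
 let ?R = "%g. tmom be h q (card T) * cav.avg0 g m (f g) + be^2 / 2 * ?S g"
 have Sg: "expgr (site_pairs N) ?S"
  by (intro expgr_sum expgr_mult expgr_const avg0_growth grows_mult grows_const gr2)
 have "\<bar>nuN m (%g s. cav.eT T s * f g s) - (\<integral>g. ?R g \<partial>MU)\<bar>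
   <= (\<integral>g. 4 * be^2 * lipcav be h (m + 2) * (real (m + 1))^2 * cav.err2 g (m + 4) (f g) \<partial>MU)"
 proof (rule nuN_resample_diff)
  fix g
  show "\<bar>(\<integral>ga. gavg (configs N) (cav.p g (pi/2) ga) {..<m} (%s. cav.eT T s * f (over (col N p) ga g) s)
   \<partial>gpr (insert (0, 0) (col N p))) - ?R g\<bar>
   <= 4 * be^2 * lipcav be h (m + 2) * (real (m + 1))^2 * cav.err2 g (m + 4) (f g)"
   using cav.second_order[OF d fi T, of g g] unfolding ov cav.Ph_def diff_diff_eq .
 qed (intro grows_eT gr expgr_mult expgr_add Sg expgr_const avg0_growth err2_growth gr2)+
 also have "(\<integral>g. ?R g \<partial>MU) = tmom be h q (card T) * n0 m f + be^2 / 2 * (\<integral>g. ?S g \<partial>MU)"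
  by (subst Bochner_Integration.integral_add)
    (intro expgr_integrable[OF finite_site_pairs] expgr_mult expgr_const avg0_growth gr Sg | simp only: n0_def' integral_mult_right_zero)+
 also have "(\<integral>g. ?S g \<partial>MU) = (\<Sum>l<m+2. \<Sum>l'\<in>{..<m+2} - {l}. cw1 m l * cw2 m l' *
      (tmom be h q (card (tog l (tog l' T))) * n0 (m + 2) (%g s. (cav.ov (s l) (s l') - q) * f g s)))"
 proof -
  have i: "integrable MU (%g. cw1 m l * cw2 m l' *
      (tmom be h q (card (tog l (tog l' T))) * cav.avg0 g (m + 2) (%s. (cav.ov (s l) (s l') - q) * f g s)))" for l l'
   by (intro integrable_mult_right avg0_integrable grows_mult grows_const gr2)
  show ?thesis
   by (simp only: Bochner_Integration.integral_sum Bochner_Integration.integrable_sum i integral_mult_right_zero n0_def')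
 qed
 finally show ?thesis by (simp only: integral_mult_right_zero err2_integral[OF gr2(2)] diff_diff_eq)
qed

lemma ell_growth: "expgr (site_pairs N) (%g. cav.ell g sm)"
 unfolding cav.ell_def using finite_site_pairs col_sub
 by (intro expgr_sum expgr_mult expgr_const expgr_coord) auto

lemma E3:
 assumes f: "cavfun m f" and T: "T \<subseteq> {..<m}" and j: "j < m"
 shows "\<bar>nuN m (%g s. cav.eT T s * (s j p * cav.ell g (s j)) * f g s)
    - lamE be h q ((real N - 1) / real N) m T j * n0 m f\<bar> <= cav.ell_const m * e1 (m + 3) f"
proof -
 have d: "!!g. dep {..<m} (f g)" and fi: "!!g. cav.flip_inv m (f g)" and ov: "!!g ga. f (over (col N p) ga g) = f g"
  and gr: "grows N m f" using f by (auto simp: cavfun_def)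
 have gr2: "grows N (m + 3) f" by (rule grows_superset[OF gr d]) simp
 let ?l = "lamE be h q ((real N - 1) / real N) m T j"
 have "\<bar>nuN m (%g s. cav.eT T s * (s j p * cav.ell g (s j)) * f g s) - (\<integral>g. ?l * cav.avg0 g m (f g) \<partial>MU)\<bar>
   <= (\<integral>g. cav.ell_const m * cav.err1 g (m + 3) (f g) \<partial>MU)"
 proof (rule nuN_resample_diff)
  fix g
  show "\<bar>(\<integral>ga. gavg (configs N) (cav.p g (pi/2) ga) {..<m}
    (%s. cav.eT T s * (s j p * cav.ell (over (col N p) ga g) (s j)) * f (over (col N p) ga g) s)
   \<partial>gpr (insert (0, 0) (col N p))) - ?l * cav.avg0 g m (f g)\<bar>
   <= cav.ell_const m * cav.err1 g (m + 3) (f g)"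
   using cav.ell_order[OF d fi T j, of g g] unfolding ov ell_over .
  show "grows N m (%g s. cav.eT T s * (s j p * cav.ell g (s j)) * f g s)"
   by (intro grows_mult grows_const gr growsI ell_growth)
 qed (intro expgr_mult expgr_const avg0_growth err1_growth gr gr2)+
 then show ?thesis by (simp only: n0_def' integral_mult_right_zero err1_integral[OF gr2])
qed

lemma ell_abs_sum_growth:
 assumes s: "s \<in> PI m" and a: "0 <= a"
 shows "expgr (site_pairs N) (%g. exp (a * (\<Sum>l<m. \<bar>cav.ell g (s l)\<bar>)))"
  and "expgr (site_pairs N) (%g. exp (- a * (\<Sum>l<m. \<bar>cav.ell g (s l)\<bar>)))"
proof -
 have meas: "(%g. cav.ell g sm) \<in> borel_measurable MU" for sm
  using ell_growth by (rule expgr_measurable)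
 show "expgr (site_pairs N) (%g. exp (a * (\<Sum>l<m. \<bar>cav.ell g (s l)\<bar>)))"
 proof (rule expgr_exp[of _ _ 0 "a * m"])
  fix g :: "nat \<times> nat => real"
  have "(\<Sum>l<m. \<bar>cav.ell g (s l)\<bar>) <= (\<Sum>l<m. \<Sum>e\<in>site_pairs N. \<bar>g e\<bar>)"
  proof (rule sum_mono)
   fix l assume "l \<in> {..<m}"
   from PiE_mem[OF s this] have "\<bar>cav.ell g (s l)\<bar> <= (\<Sum>e\<in>col N p. \<bar>g e\<bar>)" by (rule cav.abs_ell)
   also have "... <= (\<Sum>e\<in>site_pairs N. \<bar>g e\<bar>)"
    by (intro sum_mono2 finite_site_pairs col_sub) auto
   finally show "\<bar>cav.ell g (s l)\<bar> <= (\<Sum>e\<in>site_pairs N. \<bar>g e\<bar>)" .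
  qed
  from mult_left_mono[OF this a]
  show "a * (\<Sum>l<m. \<bar>cav.ell g (s l)\<bar>) <= 0 + a * m * (\<Sum>e\<in>site_pairs N. \<bar>g e\<bar>)"
   by (simp add: mult.assoc)
 qed (intro borel_measurable_times borel_measurable_sum borel_measurable_abs meas borel_measurable_const)
 show "expgr (site_pairs N) (%g. exp (- a * (\<Sum>l<m. \<bar>cav.ell g (s l)\<bar>)))"
 proof (rule expgr_exp[of _ _ 0 0])
  fix g :: "nat \<times> nat => real"
  have "0 <= a * (\<Sum>l<m. \<bar>cav.ell g (s l)\<bar>)" by (intro mult_nonneg_nonneg a sum_nonneg) auto
  then show "- a * (\<Sum>l<m. \<bar>cav.ell g (s l)\<bar>) <= 0 + 0 * (\<Sum>e\<in>site_pairs N. \<bar>g e\<bar>)" by simp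
 qed (intro borel_measurable_times borel_measurable_sum borel_measurable_abs meas borel_measurable_const)
qed

lemma Eup:
 assumes gr: "grows N m ph" and ov: "!!g ga. ph (over (col N p) ga g) = ph g"
  and nn: "!!g s. s \<in> PI m ==> 0 <= ph g s" and a: "0 <= a"
 shows "nuN m (%g s. ph g s * exp (a * (\<Sum>l<m. \<bar>cav.ell g (s l)\<bar>))) <= up_const be h m a * n0 m ph"
proof -
 let ?f = "%g s. ph g s * exp (a * (\<Sum>l<m. \<bar>cav.ell g (s l)\<bar>))"
 have grf: "grows N m ?f"
  by (intro growsI expgr_mult growsD[OF gr] ell_abs_sum_growth a)
 have "nuN m ?f <= (\<integral>g. up_const be h m a * cav.avg0 g m (ph g) \<partial>MU)"
  unfolding nuN_resample[OF grf]
 proof (rule integral_mono[OF expgr_integrable[OF finite_site_pairs nuN_resample_growth[OF grf]]])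
  show "integrable MU (%g. up_const be h m a * cav.avg0 g m (ph g))"
   by (intro integrable_mult_right avg0_integrable gr)
  fix g
  show "(\<integral>ga. gavg (configs N) (cav.p g (pi/2) ga) {..<m} (?f (over (col N p) ga g))
   \<partial>gpr (insert (0, 0) (col N p))) <= up_const be h m a * cav.avg0 g m (ph g)"
   unfolding ov ell_over by (rule cav.up_bound(1)[OF nn a])
 qed
 then show ?thesis by (simp add: n0_def')
qed

lemma Elow:
 assumes gr: "grows N m ph" and ov: "!!g ga. ph (over (col N p) ga g) = ph g"
  and nn: "!!g s. s \<in> PI m ==> 0 <= ph g s" and a: "0 <= a"
 shows "n0 m ph <= low_const be h m a * nuN m (%g s. ph g s * exp (- a * (\<Sum>l<m. \<bar>cav.ell g (s l)\<bar>)))"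
proof -
 let ?f = "%g s. ph g s * exp (- a * (\<Sum>l<m. \<bar>cav.ell g (s l)\<bar>))"
 have grf: "grows N m ?f"
  by (intro growsI expgr_mult growsD[OF gr] ell_abs_sum_growth a)
 have "n0 m ph <= (\<integral>g. low_const be h m a * (\<integral>ga. gavg (configs N) (cav.p g (pi/2) ga) {..<m} (?f (over (col N p) ga g))
   \<partial>gpr (insert (0, 0) (col N p))) \<partial>MU)"
  unfolding n0_def'
 proof (rule integral_mono[OF avg0_integrable[OF gr]])
  show "integrable MU (%g. low_const be h m a * (\<integral>ga. gavg (configs N) (cav.p g (pi/2) ga) {..<m} (?f (over (col N p) ga g))
   \<partial>gpr (insert (0, 0) (col N p))))"
   by (intro integrable_mult_right expgr_integrable[OF finite_site_pairs nuN_resample_growth[OF grf]])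
  fix g
  show "cav.avg0 g m (ph g) <= low_const be h m a * (\<integral>ga. gavg (configs N) (cav.p g (pi/2) ga) {..<m} (?f (over (col N p) ga g))
   \<partial>gpr (insert (0, 0) (col N p)))"
   unfolding ov ell_over by (rule cav.low_bound[OF nn a])
 qed
 also have "... = low_const be h m a * nuN m ?f"
  by (simp only: integral_mult_right_zero nuN_resample[OF grf])
 finally show ?thesis .
qed

end

section \<open>Test functions with controlled growth\<close>

text \<open>The \<open>l1\<close> norm makes the exponential change of weights additive over coordinates.\<close>

definition n1 :: "real ^ 'm::finite => real" where
 "n1 x = (\<Sum>k\<in>UNIV. \<bar>x $ k\<bar>)"

lemma n1_nonneg: "0 <= n1 x"
 by (simp add: n1_def sum_nonneg)

lemma n1_scale: "n1 (t *\<^sub>R x) = \<bar>t\<bar> * n1 x"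
 by (simp add: n1_def abs_mult sum_distrib_left)

lemma n1_minus: "n1 (- x) = n1 x"
 by (simp add: n1_def)

lemma abs_le_n1: "\<bar>x $ k\<bar> <= n1 x"
 unfolding n1_def by (rule member_le_sum) auto

lemma norm_le_n1: "norm x <= n1 x"
 unfolding n1_def by (rule norm_le_l1_cart)

lemma continuous_n1: "continuous_on UNIV (n1 :: real ^ 'm::finite => real)"
 unfolding n1_def by (intro continuous_intros)

lemma frechet_expand:
 fixes f :: "real ^ 'm::finite => real"
 assumes "f differentiable (at x)"
 shows "frechet_derivative f (at x) de = (\<Sum>k\<in>UNIV. de $ k * pd k f x)"
proof -
 have lin: "linear (frechet_derivative f (at x))" using assms by (rule linear_frechet_derivative)
 have "frechet_derivative f (at x) de = frechet_derivative f (at x) (\<Sum>k\<in>UNIV. de $ k *\<^sub>R axis k 1)"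
  by (simp add: basis_expansion flip: scalar_mult_eq_scaleR)
 also have "... = (\<Sum>k\<in>UNIV. de $ k * pd k f x)"
  by (simp add: linear_sum[OF lin] linear_cmul[OF lin] partial_deriv_def)
 finally show ?thesis .
qed

lemma partial_derivI:
 "(f has_derivative f') (at x) ==> pd k f x = f' (axis k 1)"
 unfolding partial_deriv_def by (metis frechet_derivative_at)

lemma line_derivative:
 fixes f :: "real ^ 'm::finite => real"
 assumes "!!x. f differentiable (at x)"
 shows "((%t. f (x + t *\<^sub>R de)) has_real_derivative (\<Sum>k\<in>UNIV. de $ k * pd k f (x + t *\<^sub>R de))) (at t)"
proof -
 have "(f has_derivative frechet_derivative f (at (x + t *\<^sub>R de))) (at (x + t *\<^sub>R de))"
  using assms by (simp add: frechet_derivative_works)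
 moreover have "((%t. x + t *\<^sub>R de) has_derivative (%s. s *\<^sub>R de)) (at t)"
  by (auto intro!: derivative_eq_intros)
 ultimately have "((%t. f (x + t *\<^sub>R de)) has_derivative (%s. frechet_derivative f (at (x + t *\<^sub>R de)) (s *\<^sub>R de))) (at t)"
  by (rule has_derivative_compose[rotated])
 moreover have "frechet_derivative f (at (x + t *\<^sub>R de)) (s *\<^sub>R de) = s * (\<Sum>k\<in>UNIV. de $ k * pd k f (x + t *\<^sub>R de))" for s
  using frechet_expand[OF assms, of "x + t *\<^sub>R de" "s *\<^sub>R de"] by (simp add: sum_distrib_left mult.assoc)
 ultimately show ?thesis
  unfolding has_field_derivative_def by (simp add: mult.commute[of _ "\<Sum>k\<in>UNIV. _ k"])
qed

lemma line_mvt: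
 fixes f :: "real ^ 'm::finite => real"
 assumes "!!x. f differentiable (at x)"
 obtains t where "0 < t" "t < 1" "f y - f x = (\<Sum>k\<in>UNIV. (y - x) $ k * pd k f (x + t *\<^sub>R (y - x)))"
proof -
 define de where "de = y - x"
 have "\<exists>t>0. t < 1 & f (x + 1 *\<^sub>R de) - f (x + 0 *\<^sub>R de) = (1 - 0) * (\<Sum>k\<in>UNIV. de $ k * pd k f (x + t *\<^sub>R de))"
  by (rule MVT2[OF zero_less_one]) (rule line_derivative[OF assms])
 then obtain t where "0 < t" "t < 1" "f y - f x = (\<Sum>k\<in>UNIV. de $ k * pd k f (x + t *\<^sub>R de))"
  by (auto simp: de_def)
 then show ?thesis using that unfolding de_def by blast
qed

definition tame :: "real => (real ^ 'm::finite => real) => (real ^ 'm => real) => bool" where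
 "tame a K f \<longleftrightarrow> 0 <= a & (\<forall>x. 0 <= K x) & continuous_on UNIV K &
   (\<forall>x y. K y <= 2 * exp (2 * n1 (y - x)) * K x) &
   (\<forall>x. f differentiable (at x)) & (\<forall>k. continuous_on UNIV (pd k f)) &
   (\<forall>x. \<bar>f x\<bar> <= a * K x) & (\<forall>x k. \<bar>pd k f x\<bar> <= a * K x) &
   (\<forall>x y k. \<bar>pd k f y - pd k f x\<bar> <= a * n1 (y - x) * exp (2 * n1 (y - x)) * K x)"

lemma tameD:
 assumes "tame a K f"
 shows "0 <= a" "0 <= K x" "continuous_on UNIV K" "K y <= 2 * exp (2 * n1 (y - x)) * K x"
  "f differentiable (at x)" "continuous_on UNIV (pd k f)"
  "\<bar>f x\<bar> <= a * K x" "\<bar>pd k f x\<bar> <= a * K x"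
  "\<bar>pd k f y - pd k f x\<bar> <= a * n1 (y - x) * exp (2 * n1 (y - x)) * K x"
 using assms by (auto simp: tame_def)

lemma tame_continuous: "tame a K f ==> continuous_on UNIV f"
 using tameD(5) by (meson continuous_at_imp_continuous_on differentiable_imp_continuous_within)

lemma sum_coord_le:
 assumes "!!k. \<bar>w k\<bar> <= b"
 shows "\<bar>\<Sum>k\<in>UNIV. de $ k * w k\<bar> <= n1 de * b"
proof -
 have "\<bar>\<Sum>k\<in>UNIV. de $ k * w k\<bar> <= (\<Sum>k\<in>UNIV. \<bar>de $ k\<bar> * b)"
  by (rule order_trans[OF sum_abs]) (intro sum_mono, simp add: abs_mult assms mult_left_mono)
 then show ?thesis by (simp add: n1_def sum_distrib_right)
qed

lemma tame_lipschitz: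
 assumes f: "tame a K f"
 shows "\<bar>f y - f x\<bar> <= 2 * a * n1 (y - x) * exp (2 * n1 (y - x)) * K x"
proof -
 let ?de = "y - x"
 obtain t where t: "0 < t" "t < 1" "f y - f x = (\<Sum>k\<in>UNIV. ?de $ k * pd k f (x + t *\<^sub>R ?de))"
  using line_mvt[OF tameD(5)[OF f]] .
 have "\<bar>pd k f (x + t *\<^sub>R ?de)\<bar> <= 2 * a * exp (2 * n1 ?de) * K x" for k
 proof -
  have "\<bar>pd k f (x + t *\<^sub>R ?de)\<bar> <= a * K (x + t *\<^sub>R ?de)" by (rule tameD(8)[OF f])
  also have "... <= a * (2 * exp (2 * n1 (t *\<^sub>R ?de)) * K x)"
   using tameD(4)[OF f, of "x + t *\<^sub>R ?de" x] tameD(1)[OF f] by (intro mult_left_mono) auto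
  also have "... <= a * (2 * exp (2 * n1 ?de) * K x)"
   using t n1_nonneg[of ?de] tameD(1,2)[OF f]
   by (intro mult_left_mono mult_right_mono) (auto simp: n1_scale mult_left_le_one_le)
  finally show ?thesis by (simp add: mult_ac)
 qed
 then have "\<bar>f y - f x\<bar> <= n1 ?de * (2 * a * exp (2 * n1 ?de) * K x)"
  unfolding t(3) by (rule sum_coord_le)
 then show ?thesis by (simp add: mult_ac)
qed

lemma tame_taylor:
 assumes f: "tame a K f"
 shows "\<bar>f y - f x - (\<Sum>k\<in>UNIV. (y - x) $ k * pd k f x)\<bar> <= a * (n1 (y - x))^2 * exp (2 * n1 (y - x)) * K x"
proof -
 let ?de = "y - x"
 obtain t where t: "0 < t" "t < 1" "f y - f x = (\<Sum>k\<in>UNIV. ?de $ k * pd k f (x + t *\<^sub>R ?de))"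
  using line_mvt[OF tameD(5)[OF f]] .
 have "\<bar>pd k f (x + t *\<^sub>R ?de) - pd k f x\<bar> <= a * n1 ?de * exp (2 * n1 ?de) * K x" for k
 proof -
  have "\<bar>pd k f (x + t *\<^sub>R ?de) - pd k f x\<bar> <= a * n1 (t *\<^sub>R ?de) * exp (2 * n1 (t *\<^sub>R ?de)) * K x"
   using tameD(9)[OF f, where y = "x + t *\<^sub>R ?de" and x = x] by simp
  also have "... <= a * n1 ?de * exp (2 * n1 ?de) * K x"
   using t n1_nonneg[of ?de] tameD(1,2)[OF f]
   by (intro mult_mono mult_left_mono) (auto simp: n1_scale mult_left_le_one_le)
  finally show ?thesis .
 qed
 then have "\<bar>\<Sum>k\<in>UNIV. ?de $ k * (pd k f (x + t *\<^sub>R ?de) - pd k f x)\<bar> <= n1 ?de * (a * n1 ?de * exp (2 * n1 ?de) * K x)"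
  by (rule sum_coord_le)
 moreover have "f y - f x - (\<Sum>k\<in>UNIV. ?de $ k * pd k f x) =
   (\<Sum>k\<in>UNIV. ?de $ k * (pd k f (x + t *\<^sub>R ?de) - pd k f x))"
  unfolding t(3) by (simp only: right_diff_distrib sum_subtractf)
 ultimately show ?thesis by (simp only: power2_eq_square mult_ac)
qed

subsection \<open>Polynomials\<close>

lemma real_poly_differentiable:
 fixes f :: "real ^ 'm::finite => real"
 assumes "real_polynomial_function f"
 shows "f differentiable (at x)"
 using assms
proof (induction f rule: real_polynomial_function.induct)
 case (linear f) then show ?case by (rule bounded_linear_imp_differentiable)
qed auto

lemma partial_deriv_add:
 assumes "f differentiable (at x)" "g differentiable (at x)"
 shows "pd k (%x. f x + g x) x = pd k f x + pd k g x"
proof -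
 have "((%x. f x + g x) has_derivative (%d. frechet_derivative f (at x) d + frechet_derivative g (at x) d)) (at x)"
  using assms by (intro has_derivative_add) (simp_all add: frechet_derivative_works)
 from partial_derivI[OF this] show ?thesis by (simp add: partial_deriv_def)
qed

lemma partial_deriv_mult:
 assumes "f differentiable (at x)" "g differentiable (at x)"
 shows "pd k (%x. f x * g x) x = pd k f x * g x + f x * pd k g x"
proof -
 have "((%x. f x * g x) has_derivative (%d. f x * frechet_derivative g (at x) d + frechet_derivative f (at x) d * g x)) (at x)"
  using assms by (intro has_derivative_mult) (simp_all add: frechet_derivative_works)
 from partial_derivI[OF this] show ?thesis by (simp add: partial_deriv_def)
qed

lemma real_poly_partial_deriv:
 fixes f :: "real ^ 'm::finite => real"
 assumes "real_polynomial_function f"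
 shows "real_polynomial_function (pd k f)"
 using assms
proof (induction f rule: real_polynomial_function.induct)
 case (linear f)
 have "pd k f = (%x. f (axis k 1))"
  by (rule ext, rule partial_derivI, rule bounded_linear_imp_has_derivative[OF linear])
 then show ?case by auto
next
 case (const c)
 have "pd k (%x. c) = (%x. 0)"
  by (rule ext) (simp add: partial_deriv_def)
 then show ?case by auto
next
 case (add f g)
 have "pd k (%x. f x + g x) = (%x. pd k f x + pd k g x)"
  by (rule ext, rule partial_deriv_add) (intro real_poly_differentiable add)+
 then show ?case using add by auto
next
 case (mult f g)
 have "pd k (%x. f x * g x) = (%x. pd k f x * g x + f x * pd k g x)"
  by (rule ext, rule partial_deriv_mult) (intro real_poly_differentiable mult)+
 then show ?case using mult by auto
qed

lemma real_poly_iterated: "real_polynomial_function f ==> real_polynomial_function (foldr pd js f)"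
 by (induction js) (auto intro: real_poly_partial_deriv)

lemma real_poly_poly_fun:
 assumes "finite {a. c a ~= 0}"
 shows "real_polynomial_function (poly_fun c)"
proof -
 have pow: "real_polynomial_function (%x. (x $ j) ^ n)" for j :: 'a and n
 proof (induction n)
  case (Suc n)
  have "real_polynomial_function (%x. x $ j)" by (rule real_polynomial_function.intros(1)[OF bounded_linear_vec_nth])
  from real_polynomial_function.intros(4)[OF this Suc] show ?case by simp
 qed auto
 show ?thesis
  unfolding poly_fun_def[abs_def] using assms
  by (intro real_polynomial_function_sum real_polynomial_function.intros
    real_polynomial_function_prod pow) auto
qed

text \<open>Finite by \<open>growth_const\<close>. It bounds all iterated derivatives at once, so by Gronwall it changes at most
exponentially from point to point.\<close>

definition dsup :: "(real ^ 'm::finite => real) => real ^ 'm => real" where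
 "dsup G x = (SUP js. \<bar>foldr pd js G x\<bar>)"

context
 fixes G :: "real ^ 'm::finite => real" and d :: nat and CG :: real
 assumes G: "real_polynomial_function G" and gr: "growth_const G d CG"
begin

lemma dsup_bdd: "bdd_above (range (%js. \<bar>foldr pd js G x\<bar>))"
 using gr by (auto simp: growth_const_def intro!: bdd_aboveI2)

lemma dsup_ge: "\<bar>foldr pd js G x\<bar> <= dsup G x"
 unfolding dsup_def by (rule cSUP_upper[OF UNIV_I dsup_bdd])

lemma dsup_le: "dsup G x <= CG * (1 + norm x) ^ d"
 unfolding dsup_def using gr by (intro cSUP_least) (auto simp: growth_const_def)

lemma dsup_nonneg: "0 <= dsup G x"
 using dsup_ge[of "[]" x] by (simp add: order_trans[OF abs_ge_zero])

lemma iter_diff: "foldr pd js G differentiable (at x)"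
 by (rule real_poly_differentiable[OF real_poly_iterated[OF G]])

lemma iter_step: "\<bar>\<Sum>k\<in>UNIV. de $ k * pd k (foldr pd js G) z\<bar> <= n1 de * dsup G z"
proof (rule sum_coord_le)
 show "\<bar>pd k (foldr pd js G) z\<bar> <= dsup G z" for k
  using dsup_ge[of "k # js" z] by simp
qed

text \<open>Gronwall's argument along the segment: with \<open>M\<close> the supremum of the weighted values,
 integrating the derivatives gives \<open>M <= dsup G x + M / 2\<close>.\<close>

lemma dsup_exp: "dsup G y <= 2 * exp (2 * n1 (y - x)) * dsup G x"
proof -
 define de where "de = y - x"
 define D where "D = n1 de"
 have D: "0 <= D" unfolding D_def by (rule n1_nonneg)
 define w where "w = (%t. exp (- (2 * D * t)) * dsup G (x + t *\<^sub>R de))"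
 define B where "B = CG * (1 + norm x + norm de) ^ d"
 have CG: "0 < CG" using gr by (simp add: growth_const_def)
 have wB: "w t <= B" if t: "t \<in> {0..1}" for t
 proof -
  have "norm (x + t *\<^sub>R de) <= norm x + \<bar>t\<bar> * norm de" using norm_triangle_ineq[of x "t *\<^sub>R de"] by simp
  also have "... <= norm x + norm de" using t by (simp add: mult_left_le_one_le)
  finally have "CG * (1 + norm (x + t *\<^sub>R de)) ^ d <= B"
   unfolding B_def using CG by (intro mult_left_mono power_mono) auto
  then have "dsup G (x + t *\<^sub>R de) <= B" using dsup_le[of "x + t *\<^sub>R de"] by linarith
  moreover have "exp (- (2 * D * t)) <= 1" using D t by simp
  ultimately show ?thesis
   unfolding w_def using mult_left_le_one_le[OF dsup_nonneg[of "x + t *\<^sub>R de"], of "exp (- (2 * D * t))"] by simp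
 qed
 define M where "M = (SUP t\<in>{0..1}. w t)"
 have bdd: "bdd_above (w ` {0..1})" using wB by (intro bdd_aboveI2[where M = B])
 have wM: "w t <= M" if "t \<in> {0..1}" for t unfolding M_def by (rule cSUP_upper[OF that bdd])
 have M0: "0 <= M" using wM[of 0] dsup_nonneg[of x] by (simp add: w_def)
 have dM: "dsup G (x + t *\<^sub>R de) <= M * exp (2 * D * t)" if "t \<in> {0..1}" for t
  using wM[OF that] by (simp add: w_def exp_minus field_simps)
 have step: "dsup G (x + t *\<^sub>R de) <= dsup G x + M / 2 * exp (2 * D * t)" if t: "t \<in> {0..1}" for t
  unfolding dsup_def[of G "x + t *\<^sub>R de"]
 proof (rule cSUP_least)
  fix js :: "'m list"
  let ?f = "foldr pd js G"
  define ph where "ph = (%t. ?f (x + t *\<^sub>R de))"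
  define ph' where "ph' = (%t. \<Sum>k\<in>UNIV. de $ k * pd k ?f (x + t *\<^sub>R de))"
  have dph: "(ph has_real_derivative ph' s) (at s)" for s
   unfolding ph_def ph'_def by (rule line_derivative[OF iter_diff])
  have bph': "\<bar>ph' s\<bar> <= M * exp (2 * D * s) * D" if "s \<in> {0..1}" for s
  proof -
   have "\<bar>ph' s\<bar> <= D * dsup G (x + s *\<^sub>R de)" unfolding ph'_def D_def by (rule iter_step)
   also have "... <= D * (M * exp (2 * D * s))" by (rule mult_left_mono[OF dM[OF that] D])
   finally show ?thesis by (simp add: mult_ac)
  qed
  have up: "sm * ph t - M / 2 * exp (2 * D * t) <= sm * ph 0 - M / 2 * exp (2 * D * 0)" if sm: "sm = 1 \<or> sm = -1" for sm :: real
  proof (rule DERIV_nonpos_imp_nonincreasing[of 0 t])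
   fix s assume s: "0 <= s" "s <= t"
   have "((%t. sm * ph t - M / 2 * exp (2 * D * t)) has_real_derivative sm * ph' s - M / 2 * (exp (2 * D * s) * (2 * D))) (at s)"
    by (auto intro!: derivative_eq_intros dph)
   moreover have "sm * ph' s - M / 2 * (exp (2 * D * s) * (2 * D)) <= 0"
    using bph'[of s] s t sm by (auto simp: abs_le_iff mult_ac)
   ultimately show "\<exists>y. ((%t. sm * ph t - M / 2 * exp (2 * D * t)) has_real_derivative y) (at s) & y <= 0" by blast
  qed (use t in auto)
  have "\<bar>ph t\<bar> <= \<bar>ph 0\<bar> + M / 2 * exp (2 * D * t)"
   using up[of 1] up[of "-1"] M0 by (auto simp: abs_le_iff)
  also have "\<bar>ph 0\<bar> <= dsup G x" unfolding ph_def using dsup_ge[of js x] by simp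
  finally show "\<bar>?f (x + t *\<^sub>R de)\<bar> <= dsup G x + M / 2 * exp (2 * D * t)" by (simp add: ph_def)
 qed simp
 have "M <= dsup G x + M / 2"
  unfolding M_def[of]
 proof (rule cSUP_least)
  fix t :: real assume t: "t \<in> {0..1}"
  have "w t <= exp (- (2 * D * t)) * (dsup G x + M / 2 * exp (2 * D * t))"
   unfolding w_def by (rule mult_left_mono[OF step[OF t]]) simp
  also have "... = exp (- (2 * D * t)) * dsup G x + M / 2"
   by (simp add: distrib_left exp_minus)
  also have "exp (- (2 * D * t)) * dsup G x <= dsup G x"
   using D t dsup_nonneg[of x] by (intro mult_left_le_one_le) auto
  finally show "w t <= dsup G x + (SUP t\<in>{0..1}. w t) / 2" by (simp add: M_def)
 qed simp
 then have "M <= 2 * dsup G x" by simp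
 then have Me: "M * exp (2 * D) <= 2 * dsup G x * exp (2 * D)" by (rule mult_right_mono) simp
 have "dsup G y <= M * exp (2 * D)" using dM[of 1] by (simp add: de_def)
 from order_trans[OF this Me] show ?thesis by (simp only: D_def de_def mult_ac)
qed

lemma iter_lipschitz:
 "\<bar>foldr pd js G y - foldr pd js G x\<bar> <= 2 * n1 (y - x) * exp (2 * n1 (y - x)) * dsup G x"
proof -
 let ?de = "y - x" and ?f = "foldr pd js G"
 obtain t where t: "0 < t" "t < 1" "?f y - ?f x = (\<Sum>k\<in>UNIV. ?de $ k * pd k ?f (x + t *\<^sub>R ?de))"
  using line_mvt[OF iter_diff] .
 have "\<bar>?f y - ?f x\<bar> <= n1 ?de * dsup G (x + t *\<^sub>R ?de)"
  unfolding t(3) by (rule iter_step)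
 also have "... <= n1 ?de * (2 * exp (2 * n1 (t *\<^sub>R ?de)) * dsup G x)"
  using dsup_exp[of "x + t *\<^sub>R ?de" x] by (intro mult_left_mono n1_nonneg) simp
 also have "... <= n1 ?de * (2 * exp (2 * n1 ?de) * dsup G x)"
  using t n1_nonneg[of ?de] dsup_nonneg
  by (intro mult_left_mono mult_right_mono) (auto simp: n1_scale mult_left_le_one_le)
 finally show ?thesis by (simp add: mult_ac)
qed

lemma dsup_lipschitz:
 "dsup G y <= dsup G x + 2 * n1 (y - x) * exp (2 * n1 (y - x)) * dsup G x"
 unfolding dsup_def[of G y]
proof (rule cSUP_least)
 fix js :: "'m list"
 show "\<bar>foldr pd js G y\<bar> <= dsup G x + 2 * n1 (y - x) * exp (2 * n1 (y - x)) * dsup G x"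
  using iter_lipschitz[of js y x] dsup_ge[of js x] by linarith
qed simp

lemma dsup_continuous: "continuous_on UNIV (dsup G)"
proof (rule continuous_at_imp_continuous_on, rule ballI)
 fix x :: "real ^ 'm"
 define \<eta> where "\<eta> = (%y. 2 * n1 (y - x) * exp (2 * n1 (y - x)))"
 have "isCont (%y. n1 (y - x)) x"
  using continuous_on_compose2[OF continuous_n1, of UNIV "%y. y - x"]
  by (simp add: continuous_on_eq_continuous_at continuous_on_diff)
 then have "isCont \<eta> x" unfolding \<eta>_def by (intro continuous_intros) auto
 then have \<eta>0: "(\<eta> \<longlongrightarrow> 0) (at x)" by (simp add: isCont_def \<eta>_def n1_def)
 then have lim: "((%y. \<eta> y * (dsup G x + \<eta> y * dsup G x)) \<longlongrightarrow> 0 * (dsup G x + 0 * dsup G x)) (at x)"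
  by (intro tendsto_intros)
 have "\<bar>dsup G y - dsup G x\<bar> <= \<eta> y * (dsup G x + \<eta> y * dsup G x)" for y
 proof -
  have e: "n1 (x - y) = n1 (y - x)" using n1_minus[of "y - x"] by simp
  have \<eta>: "0 <= \<eta> y" unfolding \<eta>_def using n1_nonneg[of "y - x"] by simp
  have 1: "dsup G y <= dsup G x + \<eta> y * dsup G x" using dsup_lipschitz[of y x] by (simp add: \<eta>_def)
  have 2: "dsup G x <= dsup G y + \<eta> y * dsup G y" using dsup_lipschitz[of x y] by (simp add: \<eta>_def e)
  have "\<eta> y * dsup G y <= \<eta> y * (dsup G x + \<eta> y * dsup G x)" using 1 \<eta> by (rule mult_left_mono)
  moreover have "\<eta> y * dsup G x <= \<eta> y * (dsup G x + \<eta> y * dsup G x)"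
   using \<eta> dsup_nonneg[of x] by (intro mult_left_mono) auto
  ultimately show ?thesis using 1 2 by linarith
 qed
 then have "\<forall>\<^sub>F y in at x. norm (dsup G y - dsup G x) <= \<eta> y * (dsup G x + \<eta> y * dsup G x)"
  unfolding real_norm_def by (intro always_eventually allI)
 then have "((%y. dsup G y - dsup G x) \<longlongrightarrow> 0) (at x)"
  by (rule Lim_null_comparison[OF _ lim[unfolded mult_zero_left]])
 then show "isCont (dsup G) x" unfolding isCont_def by (simp add: LIM_zero_iff)
qed

end

lemma test_functionD:
 assumes F: "F \<in> test_functions"
 shows "F differentiable (at x)" "continuous_on UNIV (pd k F)"
  "\<bar>F x\<bar> <= sup_norm F" "\<bar>pd k F x\<bar> <= sup_norm (grad F)"
  "\<bar>pd k F y - pd k F x\<bar> <= lip_const (grad F) * n1 (y - x)"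
  "0 <= sup_norm F" "0 <= sup_norm (grad F)" "0 <= lip_const (grad F)"
proof -
 show dF: "F differentiable (at x)" for x using F by (simp add: test_functions_def)
 have cg: "continuous_on UNIV (grad F)" using F by (simp add: test_functions_def)
 have "continuous_on UNIV (%x. grad F x $ k)" by (intro continuous_intros cg)
 then show "continuous_on UNIV (pd k F)" by (simp add: grad_def)
 have bF: "bounded (range F)" using F by (simp add: test_functions_def)
 then have bdd: "bdd_above (range (%x. norm (F x)))"
  unfolding bounded_iff by (metis (mono_tags, lifting) bdd_aboveI2 rangeI)
 have F_le: "\<bar>F x\<bar> <= sup_norm F" for x
  unfolding sup_norm_def using cSUP_upper[OF UNIV_I bdd, of x] by simp
 then show "\<bar>F x\<bar> <= sup_norm F" .
 show s0: "0 <= sup_norm F" using F_le[of 0] by linarith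
 obtain L where L: "lipschitz_on L UNIV (grad F)" using F by (auto simp: test_functions_def)
 let ?X = "{L. lipschitz_on L UNIV (grad F)}"
 have bb: "bdd_below ?X" by (rule bdd_belowI[of _ 0]) (auto dest: lipschitz_on_nonneg)
 show l0: "0 <= lip_const (grad F)"
  unfolding lip_const_def using L by (intro cInf_greatest) (auto dest: lipschitz_on_nonneg)
 have lip: "dist (grad F u) (grad F v) <= lip_const (grad F) * dist u v" for u v
 proof (cases "u = v")
  case False
  then have d: "0 < dist u v" by simp
  have "dist (grad F u) (grad F v) / dist u v <= lip_const (grad F)"
   unfolding lip_const_def
  proof (rule cInf_greatest)
   show "?X ~= {}" using L by auto
   fix L' assume "L' \<in> ?X"
   then have "dist (grad F u) (grad F v) <= L' * dist u v" by (auto dest: lipschitz_onD)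
   then show "dist (grad F u) (grad F v) / dist u v <= L'" using d by (simp add: divide_le_eq)
  qed
  then show ?thesis using d by (simp add: divide_le_eq)
 qed simp
 have pd: "\<bar>pd k F y - pd k F x\<bar> <= lip_const (grad F) * n1 (y - x)" for k x y
 proof -
  have "\<bar>pd k F y - pd k F x\<bar> = \<bar>(grad F y - grad F x) $ k\<bar>" by (simp add: grad_def)
  also have "... <= norm (grad F y - grad F x)" by (rule component_le_norm_cart)
  also have "... <= lip_const (grad F) * norm (y - x)" using lip[of y x] by (simp add: dist_norm)
  also have "... <= lip_const (grad F) * n1 (y - x)" by (intro mult_left_mono norm_le_n1 l0)
  finally show ?thesis .
 qed
 then show "\<bar>pd k F y - pd k F x\<bar> <= lip_const (grad F) * n1 (y - x)" .
 \<comment> \<open>a bounded function with Lipschitz gradient has bounded gradient\<close>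
 have pb: "\<bar>pd k F z\<bar> <= 2 * sup_norm F + lip_const (grad F)" for k z
 proof -
  let ?de = "axis k 1 :: real ^ 'a"
  have ax: "(\<Sum>i\<in>UNIV. ?de $ i * w i) = w k" for w :: "'a => real"
   by (simp add: axis_def if_distrib[of "%x. x * _"] cong: if_cong)
  have n1ax: "n1 ?de = 1" by (simp add: n1_def axis_def if_distrib[of abs] cong: if_cong)
  obtain t where t: "0 < t" "t < 1" "F (z + ?de) - F z = (\<Sum>i\<in>UNIV. (z + ?de - z) $ i * pd i F (z + t *\<^sub>R (z + ?de - z)))"
   using line_mvt[OF dF] .
  have "F (z + ?de) - F z = pd k F (z + t *\<^sub>R ?de)" using t(3) by (simp only: add_diff_cancel_left' ax)
  moreover have "\<bar>pd k F (z + t *\<^sub>R ?de) - pd k F z\<bar> <= lip_const (grad F) * 1"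
  proof -
   have "\<bar>pd k F (z + t *\<^sub>R ?de) - pd k F z\<bar> <= lip_const (grad F) * n1 (z + t *\<^sub>R ?de - z)" by (rule pd)
   also have "... <= lip_const (grad F) * 1" using t l0 by (intro mult_left_mono) (simp_all add: n1_scale n1ax)
   finally show ?thesis .
  qed
  ultimately show ?thesis using F_le[of "z + ?de"] F_le[of z] by linarith
 qed
 have "norm (grad F x) <= (\<Sum>k\<in>UNIV. \<bar>grad F x $ k\<bar>)" for x by (rule norm_le_l1_cart)
 also have "(\<Sum>k\<in>UNIV. \<bar>grad F x $ k\<bar>) <= (\<Sum>k\<in>(UNIV::'a set). 2 * sup_norm F + lip_const (grad F))" for x
  by (intro sum_mono) (simp add: grad_def pb)
 finally have bdg: "bdd_above (range (%x. norm (grad F x)))" by (rule bdd_aboveI2)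
 have g_le: "norm (grad F x) <= sup_norm (grad F)" for x
  unfolding sup_norm_def by (rule cSUP_upper[OF UNIV_I bdg])
 then show "0 <= sup_norm (grad F)" using norm_ge_zero order_trans by blast
 have "\<bar>pd k F x\<bar> = \<bar>grad F x $ k\<bar>" by (simp add: grad_def)
 also have "... <= sup_norm (grad F)" by (rule order_trans[OF component_le_norm_cart g_le])
 finally show "\<bar>pd k F x\<bar> <= sup_norm (grad F)" .
qed

text \<open>The polynomial supplies the weight and the bounded factor supplies the constant. A Lipschitz gradient
gives the increment bound for the derivatives of the product.\<close>

lemma tame_product:
 fixes F :: "real ^ 'm::finite => real"
 assumes F: "F \<in> test_functions" and G: "real_polynomial_function G" and gr: "growth_const G d CG"
 shows "tame (4 * (1 + sup_norm F + sup_norm (grad F) + lip_const (grad F))) (dsup G) (%x. G x * F x)"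
proof -
 note FD = test_functionD[OF F]
 define b1 b2 b3 where "b1 = sup_norm F" and "b2 = sup_norm (grad F)" and "b3 = lip_const (grad F)"
 have b: "0 <= b1" "0 <= b2" "0 <= b3" using FD by (simp_all add: b1_def b2_def b3_def)
 have dG: "G differentiable (at x)" for x by (rule real_poly_differentiable[OF G])
 note ge = dsup_ge[OF G gr] and nn = dsup_nonneg[OF G gr]
 have G1: "\<bar>G x\<bar> <= dsup G x" "\<bar>pd k G x\<bar> <= dsup G x" for x k
  using ge[of "[]" x] ge[of "[k]" x] by simp_all
 have pdp: "pd k (%x. G x * F x) x = pd k G x * F x + G x * pd k F x" for k x
  by (rule partial_deriv_mult[OF dG FD(1)])
 have cG: "continuous_on UNIV G" "continuous_on UNIV (pd k G)" for k
  using dG real_poly_differentiable[OF real_poly_partial_deriv[OF G]]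
  by (meson continuous_at_imp_continuous_on differentiable_imp_continuous_within)+
 have cF: "continuous_on UNIV F"
  using FD(1) by (meson continuous_at_imp_continuous_on differentiable_imp_continuous_within)
 show ?thesis
  unfolding tame_def b1_def[symmetric] b2_def[symmetric] b3_def[symmetric]
 proof (intro conjI allI)
  show "0 <= 4 * (1 + b1 + b2 + b3)" using b by simp
  show "0 <= dsup G x" for x by (rule nn)
  show "continuous_on UNIV (dsup G)" by (rule dsup_continuous[OF G gr])
  show "dsup G y <= 2 * exp (2 * n1 (y - x)) * dsup G x" for x y by (rule dsup_exp[OF G gr])
  show "(%x. G x * F x) differentiable (at x)" for x by (intro differentiable_mult dG FD(1))
  show "continuous_on UNIV (pd k (%x. G x * F x))" for k
  proof -
   have "continuous_on UNIV (%x. pd k G x * F x + G x * pd k F x)"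
    by (intro continuous_intros cG cF FD(2))
   then show ?thesis by (simp add: pdp[abs_def])
  qed
  show "\<bar>G x * F x\<bar> <= 4 * (1 + b1 + b2 + b3) * dsup G x" for x
  proof -
   have "\<bar>G x * F x\<bar> <= dsup G x * b1"
    unfolding abs_mult b1_def by (intro mult_mono G1 FD(3) nn) auto
   also have "... <= dsup G x * (4 * (1 + b1 + b2 + b3))" using b by (intro mult_left_mono nn) auto
   finally show ?thesis by (simp add: mult_ac)
  qed
  show "\<bar>pd k (%x. G x * F x) x\<bar> <= 4 * (1 + b1 + b2 + b3) * dsup G x" for x k
  proof -
   have "\<bar>pd k (%x. G x * F x) x\<bar> <= \<bar>pd k G x * F x\<bar> + \<bar>G x * pd k F x\<bar>"
    unfolding pdp by (rule abs_triangle_ineq)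
   also have "... <= dsup G x * b1 + dsup G x * b2"
    unfolding abs_mult b1_def b2_def by (intro add_mono mult_mono G1 FD(3,4) nn) auto
   also have "... = dsup G x * (b1 + b2)" by (simp add: distrib_left)
   also have "... <= dsup G x * (4 * (1 + b1 + b2 + b3))" using b by (intro mult_left_mono nn) auto
   finally show ?thesis by (simp add: mult_ac)
  qed
  show "\<bar>pd k (%x. G x * F x) y - pd k (%x. G x * F x) x\<bar> <=
    4 * (1 + b1 + b2 + b3) * n1 (y - x) * exp (2 * n1 (y - x)) * dsup G x" for x y k
  proof -
   define D where "D = n1 (y - x)"
   define e where "e = D * exp (2 * D) * dsup G x"
   have D: "0 <= D" by (simp add: D_def n1_nonneg)
   have e: "0 <= e" "D * dsup G x <= e"
   proof -
    show "0 <= e" unfolding e_def by (intro mult_nonneg_nonneg D nn) auto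
    have "D * 1 * dsup G x <= D * exp (2 * D) * dsup G x"
     using D by (intro mult_right_mono mult_left_mono nn) auto
    then show "D * dsup G x <= e" by (simp add: e_def)
   qed
   have lG: "\<bar>pd k G y - pd k G x\<bar> <= 2 * e" "\<bar>G y - G x\<bar> <= 2 * e"
    using iter_lipschitz[OF G gr, of "[k]" y x] iter_lipschitz[OF G gr, of "[]" y x]
    by (simp_all add: e_def D_def mult.assoc)
   have lF: "\<bar>F y - F x\<bar> <= D * b2"
   proof -
    obtain t where t: "0 < t" "t < 1" "F y - F x = (\<Sum>k\<in>UNIV. (y - x) $ k * pd k F (x + t *\<^sub>R (y - x)))"
     using line_mvt[OF FD(1)] .
    show ?thesis unfolding t(3) D_def b2_def by (rule sum_coord_le[OF FD(4)])
   qed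
   have lF': "\<bar>pd k F y - pd k F x\<bar> <= b3 * D" unfolding b3_def D_def by (rule FD(5))
   have "pd k (%x. G x * F x) y - pd k (%x. G x * F x) x =
     (pd k G y - pd k G x) * F y + pd k G x * (F y - F x)
     + (G y - G x) * pd k F y + G x * (pd k F y - pd k F x)"
    unfolding pdp by (simp add: algebra_simps)
   also have "\<bar>...\<bar> <= \<bar>(pd k G y - pd k G x) * F y\<bar> + \<bar>pd k G x * (F y - F x)\<bar>
     + \<bar>(G y - G x) * pd k F y\<bar> + \<bar>G x * (pd k F y - pd k F x)\<bar>"
    by linarith
   also have "... <= 2 * e * b1 + dsup G x * (D * b2) + 2 * e * b2 + dsup G x * (b3 * D)"
    unfolding abs_mult b1_def b2_def
    by (intro add_mono mult_mono lG G1 lF[unfolded b2_def] lF' FD(3,4) nn) (use e in auto)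
   also have "... = 2 * e * b1 + (D * dsup G x) * b2 + 2 * e * b2 + (D * dsup G x) * b3" by (simp add: mult_ac)
   also have "... <= 2 * e * b1 + e * b2 + 2 * e * b2 + e * b3"
    using mult_right_mono[OF e(2) b(2)] mult_right_mono[OF e(2) b(3)] by linarith
   also have "... <= 4 * e * (1 + b1 + b2 + b3)" using b e(1) by (simp add: algebra_simps)
   finally show ?thesis by (simp only: e_def D_def mult_ac)
  qed
 qed
qed

section \<open>Estimates for functions of the fluctuations\<close>

definition cD :: "real => real => real => nat => real" where
 "cD be h C0 m = low_const be h m 0 * (8 * (2 + C0))"

definition KK :: "real => real => nat => real" where
 "KK be h n = sqrt (low_const be h n 4 * (4 * exp (4 * real n)))"

lemma expgr_compose:
 fixes X :: "('j => real) => real ^ 'm::finite"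
 assumes X: "!!k. (%g. X g $ k) \<in> borel_measurable (gpr S)"
  and bX: "!!g. n1 (X g) <= u + v * (\<Sum>e\<in>S. \<bar>g e\<bar>)"
  and ph: "continuous_on UNIV ph" and b: "!!x. \<bar>ph x\<bar> <= M * exp (2 * n1 x)"
 shows "expgr S (%g. ph (X g))"
proof (rule expgrI[of _ _ "M * exp (2 * u)" "2 * v"])
 have "X \<in> borel_measurable (gpr S)"
  unfolding borel_measurable_euclidean_space[of X]
 proof
  fix i :: "real ^ 'm" assume "i \<in> Basis"
  then obtain k where "i = axis k 1" by (auto simp: Basis_vec_def)
  then show "(%x. X x \<bullet> i) \<in> borel_measurable (gpr S)" using X[of k] by (simp add: inner_axis)
 qed
 then show "(%g. ph (X g)) \<in> borel_measurable (gpr S)"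
  by (rule measurable_compose[OF _ borel_measurable_continuous_onI[OF ph]])
 fix g
 have "0 <= M * exp (2 * n1 (0 :: real ^ 'm))" by (rule order_trans[OF abs_ge_zero b])
 then have M: "0 <= M" by (simp add: n1_def)
 have "\<bar>ph (X g)\<bar> <= M * exp (2 * n1 (X g))" by (rule b)
 also have "... <= M * exp (2 * (u + v * (\<Sum>e\<in>S. \<bar>g e\<bar>)))"
  using M bX[of g] by (intro mult_left_mono) auto
 finally show "\<bar>ph (X g)\<bar> <= M * exp (2 * u) * exp (2 * v * (\<Sum>e\<in>S. \<bar>g e\<bar>))"
  by (simp add: distrib_left exp_add mult.assoc)
qed

lemma sum_sum_type: "(\<Sum>k\<in>(UNIV :: ('n::finite + 'n) set). w k) = (\<Sum>i\<in>UNIV. w (Inl i)) + (\<Sum>i\<in>UNIV. w (Inr i) :: real)"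
 by (simp add: UNIV_Plus_UNIV[symmetric] sum.Plus comp_def del: UNIV_Plus_UNIV)

text \<open>All estimates at one site. The cavity version \<open>Xm\<close> of the fluctuation vector \<open>Xf\<close> omits the spin and the
couplings at \<open>p\<close>, and differs from it by \<open>O(1/sqrt N)\<close>.\<close>

locale est = sk_site N p be h q for N p :: nat and be h q :: real +
 fixes io :: "'n::finite => nat" and n :: nat and q1 C0 :: real
 assumes io: "bij_betw io UNIV {..<n}" and C0: "0 <= C0"
  and ht: "nuN 2 (%g s. (overlap N (s 0) (s 1) - q) ^ 6) <= C0 / real N ^ 3"
begin

lemma card_n: "CARD('n) = n"
 using bij_betw_same_card[OF io] by simp

definition Xf :: "(nat \<times> nat => real) => (nat => nat => real) => real ^ ('n + 'n)" where
 "Xf g s = fluct N be q1 q g (%i. s (io i))"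

definition Xm :: "(nat \<times> nat => real) => (nat => nat => real) => real ^ ('n + 'n)" where
 "Xm g s = (\<chi> k. case k of Inl i => 1 / rtN N * cE N p g (s (io i)) - be * rtN N / 2 * (1 - q\<^sup>2)
   | Inr i => rtN N * (1 / real N * cM N p (s (io i)) - q1))"

definition Y :: "nat => (nat \<times> nat => real) => (nat => nat => real) => real" where
 "Y m g s = (\<Sum>l<m. \<bar>cav.ell g (s l)\<bar>)"

lemma N0: "0 < real N" "1 <= real N" "1 <= rtN N" "0 < rtN N"
 using N by auto

lemma io_less: "io i < n"
 using io by (auto simp: bij_betw_def)

lemma diff_Inl: "(Xf g s - Xm g s) $ Inl i = s (io i) p * cav.ell g (s (io i)) / rtN N"
 by (simp add: Xf_def Xm_def fluct_def energy_fluct_def energy_split distrib_left)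

lemma diff_Inr: "(Xf g s - Xm g s) $ Inr i = s (io i) p / rtN N"
proof -
 have "(\<Sum>k = 1..N. sm k) = sm p + cM N p sm" for sm :: "nat => real"
  unfolding cM_def using p by (subst sum.remove[of _ p]) auto
 then have "(Xf g s - Xm g s) $ Inr i = rtN N * (s (io i) p / real N)"
  by (simp add: Xf_def Xm_def fluct_def magn_fluct_def magnetization_def add_divide_distrib right_diff_distrib distrib_left)
 also have "... = s (io i) p / rtN N"
  using N0 by (simp add: real_div_sqrt field_simps)
 finally show ?thesis .
qed

lemma Y_nonneg: "0 <= Y m g s"
 unfolding Y_def by (rule sum_nonneg) simp

lemma Y_mono: "m <= m' ==> Y m g s <= Y m' g s"
 unfolding Y_def by (rule sum_mono2) auto

lemma n1_diff:
 assumes s: "s \<in> PI m" and m: "n <= m"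
 shows "n1 (Xf g s - Xm g s) <= (n + Y m g s) / rtN N"
proof -
 have abs1: "\<bar>s (io i) p\<bar> = 1" for i
  by (rule cav.abs_eps, rule PiE_mem[OF s]) (use io_less[of i] m in simp)
 have "n1 (Xf g s - Xm g s) = (\<Sum>i\<in>UNIV. \<bar>cav.ell g (s (io i))\<bar> / rtN N) + (\<Sum>i\<in>(UNIV::'n set). 1 / rtN N)"
  unfolding n1_def sum_sum_type diff_Inl diff_Inr by (simp only: abs_divide abs_mult abs1 abs_of_pos[OF N0(4)] mult_1)
 also have "(\<Sum>i\<in>UNIV. \<bar>cav.ell g (s (io i))\<bar> / rtN N) = Y n g s / rtN N"
  unfolding Y_def sum_divide_distrib by (rule sum.reindex_bij_betw[OF io])
 also have "Y n g s / rtN N + (\<Sum>i\<in>(UNIV::'n set). 1 / rtN N) = (n + Y n g s) / rtN N"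
  by (simp add: add_divide_distrib card_n)
 also have "... <= (n + Y m g s) / rtN N"
  using Y_mono[OF m] N0 by (intro divide_right_mono) auto
 finally show ?thesis .
qed

lemma n1_diff':
 assumes s: "s \<in> PI m" and m: "n <= m"
 shows "n1 (Xf g s - Xm g s) <= n + Y m g s"
proof -
 have "(n + Y m g s) / rtN N <= (n + Y m g s) / 1"
  using Y_nonneg N0 by (intro divide_left_mono) auto
 then show ?thesis using n1_diff[OF s m, of g] by simp
qed

lemma exp_Y: "exp (r * (n + Y m g s)) = exp (r * n) * exp (r * Y m g s)" for r :: real
 by (simp add: distrib_left exp_add)

lemma diff_first:
 assumes s: "s \<in> PI m" and m: "n <= m"
 shows "n1 (Xf g s - Xm g s) * exp (2 * n1 (Xf g s - Xm g s)) <= exp (3 * real n) * exp (3 * Y m g s) / rtN N"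
proof -
 define y where "y = n + Y m g s"
 have y: "0 <= y" unfolding y_def using Y_nonneg by simp
 have "n1 (Xf g s - Xm g s) * exp (2 * n1 (Xf g s - Xm g s)) <= (y / rtN N) * exp (2 * y)"
  using y N0 n1_diff[OF s m, of g] n1_diff'[OF s m, of g] by (intro mult_mono) (simp_all add: y_def[symmetric] n1_nonneg)
 also have "... <= (exp y / rtN N) * exp (2 * y)"
  using less_imp_le[OF less_le_trans[OF _ exp_ge_add_one_self[of y], of y]] N0
  by (intro mult_right_mono divide_right_mono) auto
 also have "... = exp (3 * y) / rtN N" by (simp flip: exp_add)
 finally show ?thesis unfolding y_def exp_Y .
qed

lemma diff_second:
 assumes s: "s \<in> PI m" and m: "n <= m"
 shows "(n1 (Xf g s - Xm g s))^2 * exp (2 * n1 (Xf g s - Xm g s)) <= 2 * exp (3 * real n) * exp (3 * Y m g s) / real N"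
proof -
 define y where "y = n + Y m g s"
 have y: "0 <= y" unfolding y_def using Y_nonneg by simp
 have "(n1 (Xf g s - Xm g s))^2 * exp (2 * n1 (Xf g s - Xm g s)) <= (y / rtN N)^2 * exp (2 * y)"
  using y N0 n1_diff[OF s m, of g] n1_diff'[OF s m, of g] by (intro mult_mono power_mono) (simp_all add: y_def[symmetric] n1_nonneg)
 also have "... = y^2 / real N * exp (2 * y)" using N0 by (simp add: power_divide)
 also have "... <= (2 * exp y) / real N * exp (2 * y)"
  using exp_lower_Taylor_quadratic[OF y] y N0 by (intro mult_right_mono divide_right_mono) auto
 also have "... = 2 * exp (3 * y) / real N" by (simp flip: exp_add)
 finally show ?thesis by (simp only: y_def exp_Y mult.assoc)
qed

subsection \<open>Regularity in the couplings\<close>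

lemma cE_bound: "sm \<in> configs N ==> \<bar>cE N p g sm\<bar> <= (\<Sum>e\<in>site_pairs N. \<bar>g e\<bar>)"
proof -
 assume sm: "sm \<in> configs N"
 have "\<bar>cE N p g sm\<bar> <= (\<Sum>(i, j)\<in>site_pairs N - col N p. \<bar>g (i, j)\<bar>)"
  unfolding cE_def case_prod_beta
 proof (rule order_trans[OF sum_abs sum_mono])
  fix e assume "e \<in> site_pairs N - col N p"
  then have "\<bar>sm (fst e)\<bar> = 1" "\<bar>sm (snd e)\<bar> = 1"
   using configs_abs[OF sm] by (auto simp: site_pairs_def)
  moreover have "1 / rtN N <= 1" using N0 by simp
  ultimately show "\<bar>1 / rtN N * g (fst e, snd e) * sm (fst e) * sm (snd e)\<bar> <= \<bar>g (fst e, snd e)\<bar>"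
   using mult_right_mono[of "1 / rtN N" 1 "\<bar>g e\<bar>"] by (simp add: abs_mult)
 qed
 also have "... <= (\<Sum>e\<in>site_pairs N. \<bar>g e\<bar>)"
  unfolding case_prod_beta prod.collapse by (intro sum_mono2 finite_site_pairs) auto
 finally show ?thesis .
qed

lemma energy_bound: "sm \<in> configs N ==> \<bar>energy N g sm\<bar> <= 2 * (\<Sum>e\<in>site_pairs N. \<bar>g e\<bar>)"
proof -
 assume sm: "sm \<in> configs N"
 have "\<bar>cav.ell g sm\<bar> <= (\<Sum>e\<in>site_pairs N. \<bar>g e\<bar>)"
  by (rule order_trans[OF cav.abs_ell[OF sm] sum_mono2[OF finite_site_pairs col_sub]]) auto
 moreover have "\<bar>energy N g sm\<bar> <= \<bar>cE N p g sm\<bar> + \<bar>cav.ell g sm\<bar>"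
  unfolding energy_split using cav.abs_eps[OF sm] abs_triangle_ineq[of "cE N p g sm" "sm p * cav.ell g sm"]
  by (simp add: abs_mult)
 ultimately show ?thesis using cE_bound[OF sm, of g] by linarith
qed

lemma grows_compose:
 assumes ph: "continuous_on UNIV ph" and b: "!!x. \<bar>ph x\<bar> <= M * exp (2 * n1 x)" and m: "n <= m"
 shows "grows N m (%g s. ph (Xm g s))" "grows N m (%g s. ph (Xf g s))"
proof -
 have sN: "\<bar>x / rtN N\<bar> <= \<bar>x\<bar>" for x
  using divide_left_mono[OF N0(3), of "\<bar>x\<bar>"] N0 by (simp add: abs_divide)
 show "grows N m (%g s. ph (Xm g s))"
 proof (rule growsI)
  fix s assume s: "s \<in> PI m"
  have sA: "s (io i) \<in> configs N" for i by (rule PiE_mem[OF s]) (use io_less[of i] m in simp)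
  let ?c = "\<Sum>i\<in>(UNIV::'n set). \<bar>be * rtN N / 2 * (1 - q\<^sup>2)\<bar> + \<bar>rtN N * (1 / real N * cM N p (s (io i)) - q1)\<bar>"
  show "expgr (site_pairs N) (%g. ph (Xm g s))"
  proof (rule expgr_compose[OF _ _ ph b])
   show "(%g. Xm g s $ k) \<in> borel_measurable MU" for k
    unfolding Xm_def by (cases k) simp_all
   show "n1 (Xm g s) <= ?c + real n * (\<Sum>e\<in>site_pairs N. \<bar>g e\<bar>)" for g
   proof -
    have "n1 (Xm g s) <= (\<Sum>i\<in>(UNIV::'n set). ((\<Sum>e\<in>site_pairs N. \<bar>g e\<bar>) + \<bar>be * rtN N / 2 * (1 - q\<^sup>2)\<bar>) + \<bar>rtN N * (1 / real N * cM N p (s (io i)) - q1)\<bar>)"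
     unfolding n1_def sum_sum_type sum.distrib[symmetric]
    proof (rule sum_mono, rule add_mono)
     fix i
     have "\<bar>1 / rtN N * cE N p g (s (io i))\<bar> <= (\<Sum>e\<in>site_pairs N. \<bar>g e\<bar>)"
      using order_trans[OF sN cE_bound[OF sA]] by simp
     then show "\<bar>Xm g s $ Inl i\<bar> <= (\<Sum>e\<in>site_pairs N. \<bar>g e\<bar>) + \<bar>be * rtN N / 2 * (1 - q\<^sup>2)\<bar>"
      unfolding Xm_def vec_lambda_beta sum.case by (rule order_trans[OF abs_triangle_ineq4 add_right_mono])
    qed (simp add: Xm_def)
    then show ?thesis by (simp add: sum.distrib card_n algebra_simps)
   qed
  qed
 qed
 show "grows N m (%g s. ph (Xf g s))"
 proof (rule growsI)
  fix s assume s: "s \<in> PI m"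
  have sA: "s (io i) \<in> configs N" for i by (rule PiE_mem[OF s]) (use io_less[of i] m in simp)
  let ?c = "\<Sum>i\<in>(UNIV::'n set). \<bar>be * rtN N / 2 * (1 - q\<^sup>2)\<bar> + \<bar>magn_fluct N q1 (s (io i))\<bar>"
  show "expgr (site_pairs N) (%g. ph (Xf g s))"
  proof (rule expgr_compose[OF _ _ ph b])
   show "(%g. Xf g s $ k) \<in> borel_measurable MU" for k
    unfolding Xf_def fluct_def energy_fluct_def by (cases k) simp_all
   show "n1 (Xf g s) <= ?c + (2 * real n) * (\<Sum>e\<in>site_pairs N. \<bar>g e\<bar>)" for g
   proof -
    have "n1 (Xf g s) <= (\<Sum>i\<in>(UNIV::'n set). (2 * (\<Sum>e\<in>site_pairs N. \<bar>g e\<bar>) + \<bar>be * rtN N / 2 * (1 - q\<^sup>2)\<bar>) + \<bar>magn_fluct N q1 (s (io i))\<bar>)"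
     unfolding n1_def sum_sum_type sum.distrib[symmetric]
    proof (rule sum_mono, rule add_mono)
     fix i
     have "\<bar>1 / rtN N * energy N g (s (io i))\<bar> <= 2 * (\<Sum>e\<in>site_pairs N. \<bar>g e\<bar>)"
      using order_trans[OF sN energy_bound[OF sA]] by simp
     then show "\<bar>Xf g s $ Inl i\<bar> <= 2 * (\<Sum>e\<in>site_pairs N. \<bar>g e\<bar>) + \<bar>be * rtN N / 2 * (1 - q\<^sup>2)\<bar>"
      unfolding Xf_def fluct_def energy_fluct_def vec_lambda_beta sum.case by (rule order_trans[OF abs_triangle_ineq4 add_right_mono])
    qed (simp add: Xf_def fluct_def)
    then show ?thesis by (simp add: sum.distrib card_n algebra_simps)
   qed
  qed
 qed
qed

lemma dep_Xm: "n <= m ==> dep {..<m} (%s. ph (Xm g s))"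
proof (rule depI)
 fix s s' :: "nat => nat => real" assume "n <= m" and e: "!!i. i \<in> {..<m} ==> s i = s' i"
 have "s (io i) = s' (io i)" for i using e[of "io i"] io_less[of i] \<open>n <= m\<close> by simp
 then have "Xm g s = Xm g s'" by (simp add: Xm_def vec_eq_iff split: sum.split)
 then show "ph (Xm g s) = ph (Xm g s')" by simp
qed

lemma dep_Xf: "n <= m ==> dep {..<m} (%s. ph (Xf g s))"
proof (rule depI)
 fix s s' :: "nat => nat => real" assume "n <= m" and e: "!!i. i \<in> {..<m} ==> s i = s' i"
 have "s (io i) = s' (io i)" for i using e[of "io i"] io_less[of i] \<open>n <= m\<close> by simp
 then show "ph (Xf g s) = ph (Xf g s')" by (simp add: Xf_def)
qed

lemma cavfun_Xm:
 assumes ph: "continuous_on UNIV ph" and b: "!!x. \<bar>ph x\<bar> <= M * exp (2 * n1 x)" and m: "n <= m"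
 shows "cavfun m (%g s. ph (Xm g s))"
 unfolding cavfun_def
proof (intro conjI allI)
 show "dep {..<m} (%s. ph (Xm g s))" for g by (rule dep_Xm[OF m])
 show "grows N m (%g s. ph (Xm g s))" by (rule grows_compose[OF ph b m])
 show "(%s. ph (Xm (over (col N p) ga g) s)) = (%s. ph (Xm g s))" for g ga
 proof -
  have "Xm (over (col N p) ga g) s = Xm g s" for s
   by (simp add: Xm_def cE_over vec_eq_iff split: sum.split)
  then show ?thesis by simp
 qed
 have "cE N p g (flp p sm) = cE N p g sm" for g sm
  unfolding cE_def by (intro sum.cong refl) (auto simp: col_def flp_def)
 moreover have "cM N p (flp p sm) = cM N p sm" for sm
  unfolding cM_def by (intro sum.cong refl) (auto simp: flp_def)
 ultimately have "Xm g (s(r := flp p (s r))) = Xm g s" for g s r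
  by (simp add: Xm_def vec_eq_iff split: sum.split)
 then show "cav.flip_inv m (%s. ph (Xm g s))" for g by (simp add: cav.flip_inv_def)
qed

lemma tame_exp_bound:
 assumes "tame a K f"
 shows "\<bar>K x\<bar> <= (2 * K 0) * exp (2 * n1 x)" "\<bar>f x\<bar> <= (a * (2 * K 0)) * exp (2 * n1 x)"
  "\<bar>pd k f x\<bar> <= (a * (2 * K 0)) * exp (2 * n1 x)"
proof -
 have K: "K x <= (2 * K 0) * exp (2 * n1 x)" using tameD(4)[OF assms, of x 0] by (simp add: mult_ac)
 then show "\<bar>K x\<bar> <= (2 * K 0) * exp (2 * n1 x)" using tameD(2)[OF assms, of x] by simp
 have aK: "a * K x <= (a * (2 * K 0)) * exp (2 * n1 x)"
  using mult_left_mono[OF K tameD(1)[OF assms]] by (simp only: mult.assoc)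
 show "\<bar>f x\<bar> <= (a * (2 * K 0)) * exp (2 * n1 x)" by (rule order_trans[OF tameD(7)[OF assms] aK])
 show "\<bar>pd k f x\<bar> <= (a * (2 * K 0)) * exp (2 * n1 x)" by (rule order_trans[OF tameD(8)[OF assms] aK])
qed

subsection \<open>Moments of the overlaps\<close>

lemma nuN_fourth:
 assumes l: "l < m" "l' < m" "l ~= l'"
 shows "nuN m (%g s. (overlap N (s l) (s l') - q) ^ 4) <= (1 + C0) / real N ^ 2"
proof -
 define \<pi> where "\<pi> = (%j::nat. if j = 0 then l else l')"
 have "nuN m (%g s. (overlap N (s l) (s l') - q) ^ 4) = nuN m (%g s. (%s. (overlap N (s 0) (s 1) - q) ^ 4) (%j. s (\<pi> j)))"
  by (simp add: \<pi>_def)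
 also have "... = nuN 2 (%g s. (overlap N (s 0) (s 1) - q) ^ 4)"
  by (rule sk.gex_reindex) (use l in \<open>auto simp: \<pi>_def inj_on_def intro!: depI\<close>)
 also have "... <= nuN 2 (%g s. 1 / real N ^ 2 + real N * (overlap N (s 0) (s 1) - q) ^ 6)"
 proof (rule sk.gex_mono)
  fix g s
  define y where "y = (overlap N (s 0) (s 1) - q)^2"
  have y: "0 <= y" by (simp add: y_def)
  have "y^2 <= 1 / real N ^ 2 + real N * y ^ 3"
  proof (cases "y <= 1 / real N")
   case True
   then have "y^2 <= (1 / real N)^2" using y by (intro power_mono) auto
   moreover have "0 <= real N * y ^ 3" using y by simp
   ultimately show ?thesis by (simp add: power_one_over)
  next
   case False
   then have "1 <= real N * y" using N0 by (simp add: field_simps)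
   then have "y^2 * 1 <= y^2 * (real N * y)" by (intro mult_left_mono) auto
   also have "... = real N * y ^ 3" by (simp add: power2_eq_square power3_eq_cube)
   finally show ?thesis by (simp add: add_increasing)
  qed
  then show "(overlap N (s 0) (s 1) - q) ^ 4 <= 1 / real N ^ 2 + real N * (overlap N (s 0) (s 1) - q) ^ 6"
   unfolding y_def by (simp flip: power_mult)
 qed (intro grows_const)+
 also have "... = 1 / real N ^ 2 + real N * nuN 2 (%g s. (overlap N (s 0) (s 1) - q) ^ 6)"
  by (subst sk.gex_add) (intro grows_const | simp only: sk.gex_cmult sk.gex_const)+
 also have "... <= 1 / real N ^ 2 + real N * (C0 / real N ^ 3)"
  using ht by (intro add_left_mono mult_left_mono) auto
 also have "... = (1 + C0) / real N ^ 2"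
  using N0 by (simp add: add_divide_distrib power2_eq_square power3_eq_cube)
 finally show ?thesis .
qed

lemma low_const_nonneg: "0 <= low_const be h m a"
 by (simp add: low_const_def up_const_def gauss_const_def)

lemma up_const_nonneg: "0 <= up_const be h m a"
 by (simp add: up_const_def gauss_const_def)

lemma cD_nonneg: "0 <= cD be h C0 m"
 unfolding cD_def using C0 low_const_nonneg by simp

lemma n0_fourth:
 assumes l: "l < m" "l' < m" "l ~= l'"
 shows "n0 m (%g s. (cav.ov (s l) (s l') - q) ^ 4) <= cD be h C0 m / real N ^ 2"
proof -
 have "n0 m (%g s. (cav.ov (s l) (s l') - q) ^ 4) <=
   low_const be h m 0 * nuN m (%g s. (cav.ov (s l) (s l') - q) ^ 4 * exp (- 0 * (\<Sum>l<m. \<bar>cav.ell g (s l)\<bar>)))"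
  by (rule Elow[OF grows_const]) auto
 also have "... = low_const be h m 0 * nuN m (%g s. (cav.ov (s l) (s l') - q) ^ 4)" by simp
 also have "... <= low_const be h m 0 * (8 * (2 + C0) / real N ^ 2)"
 proof (rule mult_left_mono[OF _ low_const_nonneg])
  have "nuN m (%g s. (cav.ov (s l) (s l') - q) ^ 4) <= nuN m (%g s. 8 * (overlap N (s l) (s l') - q) ^ 4 + 8 / real N ^ 2)"
  proof (rule sk.gex_mono)
   fix g s assume s: "s \<in> PI m"
   define x where "x = overlap N (s l) (s l') - q"
   define y where "y = s l p * s l' p / real N"
   have sA: "s l \<in> configs N" "s l' \<in> configs N" using l by (auto intro!: PiE_mem[OF s])
   have "\<bar>y\<bar> = 1 / real N" unfolding y_def abs_divide abs_mult using cav.abs_eps[OF sA(1)] cav.abs_eps[OF sA(2)] by simp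
   also have "... <= 1 / rtN N" using N0 mult_left_mono[OF N0(3), of "rtN N"] by (intro divide_left_mono) auto
   finally have "\<bar>y\<bar> ^ 4 <= (1 / rtN N) ^ 4" by (intro power_mono) auto
   moreover have "(1 / rtN N) ^ 4 = 1 / real N ^ 2"
    using N0 by (simp add: power_one_over power4_eq_xxxx power2_eq_square)
   ultimately have y4: "y ^ 4 <= 1 / real N ^ 2" by simp
   have sq: "(u - v)^2 <= 2 * (u^2 + v^2)" for u v :: real
    using zero_le_power2[of "u + v"] unfolding power2_diff power2_sum by (simp add: algebra_simps)
   have "(x - y) ^ 4 = ((x - y)^2)^2" by simp
   also have "... <= (2 * (x^2 + y^2))^2" by (intro power_mono sq) auto
   also have "... = 4 * (x^2 + y^2)^2" unfolding power_mult_distrib by simp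
   also have "(x^2 + y^2)^2 <= 2 * ((x^2)^2 + (y^2)^2)" using sq[of "x^2" "- y\<^sup>2"] by simp
   also have "4 * (2 * ((x^2)^2 + (y^2)^2)) = 8 * x ^ 4 + 8 * y ^ 4" by simp
   finally have "(x - y) ^ 4 <= 8 * x ^ 4 + 8 / real N ^ 2" using y4 by simp
   then show "(cav.ov (s l) (s l') - q) ^ 4 <= 8 * (overlap N (s l) (s l') - q) ^ 4 + 8 / real N ^ 2"
    unfolding ov_eq x_def y_def by (simp add: algebra_simps)
  qed (intro grows_const)+
  also have "... = 8 * nuN m (%g s. (overlap N (s l) (s l') - q) ^ 4) + 8 / real N ^ 2"
   by (subst sk.gex_add) (intro grows_const | simp only: sk.gex_cmult sk.gex_const)+
  also have "... <= 8 * ((1 + C0) / real N ^ 2) + 8 / real N ^ 2"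
   by (intro add_right_mono mult_left_mono nuN_fourth l) simp
  also have "... = 8 * (2 + C0) / real N ^ 2" by (simp add: add_divide_distrib)
  finally show "nuN m (%g s. (cav.ov (s l) (s l') - q) ^ 4) <= 8 * (2 + C0) / real N ^ 2" .
 qed
 finally show ?thesis by (simp add: cD_def)
qed

lemma n0_first_overlap:
 assumes f: "grows N m f" and l: "l < m" "l' < m" "l ~= l'"
 shows "n0 m (%g s. \<bar>f g s\<bar> * \<bar>cav.ov (s l) (s l') - q\<bar>) <=
   sqrt (n0 m (%g s. (f g s)^2)) * (sqrt (sqrt (cD be h C0 m)) / rtN N)"
proof -
 have "n0 m (%g s. (cav.ov (s l) (s l') - q)^2) = n0 m (%g s. \<bar>(cav.ov (s l) (s l') - q)^2\<bar> * \<bar>1\<bar>)" by simp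
 also have "... <= sqrt (n0 m (%g s. ((cav.ov (s l) (s l') - q)^2)^2)) * sqrt (n0 m (%g s. 1^2))"
  by (rule base.gex_cauchy_schwarz) (intro grows_const)+
 also have "... = sqrt (n0 m (%g s. (cav.ov (s l) (s l') - q) ^ 4))" by (simp add: base.gex_const)
 also have "... <= sqrt (cD be h C0 m / real N ^ 2)" by (intro real_sqrt_le_mono n0_fourth l)
 also have "... = sqrt (cD be h C0 m) / real N" using N0 by (simp add: real_sqrt_divide)
 finally have 2: "sqrt (n0 m (%g s. (cav.ov (s l) (s l') - q)^2)) <= sqrt (sqrt (cD be h C0 m)) / rtN N"
  using real_sqrt_le_mono by (fastforce simp: real_sqrt_divide)
 have "n0 m (%g s. \<bar>f g s\<bar> * \<bar>cav.ov (s l) (s l') - q\<bar>) <=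
   sqrt (n0 m (%g s. (f g s)^2)) * sqrt (n0 m (%g s. (cav.ov (s l) (s l') - q)^2))"
  by (rule base.gex_cauchy_schwarz[OF f grows_const])
 also have "... <= sqrt (n0 m (%g s. (f g s)^2)) * (sqrt (sqrt (cD be h C0 m)) / rtN N)"
  by (intro mult_left_mono 2 real_sqrt_ge_zero base.gex_nonneg) auto
 finally show ?thesis .
qed

lemma n0_second_overlap:
 assumes f: "grows N m f" and l: "l < m" "l' < m" "l ~= l'" and k: "k < m" "k' < m" "k ~= k'"
 shows "n0 m (%g s. \<bar>f g s\<bar> * (\<bar>cav.ov (s l) (s l') - q\<bar> * \<bar>cav.ov (s k) (s k') - q\<bar>)) <=
   sqrt (n0 m (%g s. (f g s)^2)) * (sqrt (cD be h C0 m) / real N)"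
proof -
 have "n0 m (%g s. ((cav.ov (s l) (s l') - q) * (cav.ov (s k) (s k') - q))^2) =
   n0 m (%g s. \<bar>(cav.ov (s l) (s l') - q)^2\<bar> * \<bar>(cav.ov (s k) (s k') - q)^2\<bar>)" by (simp add: power_mult_distrib)
 also have "... <= sqrt (n0 m (%g s. ((cav.ov (s l) (s l') - q)^2)^2)) * sqrt (n0 m (%g s. ((cav.ov (s k) (s k') - q)^2)^2))"
  by (rule base.gex_cauchy_schwarz) (intro grows_const)+
 also have "... = sqrt (n0 m (%g s. (cav.ov (s l) (s l') - q) ^ 4)) * sqrt (n0 m (%g s. (cav.ov (s k) (s k') - q) ^ 4))" by simp
 also have "... <= sqrt (cD be h C0 m / real N ^ 2) * sqrt (cD be h C0 m / real N ^ 2)"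
  by (intro mult_mono real_sqrt_le_mono n0_fourth l k real_sqrt_ge_zero base.gex_nonneg) (auto simp: cD_nonneg)
 also have "... = cD be h C0 m / real N ^ 2" using cD_nonneg by simp
 finally have "sqrt (n0 m (%g s. ((cav.ov (s l) (s l') - q) * (cav.ov (s k) (s k') - q))^2)) <= sqrt (cD be h C0 m / real N ^ 2)"
  by (rule real_sqrt_le_mono)
 also have "... = sqrt (cD be h C0 m) / real N" using N0 by (simp add: real_sqrt_divide)
 finally have 2: "sqrt (n0 m (%g s. ((cav.ov (s l) (s l') - q) * (cav.ov (s k) (s k') - q))^2)) <= sqrt (cD be h C0 m) / real N" .
 have "n0 m (%g s. \<bar>f g s\<bar> * \<bar>(cav.ov (s l) (s l') - q) * (cav.ov (s k) (s k') - q)\<bar>) <=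
   sqrt (n0 m (%g s. (f g s)^2)) * sqrt (n0 m (%g s. ((cav.ov (s l) (s l') - q) * (cav.ov (s k) (s k') - q))^2))"
  by (rule base.gex_cauchy_schwarz[OF f grows_const])
 also have "... <= sqrt (n0 m (%g s. (f g s)^2)) * (sqrt (cD be h C0 m) / real N)"
  by (intro mult_left_mono 2 real_sqrt_ge_zero base.gex_nonneg) auto
 finally show ?thesis by (simp only: abs_mult)
qed

lemma e1_le:
 assumes f: "grows N m f"
 shows "e1 m f <= (real m)^2 * sqrt (sqrt (cD be h C0 m)) * (sqrt (n0 m (%g s. (f g s)^2)) / rtN N)"
proof -
 define b where "b = sqrt (n0 m (%g s. (f g s)^2)) * (sqrt (sqrt (cD be h C0 m)) / rtN N)"
 have b: "0 <= b" unfolding b_def by (intro mult_nonneg_nonneg real_sqrt_ge_zero base.gex_nonneg divide_nonneg_nonneg) (auto simp: cD_nonneg)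
 have "e1 m f <= (\<Sum>l<m. \<Sum>l'\<in>{..<m} - {l}. b)"
  unfolding e1_def b_def by (intro sum_mono n0_first_overlap f) auto
 also have "... <= (\<Sum>l<m. \<Sum>l'\<in>{..<m}. b)" using b by (intro sum_mono sum_mono2) auto
 also have "... = (real m)^2 * b" by (simp add: power2_eq_square)
 finally show ?thesis by (simp add: b_def mult_ac)
qed

lemma e2_le:
 assumes f: "grows N m f"
 shows "e2 m f <= (real m) ^ 4 * sqrt (cD be h C0 m) * (sqrt (n0 m (%g s. (f g s)^2)) / real N)"
proof -
 define b where "b = sqrt (n0 m (%g s. (f g s)^2)) * (sqrt (cD be h C0 m) / real N)"
 have b: "0 <= b" unfolding b_def by (intro mult_nonneg_nonneg real_sqrt_ge_zero base.gex_nonneg divide_nonneg_nonneg) (auto simp: cD_nonneg)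
 have "e2 m f <= (\<Sum>l<m. \<Sum>l'\<in>{..<m} - {l}. \<Sum>k<m. \<Sum>k'\<in>{..<m} - {k}. b)"
  unfolding e2_def b_def by (intro sum_mono n0_second_overlap f) auto
 also have "... <= (\<Sum>l<m. \<Sum>l'\<in>{..<m}. \<Sum>k<m. \<Sum>k'\<in>{..<m}. b)"
  using b by (intro sum_mono order_trans[OF sum_mono sum_mono2] sum_mono2 sum_nonneg) auto
 also have "... = (real m) ^ 4 * b" by (simp add: power4_eq_xxxx)
 finally show ?thesis by (simp add: b_def mult_ac)
qed

end

context est
begin

lemma Xm_over: "Xm (over (col N p) ga g) s = Xm g s"
 by (simp add: Xm_def cE_over vec_eq_iff split: sum.split)

context
 fixes a :: real and K f :: "real ^ ('n + 'n) => real"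
 assumes f: "tame a K f"
begin

definition "S2 = nuN n (%g s. (K (Xf g s))^2)"
definition "kap = n0 n (%g s. (K (Xm g s))^2)"
definition "Wt = a * sqrt S2 / rtN N"

lemma a0: "0 <= a" using tameD(1)[OF f] .

lemmas K_bound = tame_exp_bound(1)[OF f]
lemmas f_bound = tame_exp_bound(2)[OF f]
lemmas pd_bound = tame_exp_bound(3)[OF f]
lemmas K_cont = tameD(3)[OF f]
lemmas f_cont = tame_continuous[OF f]
lemmas pd_cont = tameD(6)[OF f]

lemma grows_all:
 assumes "n <= m"
 shows "grows N m (%g s. K (Xm g s))" "grows N m (%g s. K (Xf g s))" "grows N m (%g s. f (Xm g s))"
  "grows N m (%g s. f (Xf g s))" "grows N m (%g s. pd k f (Xm g s))"
  "grows N m (%g s. pd k f (Xf g s))"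
 by (rule grows_compose[OF K_cont K_bound assms] grows_compose[OF f_cont f_bound assms] grows_compose[OF pd_cont pd_bound assms])+

lemma cavfun_all:
 assumes "n <= m"
 shows "cavfun m (%g s. f (Xm g s))" "cavfun m (%g s. pd k f (Xm g s))"
 by (rule cavfun_Xm[OF f_cont f_bound assms] cavfun_Xm[OF pd_cont pd_bound assms])+

text \<open>Compares the decoupled second moment of the weight with the true one, through \<open>Elow\<close>.\<close>

lemma kap_le: "sqrt kap <= KK be h n * sqrt S2"
proof -
 have "kap <= low_const be h n 4 * nuN n (%g s. (K (Xm g s))^2 * exp (- 4 * (\<Sum>l<n. \<bar>cav.ell g (s l)\<bar>)))"
  unfolding kap_def
 proof (rule Elow)
  show "grows N n (%g s. (K (Xm g s))^2)" by (intro grows_power grows_all order_refl)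
  show "(%s. (K (Xm (over (col N p) ga g) s))^2) = (%s. (K (Xm g s))^2)" for g ga
   by (simp only: Xm_over)
  show "0 <= (K (Xm g s))^2" for g s by (rule zero_le_power2)
  show "0 <= (4::real)" by simp
 qed
 also have "... <= low_const be h n 4 * (4 * exp (4 * real n) * S2)"
 proof (rule mult_left_mono[OF _ low_const_nonneg])
  have "nuN n (%g s. (K (Xm g s))^2 * exp (- 4 * (\<Sum>l<n. \<bar>cav.ell g (s l)\<bar>))) <= nuN n (%g s. 4 * exp (4 * real n) * (K (Xf g s))^2)"
  proof (rule sk.gex_mono)
   show "grows N n (%g s. (K (Xm g s))^2 * exp (- 4 * (\<Sum>l<n. \<bar>cav.ell g (s l)\<bar>)))"
   proof (rule growsI)
    fix s assume s: "s \<in> PI n"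
    have "expgr (site_pairs N) (%g. exp (- 4 * (\<Sum>l<n. \<bar>cav.ell g (s l)\<bar>)))"
     by (rule ell_abs_sum_growth(2)[OF s]) simp
    from expgr_mult[OF growsD[OF grows_power[OF grows_all(1)[OF order_refl]] s] this]
    show "expgr (site_pairs N) (%g. (K (Xm g s))^2 * exp (- 4 * (\<Sum>l<n. \<bar>cav.ell g (s l)\<bar>)))" .
   qed
   show "grows N n (%g s. 4 * exp (4 * real n) * (K (Xf g s))^2)"
    by (intro grows_intros grows_all order_refl)
   fix g s assume s: "s \<in> PI n"
   have "n1 (Xm g s - Xf g s) <= n + Y n g s"
    using n1_diff'[OF s order_refl, of g] n1_minus[of "Xf g s - Xm g s"] by simp
   then have e: "exp (2 * n1 (Xm g s - Xf g s)) <= exp (2 * (n + Y n g s))" by simp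
   have "K (Xm g s) <= 2 * exp (2 * n1 (Xm g s - Xf g s)) * K (Xf g s)" by (rule tameD(4)[OF f])
   also have "... <= 2 * exp (2 * (n + Y n g s)) * K (Xf g s)"
    using e tameD(2)[OF f] by (intro mult_right_mono) auto
   finally have "(K (Xm g s))^2 <= (2 * exp (2 * (n + Y n g s)) * K (Xf g s))^2"
    using tameD(2)[OF f] by (intro power_mono) auto
   also have "... = 4 * (exp (2 * (n + Y n g s)))^2 * (K (Xf g s))^2" unfolding power_mult_distrib by simp
   also have "(exp (2 * (n + Y n g s)))^2 = exp (4 * real n) * exp (4 * Y n g s)"
    by (simp add: power2_eq_square flip: exp_add)
   finally have "(K (Xm g s))^2 * exp (- 4 * Y n g s) <= 4 * (exp (4 * real n) * exp (4 * Y n g s)) * (K (Xf g s))^2 * exp (- 4 * Y n g s)"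
    by (rule mult_right_mono) simp
   also have "... = 4 * exp (4 * real n) * (K (Xf g s))^2 * (exp (4 * Y n g s) * exp (- 4 * Y n g s))" by (simp only: mult_ac)
   also have "exp (4 * Y n g s) * exp (- 4 * Y n g s) = 1" by (simp flip: exp_add)
   finally show "(K (Xm g s))^2 * exp (- 4 * (\<Sum>l<n. \<bar>cav.ell g (s l)\<bar>)) <= 4 * exp (4 * real n) * (K (Xf g s))^2"
    by (simp add: Y_def)
  qed
  then show "nuN n (%g s. (K (Xm g s))^2 * exp (- 4 * (\<Sum>l<n. \<bar>cav.ell g (s l)\<bar>))) <= 4 * exp (4 * real n) * S2"
   by (simp only: sk.gex_cmult S2_def)
 qed
 finally have "kap <= low_const be h n 4 * (4 * exp (4 * real n)) * S2" by (simp only: mult.assoc)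
 then have "sqrt kap <= sqrt (low_const be h n 4 * (4 * exp (4 * real n)) * S2)" by (rule real_sqrt_le_mono)
 then show ?thesis by (simp only: KK_def real_sqrt_mult)
qed

lemma S2_nonneg: "0 <= S2" unfolding S2_def by (rule sk.gex_nonneg) simp

lemma kap_Wt: "a * sqrt kap / rtN N <= KK be h n * Wt"
 unfolding Wt_def using mult_left_mono[OF kap_le a0] N0(4) by (simp add: divide_le_cancel mult_ac)

lemma n0_K: "n <= m ==> n0 m (%g s. K (Xm g s)) <= sqrt kap"
proof -
 assume m: "n <= m"
 have "n0 m (%g s. K (Xm g s)) = n0 n (%g s. \<bar>K (Xm g s)\<bar> * \<bar>1\<bar>)"
  using base.gex_superset[OF dep_Xm[OF order_refl, where ph = K] m] tameD(2)[OF f] by simp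
 also have "... <= sqrt kap * sqrt (n0 n (%g s. 1^2))"
  unfolding kap_def by (rule base.gex_cauchy_schwarz[OF grows_all(1)[OF order_refl] grows_const])
 finally show ?thesis by (simp add: base.gex_const)
qed

lemma n0_square:
 assumes b: "!!x. \<bar>ph x\<bar> <= a * K x" and ph: "continuous_on UNIV ph" and m: "n <= m"
 shows "sqrt (n0 m (%g s. (ph (Xm g s))^2)) <= a * sqrt kap"
proof -
 have b': "\<bar>ph x\<bar> <= (a * (2 * K 0)) * exp (2 * n1 x)" for x
 proof -
  have "\<bar>K x\<bar> <= 2 * K 0 * exp (2 * n1 x)" by (rule K_bound)
  then have "a * K x <= a * (2 * K 0 * exp (2 * n1 x))" using tameD(2)[OF f] a0 by (intro mult_left_mono) auto
  then show ?thesis using b[of x] by (simp only: mult.assoc)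
 qed
 have "n0 m (%g s. (ph (Xm g s))^2) = n0 n (%g s. (ph (Xm g s))^2)"
  by (rule base.gex_superset[OF dep_Xm[OF order_refl, where ph = "%x. (ph x)^2"] m])
 also have "... <= n0 n (%g s. a^2 * (K (Xm g s))^2)"
 proof (rule base.gex_mono)
  show "grows N n (%g s. (ph (Xm g s))^2)" by (intro grows_power grows_compose[OF ph b'] order_refl)
  show "grows N n (%g s. a^2 * (K (Xm g s))^2)" by (intro grows_intros grows_all order_refl)
  fix g s
  have "\<bar>ph (Xm g s)\<bar>^2 <= (a * K (Xm g s))^2" by (intro power_mono b) simp
  then show "(ph (Xm g s))^2 <= a^2 * (K (Xm g s))^2" by (simp add: power_mult_distrib)
 qed
 also have "... = a^2 * kap" by (simp only: base.gex_cmult kap_def)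
 finally have "sqrt (n0 m (%g s. (ph (Xm g s))^2)) <= sqrt (a^2 * kap)" by (rule real_sqrt_le_mono)
 then show ?thesis using a0 by (simp add: real_sqrt_mult)
qed

lemmas f2 = n0_square[OF tameD(7)[OF f] f_cont]
lemmas pd2 = n0_square[OF tameD(8)[OF f] pd_cont]

lemma e1_Wt:
 assumes b: "sqrt (n0 m (%g s. (w g s)^2)) <= a * sqrt kap" and w: "grows N m w"
 shows "e1 m w <= (real m)^2 * sqrt (sqrt (cD be h C0 m)) * KK be h n * Wt"
proof -
 have "e1 m w <= (real m)^2 * sqrt (sqrt (cD be h C0 m)) * (sqrt (n0 m (%g s. (w g s)^2)) / rtN N)"
  by (rule e1_le[OF w])
 also have "... <= (real m)^2 * sqrt (sqrt (cD be h C0 m)) * (KK be h n * Wt)"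
  using order_trans[OF divide_right_mono[OF b] kap_Wt] N0(4)
  by (intro mult_left_mono mult_nonneg_nonneg real_sqrt_ge_zero cD_nonneg) auto
 finally show ?thesis by (simp only: mult.assoc)
qed

lemma e2_Wt:
 assumes b: "sqrt (n0 m (%g s. (w g s)^2)) <= a * sqrt kap" and w: "grows N m w"
 shows "rtN N * e2 m w <= (real m) ^ 4 * sqrt (cD be h C0 m) * KK be h n * Wt"
proof -
 have N1: "rtN N * (x / real N) = x / rtN N" for x
  using N0 by (simp add: real_div_sqrt field_simps)
 have "rtN N * e2 m w <= rtN N * ((real m) ^ 4 * sqrt (cD be h C0 m) * (sqrt (n0 m (%g s. (w g s)^2)) / real N))"
  by (intro mult_left_mono e2_le[OF w]) simp
 also have "... = (real m) ^ 4 * sqrt (cD be h C0 m) * (sqrt (n0 m (%g s. (w g s)^2)) / rtN N)"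
  by (subst N1[symmetric]) (simp only: mult_ac)
 also have "... <= (real m) ^ 4 * sqrt (cD be h C0 m) * (KK be h n * Wt)"
  using order_trans[OF divide_right_mono[OF b] kap_Wt] N0(4)
  by (intro mult_left_mono mult_nonneg_nonneg real_sqrt_ge_zero cD_nonneg) auto
 finally show ?thesis by (simp only: mult.assoc)
qed

lemma grows_delta: "grows N m (%g s. (Xf g s - Xm g s) $ k)"
proof (cases k)
 case (Inl i)
 have "grows N m (%g s. s (io i) p * cav.ell g (s (io i)) * (1 / rtN N))"
  by (intro grows_mult grows_const growsI ell_growth)
 then show ?thesis by (simp add: Inl diff_Inl del: vector_minus_component)
qed (simp add: diff_Inr grows_const del: vector_minus_component)

lemma nuN_K_exp:
 assumes m: "n <= m" and w: "!!s. 0 <= w s"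
 shows "nuN m (%g s. w s * K (Xm g s) * exp (3 * Y m g s)) <= up_const be h m 3 * n0 m (%g s. w s * K (Xm g s))"
  and "grows N m (%g s. w s * K (Xm g s) * exp (3 * Y m g s))"
proof -
 have gr: "grows N m (%g s. w s * K (Xm g s))" by (intro grows_mult grows_const grows_all m)
 show "nuN m (%g s. w s * K (Xm g s) * exp (3 * Y m g s)) <= up_const be h m 3 * n0 m (%g s. w s * K (Xm g s))"
  unfolding Y_def
 proof (rule Eup[OF gr])
  show "(%s. w s * K (Xm (over (col N p) ga g) s)) = (%s. w s * K (Xm g s))" for g ga
   by (simp only: Xm_over)
 qed (use w tameD(2)[OF f] in auto)
 show "grows N m (%g s. w s * K (Xm g s) * exp (3 * Y m g s))"
 proof (rule growsI)
  fix s assume s: "s \<in> PI m"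
  have "expgr (site_pairs N) (%g. exp (3 * (\<Sum>l<m. \<bar>cav.ell g (s l)\<bar>)))"
   by (rule ell_abs_sum_growth(1)[OF s]) simp
  from expgr_mult[OF growsD[OF gr s] this]
  show "expgr (site_pairs N) (%g. w s * K (Xm g s) * exp (3 * Y m g s))" by (simp only: Y_def)
 qed
qed

lemma nuN_K_exp1:
 assumes m: "n <= m"
 shows "nuN m (%g s. 1 * K (Xm g s) * exp (3 * Y m g s)) <= up_const be h m 3 * sqrt kap"
proof -
 have "nuN m (%g s. 1 * K (Xm g s) * exp (3 * Y m g s)) <= up_const be h m 3 * n0 m (%g s. 1 * K (Xm g s))"
  by (rule nuN_K_exp(1)[OF m]) simp
 also have "... <= up_const be h m 3 * sqrt kap"
  using n0_K[OF m] up_const_nonneg[of m 3] by (simp add: mult_left_mono)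
 finally show ?thesis .
qed

text \<open>Taylor expansion of \<open>f\<close> at the cavity vector: the first order terms survive after multiplication by \<open>sqrt N\<close>.\<close>

lemma B1a:
 assumes T: "T \<subseteq> {..<m}" and m: "n <= m"
 shows "\<bar>rtN N * nuN m (%g s. cav.eT T s * f (Xf g s)) - rtN N * nuN m (%g s. cav.eT T s * f (Xm g s))
  - (\<Sum>i\<in>UNIV. nuN m (%g s. cav.eT T s * (s (io i) p * cav.ell g (s (io i))) * pd (Inl i) f (Xm g s)))
  - (\<Sum>i\<in>UNIV. nuN m (%g s. cav.eT T s * (s (io i) p * pd (Inr i) f (Xm g s))))\<bar>
  <= 2 * exp (3 * real n) * up_const be h m 3 * KK be h n * Wt"
proof -
 let ?d = "%k g s. pd k f (Xm g s)"
 define rem where "rem = (%g s. f (Xf g s) - f (Xm g s) - (\<Sum>k\<in>UNIV. (Xf g s - Xm g s) $ k * ?d k g s))"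
 have gl: "grows N m (%g s. cav.eT T s * (s (io i) p * cav.ell g (s (io i))) * ?d k g s)" for i k
  by (intro grows_mult grows_const growsI[OF ell_growth] grows_all m)
 have gm: "grows N m (%g s. cav.eT T s * (s (io i) p * ?d k g s))" for i k
  by (intro grows_mult grows_const grows_all m)
 have gf: "grows N m (%g s. cav.eT T s * f (Xf g s))" "grows N m (%g s. cav.eT T s * f (Xm g s))"
  by (intro grows_mult grows_const grows_all m)+
 have gr: "grows N m (%g s. rtN N * (cav.eT T s * rem g s))"
  unfolding rem_def by (intro grows_mult grows_const grows_diff grows_sum grows_delta grows_all m)
 let ?L = "rtN N * nuN m (%g s. cav.eT T s * f (Xf g s)) - rtN N * nuN m (%g s. cav.eT T s * f (Xm g s))
  - (\<Sum>i\<in>UNIV. nuN m (%g s. cav.eT T s * (s (io i) p * cav.ell g (s (io i))) * ?d (Inl i) g s))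
  - (\<Sum>i\<in>UNIV. nuN m (%g s. cav.eT T s * (s (io i) p * ?d (Inr i) g s)))"
 have "?L = nuN m (%g s. rtN N * (cav.eT T s * f (Xf g s)) - rtN N * (cav.eT T s * f (Xm g s))
   - (\<Sum>i\<in>UNIV. cav.eT T s * (s (io i) p * cav.ell g (s (io i))) * ?d (Inl i) g s)
   - (\<Sum>i\<in>UNIV. cav.eT T s * (s (io i) p * ?d (Inr i) g s)))"
  by (simp only: sk.gex_diff sk.gex_cmult sk.gex_sum gl gm gf grows_diff grows_sum grows_mult[OF grows_const])
 also have "... = nuN m (%g s. rtN N * (cav.eT T s * rem g s))"
 proof (rule sk.gex_cong)
  fix g s
  have N1: "rtN N * (x / rtN N) = x" for x using N0 by simp
  have "rtN N * (cav.eT T s * (\<Sum>k\<in>UNIV. (Xf g s - Xm g s) $ k * ?d k g s)) =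
    (\<Sum>i\<in>UNIV. cav.eT T s * (s (io i) p * cav.ell g (s (io i))) * ?d (Inl i) g s)
   + (\<Sum>i\<in>UNIV. cav.eT T s * (s (io i) p * ?d (Inr i) g s))"
   unfolding sum_sum_type diff_Inl diff_Inr distrib_left sum_distrib_left
   by (intro arg_cong2[where f = "(+)"] sum.cong refl) (use N1 in \<open>simp_all add: field_simps\<close>)
  then show "rtN N * (cav.eT T s * f (Xf g s)) - rtN N * (cav.eT T s * f (Xm g s))
   - (\<Sum>i\<in>UNIV. cav.eT T s * (s (io i) p * cav.ell g (s (io i))) * ?d (Inl i) g s)
   - (\<Sum>i\<in>UNIV. cav.eT T s * (s (io i) p * ?d (Inr i) g s)) = rtN N * (cav.eT T s * rem g s)"
   unfolding rem_def right_diff_distrib by linarith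
 qed
 finally have eq0: "?L = nuN m (%g s. rtN N * (cav.eT T s * rem g s))" .
 have "\<bar>?L\<bar> <= nuN m (%g s. \<bar>rtN N * (cav.eT T s * rem g s)\<bar>)"
  unfolding eq0 by (rule sk.gex_abs_le[OF gr])
 also have "... <= nuN m (%g s. (2 * exp (3 * real n) * a / rtN N) * (1 * K (Xm g s) * exp (3 * Y m g s)))"
 proof (rule sk.gex_mono[OF grows_abs[OF gr]])
  show "grows N m (%g s. (2 * exp (3 * real n) * a / rtN N) * (1 * K (Xm g s) * exp (3 * Y m g s)))"
   by (intro grows_mult[OF grows_const] nuN_K_exp m) simp
  fix g s assume s: "s \<in> PI m"
  have "\<bar>rem g s\<bar> <= a * (n1 (Xf g s - Xm g s))^2 * exp (2 * n1 (Xf g s - Xm g s)) * K (Xm g s)"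
   unfolding rem_def by (rule tame_taylor[OF f])
  also have "... = a * ((n1 (Xf g s - Xm g s))^2 * exp (2 * n1 (Xf g s - Xm g s))) * K (Xm g s)" by (simp only: mult_ac)
  also have "... <= a * (2 * exp (3 * real n) * exp (3 * Y m g s) / real N) * K (Xm g s)"
   by (intro mult_right_mono mult_left_mono diff_second[OF s m] a0 tameD(2)[OF f])
  finally have "rtN N * \<bar>rem g s\<bar> <= rtN N * (a * (2 * exp (3 * real n) * exp (3 * Y m g s) / real N) * K (Xm g s))"
   by (rule mult_left_mono) simp
  also have "... = (2 * exp (3 * real n) * a / rtN N) * (1 * K (Xm g s) * exp (3 * Y m g s))"
   using N0 by (simp add: real_div_sqrt field_simps)
  finally show "\<bar>rtN N * (cav.eT T s * rem g s)\<bar> <= (2 * exp (3 * real n) * a / rtN N) * (1 * K (Xm g s) * exp (3 * Y m g s))"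
   using cav.abs_eT[OF s T] by (simp add: abs_mult)
 qed
 also have "... = (2 * exp (3 * real n) * a / rtN N) * nuN m (%g s. 1 * K (Xm g s) * exp (3 * Y m g s))"
  by (rule sk.gex_cmult)
 also have "... <= (2 * exp (3 * real n) * a / rtN N) * (up_const be h m 3 * sqrt kap)"
  using a0 by (intro mult_left_mono nuN_K_exp1 m) auto
 also have "... = 2 * exp (3 * real n) * up_const be h m 3 * (a * sqrt kap / rtN N)" by simp
 also have "... <= 2 * exp (3 * real n) * up_const be h m 3 * (KK be h n * Wt)"
  by (intro mult_left_mono kap_Wt mult_nonneg_nonneg up_const_nonneg) auto
 finally show ?thesis by (simp only: mult.assoc)
qed

lemma B1b:
 assumes T: "T \<subseteq> {..<m}" and m: "n <= m"
 shows "\<bar>rtN N * nuN m (%g s. cav.eT T s * f (Xm g s)) - rtN N * tmom be h q (card T) * n0 n (%g s. f (Xm g s))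
   - be\<^sup>2 / 2 * (\<Sum>l<m+2. \<Sum>l'\<in>{..<m+2} - {l}. cw1 m l * cw2 m l' * tmom be h q (card (tog l (tog l' T))) *
      (rtN N * n0 (m + 2) (%g s. (cav.ov (s l) (s l') - q) * f (Xm g s))))\<bar>
   <= 4 * be^2 * lipcav be h (m + 2) * (real (m + 1))^2 * ((real (m + 4)) ^ 4 * sqrt (cD be h C0 (m + 4)) * KK be h n * Wt)"
proof -
 let ?A = "nuN m (%g s. cav.eT T s * f (Xm g s))" and ?B = "tmom be h q (card T) * n0 m (%g s. f (Xm g s))"
 let ?C = "\<Sum>l<m+2. \<Sum>l'\<in>{..<m+2} - {l}. cw1 m l * cw2 m l' * (tmom be h q (card (tog l (tog l' T))) * n0 (m + 2) (%g s. (cav.ov (s l) (s l') - q) * f (Xm g s)))"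
 have n0n: "n0 m (%g s. f (Xm g s)) = n0 n (%g s. f (Xm g s))"
  by (rule base.gex_superset[OF dep_Xm[OF order_refl] m])
 have "rtN N * \<bar>?A - ?B - be\<^sup>2 / 2 * ?C\<bar> <=
  rtN N * (4 * be^2 * lipcav be h (m + 2) * (real (m + 1))^2 * e2 (m + 4) (%g s. f (Xm g s)))"
  by (intro mult_left_mono E2[OF cavfun_all(1)[OF m] T]) simp
 also have "... = 4 * be^2 * lipcav be h (m + 2) * (real (m + 1))^2 * (rtN N * e2 (m + 4) (%g s. f (Xm g s)))"
  by (simp only: mult_ac)
 also have "... <= 4 * be^2 * lipcav be h (m + 2) * (real (m + 1))^2 * ((real (m + 4)) ^ 4 * sqrt (cD be h C0 (m + 4)) * KK be h n * Wt)"
  by (intro mult_left_mono e2_Wt f2 grows_all mult_nonneg_nonneg cav.lipcav_nonneg) (use m in auto)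
 also have "rtN N * \<bar>?A - ?B - be\<^sup>2 / 2 * ?C\<bar> = \<bar>rtN N * ?A - rtN N * ?B - be\<^sup>2 / 2 * (rtN N * ?C)\<bar>"
  by (simp only: abs_mult[symmetric, of "rtN N", unfolded abs_of_pos[OF N0(4)]] right_diff_distrib mult_ac)
 also have "rtN N * ?C = (\<Sum>l<m+2. \<Sum>l'\<in>{..<m+2} - {l}. cw1 m l * cw2 m l' * tmom be h q (card (tog l (tog l' T))) *
      (rtN N * n0 (m + 2) (%g s. (cav.ov (s l) (s l') - q) * f (Xm g s))))"
  by (simp only: sum_distrib_left mult_ac)
 finally show ?thesis by (simp only: n0n mult.assoc)
qed

lemma B1c:
 assumes T: "T \<subseteq> {..<m}" and m: "n <= m"
 shows "\<bar>nuN m (%g s. cav.eT T s * (s (io i) p * cav.ell g (s (io i))) * pd k f (Xm g s))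
   - lamE be h q ((real N - 1) / real N) m T (io i) * n0 n (%g s. pd k f (Xm g s))\<bar>
   <= be * (2 * m) * (2 * lipcav be h (Suc m) + up_const be h (Suc m) 0) *
    ((real (m + 3))^2 * sqrt (sqrt (cD be h C0 (m + 3))) * KK be h n * Wt)"
proof -
 have n0n: "n0 m (%g s. pd k f (Xm g s)) = n0 n (%g s. pd k f (Xm g s))"
  by (rule base.gex_superset[OF dep_Xm[OF order_refl] m])
 have "io i < m" using io_less[of i] m by simp
 from E3[OF cavfun_all(2)[OF m, of k] T this] have "\<bar>nuN m (%g s. cav.eT T s * (s (io i) p * cav.ell g (s (io i))) * pd k f (Xm g s))
   - lamE be h q ((real N - 1) / real N) m T (io i) * n0 m (%g s. pd k f (Xm g s))\<bar>
   <= be * (2 * m) * (2 * lipcav be h (Suc m) + up_const be h (Suc m) 0) * e1 (m + 3) (%g s. pd k f (Xm g s))"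
  by (simp only: cav.ell_const_def)
 also have "... <= be * (2 * m) * (2 * lipcav be h (Suc m) + up_const be h (Suc m) 0) *
    ((real (m + 3))^2 * sqrt (sqrt (cD be h C0 (m + 3))) * KK be h n * Wt)"
  using be cav.lipcav_nonneg[of "Suc m"] up_const_nonneg[of "Suc m" 0] m
  by (intro mult_left_mono e1_Wt pd2 grows_all) auto
 finally show ?thesis unfolding n0n .
qed

lemma B1d:
 assumes T: "T \<subseteq> {..<m}" and m: "n <= m"
 shows "\<bar>nuN m (%g s. cav.eT T s * (s (io i) p * pd k f (Xm g s)))
   - tmom be h q (card (tog (io i) T)) * n0 n (%g s. pd k f (Xm g s))\<bar>
   <= 2 * lipcav be h m * ((real (m + 2))^2 * sqrt (sqrt (cD be h C0 (m + 2))) * KK be h n * Wt)"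
proof -
 have finT: "finite T" using T finite_subset by auto
 have i: "io i < m" using io_less[of i] m by simp
 have T': "tog (io i) T \<subseteq> {..<m}" using T i by (intro tog_subset) auto
 have n0n: "n0 m (%g s. pd k f (Xm g s)) = n0 n (%g s. pd k f (Xm g s))"
  by (rule base.gex_superset[OF dep_Xm[OF order_refl] m])
 have eq: "nuN m (%g s. cav.eT T s * (s (io i) p * pd k f (Xm g s))) = nuN m (%g s. cav.eT (tog (io i) T) s * pd k f (Xm g s))"
 proof (rule sk.gex_cong)
  fix g s assume s: "s \<in> PI m"
  have "s (io i) \<in> configs N" by (rule PiE_mem[OF s]) (use i in simp)
  from cav.eT_tog[where l = "io i" and s = s, OF finT this]
  show "cav.eT T s * (s (io i) p * pd k f (Xm g s)) = cav.eT (tog (io i) T) s * pd k f (Xm g s)"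
   by (simp flip: mult.assoc)
 qed
 have "\<bar>nuN m (%g s. cav.eT (tog (io i) T) s * pd k f (Xm g s)) - tmom be h q (card (tog (io i) T)) * n0 m (%g s. pd k f (Xm g s))\<bar>
   <= 2 * lipcav be h m * e1 (m + 2) (%g s. pd k f (Xm g s))"
  by (rule E1[OF cavfun_all(2)[OF m] T'])
 also have "... <= 2 * lipcav be h m * ((real (m + 2))^2 * sqrt (sqrt (cD be h C0 (m + 2))) * KK be h n * Wt)"
  using cav.lipcav_nonneg[of m] m by (intro mult_left_mono e1_Wt pd2 grows_all) auto
 finally show ?thesis unfolding n0n eq .
qed

lemma eT_empty: "cav.eT {} s = 1"
 by (simp add: cav.eT_def)

lemma tmom_0: "tmom be h q 0 = 1"
 using std_gauss.prob_space by (simp add: tmom_def)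

lemma B3:
 "\<bar>n0 n (%g s. pd k f (Xm g s)) - nuN n (%g s. pd k f (Xf g s))\<bar>
  <= (exp (3 * real n) * up_const be h n 3 * KK be h n
   + 2 * lipcav be h n * ((real (n + 2))^2 * sqrt (sqrt (cD be h C0 (n + 2))) * KK be h n)) * Wt"
proof -
 have gr: "grows N n (%g s. pd k f (Xf g s) - pd k f (Xm g s))"
  by (intro grows_diff grows_all order_refl)
 have "\<bar>nuN n (%g s. pd k f (Xf g s)) - nuN n (%g s. pd k f (Xm g s))\<bar>
   = \<bar>nuN n (%g s. pd k f (Xf g s) - pd k f (Xm g s))\<bar>"
  by (simp only: sk.gex_diff grows_all order_refl)
 also have "... <= nuN n (%g s. \<bar>pd k f (Xf g s) - pd k f (Xm g s)\<bar>)" by (rule sk.gex_abs_le[OF gr])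
 also have "... <= nuN n (%g s. (exp (3 * real n) * a / rtN N) * (1 * K (Xm g s) * exp (3 * Y n g s)))"
 proof (rule sk.gex_mono[OF grows_abs[OF gr]])
  show "grows N n (%g s. (exp (3 * real n) * a / rtN N) * (1 * K (Xm g s) * exp (3 * Y n g s)))"
   by (intro grows_mult[OF grows_const] nuN_K_exp order_refl) simp
  fix g s assume s: "s \<in> PI n"
  have "\<bar>pd k f (Xf g s) - pd k f (Xm g s)\<bar> <= a * n1 (Xf g s - Xm g s) * exp (2 * n1 (Xf g s - Xm g s)) * K (Xm g s)"
   by (rule tameD(9)[OF f])
  also have "... = a * (n1 (Xf g s - Xm g s) * exp (2 * n1 (Xf g s - Xm g s))) * K (Xm g s)" by (simp only: mult_ac)
  also have "... <= a * (exp (3 * real n) * exp (3 * Y n g s) / rtN N) * K (Xm g s)"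
   by (intro mult_right_mono mult_left_mono diff_first[OF s order_refl] a0 tameD(2)[OF f])
  also have "... = (exp (3 * real n) * a / rtN N) * (1 * K (Xm g s) * exp (3 * Y n g s))" by simp
  finally show "\<bar>pd k f (Xf g s) - pd k f (Xm g s)\<bar> <= (exp (3 * real n) * a / rtN N) * (1 * K (Xm g s) * exp (3 * Y n g s))" .
 qed
 also have "... = (exp (3 * real n) * a / rtN N) * nuN n (%g s. 1 * K (Xm g s) * exp (3 * Y n g s))"
  by (rule sk.gex_cmult)
 also have "... <= (exp (3 * real n) * a / rtN N) * (up_const be h n 3 * sqrt kap)"
  using a0 by (intro mult_left_mono nuN_K_exp1 order_refl) auto
 also have "... = exp (3 * real n) * up_const be h n 3 * (a * sqrt kap / rtN N)" by simp
 also have "... <= exp (3 * real n) * up_const be h n 3 * (KK be h n * Wt)"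
  by (intro mult_left_mono kap_Wt mult_nonneg_nonneg up_const_nonneg) auto
 finally have 1: "\<bar>nuN n (%g s. pd k f (Xf g s)) - nuN n (%g s. pd k f (Xm g s))\<bar> <= ..." .
 have "\<bar>nuN n (%g s. cav.eT {} s * pd k f (Xm g s)) - tmom be h q (card ({}::nat set)) * n0 n (%g s. pd k f (Xm g s))\<bar>
   <= 2 * lipcav be h n * e1 (n + 2) (%g s. pd k f (Xm g s))"
  by (rule E1[OF cavfun_all(2)[OF order_refl]]) simp
 also have "... <= 2 * lipcav be h n * ((real (n + 2))^2 * sqrt (sqrt (cD be h C0 (n + 2))) * KK be h n * Wt)"
  using cav.lipcav_nonneg[of n] by (intro mult_left_mono e1_Wt pd2 grows_all) auto
 finally have 2: "\<bar>nuN n (%g s. pd k f (Xm g s)) - n0 n (%g s. pd k f (Xm g s))\<bar> <= ..."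
  unfolding eT_empty card.empty tmom_0 mult_1 .
 show ?thesis using 1 2 unfolding distrib_right by (simp only: mult.assoc)
qed

text \<open>In \<open>rho\<close>, the full overlap, fluctuation vector and Gibbs measure may all be replaced by their cavity versions.\<close>

lemma B2:
 assumes m: "n <= m" and l: "l < m" "l' < m" "l ~= l'"
 shows "\<bar>rtN N * n0 m (%g s. (cav.ov (s l) (s l') - q) * f (Xm g s))
   - rtN N * nuN m (%g s. (overlap N (s l) (s l') - q) * f (Xf g s))\<bar>
  <= (1 + 2 * exp (3 * real n) * up_const be h m 3 * sqrt (sqrt (cD be h C0 m)) * KK be h n
   + 2 * lipcav be h m * ((real (m + 2))^2 * sqrt (cD be h C0 (m + 2)) * KK be h n)) * Wt"
proof -
 let ?\<Delta> = "%s. cav.ov (s l) (s l') - q"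
 have N1: "rtN N * (x / real N) = x / rtN N" for x using N0 by (simp add: real_div_sqrt field_simps)
 have gf: "grows N m (%g s. f (Xm g s))" "grows N m (%g s. f (Xf g s))" by (intro grows_all m)+
 have sA: "s l \<in> configs N" "s l' \<in> configs N" if "s \<in> PI m" for s using l by (auto intro!: PiE_mem[OF that])
 \<comment> \<open>the diagonal term of the overlap\<close>
 have i: "\<bar>rtN N * nuN m (%g s. s l p * s l' p / real N * f (Xf g s))\<bar> <= Wt"
 proof -
  have gr: "grows N m (%g s. s l p * s l' p / real N * f (Xf g s))" by (intro grows_mult grows_const gf)
  have "\<bar>nuN m (%g s. s l p * s l' p / real N * f (Xf g s))\<bar> <= nuN m (%g s. \<bar>s l p * s l' p / real N * f (Xf g s)\<bar>)"
   by (rule sk.gex_abs_le[OF gr])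
  also have "... <= nuN m (%g s. a / real N * K (Xf g s))"
  proof (rule sk.gex_mono[OF grows_abs[OF gr]])
   fix g s assume s: "s \<in> PI m"
   show "\<bar>s l p * s l' p / real N * f (Xf g s)\<bar> <= a / real N * K (Xf g s)"
    using cav.abs_eps[OF sA(1)[OF s]] cav.abs_eps[OF sA(2)[OF s]] tameD(7)[OF f, of "Xf g s"] N0
    by (simp add: abs_mult divide_right_mono)
  qed (intro grows_mult grows_const grows_all m)
  also have "... = a / real N * nuN n (%g s. \<bar>K (Xf g s)\<bar> * \<bar>1\<bar>)"
  proof -
   have e: "nuN m (%g s. K (Xf g s)) = nuN n (%g s. K (Xf g s))"
    by (rule sk.gex_superset[OF dep_Xf[OF order_refl] m])
   show ?thesis unfolding sk.gex_cmult e using tameD(2)[OF f] by simp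
  qed
  also have "... <= a / real N * (sqrt S2 * sqrt (nuN n (%g s. 1^2)))"
   unfolding S2_def using a0 by (intro mult_left_mono sk.gex_cauchy_schwarz grows_all grows_const) auto
  also have "... = a / real N * sqrt S2" by (simp add: sk.gex_const)
  finally have "rtN N * \<bar>nuN m (%g s. s l p * s l' p / real N * f (Xf g s))\<bar> <= rtN N * (a / real N * sqrt S2)"
   by (rule mult_left_mono) simp
  also have "... = Wt" unfolding Wt_def using N1[of "a * sqrt S2"] by simp
  finally show ?thesis by (simp add: abs_mult)
 qed
 \<comment> \<open>replacing the fluctuations by their cavity version\<close>
 have ii: "\<bar>rtN N * nuN m (%g s. ?\<Delta> s * (f (Xf g s) - f (Xm g s)))\<bar> <= 2 * exp (3 * real n) * up_const be h m 3 * sqrt (sqrt (cD be h C0 m)) * KK be h n * Wt"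
 proof -
  have gr: "grows N m (%g s. ?\<Delta> s * (f (Xf g s) - f (Xm g s)))" by (intro grows_mult[OF grows_const] grows_diff gf)
  have "\<bar>nuN m (%g s. ?\<Delta> s * (f (Xf g s) - f (Xm g s)))\<bar> <= nuN m (%g s. \<bar>?\<Delta> s * (f (Xf g s) - f (Xm g s))\<bar>)"
   by (rule sk.gex_abs_le[OF gr])
  also have "... <= nuN m (%g s. (2 * exp (3 * real n) * a / rtN N) * (\<bar>?\<Delta> s\<bar> * K (Xm g s) * exp (3 * Y m g s)))"
  proof (rule sk.gex_mono[OF grows_abs[OF gr]])
   show "grows N m (%g s. (2 * exp (3 * real n) * a / rtN N) * (\<bar>?\<Delta> s\<bar> * K (Xm g s) * exp (3 * Y m g s)))"
    by (intro grows_mult[OF grows_const] nuN_K_exp m) simp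
   fix g s assume s: "s \<in> PI m"
   have "\<bar>f (Xf g s) - f (Xm g s)\<bar> <= 2 * a * n1 (Xf g s - Xm g s) * exp (2 * n1 (Xf g s - Xm g s)) * K (Xm g s)"
    by (rule tame_lipschitz[OF f])
   also have "... = 2 * a * (n1 (Xf g s - Xm g s) * exp (2 * n1 (Xf g s - Xm g s))) * K (Xm g s)" by (simp only: mult_ac)
   also have "... <= 2 * a * (exp (3 * real n) * exp (3 * Y m g s) / rtN N) * K (Xm g s)"
    using a0 by (intro mult_right_mono mult_left_mono diff_first[OF s m] tameD(2)[OF f]) auto
   finally have "\<bar>?\<Delta> s\<bar> * \<bar>f (Xf g s) - f (Xm g s)\<bar> <= \<bar>?\<Delta> s\<bar> * (2 * a * (exp (3 * real n) * exp (3 * Y m g s) / rtN N) * K (Xm g s))"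
    by (rule mult_left_mono) simp
   then show "\<bar>?\<Delta> s * (f (Xf g s) - f (Xm g s))\<bar> <= (2 * exp (3 * real n) * a / rtN N) * (\<bar>?\<Delta> s\<bar> * K (Xm g s) * exp (3 * Y m g s))"
    by (simp add: abs_mult mult_ac)
  qed
  also have "... = (2 * exp (3 * real n) * a / rtN N) * nuN m (%g s. \<bar>?\<Delta> s\<bar> * K (Xm g s) * exp (3 * Y m g s))"
   by (rule sk.gex_cmult)
  also have "... <= (2 * exp (3 * real n) * a / rtN N) * (up_const be h m 3 * n0 m (%g s. \<bar>K (Xm g s)\<bar> * \<bar>?\<Delta> s\<bar>))"
   using nuN_K_exp(1)[OF m, of "%s. \<bar>?\<Delta> s\<bar>"] a0 tameD(2)[OF f] by (intro mult_left_mono) (auto simp: mult.commute)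
  also have "... <= (2 * exp (3 * real n) * a / rtN N) * (up_const be h m 3 * (sqrt kap * (sqrt (sqrt (cD be h C0 m)) / rtN N)))"
  proof -
   have "n0 m (%g s. (K (Xm g s))^2) = kap"
    unfolding kap_def by (rule base.gex_superset[OF dep_Xm[OF order_refl, where ph = "%x. (K x)^2"] m])
   then show ?thesis
    using n0_first_overlap[OF grows_all(1)[OF m] l] a0 by (intro mult_left_mono up_const_nonneg) auto
  qed
  finally have "rtN N * \<bar>nuN m (%g s. ?\<Delta> s * (f (Xf g s) - f (Xm g s)))\<bar> <=
   rtN N * ((2 * exp (3 * real n) * a / rtN N) * (up_const be h m 3 * (sqrt kap * (sqrt (sqrt (cD be h C0 m)) / rtN N))))"
   by (rule mult_left_mono) simp
  also have "... = 2 * exp (3 * real n) * up_const be h m 3 * sqrt (sqrt (cD be h C0 m)) * (a * sqrt kap / rtN N)"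
   using N0 by (simp add: field_simps)
  also have "... <= 2 * exp (3 * real n) * up_const be h m 3 * sqrt (sqrt (cD be h C0 m)) * (KK be h n * Wt)"
   by (intro mult_left_mono kap_Wt mult_nonneg_nonneg up_const_nonneg real_sqrt_ge_zero cD_nonneg) auto
  finally show ?thesis by (simp add: abs_mult mult_ac)
 qed
 \<comment> \<open>removing the cavity spin from the Gibbs measure\<close>
 have iii: "\<bar>rtN N * nuN m (%g s. ?\<Delta> s * f (Xm g s)) - rtN N * n0 m (%g s. ?\<Delta> s * f (Xm g s))\<bar>
   <= 2 * lipcav be h m * ((real (m + 2))^2 * sqrt (cD be h C0 (m + 2)) * KK be h n) * Wt"
 proof -
  let ?w = "%g s. ?\<Delta> s * f (Xm g s)"
  have cf: "cavfun m ?w"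
  proof -
   note c = cavfun_all(1)[OF m]
   show ?thesis unfolding cavfun_def
   proof (intro conjI allI)
    show "dep {..<m} (?w g)" for g
     by (intro dep_mult dep_Xm m dep_diff dep_const dep_coord2) (use l in auto)
    show "cav.flip_inv m (?w g)" for g
     using c l by (intro cav.flip_inv_mult cav.flip_inv_ov) (auto simp: cavfun_def)
    show "?w (over (col N p) ga g) = ?w g" for g ga
     by (simp only: Xm_over)
    show "grows N m ?w" by (intro grows_mult[OF grows_const] gf)
   qed
  qed
  have "\<bar>nuN m (%g s. cav.eT {} s * ?w g s) - tmom be h q (card ({}::nat set)) * n0 m ?w\<bar> <= 2 * lipcav be h m * e1 (m + 2) ?w"
   by (rule E1[OF cf]) simp
  then have "\<bar>nuN m ?w - n0 m ?w\<bar> <= 2 * lipcav be h m * e1 (m + 2) ?w"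
   unfolding eT_empty card.empty tmom_0 mult_1 .
  also have "e1 (m + 2) ?w <= (real (m + 2))^2 * (a * sqrt kap * (sqrt (cD be h C0 (m + 2)) / real N))"
  proof -
   define b where "b = a * sqrt kap * (sqrt (cD be h C0 (m + 2)) / real N)"
   have kap0: "0 <= kap" unfolding kap_def by (rule base.gex_nonneg) simp
   have b: "0 <= b" unfolding b_def
    by (intro mult_nonneg_nonneg a0 divide_nonneg_nonneg real_sqrt_ge_zero cD_nonneg kap0) simp
   have "e1 (m + 2) ?w <= (\<Sum>k<m+2. \<Sum>k'\<in>{..<m+2} - {k}. b)"
    unfolding e1_def
   proof (intro sum_mono)
    fix k k' assume k: "k \<in> {..<m+2}" "k' \<in> {..<m+2} - {k}"
    have "n0 (m + 2) (%g s. \<bar>?w g s\<bar> * \<bar>cav.ov (s k) (s k') - q\<bar>) =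
      n0 (m + 2) (%g s. \<bar>f (Xm g s)\<bar> * (\<bar>?\<Delta> s\<bar> * \<bar>cav.ov (s k) (s k') - q\<bar>))"
     by (simp only: abs_mult mult_ac)
    also have "... <= sqrt (n0 (m + 2) (%g s. (f (Xm g s))^2)) * (sqrt (cD be h C0 (m + 2)) / real N)"
     by (rule n0_second_overlap[OF grows_all(3)]) (use m l k in auto)
    also have "... <= b"
     unfolding b_def by (intro mult_right_mono f2 divide_nonneg_nonneg real_sqrt_ge_zero cD_nonneg) (use m in auto)
    finally show "n0 (m + 2) (%g s. \<bar>?w g s\<bar> * \<bar>cav.ov (s k) (s k') - q\<bar>) <= b" .
   qed
   also have "... <= (\<Sum>k<m+2. \<Sum>k'\<in>{..<m+2}. b)" using b by (intro sum_mono sum_mono2) auto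
   also have "... = (real (m + 2))^2 * b" by (simp add: power2_eq_square)
   finally show ?thesis by (simp only: b_def)
  qed
  finally have "\<bar>nuN m ?w - n0 m ?w\<bar> <= 2 * lipcav be h m * ((real (m + 2))^2 * (a * sqrt kap * (sqrt (cD be h C0 (m + 2)) / real N)))"
   using cav.lipcav_nonneg[of m] by (simp add: mult_left_mono)
  then have "rtN N * \<bar>nuN m ?w - n0 m ?w\<bar> <= rtN N * (2 * lipcav be h m * ((real (m + 2))^2 * (a * sqrt kap * (sqrt (cD be h C0 (m + 2)) / real N))))"
   by (rule mult_left_mono) simp
  also have "... = 2 * lipcav be h m * ((real (m + 2))^2 * sqrt (cD be h C0 (m + 2))) * (a * sqrt kap / rtN N)"
   by (subst N1[symmetric]) simp
  also have "... <= 2 * lipcav be h m * ((real (m + 2))^2 * sqrt (cD be h C0 (m + 2))) * (KK be h n * Wt)"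
   by (intro mult_left_mono kap_Wt mult_nonneg_nonneg cav.lipcav_nonneg real_sqrt_ge_zero cD_nonneg) auto
  finally have "rtN N * \<bar>nuN m ?w - n0 m ?w\<bar> <= 2 * lipcav be h m * ((real (m + 2))^2 * sqrt (cD be h C0 (m + 2)) * KK be h n) * Wt"
   by (simp only: mult_ac)
  then show ?thesis by (simp add: abs_mult flip: right_diff_distrib)
 qed
 have "nuN m (%g s. (overlap N (s l) (s l') - q) * f (Xf g s)) =
   nuN m (%g s. s l p * s l' p / real N * f (Xf g s) + (?\<Delta> s * (f (Xf g s) - f (Xm g s)) + ?\<Delta> s * f (Xm g s)))"
  unfolding ov_eq by (rule sk.gex_cong) (simp add: algebra_simps)
 also have "... = nuN m (%g s. s l p * s l' p / real N * f (Xf g s)) + (nuN m (%g s. ?\<Delta> s * (f (Xf g s) - f (Xm g s))) + nuN m (%g s. ?\<Delta> s * f (Xm g s)))"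
  by (subst sk.gex_add | intro grows_add grows_mult[OF grows_const] grows_diff gf | rule refl)+
 finally have "rtN N * nuN m (%g s. (overlap N (s l) (s l') - q) * f (Xf g s)) =
   rtN N * nuN m (%g s. s l p * s l' p / real N * f (Xf g s)) + (rtN N * nuN m (%g s. ?\<Delta> s * (f (Xf g s) - f (Xm g s))) + rtN N * nuN m (%g s. ?\<Delta> s * f (Xm g s)))"
  by (simp add: distrib_left)
 then show ?thesis using i ii iii unfolding distrib_right mult_1 by linarith
qed

end

end

section \<open>Approximable functionals\<close>

text \<open>The assumptions \<open>Q2\<close> and \<open>x_pos\<close> are supplied by \<open>fixed_point\<close> and \<open>stability\<close>.\<close>

locale hightemp =
 fixes be h q :: real and io :: "'n::finite => nat" and n :: nat and q1 C0 :: real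
 assumes be: "0 <= be" and q: "0 <= q" "q <= 1" and io: "bij_betw io UNIV {..<n}" and C0: "0 <= C0"
  and ht: "!!N. 1 <= N ==> sk.gex N be h 2 (%g s. (overlap N (s 0) (s 1) - q) ^ 6) <= C0 / real N ^ 3"
  and Q2: "tmom be h q 2 = q" and Q1: "tmom be h q 1 = q1"
  and x_pos: "be^2 * (1 - 2 * q + tmom be h q 4) < 1"
begin

abbreviation "Q \<equiv> tmom be h q"

lemma est_inst: "1 <= p ==> p <= N ==> est N p be h q io n C0"
 using be q io C0 ht by unfold_locales auto

definition X :: "nat => (nat \<times> nat => real) => (nat => nat => real) => real ^ ('n + 'n)" where
 "X N g s = fluct N be q1 q g (%i. s (io i))"

abbreviation "E N \<equiv> sk.gex N be h"

definition "w N a K = a * sqrt (E N n (%g s. (K (X N g s))^2)) / rtN N"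

text \<open>The constant must not depend on \<open>N\<close>, on the site or on the test function. Site-dependent functionals are averaged later.\<close>

definition "small Ph \<longleftrightarrow> (\<exists>C. \<forall>N p a K f. 1 <= p --> p <= N --> tame a K f --> \<bar>Ph N p f\<bar> <= C * w N a K)"
 for Ph :: "nat => nat => (real ^ ('n + 'n) => real) => real"

definition "Dk k N f = E N n (%g s. pd k f (X N g s))"

definition "appr Ph \<longleftrightarrow> (\<exists>u. small (%N p f. Ph N f - (\<Sum>k\<in>UNIV. u k * Dk k N f)))"
 for Ph :: "nat => (real ^ ('n + 'n) => real) => real"

lemma w_nonneg: "tame a K f ==> 0 <= w N a K"
 unfolding w_def using tameD(1) by (intro divide_nonneg_nonneg mult_nonneg_nonneg real_sqrt_ge_zero sk.gex_nonneg) auto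

lemma smallI:
 "(!!N p a K f. 1 <= p ==> p <= N ==> tame a K f ==> \<bar>Ph N p f\<bar> <= C * w N a K) ==> small Ph"
 unfolding small_def by blast

lemma smallD:
 assumes "small Ph"
 shows "\<exists>C. 0 <= C & (\<forall>N p a K f. 1 <= p --> p <= N --> tame a K f --> \<bar>Ph N p f\<bar> <= C * w N a K)"
proof -
 obtain C where C: "!!N p a K f. 1 <= p ==> p <= N ==> tame a K f ==> \<bar>Ph N p f\<bar> <= C * w N a K"
  using assms unfolding small_def by blast
 show ?thesis
 proof (intro exI[of _ "max 0 C"] conjI allI impI)
  fix N p a K f assume *: "(1::nat) <= p" "p <= N" "tame a K (f :: real ^ ('n + 'n) => real)"
  have "C * w N a K <= max 0 C * w N a K" by (intro mult_right_mono w_nonneg[OF *(3)]) simp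
  then show "\<bar>Ph N p f\<bar> <= max 0 C * w N a K" using C[OF *] by linarith
 qed simp
qed

lemma small_cong:
 assumes "small Ph" "!!N p a K f. 1 <= p ==> p <= N ==> tame a K f ==> \<Psi> N p f = Ph N p f"
 shows "small \<Psi>"
proof -
 obtain C where "0 <= C" and C: "!!N p a K f. 1 <= p ==> p <= N ==> tame a K f ==> \<bar>Ph N p f\<bar> <= C * w N a K"
  using smallD[OF assms(1)] by blast
 show ?thesis proof (rule smallI[of _ C])
  fix N p a K f assume *: "(1::nat) <= p" "p <= N" "tame a K (f :: real ^ ('n + 'n) => real)"
  show "\<bar>\<Psi> N p f\<bar> <= C * w N a K" unfolding assms(2)[OF *] by (rule C[OF *])
 qed
qed

lemma small_add: assumes "small Ph" "small \<Psi>" shows "small (%N p f. Ph N p f + \<Psi> N p f)"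
proof -
 obtain C where "0 <= C" and C: "!!N p a K f. 1 <= p ==> p <= N ==> tame a K f ==> \<bar>Ph N p f\<bar> <= C * w N a K"
  using smallD[OF assms(1)] by blast
 obtain D where "0 <= D" and D: "!!N p a K f. 1 <= p ==> p <= N ==> tame a K f ==> \<bar>\<Psi> N p f\<bar> <= D * w N a K"
  using smallD[OF assms(2)] by blast
 show ?thesis
 proof (rule smallI[of _ "C + D"])
  fix N p a K f assume *: "(1::nat) <= p" "p <= N" "tame a K (f :: real ^ ('n + 'n) => real)"
  show "\<bar>Ph N p f + \<Psi> N p f\<bar> <= (C + D) * w N a K"
   using C[OF *] D[OF *] abs_triangle_ineq[of "Ph N p f" "\<Psi> N p f"] by (simp add: distrib_right)
 qed
qed

lemma small_mult:
 assumes "small Ph" and b: "!!N p. 1 <= p ==> p <= N ==> \<bar>b N p\<bar> <= B"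
 shows "small (%N p f. b N p * Ph N p f)"
proof -
 obtain C where C: "0 <= C" "!!N p a K f. 1 <= p ==> p <= N ==> tame a K f ==> \<bar>Ph N p f\<bar> <= C * w N a K"
  using smallD[OF assms(1)] by blast
 show ?thesis
 proof (rule smallI[of _ "B * C"])
  fix N p a K f assume *: "(1::nat) <= p" "p <= N" "tame a K (f :: real ^ ('n + 'n) => real)"
  show "\<bar>b N p * Ph N p f\<bar> <= B * C * w N a K"
   unfolding abs_mult mult.assoc using b[OF *(1,2)] by (intro mult_mono C(2)[OF *] b[OF *(1,2)]) auto
 qed
qed

lemma small_cmult: "small Ph ==> small (%N p f. c * Ph N p f)"
 by (rule small_mult[of _ _ "\<bar>c\<bar>"]) auto

lemma small_zero: "small (%N p f. 0)"
 by (rule smallI[of _ 0]) simp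

lemma small_sum: "(!!i. i \<in> I ==> small (Ph i)) ==> small (%N p f. \<Sum>i\<in>I. Ph i N p f)"
 by (induction I rule: infinite_finite_induct) (auto intro: small_zero small_add)

lemma small_site_average:
 assumes "small Ph"
 shows "small (%N p f. (\<Sum>p=1..N. Ph N p f) / real N)"
proof -
 obtain C where C: "0 <= C" "!!N p a K f. 1 <= p ==> p <= N ==> tame a K f ==> \<bar>Ph N p f\<bar> <= C * w N a K"
  using smallD[OF assms(1)] by blast
 show ?thesis
 proof (rule smallI[of _ C])
  fix N p a K f assume *: "(1::nat) <= p" "p <= N" "tame a K (f :: real ^ ('n + 'n) => real)"
  have "\<bar>\<Sum>p=1..N. Ph N p f\<bar> <= (\<Sum>p=1..N. C * w N a K)"
   by (rule order_trans[OF sum_abs sum_mono]) (auto intro: C(2)[OF _ _ *(3)])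
  also have "... = real N * (C * w N a K)" by simp
  finally show "\<bar>(\<Sum>p=1..N. Ph N p f) / real N\<bar> <= C * w N a K"
   using * by (simp add: abs_divide divide_le_eq mult.commute)
 qed
qed

lemma apprI: "small (%N p f. Ph N f - (\<Sum>k\<in>UNIV. u k * Dk k N f)) ==> appr Ph"
 unfolding appr_def by blast

lemma appr_add: assumes "appr Ph" "appr \<Psi>" shows "appr (%N f. Ph N f + \<Psi> N f)"
proof -
 obtain u where u: "small (%N p f. Ph N f - (\<Sum>k\<in>UNIV. u k * Dk k N f))" using assms by (auto simp: appr_def)
 obtain v where v: "small (%N p f. \<Psi> N f - (\<Sum>k\<in>UNIV. v k * Dk k N f))" using assms by (auto simp: appr_def)
 show ?thesis
  by (rule apprI[of _ "%k. u k + v k"], rule small_cong[OF small_add[OF u v]])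
    (simp add: distrib_right sum.distrib)
qed

lemma appr_cmult: assumes "appr Ph" shows "appr (%N f. c * Ph N f)"
proof -
 obtain u where u: "small (%N p f. Ph N f - (\<Sum>k\<in>UNIV. u k * Dk k N f))" using assms by (auto simp: appr_def)
 show ?thesis
  by (rule apprI[of _ "%k. c * u k"], rule small_cong[OF small_cmult[OF u, of c]])
    (simp add: right_diff_distrib sum_distrib_left mult.assoc)
qed

lemma small_appr: "small (%N p f. Ph N f) ==> appr Ph"
 by (rule apprI[of _ "%_. 0"]) simp

lemma appr_cong:
 assumes "appr Ph" "!!N a K f. 1 <= N ==> tame a K f ==> \<Psi> N f = Ph N f"
 shows "appr \<Psi>"
proof -
 obtain u where u: "small (%N p f. Ph N f - (\<Sum>k\<in>UNIV. u k * Dk k N f))" using assms by (auto simp: appr_def)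
 show ?thesis by (rule apprI[of _ u], rule small_cong[OF u]) (use assms(2) in auto)
qed

lemma appr_diff: assumes "appr Ph" "appr \<Psi>" shows "appr (%N f. Ph N f - \<Psi> N f)"
 by (rule appr_cong[OF appr_add[OF assms(1) appr_cmult[OF assms(2), of "-1"]]]) simp

lemma appr_zero: "appr (%N f. 0)" by (rule small_appr[OF small_zero])

lemma appr_sum: "(!!i. i \<in> I ==> appr (Ph i)) ==> appr (%N f. \<Sum>i\<in>I. Ph i N f)"
 by (induction I rule: infinite_finite_induct) (auto intro: appr_zero appr_add)

lemma appr_Dk: "appr (%N f. Dk k N f)"
 by (rule apprI[of _ "%j. if j = k then 1 else 0"], rule small_cong[OF small_zero]) (simp add: if_distrib[of "%x. x * _"] cong: if_cong)

lemma appr_cancel: assumes "appr (%N f. c * Ph N f)" "c ~= 0" shows "appr Ph"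
 by (rule appr_cong[OF appr_cmult[OF assms(1), of "1 / c"]]) (use assms(2) in simp)

section \<open>The cavity equations\<close>

definition "m = n + 2"

definition "\<rho> l l' N f = rtN N * E N (m + 2) (%g s. (overlap N (s l) (s l') - q) * f (X N g s))"

definition "zT T N p f = rtN N * E N m (%g s. (\<Prod>r\<in>T. s r p) * f (X N g s))"

lemma X_grows:
 assumes "tame a K f" "n <= m'" "1 <= N"
 shows "grows N m' (%g s. f (X N g s))" "grows N m' (%g s. pd k f (X N g s))" "grows N m' (%g s. K (X N g s))"
proof -
 interpret e: est N 1 be h q io n q1 C0 by (rule est_inst) (use assms in auto)
 have "X N = e.Xf" by (simp add: fun_eq_iff X_def e.Xf_def)
 then show "grows N m' (%g s. f (X N g s))" "grows N m' (%g s. pd k f (X N g s))" "grows N m' (%g s. K (X N g s))"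
  using e.grows_all[OF assms(1,2)] by simp_all
qed

lemma dep_X: "n <= m' ==> dep {..<m'} (%s. ph (X N g s))"
proof (rule depI)
 fix s s' :: "nat => nat => real" assume "n <= m'" and e: "!!i. i \<in> {..<m'} ==> s i = s' i"
 have "io i < n" for i using io by (auto simp: bij_betw_def)
 then have "s (io i) = s' (io i)" for i using e[of "io i"] \<open>n <= m'\<close> by (meson lessThan_iff less_le_trans)
 then show "ph (X N g s) = ph (X N g s')" by (simp add: X_def)
qed

definition "n0f N p f = gibbs_field.gex N (cL N p be h) n (%g s. f (est.Xm N p be q io q1 g s))"

definition "lamN T N j = lamE be h q ((real N - 1) / real N) m T j"

lemma abs_Q: "\<bar>Q k\<bar> <= 1"
proof -
 have le: "\<bar>tanh x ^ k\<bar> <= 1" for x :: real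
  using abs_le_iff tanh_real_bounds[of x] by (simp add: power_abs power_le_one abs_le_iff less_imp_le)
 have i: "integrable std_gauss (%z. tanh (be * (sqrt q * z) + be * h) ^ k)"
  by (rule std_gauss.integrable_const_bound[of _ 1]) (auto simp: le measurable_cong_sets[OF sets_std_gauss refl])
 have "\<bar>Q k\<bar> <= (\<integral>z. \<bar>tanh (be * (sqrt q * z) + be * h) ^ k\<bar> \<partial>std_gauss)"
  unfolding tmom_def by (rule integral_abs_bound)
 also have "... <= (\<integral>z. 1 \<partial>std_gauss)"
  by (intro integral_mono integrable_abs i le) auto
 finally show ?thesis using std_gauss.prob_space by simp
qed

text \<open>The expansion of a product of spins at \<open>p\<close>, with all cavity averages turned back into true averages.\<close>

lemma star1:
 assumes T: "T \<subseteq> {..<m}"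
 shows "small (%N p f. zT T N p f - rtN N * Q (card T) * n0f N p f
  - be\<^sup>2 / 2 * (\<Sum>l<m+2. \<Sum>l'\<in>{..<m+2} - {l}. cw1 m l * cw2 m l' * Q (card (tog l (tog l' T))) * \<rho> l l' N f)
  - (\<Sum>i\<in>UNIV. lamN T N (io i) * Dk (Inl i) N f) - (\<Sum>i\<in>UNIV. Q (card (tog (io i) T)) * Dk (Inr i) N f))"
proof -
 have nm: "n <= m" by (simp add: m_def)
 define Xm where "Xm = (%N p. est.Xm N p be q io q1)"
 define n0 where "n0 = (%N p. gibbs_field.gex N (cL N p be h))"
 define ov where "ov = (%N p. cavity.ov (col N p) (cv N p))"
 define ell where "ell = (%N p. cavity.ell (col N p) (cv N p))"
 define z' where "z' = (%N p f. rtN N * E N m (%g s. (\<Prod>r\<in>T. s r p) * f (Xm N p g s)))"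
 define A where "A = (%i N p f. E N m (%g s. (\<Prod>r\<in>T. s r p) * (s (io i) p * ell N p g (s (io i))) * pd (Inl i) f (Xm N p g s)))"
 define B where "B = (%i N p f. E N m (%g s. (\<Prod>r\<in>T. s r p) * (s (io i) p * pd (Inr i) f (Xm N p g s))))"
 define D0 where "D0 = (%k N p f. n0 N p n (%g s. pd k f (Xm N p g s)))"
 define r0 where "r0 = (%l l' N p f. rtN N * n0 N p (m + 2) (%g s. (ov N p (s l) (s l') - q) * f (Xm N p g s)))"
 note defs = Xm_def n0_def ov_def ell_def z'_def A_def B_def D0_def r0_def zT_def n0f_def lamN_def \<rho>_def Dk_def
 have sa: "small (%N p f. zT T N p f - z' N p f - (\<Sum>i\<in>UNIV. A i N p f) - (\<Sum>i\<in>UNIV. B i N p f))"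
 proof (rule smallI)
  fix N p a K f assume *: "(1::nat) <= p" "p <= N" "tame a K (f :: real ^ ('n + 'n) => real)"
  interpret e: est N p be h q io n q1 C0 by (rule est_inst[OF *(1,2)])
  have hX: "e.Xf = X N" and hw: "e.Wt a K = w N a K"
   by (simp_all add: fun_eq_iff X_def e.Xf_def e.Wt_def[OF *(3)] e.S2_def[OF *(3)] w_def)
  show "\<bar>zT T N p f - z' N p f - (\<Sum>i\<in>UNIV. A i N p f) - (\<Sum>i\<in>UNIV. B i N p f)\<bar> <= (2 * exp (3 * real n) * up_const be h m 3 * KK be h n) * w N a K"
   using e.B1a[OF *(3) T nm] unfolding hX hw defs e.cav.eT_def .
 qed
 have sb: "small (%N p f. z' N p f - rtN N * Q (card T) * n0f N p f - be\<^sup>2 / 2 * (\<Sum>l<m+2. \<Sum>l'\<in>{..<m+2} - {l}. cw1 m l * cw2 m l' * Q (card (tog l (tog l' T))) * r0 l l' N p f))"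
 proof (rule smallI)
  fix N p a K f assume *: "(1::nat) <= p" "p <= N" "tame a K (f :: real ^ ('n + 'n) => real)"
  interpret e: est N p be h q io n q1 C0 by (rule est_inst[OF *(1,2)])
  have hX: "e.Xf = X N" and hw: "e.Wt a K = w N a K"
   by (simp_all add: fun_eq_iff X_def e.Xf_def e.Wt_def[OF *(3)] e.S2_def[OF *(3)] w_def)
  show "\<bar>z' N p f - rtN N * Q (card T) * n0f N p f - be\<^sup>2 / 2 * (\<Sum>l<m+2. \<Sum>l'\<in>{..<m+2} - {l}. cw1 m l * cw2 m l' * Q (card (tog l (tog l' T))) * r0 l l' N p f)\<bar>
   <= (4 * be^2 * lipcav be h (m + 2) * (real (m + 1))^2 * ((real (m + 4)) ^ 4 * sqrt (cD be h C0 (m + 4)) * KK be h n)) * w N a K"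
   using e.B1b[OF *(3) T nm] unfolding hX hw defs e.cav.eT_def by (simp only: mult.assoc)
 qed
 have sc: "small (%N p f. A i N p f - lamN T N (io i) * D0 (Inl i) N p f)" for i
 proof (rule smallI)
  fix N p a K f assume *: "(1::nat) <= p" "p <= N" "tame a K (f :: real ^ ('n + 'n) => real)"
  interpret e: est N p be h q io n q1 C0 by (rule est_inst[OF *(1,2)])
  have hX: "e.Xf = X N" and hw: "e.Wt a K = w N a K"
   by (simp_all add: fun_eq_iff X_def e.Xf_def e.Wt_def[OF *(3)] e.S2_def[OF *(3)] w_def)
  show "\<bar>A i N p f - lamN T N (io i) * D0 (Inl i) N p f\<bar> <= (be * (2 * m) * (2 * lipcav be h (Suc m) + up_const be h (Suc m) 0) *
    ((real (m + 3))^2 * sqrt (sqrt (cD be h C0 (m + 3))) * KK be h n)) * w N a K"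
   using e.B1c[OF *(3) T nm, of i "Inl i"] unfolding hX hw defs e.cav.eT_def by (simp only: mult.assoc)
 qed
 have sd: "small (%N p f. B i N p f - Q (card (tog (io i) T)) * D0 (Inr i) N p f)" for i
 proof (rule smallI)
  fix N p a K f assume *: "(1::nat) <= p" "p <= N" "tame a K (f :: real ^ ('n + 'n) => real)"
  interpret e: est N p be h q io n q1 C0 by (rule est_inst[OF *(1,2)])
  have hX: "e.Xf = X N" and hw: "e.Wt a K = w N a K"
   by (simp_all add: fun_eq_iff X_def e.Xf_def e.Wt_def[OF *(3)] e.S2_def[OF *(3)] w_def)
  show "\<bar>B i N p f - Q (card (tog (io i) T)) * D0 (Inr i) N p f\<bar> <= (2 * lipcav be h m * ((real (m + 2))^2 * sqrt (sqrt (cD be h C0 (m + 2))) * KK be h n)) * w N a K"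
   using e.B1d[OF *(3) T nm, of i "Inr i"] unfolding hX hw defs e.cav.eT_def by (simp only: mult.assoc)
 qed
 have s2: "small (%N p f. r0 l l' N p f - \<rho> l l' N f)" if l: "l < m + 2" "l' < m + 2" "l ~= l'" for l l'
 proof (rule smallI)
  fix N p a K f assume *: "(1::nat) <= p" "p <= N" "tame a K (f :: real ^ ('n + 'n) => real)"
  interpret e: est N p be h q io n q1 C0 by (rule est_inst[OF *(1,2)])
  have hX: "e.Xf = X N" and hw: "e.Wt a K = w N a K"
   by (simp_all add: fun_eq_iff X_def e.Xf_def e.Wt_def[OF *(3)] e.S2_def[OF *(3)] w_def)
  have nm2: "n <= m + 2" using nm by simp
  show "\<bar>r0 l l' N p f - \<rho> l l' N f\<bar> <= (1 + 2 * exp (3 * real n) * up_const be h (m + 2) 3 * sqrt (sqrt (cD be h C0 (m + 2))) * KK be h n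
   + 2 * lipcav be h (m + 2) * ((real (m + 2 + 2))^2 * sqrt (cD be h C0 (m + 2 + 2)) * KK be h n)) * w N a K"
   using e.B2[OF *(3) nm2 l] unfolding hX hw defs .
 qed
 have s3: "small (%N p f. D0 k N p f - Dk k N f)" for k
 proof (rule smallI)
  fix N p a K f assume *: "(1::nat) <= p" "p <= N" "tame a K (f :: real ^ ('n + 'n) => real)"
  interpret e: est N p be h q io n q1 C0 by (rule est_inst[OF *(1,2)])
  have hX: "e.Xf = X N" and hw: "e.Wt a K = w N a K"
   by (simp_all add: fun_eq_iff X_def e.Xf_def e.Wt_def[OF *(3)] e.S2_def[OF *(3)] w_def)
  show "\<bar>D0 k N p f - Dk k N f\<bar> <= (exp (3 * real n) * up_const be h n 3 * KK be h n
   + 2 * lipcav be h n * ((real (n + 2))^2 * sqrt (sqrt (cD be h C0 (n + 2))) * KK be h n)) * w N a K"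
   using e.B3[OF *(3), of k] unfolding hX hw defs .
 qed
 have lamb: "\<bar>lamN T N j\<bar> <= be * (1 + q * (real m + real m))" if "1 <= N" for N j
 proof -
  have c: "0 <= (real N - 1) / real N" "(real N - 1) / real N <= 1" using that by (auto simp: divide_le_eq)
  have "\<bar>\<Sum>r\<in>{..<m} - {j}. Q (card (tog r (tog j T)))\<bar> <= (\<Sum>r\<in>{..<m} - {j}. 1)"
   by (rule order_trans[OF sum_abs]) (intro sum_mono abs_Q)
  also have "... <= (\<Sum>r<m. 1)" by (intro sum_mono2) auto
  finally have 1: "\<bar>\<Sum>r\<in>{..<m} - {j}. Q (card (tog r (tog j T)))\<bar> <= real m" by simp
  have 2: "\<bar>real m * Q (card (tog m (tog j T)))\<bar> <= real m"
   using mult_left_mono[OF abs_Q, of "real m"] by (simp add: abs_mult)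
  have 3: "\<bar>(real N - 1) / real N * Q (card T)\<bar> <= 1"
   unfolding abs_mult using mult_mono[OF _ abs_Q, of "\<bar>(real N - 1) / real N\<bar>" 1] c by simp
  let ?s = "(\<Sum>r\<in>{..<m} - {j}. Q (card (tog r (tog j T)))) - real m * Q (card (tog m (tog j T)))"
  have 4: "\<bar>q * ?s\<bar> <= q * (real m + real m)"
   unfolding abs_mult abs_of_nonneg[OF q(1)] using 1 2 by (intro mult_left_mono q) linarith
  have "\<bar>(real N - 1) / real N * Q (card T) + q * ?s\<bar> <= 1 + q * (real m + real m)" using 3 4 by linarith
  then show ?thesis
   unfolding lamN_def lamE_def abs_mult abs_of_nonneg[OF be] by (intro mult_left_mono be)
 qed
 let ?W = "%l l'. cw1 m l * cw2 m l' * Q (card (tog l (tog l' T)))"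
 have s2': "small (%N p f. be^2 / 2 * (\<Sum>l<m+2. \<Sum>l'\<in>{..<m+2} - {l}. ?W l l' * (r0 l l' N p f - \<rho> l l' N f)))"
  by (intro small_cmult small_sum s2) auto
 have s3l: "small (%N p f. \<Sum>i\<in>UNIV. lamN T N (io i) * (D0 (Inl i) N p f - Dk (Inl i) N f))"
  by (intro small_sum small_mult[OF s3, of _ "be * (1 + q * (real m + real m))"] lamb) auto
 have s3r: "small (%N p f. \<Sum>i\<in>UNIV. Q (card (tog (io i) T)) * (D0 (Inr i) N p f - Dk (Inr i) N f))"
  by (intro small_sum small_cmult s3)
 have sc': "small (%N p f. \<Sum>i\<in>UNIV. A i N p f - lamN T N (io i) * D0 (Inl i) N p f)"
  and sd': "small (%N p f. \<Sum>i\<in>UNIV. B i N p f - Q (card (tog (io i) T)) * D0 (Inr i) N p f)"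
  by (rule small_sum, rule sc) (rule small_sum, rule sd)
 note all = small_add[OF small_add[OF small_add[OF small_add[OF small_add[OF small_add[OF sa sb] sc'] sd'] s2'] s3l] s3r]
 show ?thesis
  by (rule small_cong[OF all]) (simp only: right_diff_distrib sum_subtractf; simp?)
qed

definition "wQ T l l' = Q (card (tog l (tog l' T))) - Q (card T) * q"

lemma tog_pair: "l ~= l' ==> card (tog l (tog l' {})) = 2"
 by (simp add: tog_def)

lemma Q0: "Q 0 = 1"
 using std_gauss.prob_space by (simp add: tmom_def)

text \<open>Subtracting the expansion for the empty product removes the unknown cavity average of \<open>f\<close>; the average over
\<open>p\<close> turns spins into overlaps or magnetizations.\<close>

lemma star2:
 assumes T: "T \<subseteq> {..<m}"
 shows "appr (%N f. (\<Sum>p=1..N. zT T N p f) / real N - Q (card T) * (rtN N * E N m (%g s. f (X N g s)))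
  - be\<^sup>2 / 2 * (\<Sum>l<m+2. \<Sum>l'\<in>{..<m+2} - {l}. cw1 m l * cw2 m l' * wQ T l l' * \<rho> l l' N f))"
proof -
 define lam where "lam = (%j. be * (q * (((\<Sum>r\<in>{..<m} - {j}. Q (card (tog r (tog j T)))) - m * Q (card (tog m (tog j T))))
   - Q (card T) * ((\<Sum>r\<in>{..<m} - {j}. Q (card (tog r (tog j {})))) - m * Q (card (tog m (tog j {})))))))"
 have lam: "lamN T N j - Q (card T) * lamN {} N j = lam j" for N j
  by (simp add: lamN_def lamE_def lam_def Q0 algebra_simps)
 define mu where "mu = (%i. Q (card (tog (io i) T)) - Q (card T) * Q (card (tog (io i) {})))"
 let ?S = "%u N f. \<Sum>l<m+2. \<Sum>l'\<in>{..<m+2} - {l}. cw1 m l * cw2 m l' * u l l' * \<rho> l l' N f"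
 have d: "small (%N p f. zT T N p f - Q (card T) * zT {} N p f - be\<^sup>2 / 2 * ?S (wQ T) N f
   - (\<Sum>i\<in>UNIV. lam (io i) * Dk (Inl i) N f) - (\<Sum>i\<in>UNIV. mu i * Dk (Inr i) N f))"
 proof (rule small_cong[OF small_add[OF star1[OF T] small_cmult[OF star1[of "{}"], of "- Q (card T)"]]])
  fix N p f
  have S: "?S (wQ T) N f = ?S (%l l'. Q (card (tog l (tog l' T)))) N f - Q (card T) * ?S (%l l'. Q (card (tog l (tog l' {})))) N f"
  proof -
   have "?S (wQ T) N f = (\<Sum>l<m+2. \<Sum>l'\<in>{..<m+2} - {l}. cw1 m l * cw2 m l' * Q (card (tog l (tog l' T))) * \<rho> l l' N f
     - Q (card T) * (cw1 m l * cw2 m l' * Q (card (tog l (tog l' {}))) * \<rho> l l' N f))"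
    by (intro sum.cong refl) (simp add: wQ_def tog_pair Q2 algebra_simps)
   then show ?thesis by (simp only: sum_subtractf sum_distrib_left)
  qed
  have L: "(\<Sum>i\<in>UNIV. lam (io i) * Dk (Inl i) N f) = (\<Sum>i\<in>UNIV. lamN T N (io i) * Dk (Inl i) N f) - Q (card T) * (\<Sum>i\<in>UNIV. lamN {} N (io i) * Dk (Inl i) N f)"
   unfolding lam[of N, symmetric] by (simp add: left_diff_distrib sum_subtractf sum_distrib_left mult.assoc)
  have M: "(\<Sum>i\<in>UNIV. mu i * Dk (Inr i) N f) = (\<Sum>i\<in>UNIV. Q (card (tog (io i) T)) * Dk (Inr i) N f) - Q (card T) * (\<Sum>i\<in>UNIV. Q (card (tog (io i) {})) * Dk (Inr i) N f)"
   unfolding mu_def by (simp add: left_diff_distrib sum_subtractf sum_distrib_left mult.assoc)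
  show "zT T N p f - Q (card T) * zT {} N p f - be\<^sup>2 / 2 * ?S (wQ T) N f
   - (\<Sum>i\<in>UNIV. lam (io i) * Dk (Inl i) N f) - (\<Sum>i\<in>UNIV. mu i * Dk (Inr i) N f) =
   (zT T N p f - rtN N * Q (card T) * n0f N p f - be\<^sup>2 / 2 * ?S (%l l'. Q (card (tog l (tog l' T)))) N f
    - (\<Sum>i\<in>UNIV. lamN T N (io i) * Dk (Inl i) N f) - (\<Sum>i\<in>UNIV. Q (card (tog (io i) T)) * Dk (Inr i) N f))
   + - Q (card T) * (zT {} N p f - rtN N * Q (card ({}::nat set)) * n0f N p f - be\<^sup>2 / 2 * ?S (%l l'. Q (card (tog l (tog l' {})))) N f
    - (\<Sum>i\<in>UNIV. lamN {} N (io i) * Dk (Inl i) N f) - (\<Sum>i\<in>UNIV. Q (card (tog (io i) {})) * Dk (Inr i) N f))"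
   unfolding S L M card.empty Q0 by (simp only: algebra_simps)
 qed simp
 have "small (%N p f. (\<Sum>p=1..N. zT T N p f) / real N - Q (card T) * (rtN N * E N m (%g s. f (X N g s)))
  - be\<^sup>2 / 2 * ?S (wQ T) N f - (\<Sum>k\<in>UNIV. (case k of Inl i => lam (io i) | Inr i => mu i) * Dk k N f))"
 proof (rule small_cong[OF small_site_average[OF d]])
  fix N p a K f assume "(1::nat) <= p" "p <= N"
  then have N: "real N ~= 0" by simp
  let ?c = "Q (card T) * (rtN N * E N m (%g s. f (X N g s))) + be^2 / 2 * ?S (wQ T) N f + (\<Sum>k\<in>UNIV. (case k of Inl i => lam (io i) | Inr i => mu i) * Dk k N f)"
  have "(\<Sum>p=1..N. zT T N p f - Q (card T) * zT {} N p f - be\<^sup>2 / 2 * ?S (wQ T) N f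
   - (\<Sum>i\<in>UNIV. lam (io i) * Dk (Inl i) N f) - (\<Sum>i\<in>UNIV. mu i * Dk (Inr i) N f)) = (\<Sum>p=1..N. zT T N p f - ?c)"
   by (intro sum.cong refl) (simp add: zT_def sum_sum_type)
  also have "... = (\<Sum>p=1..N. zT T N p f) - real N * ?c" by (simp only: sum_subtractf sum_constant card_atLeastAtMost) simp
  finally show "(\<Sum>p=1..N. zT T N p f) / real N - Q (card T) * (rtN N * E N m (%g s. f (X N g s)))
   - be\<^sup>2 / 2 * ?S (wQ T) N f - (\<Sum>k\<in>UNIV. (case k of Inl i => lam (io i) | Inr i => mu i) * Dk k N f) =
   (\<Sum>p=1..N. zT T N p f - Q (card T) * zT {} N p f - be\<^sup>2 / 2 * ?S (wQ T) N f
   - (\<Sum>i\<in>UNIV. lam (io i) * Dk (Inl i) N f) - (\<Sum>i\<in>UNIV. mu i * Dk (Inr i) N f)) / real N"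
   using N by (simp only: diff_divide_distrib nonzero_mult_div_cancel_left not_False_eq_True diff_diff_eq)
 qed
 then show ?thesis by (rule apprI)
qed

end

section \<open>Solving the cavity equations\<close>

lemma offdiag_row:
 fixes f :: "nat => nat => real"
 assumes "k < M"
 shows "(\<Sum>l<M. \<Sum>l'\<in>{..<M} - {l}. (if l = k then 1 else 0) * f l l') = (\<Sum>l'\<in>{..<M} - {k}. f k l')"
proof -
 have "(\<Sum>l<M. \<Sum>l'\<in>{..<M} - {l}. (if l = k then 1 else 0) * f l l') = (\<Sum>l<M. if l = k then (\<Sum>l'\<in>{..<M} - {k}. f k l') else 0)"
  by (intro sum.cong refl) simp
 then show ?thesis using assms by simp
qed

lemma offdiag_eq:
 fixes f :: "nat => nat => real"
 shows "(\<Sum>l<M. \<Sum>l'<M. f l l') = (\<Sum>l<M. \<Sum>l'\<in>{..<M} - {l}. f l l') + (\<Sum>l<M. f l l)"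
 unfolding sum.distrib[symmetric] by (intro sum.cong refl) (simp add: sum.remove add.commute)

lemma offdiag_swap:
 fixes f :: "nat => nat => real"
 shows "(\<Sum>l<M. \<Sum>l'\<in>{..<M} - {l}. f l l') = (\<Sum>l<M. \<Sum>l'\<in>{..<M} - {l}. f l' l)"
 using offdiag_eq[of f M] offdiag_eq[of "%l l'. f l' l" M]
  sum.swap[of f "{..<M}" "{..<M}"] by simp

lemma offdiag_col:
 fixes f :: "nat => nat => real"
 assumes "k < M"
 shows "(\<Sum>l<M. \<Sum>l'\<in>{..<M} - {l}. (if l' = k then 1 else 0) * f l l') = (\<Sum>l\<in>{..<M} - {k}. f l k)"
 unfolding offdiag_swap[of "%l l'. (if l' = k then 1 else 0) * f l l'"] by (rule offdiag_row[OF assms])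

text \<open>The quadratic interpolation of the three possible cardinalities 0, 2, 4 in the indicators of the pair.\<close>

lemma tog_pair_poly:
 assumes "k ~= a" "l ~= l'"
 shows "F (card (tog l (tog l' {k, a}))) = F 4 + (F 2 - F 4) * (((if l = k then 1 else 0) + (if l = a then 1 else 0)) + ((if l' = k then 1 else 0) + (if l' = a then 1 else 0)))
  + (F 0 - 2 * F 2 + F 4 :: real) * (((if l = k then 1 else 0) + (if l = a then 1 else 0)) * ((if l' = k then 1 else 0) + (if l' = a then 1 else 0)))"
proof -
 have "F (Suc (Suc 0)) = F 2" "F (Suc (Suc (Suc (Suc 0)))) = F 4"
  by (simp_all add: numeral_eq_Suc)
 then show ?thesis
  using assms by (auto simp: tog_def algebra_simps card_insert_if insert_Diff_if)
qed

lemma offdiag_pair: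
 fixes r :: "nat => nat => real" and a0 a1 a2 :: real
 assumes k: "k < m" "a < m" "k ~= a" and sym: "!!l l'. r l l' = r l' l"
  and W: "!!l l'. l ~= l' ==> W l l' = a0 + a1 * (((if l = k then 1 else 0) + (if l = a then 1 else 0)) + ((if l' = k then 1 else 0) + (if l' = a then 1 else 0)))
  + a2 * (((if l = k then 1 else 0) + (if l = a then 1 else 0)) * ((if l' = k then 1 else 0) + (if l' = a then 1 else 0)))"
 shows "(\<Sum>l<m+2. \<Sum>l'\<in>{..<m+2} - {l}. cw1 m l * cw2 m l' * W l l' * r l l') =
  a0 * (\<Sum>l<m+2. \<Sum>l'\<in>{..<m+2} - {l}. cw1 m l * cw2 m l' * r l l')
  + a1 * ((\<Sum>l\<in>{..<m+2} - {k}. (cw1 m l + cw2 m l) * r k l) + (\<Sum>l\<in>{..<m+2} - {a}. (cw1 m l + cw2 m l) * r a l))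
  + 2 * a2 * r k a"
proof -
 let ?d = "%k l. if l = (k::nat) then 1 else (0::real)"
 let ?c = "%l l'. cw1 m l * cw2 m l' * r l l'"
 let ?S = "%g. \<Sum>l<m+2. \<Sum>l'\<in>{..<m+2} - {l}. g l l'"
 have cw: "cw1 m j = 1" "cw2 m j = 1" if "j < m" for j using that by (simp_all add: cw1_def cw2_def)
 have row: "?S (%l l'. ?d j l * ?c l l') = (\<Sum>l\<in>{..<m+2} - {j}. cw2 m l * r j l)" if "j < m" for j
  by (subst offdiag_row) (use that in \<open>simp_all add: cw\<close>)
 have col: "?S (%l l'. ?d j l' * ?c l l') = (\<Sum>l\<in>{..<m+2} - {j}. cw1 m l * r j l)" if "j < m" for j
  by (subst offdiag_col) (use that in \<open>simp_all add: cw sym[of _ j]\<close>)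
 have B: "?S (%l l'. ?d j l * ?c l l') + ?S (%l l'. ?d j l' * ?c l l') = (\<Sum>l\<in>{..<m+2} - {j}. (cw1 m l + cw2 m l) * r j l)" if "j < m" for j
  unfolding row[OF that] col[OF that] by (simp add: sum.distrib[symmetric] distrib_right add.commute)
 have P: "?S (%l l'. ?d i l * (?d j l' * ?c l l')) = r i j" if "i < m" "j < m" "i ~= j" for i j
 proof -
  have "?S (%l l'. ?d i l * (?d j l' * ?c l l')) = (\<Sum>l'\<in>{..<m+2} - {i}. ?d j l' * ?c i l')"
   using that by (subst offdiag_row) auto
  also have "... = (\<Sum>l'\<in>{..<m+2} - {i}. if l' = j then ?c i j else 0)" by (intro sum.cong refl) simp
  also have "... = r i j" using that by (simp add: cw)
  finally show ?thesis .
 qed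
 have "?S (%l l'. cw1 m l * cw2 m l' * W l l' * r l l') =
  ?S (%l l'. a0 * ?c l l' + a1 * ((?d k l * ?c l l' + ?d k l' * ?c l l') + (?d a l * ?c l l' + ?d a l' * ?c l l'))
   + a2 * (?d k l * (?d a l' * ?c l l') + ?d a l * (?d k l' * ?c l l')))"
 proof (intro sum.cong refl)
  fix l l' assume "l' \<in> {..<m+2} - {l}"
  then have ll: "l ~= l'" by auto
  have dd: "?d k l * ?d k l' = 0" "?d a l * ?d a l' = 0" using ll by auto
  show "cw1 m l * cw2 m l' * W l l' * r l l' =
   a0 * ?c l l' + a1 * ((?d k l * ?c l l' + ?d k l' * ?c l l') + (?d a l * ?c l l' + ?d a l' * ?c l l'))
   + a2 * (?d k l * (?d a l' * ?c l l') + ?d a l * (?d k l' * ?c l l'))"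
   unfolding W[OF ll] using dd by algebra
 qed
 also have "... = a0 * ?S ?c + a1 * ((?S (%l l'. ?d k l * ?c l l') + ?S (%l l'. ?d k l' * ?c l l')) + (?S (%l l'. ?d a l * ?c l l') + ?S (%l l'. ?d a l' * ?c l l')))
   + a2 * (?S (%l l'. ?d k l * (?d a l' * ?c l l')) + ?S (%l l'. ?d a l * (?d k l' * ?c l l')))"
  unfolding sum.distrib sum_distrib_left[symmetric] ..
 also have "... = a0 * ?S ?c + a1 * ((\<Sum>l\<in>{..<m+2} - {k}. (cw1 m l + cw2 m l) * r k l) + (\<Sum>l\<in>{..<m+2} - {a}. (cw1 m l + cw2 m l) * r a l)) + a2 * (r k a + r a k)"
  unfolding B[OF k(1)] B[OF k(2)] P[OF k(1,2,3)] P[OF k(2,1) k(3)[symmetric]] ..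
 finally show ?thesis unfolding sym[of a k] by simp
qed

context hightemp
begin

lemma N_est: "1 <= N ==> est N 1 be h q io n C0"
 by (rule est_inst) auto

lemma iota_less: "io i < n"
 using io by (auto simp: bij_betw_def)

lemma site_average:
 assumes f: "tame a K f" and N: "1 <= N" and m': "n <= m'"
 shows "(\<Sum>p=1..N. E N m' (%g s. (\<Prod>r\<in>T. s r p) * f (X N g s))) / real N =
  E N m' (%g s. (1 / real N * (\<Sum>p=1..N. \<Prod>r\<in>T. s r p)) * f (X N g s))"
proof -
 have "E N m' (%g s. (1 / real N * (\<Sum>p=1..N. \<Prod>r\<in>T. s r p)) * f (X N g s)) =
  E N m' (%g s. 1 / real N * (\<Sum>p=1..N. (\<Prod>r\<in>T. s r p) * f (X N g s)))"
  by (simp only: sum_distrib_right mult.assoc)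
 also have "... = 1 / real N * (\<Sum>p=1..N. E N m' (%g s. (\<Prod>r\<in>T. s r p) * f (X N g s)))"
  unfolding sk.gex_cmult by (subst sk.gex_sum[OF grows_mult[OF grows_const X_grows(1)[OF f m' N]]]) rule
 finally show ?thesis by simp
qed

lemma zT_average:
 assumes f: "tame a K f" and N: "1 <= N"
 shows "(\<Sum>p=1..N. zT T N p f) / real N =
  rtN N * E N m (%g s. (1 / real N * (\<Sum>p=1..N. \<Prod>r\<in>T. s r p)) * f (X N g s))"
proof -
 have "n <= m" by (simp add: m_def)
 from site_average[OF f N this, of T, symmetric] show ?thesis
  by (simp only: zT_def sum_distrib_left[symmetric] times_divide_eq_right)
qed

subsection \<open>Symmetries of the overlap functionals\<close>

lemma rho_sym: "\<rho> l l' = \<rho> l' l"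
 unfolding \<rho>_def overlap_def by (simp add: mult.commute fun_eq_iff)

lemma rho_perm:
 assumes \<pi>: "inj_on \<pi> {..<m+2}" "\<pi> ` {..<m+2} \<subseteq> {..<m+2}" "!!i. i < n ==> \<pi> i = i" and l: "l < m + 2" "l' < m + 2"
 shows "\<rho> (\<pi> l) (\<pi> l') N f = \<rho> l l' N f"
proof -
 have nm: "n <= m + 2" by (simp add: m_def)
 let ?F = "%g s. (overlap N (s l) (s l') - q) * f (X N g s)"
 have d: "dep {..<m+2} (?F g)" for g
  using l by (intro depI arg_cong2[where f = "(*)"]) (auto intro: depD[OF dep_X[OF nm]])
 have X: "X N g (%j. s (\<pi> j)) = X N g s" for g s
  by (simp add: X_def \<pi>(3) iota_less)
 show ?thesis
  unfolding \<rho>_def using sk.gex_reindex[OF \<pi>(1,2) d, of N be h] by (simp add: X)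
qed

text \<open>Replicas with labels at least \<open>n\<close> do not occur in \<open>X\<close> and are exchangeable.\<close>

lemma rho_swap:
 assumes c: "n <= c" "c < m + 2" "n <= d" "d < m + 2" and l: "l < m + 2" "l' < m + 2"
 shows "\<rho> (Transposition.transpose c d l) (Transposition.transpose c d l') = \<rho> l l'"
proof (intro ext rho_perm l)
 show "inj_on (Transposition.transpose c d) {..<m+2}" by (rule inj_on_subset[OF inj_transpose]) simp
 show "Transposition.transpose c d ` {..<m+2} \<subseteq> {..<m+2}" using c by (auto simp: Transposition.transpose_def)
 show "Transposition.transpose c d i = i" if "i < n" for i using c that by (simp add: Transposition.transpose_def)
qed

lemma rho_fresh:
 assumes "j < n" "n <= c" "c < m + 2"
 shows "\<rho> j c = \<rho> j n"
proof -
 have "n < m + 2" by (simp add: m_def)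
 with rho_swap[of n c j n] assms show ?thesis by (simp add: Transposition.transpose_def)
qed

lemma rho_fresh2:
 assumes "n <= c" "c < m + 2" "n <= d" "d < m + 2" "c ~= d"
 shows "\<rho> c d = \<rho> n (n + 1)"
proof -
 have b: "n < m + 2" "n + 1 < m + 2" by (simp_all add: m_def)
 have 1: "\<rho> c d = \<rho> n d" if "n <= c" "c < m + 2" "n <= d" "d < m + 2" "c ~= d" "d ~= n" for c d
  using rho_swap[of n c n d] that b by (simp add: Transposition.transpose_def)
 have 2: "\<rho> n d = \<rho> n (n + 1)" if "n <= d" "d < m + 2" "d ~= n" for d
  using rho_swap[of d "n + 1" n d] that b by (simp add: Transposition.transpose_def split: if_splits)
 show ?thesis
 proof (cases "d = n")
  case True
  then show ?thesis using 2[of c] assms by (simp add: rho_sym[of c])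
 next
  case False
  then show ?thesis using 1[OF assms] 2[of d] assms by simp
 qed
qed

subsection \<open>The linear system\<close>

abbreviation "\<alpha>0 \<equiv> Q 4 - q\<^sup>2"
abbreviation "\<alpha>1 \<equiv> q - Q 4"
abbreviation "\<alpha>2 \<equiv> 1 - 2 * q + Q 4"

definition "Brow j N f = (\<Sum>l\<in>{..<m+2} - {j}. (cw1 m l + cw2 m l) * \<rho> j l N f)"
definition "A0 N f = (\<Sum>l<m+2. \<Sum>l'\<in>{..<m+2} - {l}. cw1 m l * cw2 m l' * \<rho> l l' N f)"

lemma wQ_pair:
 assumes "k ~= a" "l ~= l'"
 shows "wQ {k, a} l l' = \<alpha>0 + \<alpha>1 * (((if l = k then 1 else 0) + (if l = a then 1 else 0)) + ((if l' = k then 1 else 0) + (if l' = a then 1 else 0)))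
  + \<alpha>2 * (((if l = k then 1 else 0) + (if l = a then 1 else 0)) * ((if l' = k then 1 else 0) + (if l' = a then 1 else 0)))"
 unfolding wQ_def tog_pair_poly[of k a l l' Q, OF assms] using assms by (simp add: Q0 Q2 Q2[unfolded numeral_2_eq_2] power2_eq_square)

lemma offdiag_wQ:
 assumes k: "k < m" "a < m" "k ~= a"
 shows "(\<Sum>l<m+2. \<Sum>l'\<in>{..<m+2} - {l}. cw1 m l * cw2 m l' * wQ {k, a} l l' * \<rho> l l' N f) =
  \<alpha>0 * A0 N f + \<alpha>1 * (Brow k N f + Brow a N f) + 2 * \<alpha>2 * \<rho> k a N f"
 unfolding A0_def Brow_def
 by (rule offdiag_pair[OF k]) (use rho_sym wQ_pair[OF k(3)] in \<open>metis+\<close>)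

lemma cavity_system:
 assumes k: "k < m" "a < m" "k ~= a"
 shows "appr (%N f. (1 - be\<^sup>2 * \<alpha>2) * \<rho> k a N f - be\<^sup>2 / 2 * (\<alpha>0 * A0 N f + \<alpha>1 * (Brow k N f + Brow a N f)))"
proof (rule appr_cong[OF star2[of "{k, a}"]])
 show "{k, a} \<subseteq> {..<m}" using k by simp
 fix N :: nat and A K f assume N: "1 <= N" and f: "tame A K (f :: real ^ ('n + 'n) => real)"
 have nm: "n <= m" by (simp add: m_def)
 have p: "(\<Prod>r\<in>{k, a}. s r p) = s k p * s a p" for s :: "nat => nat => real" and p using k by simp
 have d: "dep {..<m} (%s. (overlap N (s k) (s a) - q) * f (X N g s))" for g
  using k by (intro depI arg_cong2[where f = "(*)"]) (auto intro: depD[OF dep_X[OF nm]])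
 have "\<rho> k a N f = rtN N * E N m (%g s. (overlap N (s k) (s a) - q) * f (X N g s))"
  unfolding \<rho>_def by (subst sk.gex_superset[OF d]) simp_all
 also have "E N m (%g s. (overlap N (s k) (s a) - q) * f (X N g s)) =
  E N m (%g s. overlap N (s k) (s a) * f (X N g s)) - q * E N m (%g s. f (X N g s))"
  unfolding left_diff_distrib by (simp only: sk.gex_diff[OF grows_mult[OF grows_const X_grows(1)[OF f nm N]] grows_mult[OF grows_const X_grows(1)[OF f nm N]]] sk.gex_cmult)
 finally have r: "(\<Sum>p=1..N. zT {k, a} N p f) / real N - Q (card {k, a}) * (rtN N * E N m (%g s. f (X N g s))) = \<rho> k a N f"
  unfolding zT_average[OF f N] p overlap_def[symmetric] using k by (simp add: Q2[unfolded numeral_2_eq_2] algebra_simps)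
 show "(1 - be\<^sup>2 * \<alpha>2) * \<rho> k a N f - be\<^sup>2 / 2 * (\<alpha>0 * A0 N f + \<alpha>1 * (Brow k N f + Brow a N f)) =
  (\<Sum>p=1..N. zT {k, a} N p f) / real N - Q (card {k, a}) * (rtN N * E N m (%g s. f (X N g s)))
  - be\<^sup>2 / 2 * (\<Sum>l<m+2. \<Sum>l'\<in>{..<m+2} - {l}. cw1 m l * cw2 m l' * wQ {k, a} l l' * \<rho> l l' N f)"
  unfolding r offdiag_wQ[OF k] by (simp add: algebra_simps)
qed

definition "vv j N f = be^2 / (2 * (1 - be\<^sup>2 * \<alpha>2)) * (\<alpha>0 / 2 * A0 N f + \<alpha>1 * Brow j N f)"
definition "tt l = vv (min l n)"

lemma x_pos': "0 < 1 - be\<^sup>2 * \<alpha>2" using x_pos by simp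

text \<open>Once the diagonal term is moved to the left, the right side is a sum of a function of \<open>k\<close> and one of \<open>a\<close>.\<close>

lemma rho_vv:
 assumes k: "k < m" "a < m" "k ~= a"
 shows "appr (%N f. \<rho> k a N f - (vv k N f + vv a N f))"
proof (rule appr_cong[OF appr_cmult[OF cavity_system[OF k], of "1 / (1 - be\<^sup>2 * \<alpha>2)"]])
 fix N f
 show "\<rho> k a N f - (vv k N f + vv a N f) = 1 / (1 - be\<^sup>2 * \<alpha>2) * ((1 - be\<^sup>2 * \<alpha>2) * \<rho> k a N f - be\<^sup>2 / 2 * (\<alpha>0 * A0 N f + \<alpha>1 * (Brow k N f + Brow a N f)))"
 proof -
  define x where "x = 1 - be\<^sup>2 * \<alpha>2"
  have "x ~= 0" using x_pos' by (simp add: x_def)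
  then show ?thesis unfolding vv_def x_def[symmetric] by (simp add: field_simps)
 qed
qed

lemma Brow_fresh: "Brow (n + 1) = Brow n"
proof (intro ext)
 fix N f
 let ?t = "Transposition.transpose n (n + 1)"
 have b: "n < m" "n + 1 < m" by (simp_all add: m_def)
 have "Brow n N f = (\<Sum>l\<in>{..<m+2} - {n + 1}. (cw1 m (?t l) + cw2 m (?t l)) * \<rho> n (?t l) N f)"
  unfolding Brow_def
  by (rule sum.reindex_bij_betw[symmetric], rule bij_betw_byWitness[of _ ?t]) (use b in \<open>auto simp: Transposition.transpose_def split: if_splits\<close>)
 also have "... = Brow (n + 1) N f"
  unfolding Brow_def
 proof (intro sum.cong refl)
  fix l assume l: "l \<in> {..<m+2} - {n + 1}"
  have "\<rho> n (?t l) = \<rho> (n + 1) l"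
   using rho_swap[of n "n + 1" "n + 1" l] l b by (simp add: Transposition.transpose_def split: if_splits)
  moreover have "cw1 m (?t l) = cw1 m l" "cw2 m (?t l) = cw2 m l"
   using b by (auto simp: Transposition.transpose_def cw1_def cw2_def)
  ultimately show "(cw1 m (?t l) + cw2 m (?t l)) * \<rho> n (?t l) N f = (cw1 m l + cw2 m l) * \<rho> (n + 1) l N f" by simp
 qed
 finally show "Brow (n + 1) N f = Brow n N f" by simp
qed

lemma rho_tt:
 assumes "l < m + 2" "l' < m + 2" "l ~= l'"
 shows "appr (%N f. \<rho> l l' N f - (tt l N f + tt l' N f))"
proof -
 have b: "n < m" "n + 1 < m" by (simp_all add: m_def)
 have v: "vv (n + 1) = vv n" by (simp only: vv_def Brow_fresh fun_eq_iff) simp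
 have *: "appr (%N f. \<rho> l l' N f - (tt l N f + tt l' N f))" if l: "l < m + 2" "l' < m + 2" "l < l'" for l l'
 proof -
  consider "l' < n" | "l < n" "n <= l'" | "n <= l" using l by linarith
  then show ?thesis
  proof cases
   case 1
   then show ?thesis using rho_vv[of l l'] l b by (simp add: tt_def)
  next
   case 2
   then show ?thesis using rho_vv[of l n] rho_fresh[of l l'] l b by (simp add: tt_def)
  next
   case 3
   then show ?thesis using rho_vv[of n "n + 1"] rho_fresh2[of l l'] l b v by (simp add: tt_def)
  qed
 qed
 consider "l < l'" | "l' < l" using assms by linarith
 then show ?thesis
 proof cases
  case 2
  then show ?thesis using *[of l' l] assms by (simp add: rho_sym[of l'] add.commute)
 qed (use * assms in simp)
qed

text \<open>Insert \<open>rho_tt\<close> into the definition of \<open>vv\<close>. Since both weights sum to 0, only the deviation of the sum of \<open>tt\<close>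
from its value for equal replicas remains.\<close>

lemma tt_system:
 assumes j: "j < m"
 shows "appr (%N f. tt j N f - be\<^sup>2 / (2 * (1 - be\<^sup>2 * \<alpha>2)) * (\<alpha>1 * (2 * ((\<Sum>l<m. tt l N f) - real m * tt n N f) - 4 * tt j N f)
   - \<alpha>0 * ((\<Sum>l<m. tt l N f) - real m * tt n N f)))"
proof -
 let ?j = "min j n" and ?r = "%l l' N f. \<rho> l l' N f - (tt l N f + tt l' N f)"
 have b: "n < m" "?j < m" "j < m + 2" using j by (auto simp: m_def)
 have A: "appr (%N f. \<Sum>l<m+2. \<Sum>l'\<in>{..<m+2} - {l}. cw1 m l * cw2 m l' * ?r l l' N f)"
  by (intro appr_sum appr_cmult rho_tt) auto
 have B: "appr (%N f. \<Sum>l\<in>{..<m+2} - {?j}. (cw1 m l + cw2 m l) * ?r ?j l N f)"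
  by (intro appr_sum appr_cmult rho_tt) (use b in auto)
 note AB = appr_cmult[OF appr_add[OF appr_cmult[OF A, of "\<alpha>0 / 2"] appr_cmult[OF B, of \<alpha>1]], of "be^2 / (2 * (1 - be\<^sup>2 * \<alpha>2))"]
 show ?thesis
 proof (rule appr_cong[OF AB])
  fix N f
  let ?t = "%l. tt l N f"
  let ?\<Theta> = "(\<Sum>l<m. ?t l) - real m * ?t n"
  have ts: "?t m = ?t n" "?t (Suc m) = ?t n" "?t ?j = ?t j" by (simp_all add: tt_def m_def)
  have sp: "(\<Sum>l<m+2. u l) = (\<Sum>l<m. u l) + u m + u (Suc m)" for u :: "nat => real" by simp
  have cwm: "(\<Sum>l<m. cw1 m l * u l) = (\<Sum>l<m. u l)" "(\<Sum>l<m. cw2 m l * u l) = (\<Sum>l<m. u l)" for u :: "nat => real"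
   by (intro sum.cong refl; simp add: cw1_def cw2_def)+
  have cwl: "cw1 m m = 1" "cw1 m (Suc m) = - real (m + 1)" "cw2 m m = - real m" "cw2 m (Suc m) = 0" by (simp_all add: cw1_def cw2_def)
  have s1: "(\<Sum>l<m+2. cw1 m l * ?t l) = ?\<Theta>" "(\<Sum>l<m+2. cw2 m l * ?t l) = ?\<Theta>"
   unfolding sp cwm cwl ts by (simp_all add: algebra_simps)
  have s2: "(\<Sum>l<m+2. cw1 m l * (cw2 m l * ?t l)) = ?\<Theta>"
   unfolding sp cwm cwl ts by (simp add: algebra_simps)
  have s0: "(\<Sum>l<m+2. cw1 m l) = 0" "(\<Sum>l<m+2. cw2 m l) = 0"
   using cwm[of "%_. 1"] by (simp_all add: sp cwl)
  have SA: "(\<Sum>l<m+2. \<Sum>l'\<in>{..<m+2} - {l}. cw1 m l * cw2 m l' * (?t l + ?t l')) = - 2 * ?\<Theta>"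
  proof -
   have "(\<Sum>l<m+2. \<Sum>l'<m+2. cw1 m l * cw2 m l' * (?t l + ?t l')) =
    (\<Sum>l<m+2. cw1 m l * ?t l) * (\<Sum>l<m+2. cw2 m l) + (\<Sum>l<m+2. cw1 m l) * (\<Sum>l<m+2. cw2 m l * ?t l)"
    unfolding sum_product sum.distrib[symmetric] by (intro sum.cong refl) (simp add: algebra_simps)
   also have "... = 0" unfolding s0 by simp
   finally have "(\<Sum>l<m+2. \<Sum>l'\<in>{..<m+2} - {l}. cw1 m l * cw2 m l' * (?t l + ?t l')) + (\<Sum>l<m+2. cw1 m l * cw2 m l * (?t l + ?t l)) = 0"
    unfolding offdiag_eq .
   moreover have "(\<Sum>l<m+2. cw1 m l * cw2 m l * (?t l + ?t l)) = 2 * (\<Sum>l<m+2. cw1 m l * (cw2 m l * ?t l))"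
    unfolding sum_distrib_left by (intro sum.cong refl) simp
   ultimately show ?thesis unfolding s2 by linarith
  qed
  have SB: "(\<Sum>l\<in>{..<m+2} - {?j}. (cw1 m l + cw2 m l) * (?t ?j + ?t l)) = 2 * ?\<Theta> - 4 * ?t j"
  proof -
   have "(\<Sum>l<m+2. (cw1 m l + cw2 m l) * (?t ?j + ?t l)) = ((\<Sum>l<m+2. cw1 m l) + (\<Sum>l<m+2. cw2 m l)) * ?t ?j
    + ((\<Sum>l<m+2. cw1 m l * ?t l) + (\<Sum>l<m+2. cw2 m l * ?t l))"
    unfolding sum.distrib[symmetric] sum_distrib_right by (intro sum.cong refl) (simp add: algebra_simps)
   also have "... = 2 * ?\<Theta>" unfolding s0 s1 by simp
   finally have "(\<Sum>l<m+2. (cw1 m l + cw2 m l) * (?t ?j + ?t l)) = 2 * ?\<Theta>" .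
   moreover have "(\<Sum>l<m+2. (cw1 m l + cw2 m l) * (?t ?j + ?t l)) = (cw1 m ?j + cw2 m ?j) * (?t ?j + ?t ?j)
    + (\<Sum>l\<in>{..<m+2} - {?j}. (cw1 m l + cw2 m l) * (?t ?j + ?t l))"
    by (rule sum.remove) (use b in auto)
   moreover have "cw1 m ?j + cw2 m ?j = 2" using b by (simp add: cw1_def cw2_def)
   ultimately show ?thesis unfolding ts by simp
  qed
  have EA: "(\<Sum>l<m+2. \<Sum>l'\<in>{..<m+2} - {l}. cw1 m l * cw2 m l' * ?r l l' N f) = A0 N f + 2 * ?\<Theta>"
   unfolding right_diff_distrib sum_subtractf SA A0_def[symmetric] by simp
  have EB: "(\<Sum>l\<in>{..<m+2} - {?j}. (cw1 m l + cw2 m l) * ?r ?j l N f) = Brow ?j N f - (2 * ?\<Theta> - 4 * ?t j)"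
   unfolding right_diff_distrib sum_subtractf SB Brow_def[symmetric] ..
  show "?t j - be\<^sup>2 / (2 * (1 - be\<^sup>2 * \<alpha>2)) * (\<alpha>1 * (2 * ?\<Theta> - 4 * ?t j) - \<alpha>0 * ?\<Theta>) =
   be^2 / (2 * (1 - be\<^sup>2 * \<alpha>2)) * (\<alpha>0 / 2 * (\<Sum>l<m+2. \<Sum>l'\<in>{..<m+2} - {l}. cw1 m l * cw2 m l' * ?r l l' N f)
   + \<alpha>1 * (\<Sum>l\<in>{..<m+2} - {?j}. (cw1 m l + cw2 m l) * ?r ?j l N f))"
  proof -
   define u where "u = be^2 / (2 * (1 - be\<^sup>2 * \<alpha>2))"
   define th where "th = ?\<Theta>"
   define a0 where "a0 = \<alpha>0 / 2"
   have a: "\<alpha>0 = 2 * a0" by (simp add: a0_def)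
   have e: "?t j = u * (a0 * A0 N f + \<alpha>1 * Brow ?j N f)" by (simp add: tt_def vv_def u_def a0_def)
   have gen: "u * (a0 * A + a1 * B) - u * (a1 * (2 * th - 4 * t) - 2 * a0 * th) = u * (a0 * (A + 2 * th) + a1 * (B - (2 * th - 4 * t)))"
    for t a1 A B :: real by (simp add: algebra_simps)
   show ?thesis
    unfolding EA EB u_def[symmetric] th_def[symmetric] a
    using gen[of "A0 N f" \<alpha>1 "Brow ?j N f" "?t j"] unfolding e[symmetric] by simp
  qed
 qed
qed

lemma Q4_le: "Q 4 <= q"
proof -
 have le: "\<bar>tanh x ^ k\<bar> <= 1" for x :: real and k
  using tanh_real_bounds[of x] by (simp add: power_abs power_le_one abs_le_iff less_imp_le)
 have i: "integrable std_gauss (%z. tanh (be * (sqrt q * z) + be * h) ^ k)" for k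
  by (rule std_gauss.integrable_const_bound[of _ 1]) (auto simp: le measurable_cong_sets[OF sets_std_gauss refl])
 have "tanh x ^ 4 <= tanh x ^ 2" for x :: real
 proof -
  have "tanh x ^ 2 * tanh x ^ 2 <= tanh x ^ 2 * 1"
   using le[of x 2] by (intro mult_left_mono) auto
  then show ?thesis by (simp flip: power_add)
 qed
 then have "Q 4 <= Q 2" unfolding tmom_def by (intro integral_mono i)
 then show ?thesis by (simp add: Q2)
qed

text \<open>The right side of the system is the same for all labels, so differences of the \<open>tt\<close> are approximable; hence so
is the deviation on the right, and then each \<open>tt\<close>.\<close>

lemma tt_appr: "j < m ==> appr (tt j)"
proof -
 have y: "0 < 1 - be\<^sup>2 * \<alpha>2 + 2 * be^2 * \<alpha>1"
  using x_pos' Q4_le by (intro add_pos_nonneg mult_nonneg_nonneg) auto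
 let ?\<Theta> = "%N f. (\<Sum>l<m. tt l N f) - real m * tt n N f"
 define \<kappa> where "\<kappa> = be^2 * (\<alpha>1 - \<alpha>0 / 2)"
 have sys: "appr (%N f. (1 - be\<^sup>2 * \<alpha>2 + 2 * be^2 * \<alpha>1) * tt j N f - \<kappa> * ?\<Theta> N f)" if "j < m" for j
 proof (rule appr_cong[OF appr_cmult[OF tt_system[OF that], of "1 - be\<^sup>2 * \<alpha>2"]])
  fix N f
  define x where "x = 1 - be\<^sup>2 * \<alpha>2"
  define th where "th = ?\<Theta> N f"
  have x: "x ~= 0" using x_pos' by (simp add: x_def)
  have c: "x * (be^2 / (2 * x)) = be^2 / 2" using x by simp
  have e: "x * (tt j N f - be\<^sup>2 / (2 * x) * (\<alpha>1 * (2 * th - 4 * tt j N f) - \<alpha>0 * th)) =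
   x * tt j N f - be\<^sup>2 / 2 * (\<alpha>1 * (2 * th - 4 * tt j N f) - \<alpha>0 * th)"
   by (simp only: right_diff_distrib mult.assoc[symmetric] c)
  show "(1 - be\<^sup>2 * \<alpha>2 + 2 * be^2 * \<alpha>1) * tt j N f - \<kappa> * ?\<Theta> N f = (1 - be\<^sup>2 * \<alpha>2) * (tt j N f - be\<^sup>2 / (2 * (1 - be\<^sup>2 * \<alpha>2)) * (\<alpha>1 * (2 * ?\<Theta> N f - 4 * tt j N f) - \<alpha>0 * ?\<Theta> N f))"
   unfolding x_def[symmetric] th_def[symmetric] e by (simp add: \<kappa>_def field_simps)
 qed
 have nm: "n < m" by (simp add: m_def)
 have diff: "appr (%N f. tt j N f - tt n N f)" if "j < m" for j
 proof (rule appr_cancel[OF appr_cong[OF appr_diff[OF sys[OF that] sys[OF nm]]]])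
  show "1 - be\<^sup>2 * \<alpha>2 + 2 * be^2 * \<alpha>1 ~= 0" using y by linarith
  show "(1 - be\<^sup>2 * \<alpha>2 + 2 * be^2 * \<alpha>1) * (tt j N f - tt n N f) = (1 - be\<^sup>2 * \<alpha>2 + 2 * be^2 * \<alpha>1) * tt j N f - \<kappa> * ?\<Theta> N f -
   ((1 - be\<^sup>2 * \<alpha>2 + 2 * be^2 * \<alpha>1) * tt n N f - \<kappa> * ?\<Theta> N f)" for N f
   by (simp only: right_diff_distrib)
 qed
 have "appr (%N f. \<Sum>l<m. tt l N f - tt n N f)" by (intro appr_sum diff) auto
 then have \<Theta>: "appr ?\<Theta>" by (simp add: sum_subtractf)
 assume "j < m"
 show "appr (tt j)"
 proof (rule appr_cancel[OF appr_cong[OF appr_add[OF sys[OF \<open>j < m\<close>] appr_cmult[OF \<Theta>, of \<kappa>]]]])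
  show "1 - be\<^sup>2 * \<alpha>2 + 2 * be^2 * \<alpha>1 ~= 0" using y by linarith
 qed simp
qed

theorem rho_appr:
 assumes "l < m + 2" "l' < m + 2" "l ~= l'"
 shows "appr (\<rho> l l')"
proof -
 have m: "min l n < m" "min l' n < m" by (auto simp: m_def)
 have "appr (tt l)" "appr (tt l')" using tt_appr[OF m(1)] tt_appr[OF m(2)] by (simp_all add: tt_def)
 from appr_add[OF rho_tt[OF assms] appr_add[OF this]] show ?thesis by simp
qed

theorem magn_appr: "appr (%N f. E N n (%g s. magn_fluct N q1 (s (io i)) * f (X N g s)))"
proof -
 have T: "{io i} \<subseteq> {..<m}" using iota_less[of i] by (simp add: m_def)
 have A: "appr (%N f. be^2 / 2 * (\<Sum>l<m+2. \<Sum>l'\<in>{..<m+2} - {l}. cw1 m l * cw2 m l' * wQ {io i} l l' * \<rho> l l' N f))"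
  by (intro appr_cmult appr_sum rho_appr) auto
 show ?thesis
 proof (rule appr_cong[OF appr_add[OF star2[OF T] A]])
  fix N :: nat and a K f assume N: "1 <= N" and f: "tame a K (f :: real ^ ('n + 'n) => real)"
  have nm: "n <= m" by (simp add: m_def)
  have d: "dep {..<n} (%s. magn_fluct N q1 (s (io i)) * f (X N g s))" for g
   using iota_less by (intro depI arg_cong2[where f = "(*)"]) (auto intro: depD[OF dep_X[OF order_refl]])
  have "E N n (%g s. magn_fluct N q1 (s (io i)) * f (X N g s)) = E N m (%g s. magn_fluct N q1 (s (io i)) * f (X N g s))"
   by (rule sk.gex_superset[OF d nm, symmetric])
  also have "... = E N m (%g s. rtN N * ((1 / real N * (\<Sum>p=1..N. \<Prod>r\<in>{io i}. s r p)) * f (X N g s) - q1 * f (X N g s)))"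
   by (simp add: magn_fluct_def magnetization_def algebra_simps)
  also have "... = rtN N * (E N m (%g s. (1 / real N * (\<Sum>p=1..N. \<Prod>r\<in>{io i}. s r p)) * f (X N g s)) - q1 * E N m (%g s. f (X N g s)))"
   unfolding sk.gex_cmult by (simp only: sk.gex_diff[OF grows_mult[OF grows_const X_grows(1)[OF f nm N]] grows_mult[OF grows_const X_grows(1)[OF f nm N]]] sk.gex_cmult)
  also have "... = (\<Sum>p=1..N. zT {io i} N p f) / real N - Q (card {io i}) * (rtN N * E N m (%g s. f (X N g s)))"
   unfolding zT_average[OF f N] by (simp add: Q1[symmetric] right_diff_distrib)
  finally show "E N n (%g s. magn_fluct N q1 (s (io i)) * f (X N g s)) =
   (\<Sum>p=1..N. zT {io i} N p f) / real N - Q (card {io i}) * (rtN N * E N m (%g s. f (X N g s)))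
   - be\<^sup>2 / 2 * (\<Sum>l<m+2. \<Sum>l'\<in>{..<m+2} - {l}. cw1 m l * cw2 m l' * wQ {io i} l l' * \<rho> l l' N f)
   + be^2 / 2 * (\<Sum>l<m+2. \<Sum>l'\<in>{..<m+2} - {l}. cw1 m l * cw2 m l' * wQ {io i} l l' * \<rho> l l' N f)"
   by simp
 qed
qed

end

section \<open>The energy\<close>

definition pr :: "nat \<times> nat => (nat => real) => real" where
 "pr e sm = sm (fst e) * sm (snd e)"

lemma energy_pr: "energy N g sm = (\<Sum>e\<in>site_pairs N. 1 / rtN N * (g e * pr e sm))"
 unfolding energy_def pr_def case_prod_beta by (simp only: mult.assoc prod.collapse)

lemma sum_site_pairs:
 fixes u :: "nat => real"
 shows "2 * (\<Sum>e\<in>site_pairs N. u (fst e) * u (snd e)) + (\<Sum>i=1..N. u i * u i) = (\<Sum>i=1..N. u i)^2"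
proof (induction N)
 case 0
 have "site_pairs 0 = {}" by (auto simp: site_pairs_def)
 then show ?case by simp
next
 case (Suc N)
 have "site_pairs (Suc N) = site_pairs N \<union> (%i. (i, Suc N)) ` {1..N}" by (auto simp: site_pairs_def)
 moreover have "site_pairs N \<inter> (%i. (i, Suc N)) ` {1..N} = {}" by (auto simp: site_pairs_def)
 ultimately have "(\<Sum>e\<in>site_pairs (Suc N). u (fst e) * u (snd e)) = (\<Sum>e\<in>site_pairs N. u (fst e) * u (snd e)) + (\<Sum>i=1..N. u i) * u (Suc N)"
  by (simp add: sum.union_disjoint finite_site_pairs sum.reindex inj_on_def sum_distrib_right)
 then show ?case using Suc by (simp add: power2_eq_square algebra_simps)
qed

lemma sum_pr:
 assumes sm: "sm \<in> configs N" "\<tau> \<in> configs N" and N: "1 <= N"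
 shows "(\<Sum>e\<in>site_pairs N. pr e sm * pr e \<tau>) = (real N)^2 / 2 * ((overlap N sm \<tau>)^2 - 1 / real N)"
proof -
 let ?u = "%i. sm i * \<tau> i"
 have "(\<Sum>i=1..N. ?u i * ?u i) = (\<Sum>i=1..N. 1)"
 proof (intro sum.cong refl)
  fix i assume "i \<in> {1..N}"
  then have "sm i * sm i = 1" "\<tau> i * \<tau> i = 1" using configs_sq[OF sm(1), of i] configs_sq[OF sm(2), of i] by auto
  then show "?u i * ?u i = 1" by algebra
 qed
 moreover have "(\<Sum>e\<in>site_pairs N. pr e sm * pr e \<tau>) = (\<Sum>e\<in>site_pairs N. ?u (fst e) * ?u (snd e))"
  by (intro sum.cong refl) (simp add: pr_def)
 moreover have "(\<Sum>i=1..N. ?u i)^2 = (real N)^2 * (overlap N sm \<tau>)^2"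
  using N by (simp add: overlap_def power_divide)
 ultimately have "2 * (\<Sum>e\<in>site_pairs N. pr e sm * pr e \<tau>) + real N = (real N)^2 * (overlap N sm \<tau>)^2"
  using sum_site_pairs[where u = ?u and N = N] by simp
 then have "(\<Sum>e\<in>site_pairs N. pr e sm * pr e \<tau>) = ((real N)^2 * (overlap N sm \<tau>)^2 - real N) / 2" by simp
 moreover have "(real N)^2 * (1 / real N) = real N" using N by (simp add: power2_eq_square)
 moreover have "(real N)^2 / 2 * ((overlap N sm \<tau>)^2 - 1 / real N) = ((real N)^2 * (overlap N sm \<tau>)^2 - (real N)\<^sup>2 * (1 / real N)) / 2"
  by (simp only: right_diff_distrib diff_divide_distrib times_divide_eq_left)
 ultimately show ?thesis by simp
qed

lemma overlap_self: "sm \<in> configs N ==> 1 <= N ==> overlap N sm sm = 1"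
proof -
 assume "sm \<in> configs N" "1 <= N"
 then have "(\<Sum>i=1..N. sm i * sm i) = (\<Sum>i=1..N. 1)" by (intro sum.cong refl) (simp add: configs_sq)
 then show "overlap N sm sm = 1" using \<open>1 <= N\<close> by (simp add: overlap_def)
qed

lemma gex_by_parts:
 assumes e: "e \<in> site_pairs N"
  and gr: "grows N m F" "grows N m F'" and d: "!!g. dep {..<m} (F g)"
  and F: "!!g x s. s \<in> PiE {..<m} (%_. configs N) ==>
     ((%y. F (g(e := y)) s) has_real_derivative F' (g(e := x)) s) (at x)"
  and cont: "!!g s. s \<in> PiE {..<m} (%_. configs N) ==> continuous_on UNIV (%y. F' (g(e := y)) s)"
 shows "sk.gex N be h m (%g s. g e * F g s) = sk.gex N be h m F' +
  be / rtN N * sk.gex N be h (Suc m) (%g s. ((\<Sum>r<m. pr e (s r)) - real m * pr e (s m)) * F g s)"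
proof -
 let ?P = "PiE {..<m} (%_. configs N)"
 define T :: "((nat \<times> nat => real) => (nat => nat => real) => real) => (nat \<times> nat => real) => (nat => nat => real) => real"
  where "T = (%F g s. if restrict s {..<m} \<in> ?P then F g (restrict s {..<m}) else 0)"
 have T: "T F g s = F g s" if "s \<in> ?P" for F g s by (simp only: T_def PiE_restrict[OF that] that if_True)
 have gT: "expgr (site_pairs N) (%g. T F g s)" if "grows N m F" for F s
  unfolding T_def using growsD[OF that, of "restrict s {..<m}"] by (cases "restrict s {..<m} \<in> ?P") auto
 have dT: "dep {..<m} (T F g)" for F g
 proof (rule depI)
  fix s s' :: "nat => nat => real" assume "!!i. i \<in> {..<m} ==> s i = s' i"
  then have "restrict s {..<m} = restrict s' {..<m}" by (intro restrict_ext)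
  then show "T F g s = T F g s'" by (simp only: T_def)
 qed
 have L: "((%y. Ham N be h (g(e := y)) a) has_real_derivative be / rtN N * pr e a) (at x)" for g x a
 proof -
  have "energy N (g(e := y)) a = y * (pr e a / rtN N) + (\<Sum>j\<in>site_pairs N - {e}. 1 / rtN N * (g j * pr j a))" for y
   unfolding energy_pr by (subst sum.remove[OF finite_site_pairs e]) simp
  then have "(%y. Ham N be h (g(e := y)) a) = (%y. y * (be / rtN N * pr e a) + be * ((\<Sum>j\<in>site_pairs N - {e}. 1 / rtN N * (g j * pr j a)) + real N * h * magnetization N a))"
   by (simp add: Ham_def hamiltonian_def algebra_simps)
  moreover have "((%y. y * k + C) has_real_derivative k) (at x)" for k C :: real
   by (auto intro!: derivative_eq_intros)
  ultimately show ?thesis by (simp only:)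
 qed
 have 1: "sk.gex N be h m (%g s. g e * F g s) = (\<integral>g. g e * gavg (configs N) (gb (configs N) (Ham N be h g)) {..<m} (T F g) \<partial>gpr (site_pairs N))"
  unfolding sk.gex_def by (simp only: gavg_cmult gavg_cong[OF T])
 have 2: "(\<integral>g. gavg (configs N) (gb (configs N) (Ham N be h g)) {..<m} (T F' g) \<partial>gpr (site_pairs N)) = sk.gex N be h m F'"
  unfolding sk.gex_def by (simp only: gavg_cong[OF T])
 have 3: "(\<integral>g. gavg (configs N) (gb (configs N) (Ham N be h g)) (insert m {..<m}) (%s. ((\<Sum>r\<in>{..<m}. be / rtN N * pr e (s r))
   - real (card {..<m}) * (be / rtN N * pr e (s m))) * T F g s) \<partial>gpr (site_pairs N)) =
  be / rtN N * sk.gex N be h (Suc m) (%g s. ((\<Sum>r<m. pr e (s r)) - real m * pr e (s m)) * F g s)"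
  unfolding sk.gex_cmult[symmetric] unfolding sk.gex_def lessThan_Suc[symmetric]
 proof (intro Bochner_Integration.integral_cong refl gavg_cong)
  fix g s assume s: "s \<in> PiE {..<Suc m} (%_. configs N)"
  have "restrict s {..<m} \<in> ?P"
  proof (rule PiE_I)
   fix i assume "i \<in> {..<m}"
   then have "i \<in> {..<Suc m}" by simp
   from PiE_mem[OF s this] show "restrict s {..<m} i \<in> configs N" using \<open>i \<in> {..<m}\<close> by simp
  qed simp
  moreover have "F g (restrict s {..<m}) = F g s" by (rule depD[OF d]) simp
  ultimately have "T F g s = F g s" by (simp add: T_def)
  moreover have "(\<Sum>r\<in>{..<m}. be / rtN N * pr e (s r)) = be / rtN N * (\<Sum>r<m. pr e (s r))"
   by (rule sum_distrib_left[symmetric])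
  ultimately show "((\<Sum>r\<in>{..<m}. be / rtN N * pr e (s r)) - real (card {..<m}) * (be / rtN N * pr e (s m))) * T F g s =
   be / rtN N * (((\<Sum>r<m. pr e (s r)) - real m * pr e (s m)) * F g s)"
   by (simp only: card_lessThan right_diff_distrib left_diff_distrib mult_ac)
 qed
 show ?thesis
  unfolding 1 2[symmetric] 3[symmetric]
 proof (rule gibbs_by_parts[OF finite_site_pairs e finite_configs configs_nonempty])
  show "((%y. T F (g(e := y)) s) has_real_derivative T F' (g(e := x)) s) (at x)" if "s \<in> ?P" for g x s
   unfolding T[OF that] by (rule F[OF that])
  show "continuous_on UNIV (%y. T F' (g(e := y)) s)" if "s \<in> ?P" for g s
   unfolding T[OF that] by (rule cont[OF that])
  show "expgr (site_pairs N) (%g. T F g s)" "expgr (site_pairs N) (%g. T F' g s)" for s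
   by (rule gT[OF gr(1)], rule gT[OF gr(2)])
  show "finite {..<m}" "m \<notin> {..<m}" by simp_all
  show "((%y. Ham N be h (g(e := y)) a) has_real_derivative be / rtN N * pr e a) (at x)" for g x a by (rule L)
  show "(%g. Ham N be h g a) \<in> borel_measurable (gpr (site_pairs N))" for a by (rule Ham_measurable)
  show "dep {..<m} (T F g)" for g by (rule dT)
 qed
qed

context hightemp
begin

lemma X_upd:
 assumes N: "1 <= N" and e: "e \<in> site_pairs N"
 shows "X N (g(e := y)) s = X N (g(e := 0)) s + y *\<^sub>R (\<chi> k. case k of Inl j => 1 / real N * pr e (s (io j)) | Inr j => 0)"
proof -
 have en: "energy N (g(e := y)) a = y * (pr e a / rtN N) + energy N (g(e := 0)) a" for y a
 proof -
  have "energy N (g(e := y)) a = y * (pr e a / rtN N) + (\<Sum>j\<in>site_pairs N - {e}. 1 / rtN N * (g j * pr j a))" for y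
   unfolding energy_pr by (subst sum.remove[OF finite_site_pairs e]) simp
  from this[of y] this[of 0] show ?thesis by simp
 qed
 have "energy_fluct N be q (g(e := y)) a = energy_fluct N be q (g(e := 0)) a + y * (1 / real N * pr e a)" for a
  unfolding energy_fluct_def en[of y] using N by (simp add: distrib_left)
 then show ?thesis
  unfolding X_def fluct_def vec_eq_iff by (simp split: sum.split)
qed

text \<open>Summed over all couplings, products of pairs of spins become squared overlaps. The term of replica \<open>i\<close>
with itself cancels the centering of the energy.\<close>

lemma energy_by_parts:
 assumes f: "tame a K f" and N: "1 <= N"
 shows "E N n (%g s. energy_fluct N be q g (s (io i)) * f (X N g s)) =
  1 / 2 * (\<Sum>j\<in>UNIV. E N n (%g s. ((overlap N (s (io i)) (s (io j)))^2 - 1 / real N) * pd (Inl j) f (X N g s)))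
  + be / 2 * rtN N * ((\<Sum>r\<in>{..<n} - {io i}. E N (Suc n) (%g s. ((overlap N (s (io i)) (s r))^2 - q\<^sup>2) * f (X N g s)))
   - real n * E N (Suc n) (%g s. ((overlap N (s (io i)) (s n))^2 - q\<^sup>2) * f (X N g s)))"
proof -
 have N0: "0 < real N" using N by simp
 let ?f = "%g s. f (X N g s)" and ?D = "%j g s. pd (Inl j) f (X N g s)" and ?R = "%s r. overlap N (s (io i)) (s r)"
 have nn: "n <= Suc n" by simp
 note gf = X_grows(1)[OF f order_refl N] X_grows(1)[OF f nn N] and gD = X_grows(2)[OF f order_refl N]
 note gm = grows_mult[OF grows_const gf(1)] grows_mult[OF grows_const gf(2)] grows_mult[OF grows_const gD]
 define F' where "F' = (%e g s. pr e (s (io i)) * (\<Sum>j\<in>UNIV. 1 / real N * pr e (s (io j)) * ?D j g s))"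
 have gF': "grows N n (F' e)" for e
  unfolding F'_def by (intro grows_mult grows_sum grows_const gD)
 define U where "U = (%e. E N (Suc n) (%g s. ((\<Sum>r<n. pr e (s r)) - real n * pr e (s n)) * (pr e (s (io i)) * ?f g s)))"
 have ibp: "E N n (%g s. g e * (pr e (s (io i)) * ?f g s)) = E N n (F' e) + be / rtN N * U e" if e: "e \<in> site_pairs N" for e
  unfolding U_def
 proof (rule gex_by_parts[OF e gm(1) gF'])
  show "dep {..<n} (%s. pr e (s (io i)) * ?f g s)" for g
   using iota_less by (intro depI arg_cong2[where f = "(*)"]) (auto intro: depD[OF dep_X[OF order_refl]])
  fix g s
  let ?de = "(\<chi> k. case k of Inl j => 1 / real N * pr e (s (io j)) | Inr j => 0) :: real ^ ('n + 'n)"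
  define Z where "Z = X N (g(e := 0)) s"
  have Z: "X N (g(e := y)) s = Z + y *\<^sub>R ?de" for y unfolding Z_def by (rule X_upd[OF N e])
  have eq: "F' e (g(e := y)) s = pr e (s (io i)) * (\<Sum>k\<in>UNIV. ?de $ k * pd k f (Z + y *\<^sub>R ?de))" for y
   unfolding F'_def sum_sum_type Z by simp
  show "((%y. pr e (s (io i)) * ?f (g(e := y)) s) has_real_derivative F' e (g(e := x)) s) (at x)" for x
   unfolding eq Z by (intro DERIV_cmult line_derivative tameD(5)[OF f])
  have c: "continuous_on UNIV (%y. pd k f (Z + y *\<^sub>R ?de))" for k
   by (rule continuous_on_compose2[OF tameD(6)[OF f]]) (auto intro!: continuous_intros)
  show "continuous_on UNIV (%y. F' e (g(e := y)) s)"
   unfolding eq by (intro continuous_intros c)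
 qed
 have gs: "grows N n (%g s. g e * (pr e (s (io i)) * ?f g s))" if "e \<in> site_pairs N" for e
  by (rule grows_mult[OF _ gm(1)]) (auto simp: grows_def intro: expgr_coord[OF finite_site_pairs that])
 have en: "E N n (%g s. energy N g (s (io i)) * ?f g s) = 1 / rtN N * (\<Sum>e\<in>site_pairs N. E N n (F' e) + be / rtN N * U e)"
 proof -
  have "E N n (%g s. energy N g (s (io i)) * ?f g s) = E N n (%g s. 1 / rtN N * (\<Sum>e\<in>site_pairs N. g e * (pr e (s (io i)) * ?f g s)))"
   unfolding energy_pr by (simp only: sum_distrib_right sum_distrib_left mult.assoc)
  also have "... = 1 / rtN N * (\<Sum>e\<in>site_pairs N. E N n (%g s. g e * (pr e (s (io i)) * ?f g s)))"
   unfolding sk.gex_cmult by (subst sk.gex_sum[OF gs]) auto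
  finally show ?thesis by (simp only: ibp cong: sum.cong)
 qed
 have mem: "s r \<in> configs N" if "s \<in> PiE {..<M} (%_. configs N)" "r < M" for s r M
  by (rule PiE_mem[OF that(1)]) (use that(2) in simp)
 have sF: "(\<Sum>e\<in>site_pairs N. E N n (F' e)) = real N / 2 * (\<Sum>j\<in>UNIV. E N n (%g s. ((?R s (io j))^2 - 1 / real N) * ?D j g s))"
 proof -
  have "(\<Sum>e\<in>site_pairs N. E N n (F' e)) = E N n (%g s. \<Sum>e\<in>site_pairs N. F' e g s)"
   by (rule sk.gex_sum[symmetric]) (rule gF')
  also have "... = E N n (%g s. real N / 2 * (\<Sum>j\<in>UNIV. ((?R s (io j))^2 - 1 / real N) * ?D j g s))"
  proof (rule sk.gex_cong)
   fix g s assume s: "s \<in> PiE {..<n} (%_. configs N)"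
   have "(\<Sum>e\<in>site_pairs N. F' e g s) = (\<Sum>j\<in>UNIV. 1 / real N * (\<Sum>e\<in>site_pairs N. pr e (s (io i)) * pr e (s (io j))) * ?D j g s)"
    unfolding F'_def sum_distrib_left sum_distrib_right by (subst sum.swap) (simp only: mult_ac)
   also have "... = (\<Sum>j\<in>UNIV. 1 / real N * ((real N)^2 / 2 * ((?R s (io j))^2 - 1 / real N)) * ?D j g s)"
    by (simp only: sum_pr[OF mem[OF s iota_less] mem[OF s iota_less] N])
   also have "... = real N / 2 * (\<Sum>j\<in>UNIV. ((?R s (io j))^2 - 1 / real N) * ?D j g s)"
    unfolding sum_distrib_left by (intro sum.cong refl) (use N0 in \<open>simp add: power2_eq_square\<close>)
   finally show "(\<Sum>e\<in>site_pairs N. F' e g s) = real N / 2 * (\<Sum>j\<in>UNIV. ((?R s (io j))^2 - 1 / real N) * ?D j g s)" .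
  qed
  also have "... = real N / 2 * (\<Sum>j\<in>UNIV. E N n (%g s. ((?R s (io j))^2 - 1 / real N) * ?D j g s))"
   unfolding sk.gex_cmult by (subst sk.gex_sum[OF gm(3)]) rule
  finally show ?thesis .
 qed
 let ?r = "%r. E N (Suc n) (%g s. ((?R s r)^2 - q\<^sup>2) * ?f g s)"
 have sU: "(\<Sum>e\<in>site_pairs N. U e) = (real N)^2 / 2 * ((1 - q\<^sup>2) * E N n ?f + (\<Sum>r\<in>{..<n} - {io i}. ?r r) - real n * ?r n)"
 proof -
  have "(\<Sum>e\<in>site_pairs N. U e) = E N (Suc n) (%g s. \<Sum>e\<in>site_pairs N. ((\<Sum>r<n. pr e (s r)) - real n * pr e (s n)) * (pr e (s (io i)) * ?f g s))"
   unfolding U_def by (rule sk.gex_sum[symmetric]) (intro grows_mult[OF grows_const] gm(2))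
  also have "... = E N (Suc n) (%g s. (real N)^2 / 2 * ((\<Sum>r<n. ((?R s r)^2 - q\<^sup>2) * ?f g s) - real n * (((?R s n)^2 - q\<^sup>2) * ?f g s)))"
  proof (rule sk.gex_cong)
   fix g s assume s: "s \<in> PiE {..<Suc n} (%_. configs N)"
   have P: "(\<Sum>e\<in>site_pairs N. pr e (s r) * pr e (s (io i))) = (real N)^2 / 2 * ((?R s r)^2 - 1 / real N)" if "r < Suc n" for r
    using sum_pr[OF mem[OF s less_SucI[OF iota_less]] mem[OF s that] N] by (simp add: mult.commute)
   have "(\<Sum>e\<in>site_pairs N. ((\<Sum>r<n. pr e (s r)) - real n * pr e (s n)) * (pr e (s (io i)) * ?f g s)) =
    ((\<Sum>r<n. \<Sum>e\<in>site_pairs N. pr e (s r) * pr e (s (io i))) - real n * (\<Sum>e\<in>site_pairs N. pr e (s n) * pr e (s (io i)))) * ?f g s"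
    by (subst sum.swap) (simp add: left_diff_distrib sum_subtractf sum_distrib_right sum_distrib_left mult.assoc)
   also have "... = ((\<Sum>r<n. (real N)^2 / 2 * ((?R s r)^2 - 1 / real N)) - real n * ((real N)^2 / 2 * ((?R s n)^2 - 1 / real N))) * ?f g s"
    by (simp add: P)
   also have "... = (real N)^2 / 2 * ((\<Sum>r<n. ((?R s r)^2 - q\<^sup>2) * ?f g s) - real n * (((?R s n)^2 - q\<^sup>2) * ?f g s))"
    unfolding sum_distrib_left[symmetric] sum_distrib_right[symmetric] sum_subtractf by (simp add: algebra_simps)
   finally show "(\<Sum>e\<in>site_pairs N. ((\<Sum>r<n. pr e (s r)) - real n * pr e (s n)) * (pr e (s (io i)) * ?f g s)) =
     (real N)^2 / 2 * ((\<Sum>r<n. ((?R s r)^2 - q\<^sup>2) * ?f g s) - real n * (((?R s n)^2 - q\<^sup>2) * ?f g s))" .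
  qed
  also have "... = (real N)^2 / 2 * ((\<Sum>r<n. ?r r) - real n * ?r n)"
   unfolding sk.gex_cmult sk.gex_diff[OF grows_sum[OF gm(2)] grows_mult[OF grows_const gm(2)]] sk.gex_sum[OF gm(2)] ..
  also have "(\<Sum>r<n. ?r r) = ?r (io i) + (\<Sum>r\<in>{..<n} - {io i}. ?r r)"
   by (rule sum.remove) (use iota_less in auto)
  also have "?r (io i) = E N (Suc n) (%g s. (1 - q\<^sup>2) * ?f g s)"
  proof (rule sk.gex_cong)
   fix g s assume s: "s \<in> PiE {..<Suc n} (%_. configs N)"
   show "((?R s (io i))^2 - q\<^sup>2) * ?f g s = (1 - q\<^sup>2) * ?f g s"
    unfolding overlap_self[OF mem[OF s less_SucI[OF iota_less]] N] by simp
  qed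
  also have "... = (1 - q\<^sup>2) * E N n ?f"
   unfolding sk.gex_cmult by (subst sk.gex_superset[OF dep_X[OF order_refl]]) simp_all
  finally show ?thesis .
 qed
 have ge: "grows N n (%g s. energy N g (s (io i)) * ?f g s)"
  unfolding energy_pr sum_distrib_right mult.assoc by (intro grows_sum grows_mult[OF grows_const gs])
 have "E N n (%g s. energy_fluct N be q g (s (io i)) * ?f g s) =
  E N n (%g s. 1 / rtN N * (energy N g (s (io i)) * ?f g s) - be * rtN N / 2 * (1 - q\<^sup>2) * ?f g s)"
  by (simp only: energy_fluct_def left_diff_distrib mult.assoc)
 also have "... = 1 / rtN N * E N n (%g s. energy N g (s (io i)) * ?f g s) - be * rtN N / 2 * (1 - q\<^sup>2) * E N n ?f"
  unfolding sk.gex_diff[OF grows_mult[OF grows_const ge] gm(1)] sk.gex_cmult ..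
 finally have main: "E N n (%g s. energy_fluct N be q g (s (io i)) * ?f g s) =
  1 / rtN N * (1 / rtN N * ((\<Sum>e\<in>site_pairs N. E N n (F' e)) + be / rtN N * (\<Sum>e\<in>site_pairs N. U e)))
  - be * rtN N / 2 * (1 - q\<^sup>2) * E N n ?f"
  unfolding en sum.distrib sum_distrib_left[symmetric] .
 have alg: "1 / r * (1 / r * (r * r / 2 * D + be / r * ((r * r)^2 / 2 * (u * e + S - k)))) - be * r / 2 * u * e = 1 / 2 * D + be / 2 * r * (S - k)"
  if "0 < r" for r D u e S k :: real
  using that by (simp add: field_simps power2_eq_square)
 have "0 < rtN N" using N0 by simp
 from alg[OF this] show ?thesis unfolding main sF sU by (simp only: real_sqrt_mult_self abs_of_nat)
qed

lemma gex_le_sqrt: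
 assumes f: "tame a K f" and N: "1 <= N" and m': "n <= m'" and ph: "grows N m' ph" "!!g s. \<bar>\<psi> g s\<bar> <= a * K (X N g s)" "grows N m' \<psi>"
 shows "\<bar>E N m' (%g s. ph g s * \<psi> g s)\<bar> <= sqrt (E N m' (%g s. (ph g s)^2)) * (rtN N * w N a K)"
proof -
 have gK: "grows N m' (%g s. a * K (X N g s))" by (intro grows_mult grows_const X_grows(3)[OF f m' N])
 have "\<bar>E N m' (%g s. ph g s * \<psi> g s)\<bar> <= E N m' (%g s. \<bar>ph g s * \<psi> g s\<bar>)"
  by (rule sk.gex_abs_le[OF grows_mult[OF ph(1,3)]])
 also have "... <= E N m' (%g s. \<bar>ph g s\<bar> * \<bar>a * K (X N g s)\<bar>)"
 proof (rule sk.gex_mono)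
  show "grows N m' (%g s. \<bar>ph g s * \<psi> g s\<bar>)" "grows N m' (%g s. \<bar>ph g s\<bar> * \<bar>a * K (X N g s)\<bar>)"
   by (intro grows_abs grows_mult ph gK)+
  show "\<bar>ph g s * \<psi> g s\<bar> <= \<bar>ph g s\<bar> * \<bar>a * K (X N g s)\<bar>" for g s
   unfolding abs_mult[of "ph g s"] using ph(2)[of g s] by (intro mult_left_mono) auto
 qed
 also have "... <= sqrt (E N m' (%g s. (ph g s)^2)) * sqrt (E N m' (%g s. (a * K (X N g s))^2))"
  by (rule sk.gex_cauchy_schwarz[OF ph(1) gK])
 also have "E N m' (%g s. (a * K (X N g s))^2) = a^2 * E N n (%g s. (K (X N g s))^2)"
  unfolding power_mult_distrib sk.gex_cmult by (subst sk.gex_superset[OF dep_X[OF order_refl] m']) rule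
 also have "sqrt ... = rtN N * w N a K"
  using tameD(1)[OF f] N by (simp add: w_def real_sqrt_mult)
 finally show ?thesis .
qed

lemma overlap_fourth:
 assumes "1 <= N" "l < m'" "l' < m'" "l ~= l'"
 shows "E N m' (%g s. (overlap N (s l) (s l') - q) ^ 4) <= (1 + C0) / real N ^ 2"
proof -
 interpret e: est N 1 be h q io n q1 C0 by (rule N_est[OF assms(1)])
 show ?thesis by (rule e.nuN_fourth[OF assms(2-)])
qed

lemma overlap_second:
 assumes "1 <= N" "l < m'" "l' < m'" "l ~= l'"
 shows "E N m' (%g s. (overlap N (s l) (s l') - q) ^ 2) <= sqrt (1 + C0) / real N"
proof -
 have "E N m' (%g s. \<bar>(overlap N (s l) (s l') - q)^2\<bar> * \<bar>1\<bar>) <= sqrt (E N m' (%g s. ((overlap N (s l) (s l') - q)^2)^2)) * sqrt (E N m' (%g s. 1^2))"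
  by (intro sk.gex_cauchy_schwarz grows_const)
 also have "... <= sqrt ((1 + C0) / real N ^ 2)"
  using overlap_fourth[OF assms] by (simp add: sk.gex_const)
 also have "... = sqrt (1 + C0) / real N" by (simp add: real_sqrt_divide)
 finally show ?thesis by simp
qed

lemma overlap_bound:
 assumes "sm \<in> configs N" "\<tau> \<in> configs N" "1 <= N" shows "\<bar>overlap N sm \<tau>\<bar> <= 1"
proof -
 have "\<bar>\<Sum>i=1..N. sm i * \<tau> i\<bar> <= (\<Sum>i=1..N. 1)"
  by (rule order_trans[OF sum_abs sum_mono]) (use configs_abs[OF assms(1)] configs_abs[OF assms(2)] in \<open>simp add: abs_mult\<close>)
 then show ?thesis using assms by (simp add: overlap_def abs_mult divide_le_eq)
qed

text \<open>Since \<open>R^2 - q^2 = 2 q (R - q) + (R - q)^2\<close>, and the last term is of order \<open>1/N\<close>.\<close>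

lemma square_fluct_appr:
 assumes l: "l < n" "l' < Suc n" "l ~= l'"
 shows "appr (%N f. rtN N * E N (Suc n) (%g s. ((overlap N (s l) (s l'))^2 - q\<^sup>2) * f (X N g s)))"
proof -
 have s: "small (%N p f. rtN N * E N (Suc n) (%g s. (overlap N (s l) (s l') - q)^2 * f (X N g s)))"
 proof (rule smallI)
  fix N p a K f assume "(1::nat) <= p" "p <= N" and f: "tame a K (f :: real ^ ('n + 'n) => real)"
  then have N: "1 <= N" by simp
  have "\<bar>E N (Suc n) (%g s. (overlap N (s l) (s l') - q)^2 * f (X N g s))\<bar> <=
   sqrt (E N (Suc n) (%g s. ((overlap N (s l) (s l') - q)^2)^2)) * (rtN N * w N a K)"
   by (rule gex_le_sqrt[OF f N]) (auto intro: grows_const tameD(7)[OF f] X_grows(1)[OF f _ N])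
  also have "... <= sqrt ((1 + C0) / real N ^ 2) * (rtN N * w N a K)"
   using overlap_fourth[OF N, of l "Suc n" l'] l w_nonneg[OF f] by (intro mult_right_mono real_sqrt_le_mono) auto
  finally have "rtN N * \<bar>E N (Suc n) (%g s. (overlap N (s l) (s l') - q)^2 * f (X N g s))\<bar> <= rtN N * (sqrt ((1 + C0) / real N ^ 2) * (rtN N * w N a K))"
   by (intro mult_left_mono) auto
  also have "... = (rtN N * rtN N) / real N * sqrt (1 + C0) * w N a K"
   by (simp only: real_sqrt_divide real_sqrt_abs abs_of_nat times_divide_eq_left times_divide_eq_right mult_ac)
  also have "... = sqrt (1 + C0) * w N a K" using N by simp
  finally show "\<bar>rtN N * E N (Suc n) (%g s. (overlap N (s l) (s l') - q)^2 * f (X N g s))\<bar> <= sqrt (1 + C0) * w N a K"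
   by (simp add: abs_mult)
 qed
 have l2: "l < m + 2" "l' < m + 2" using l by (simp_all add: m_def)
 show ?thesis
 proof (rule appr_cong[OF appr_add[OF appr_cmult[OF rho_appr[OF l2 l(3)], of "2 * q"] small_appr[OF s]]])
  fix N :: nat and a K f assume N: "1 <= N" and f: "tame a K (f :: real ^ ('n + 'n) => real)"
  have d: "dep {..<Suc n} (%s. (overlap N (s l) (s l') - q) * f (X N g s))" for g
   using l by (intro depI arg_cong2[where f = "(*)"]) (auto intro: depD[OF dep_X[of "Suc n"]])
  have r: "\<rho> l l' N f = rtN N * E N (Suc n) (%g s. (overlap N (s l) (s l') - q) * f (X N g s))"
   unfolding \<rho>_def by (subst sk.gex_superset[OF d]) (simp_all add: m_def)
  have nn: "n <= Suc n" by simp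
  note gf = X_grows(1)[OF f nn N]
  have "E N (Suc n) (%g s. ((overlap N (s l) (s l'))^2 - q\<^sup>2) * f (X N g s)) =
   E N (Suc n) (%g s. 2 * q * ((overlap N (s l) (s l') - q) * f (X N g s)) + (overlap N (s l) (s l') - q)^2 * f (X N g s))"
   by (simp add: power2_eq_square algebra_simps)
  also have "... = 2 * q * E N (Suc n) (%g s. (overlap N (s l) (s l') - q) * f (X N g s)) + E N (Suc n) (%g s. (overlap N (s l) (s l') - q)^2 * f (X N g s))"
   by (simp only: sk.gex_add[OF grows_mult[OF grows_const grows_mult[OF grows_const gf]] grows_mult[OF grows_const gf]] sk.gex_cmult)
  finally show "rtN N * E N (Suc n) (%g s. ((overlap N (s l) (s l'))^2 - q\<^sup>2) * f (X N g s)) =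
   2 * q * \<rho> l l' N f + rtN N * E N (Suc n) (%g s. (overlap N (s l) (s l') - q)^2 * f (X N g s))"
   unfolding r by (simp add: distrib_left)
 qed
qed

lemma square_deriv_appr:
 "appr (%N f. E N n (%g s. ((overlap N (s (io i)) (s (io j)))^2 - 1 / real N) * pd (Inl j) f (X N g s)))"
proof -
 define b where "b = (if i = j then 1 else q^2)"
 have "small (%N p f. E N n (%g s. ((overlap N (s (io i)) (s (io j)))^2 - 1 / real N) * pd (Inl j) f (X N g s)) - b * Dk (Inl j) N f)"
 proof (rule smallI)
  fix N p a K f assume "(1::nat) <= p" "p <= N" and f: "tame a K (f :: real ^ ('n + 'n) => real)"
  then have N: "1 <= N" by simp
  let ?R = "%s. overlap N (s (io i)) (s (io j))" and ?D = "%g s. pd (Inl j) f (X N g s)"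
  note gD = X_grows(2)[OF f order_refl N] and wn = w_nonneg[OF f, of N]
  note g = grows_mult[OF grows_const gD]
  have R: "\<bar>?R s\<bar> <= 1" if "s \<in> PiE {..<n} (%_. configs N)" for s
   by (rule overlap_bound[OF PiE_mem[OF that] PiE_mem[OF that] N]) (use iota_less in auto)
  have e2: "E N n (%g s. ((?R s)^2 - b)^2) <= (2 * sqrt (sqrt (1 + C0) / real N))^2"
  proof (cases "i = j")
   case True
   have "E N n (%g s. ((?R s)^2 - b)^2) = E N n (%g s. 0)"
   proof (rule sk.gex_cong)
    fix g s assume s: "s \<in> PiE {..<n} (%_. configs N)"
    have "?R s = 1" unfolding True by (rule overlap_self[OF PiE_mem[OF s] N]) (use iota_less in auto)
    then show "((?R s)^2 - b)^2 = 0" by (simp add: b_def True)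
   qed
   then show ?thesis by (simp add: sk.gex_const)
  next
   case False
   then have l: "io i ~= io j" using io by (auto simp: bij_betw_def inj_on_def)
   have "E N n (%g s. ((?R s)^2 - b)^2) <= E N n (%g s. 4 * (?R s - q)^2)"
   proof (rule sk.gex_mono)
    fix g s assume s: "s \<in> PiE {..<n} (%_. configs N)"
    have "((?R s)^2 - b)^2 = (?R s + q)^2 * (?R s - q)^2" using False by (simp add: b_def power2_eq_square algebra_simps)
    also have "... <= 2^2 * (?R s - q)^2"
     using R[OF s] q by (intro mult_right_mono abs_le_square_iff[THEN iffD1]) auto
    finally show "((?R s)^2 - b)^2 <= 4 * (?R s - q)^2" by simp
   qed (rule grows_const)+
   also have "... <= 4 * (sqrt (1 + C0) / real N)"
    unfolding sk.gex_cmult using overlap_second[OF N iota_less iota_less l] by simp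
   finally show ?thesis using C0 by (simp add: power_mult_distrib)
  qed
  have "\<bar>E N n (%g s. ((?R s)^2 - b) * ?D g s)\<bar> <= sqrt (E N n (%g s. ((?R s)^2 - b)^2)) * (rtN N * w N a K)"
   by (rule gex_le_sqrt[OF f N order_refl grows_const tameD(8)[OF f] gD])
  also have "... <= sqrt ((2 * sqrt (sqrt (1 + C0) / real N))^2) * (rtN N * w N a K)"
   using e2 wn by (intro mult_right_mono real_sqrt_le_mono) auto
  also have "... = 2 * sqrt (sqrt (1 + C0)) * w N a K" using N C0 by (simp add: real_sqrt_divide)
  finally have 1: "\<bar>E N n (%g s. ((?R s)^2 - b) * ?D g s)\<bar> <= 2 * sqrt (sqrt (1 + C0)) * w N a K" .
  have "\<bar>E N n (%g s. 1 / real N * ?D g s)\<bar> <= sqrt (E N n (%g s. (1 / real N)^2)) * (rtN N * w N a K)"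
   by (rule gex_le_sqrt[OF f N order_refl grows_const tameD(8)[OF f] gD])
  also have "... = rtN N / real N * w N a K" by (simp add: sk.gex_const real_sqrt_divide)
  also have "... <= 1 * w N a K"
   using N wn sqrt_le_D[of "real N" "real N"] by (intro mult_right_mono) (auto simp: divide_le_eq real_le_lsqrt power2_eq_square)
  finally have 2: "\<bar>E N n (%g s. 1 / real N * ?D g s)\<bar> <= w N a K" by simp
  have "E N n (%g s. ((?R s)^2 - 1 / real N) * ?D g s) = E N n (%g s. (((?R s)^2 - b) * ?D g s - 1 / real N * ?D g s) + b * ?D g s)"
   by (simp add: algebra_simps)
  also have "... = E N n (%g s. ((?R s)^2 - b) * ?D g s) - E N n (%g s. 1 / real N * ?D g s) + b * Dk (Inl j) N f"
   unfolding Dk_def by (simp only: sk.gex_add[OF grows_diff[OF g g] g] sk.gex_diff[OF g g] sk.gex_cmult)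
  finally show "\<bar>E N n (%g s. ((?R s)^2 - 1 / real N) * ?D g s) - b * Dk (Inl j) N f\<bar> <= (2 * sqrt (sqrt (1 + C0)) + 1) * w N a K"
   using 1 2 by (simp add: distrib_right)
 qed
 from small_appr[OF this] have "appr (%N f. E N n (%g s. ((overlap N (s (io i)) (s (io j)))^2 - 1 / real N) * pd (Inl j) f (X N g s)) - b * Dk (Inl j) N f)" .
 from appr_add[OF this appr_cmult[OF appr_Dk[of "Inl j"], of b]] show ?thesis by simp
qed

theorem energy_appr: "appr (%N f. E N n (%g s. energy_fluct N be q g (s (io i)) * f (X N g s)))"
proof -
 let ?r = "%r N f. rtN N * E N (Suc n) (%g s. ((overlap N (s (io i)) (s r))^2 - q\<^sup>2) * f (X N g s))"
 have r: "appr (?r r)" if "r < Suc n" "r ~= io i" for r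
  using that iota_less[of i] by (intro square_fluct_appr) auto
 have "appr (%N f. 1 / 2 * (\<Sum>j\<in>UNIV. E N n (%g s. ((overlap N (s (io i)) (s (io j)))^2 - 1 / real N) * pd (Inl j) f (X N g s)))
  + be / 2 * ((\<Sum>r\<in>{..<n} - {io i}. ?r r N f) - real n * ?r n N f))"
  using iota_less[of i] by (intro appr_add appr_diff appr_cmult appr_sum square_deriv_appr r) auto
 then show ?thesis
  by (rule appr_cong) (simp add: energy_by_parts right_diff_distrib sum_distrib_left mult_ac)
qed

end

section \<open>Consequences of the high temperature condition\<close>

lemma four_power4: "(a - b - c + d) ^ 4 <= 64 * (a ^ 4 + b ^ 4 + c ^ 4 + d ^ 4)" for a b c d :: real
proof -
 have sq: "(x + y)^2 <= 2 * (x^2 + y^2)" for x y :: real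
  using zero_le_power2[of "x - y"] by (simp add: power2_eq_square algebra_simps)
 have p4: "(x + y) ^ 4 <= 8 * (x ^ 4 + y ^ 4)" for x y :: real
 proof -
  have "(x + y) ^ 4 = ((x + y)^2)^2" by simp
  also have "... <= (2 * (x^2 + y^2))^2" by (intro power_mono sq) simp
  also have "... = 4 * (x^2 + y^2)^2" by (simp only: power_mult_distrib) simp
  also have "... <= 4 * (2 * ((x^2)^2 + (y^2)^2))" by (intro mult_left_mono sq) simp
  finally show ?thesis by simp
 qed
 have "(a - b - c + d) ^ 4 = ((a + - b) + (- c + d)) ^ 4" by (simp add: algebra_simps)
 also have "... <= 8 * ((a + - b) ^ 4 + (- c + d) ^ 4)" by (rule p4)
 also have "... <= 8 * (8 * (a ^ 4 + (- b) ^ 4) + 8 * ((- c) ^ 4 + d ^ 4))"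
  by (intro mult_left_mono add_mono p4) auto
 finally show ?thesis by simp
qed

context est
begin

abbreviation "Qm \<equiv> tmom be h q"

lemma cavfun_one: "cavfun m (%g s. 1)"
 by (auto simp: cavfun_def dep_def cav.flip_inv_def intro: grows_const)

definition "c1 m = 2 * lipcav be h m * ((real (m + 2))^2 * sqrt (sqrt (cD be h C0 (m + 2))))" for m :: nat

lemma site_moment:
 assumes T: "T \<subseteq> {..<m}"
 shows "\<bar>nuN m (%g s. cav.eT T s) - Qm (card T)\<bar> <= c1 m / rtN N"
proof -
 have "\<bar>nuN m (%g s. cav.eT T s * 1) - Qm (card T) * n0 m (%g s. 1)\<bar> <= 2 * lipcav be h m * e1 (m + 2) (%g s. 1)"
  by (rule E1[OF cavfun_one T])
 also have "... <= 2 * lipcav be h m * ((real (m + 2))^2 * sqrt (sqrt (cD be h C0 (m + 2))) * (sqrt (n0 (m + 2) (%g s. 1^2)) / rtN N))"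
  by (intro mult_left_mono e1_le grows_const mult_nonneg_nonneg cav.lipcav_nonneg) simp
 finally show ?thesis by (simp add: base.gex_const c1_def)
qed

definition "U s = overlap N (s 0) (s 2) - overlap N (s 0) (s 3) - overlap N (s 1) (s 2) + overlap N (s 1) (s (3::nat))"
 for s :: "nat => nat => real"
definition "um s = cav.ov (s 0) (s 2) - cav.ov (s 0) (s 3) - cav.ov (s 1) (s 2) + cav.ov (s 1) (s (3::nat))"
 for s :: "nat => nat => real"
definition "dl s = s 0 p * s 2 p - s 0 p * s 3 p - s 1 p * s 2 p + s 1 p * s (3::nat) p" for s :: "nat => nat => real"

lemma U_um: "U s = um s + dl s / real N"
 by (simp add: U_def um_def dl_def ov_eq diff_divide_distrib add_divide_distrib)

lemma um4: assumes "4 <= M" shows "n0 M (%g s. um s ^ 4) <= 256 * cD be h C0 M / real N ^ 2"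
proof -
 let ?o = "%l l' s. (cav.ov (s l) (s l') - q) ^ 4"
 have "n0 M (%g s. um s ^ 4) <= n0 M (%g s. 64 * (?o 0 2 s + ?o 0 3 s + ?o 1 2 s + ?o 1 3 s))"
 proof (intro base.gex_mono grows_const)
  fix s :: "nat => nat => real"
  have "um s = (cav.ov (s 0) (s 2) - q) - (cav.ov (s 0) (s 3) - q) - (cav.ov (s 1) (s 2) - q) + (cav.ov (s 1) (s 3) - q)"
   by (simp add: um_def)
  then show "um s ^ 4 <= 64 * (?o 0 2 s + ?o 0 3 s + ?o 1 2 s + ?o 1 3 s)" by (simp only: four_power4)
 qed
 also have "... = 64 * (n0 M (%g s. ?o 0 2 s) + n0 M (%g s. ?o 0 3 s) + n0 M (%g s. ?o 1 2 s) + n0 M (%g s. ?o 1 3 s))"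
  by (simp only: base.gex_cmult base.gex_add[OF grows_const grows_const])
 also have "... <= 64 * (cD be h C0 M / real N ^ 2 + cD be h C0 M / real N ^ 2 + cD be h C0 M / real N ^ 2 + cD be h C0 M / real N ^ 2)"
  using assms by (intro mult_left_mono add_mono n0_fourth) auto
 finally show ?thesis by simp
qed

lemma um2: assumes "4 <= M" shows "n0 M (%g s. (um s)^2) <= 16 * sqrt (cD be h C0 M) / real N"
proof -
 have "n0 M (%g s. (um s)^2) = n0 M (%g s. \<bar>(um s)^2\<bar> * \<bar>1\<bar>)" by simp
 also have "... <= sqrt (n0 M (%g s. ((um s)^2)^2)) * sqrt (n0 M (%g s. 1^2))"
  by (intro base.gex_cauchy_schwarz grows_const)
 also have "... = sqrt (n0 M (%g s. um s ^ 4))" by (simp add: base.gex_const)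
 also have "... <= sqrt (16^2 * cD be h C0 M / real N ^ 2)" using um4[OF assms] by (intro real_sqrt_le_mono) simp
 also have "... = 16 * sqrt (cD be h C0 M) / real N" by (simp only: real_sqrt_divide real_sqrt_mult real_sqrt_abs; simp?)
 finally show ?thesis .
qed

lemma U2: "nuN 4 (%g s. (U s)^2) <= 16 * sqrt (1 + C0) / real N"
proof -
 let ?o = "%l l' s. (overlap N (s l) (s l') - q) ^ 4"
 have "nuN 4 (%g s. U s ^ 4) <= nuN 4 (%g s. 64 * (?o 0 2 s + ?o 0 3 s + ?o 1 2 s + ?o 1 3 s))"
 proof (intro sk.gex_mono grows_const)
  fix s :: "nat => nat => real"
  have "U s = (overlap N (s 0) (s 2) - q) - (overlap N (s 0) (s 3) - q) - (overlap N (s 1) (s 2) - q) + (overlap N (s 1) (s 3) - q)"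
   by (simp add: U_def)
  then show "U s ^ 4 <= 64 * (?o 0 2 s + ?o 0 3 s + ?o 1 2 s + ?o 1 3 s)" by (simp only: four_power4)
 qed
 also have "... = 64 * (nuN 4 (%g s. ?o 0 2 s) + nuN 4 (%g s. ?o 0 3 s) + nuN 4 (%g s. ?o 1 2 s) + nuN 4 (%g s. ?o 1 3 s))"
  by (simp only: sk.gex_cmult sk.gex_add[OF grows_const grows_const])
 also have "... <= 64 * ((1 + C0) / real N ^ 2 + (1 + C0) / real N ^ 2 + (1 + C0) / real N ^ 2 + (1 + C0) / real N ^ 2)"
  by (intro mult_left_mono add_mono nuN_fourth) auto
 finally have 4: "nuN 4 (%g s. U s ^ 4) <= 16^2 * (1 + C0) / real N ^ 2" by simp
 have "nuN 4 (%g s. (U s)^2) = nuN 4 (%g s. \<bar>(U s)^2\<bar> * \<bar>1\<bar>)" by simp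
 also have "... <= sqrt (nuN 4 (%g s. ((U s)^2)^2)) * sqrt (nuN 4 (%g s. 1^2))"
  by (intro sk.gex_cauchy_schwarz grows_const)
 also have "... = sqrt (nuN 4 (%g s. U s ^ 4))" by (simp add: sk.gex_const)
 also have "... <= sqrt (16^2 * (1 + C0) / real N ^ 2)" using 4 by (rule real_sqrt_le_mono)
 also have "... = 16 * sqrt (1 + C0) / real N" by (simp only: real_sqrt_divide real_sqrt_mult real_sqrt_abs; simp?)
 finally show ?thesis .
qed

lemma cavfun_um: "cavfun 4 (%g s. um s)" "cavfun 4 (%g s. (um s)^2)"
proof -
 have d: "dep {..<4} um" unfolding um_def by (intro depI) auto
 have fl: "cav.flip_inv 4 um"
  unfolding cav.flip_inv_def
 proof (intro ballI allI impI)
  fix s :: "nat => nat => real" and r :: nat assume s: "s \<in> PiE {..<4} (%_. configs N)" and r: "r < (4::nat)"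
  have A: "s 0 \<in> configs N" "s 1 \<in> configs N" "s 2 \<in> configs N" "s 3 \<in> configs N"
   by (rule PiE_mem[OF s]; simp)+
  have "r = 0 \<or> r = 1 \<or> r = 2 \<or> r = 3" using r by auto
  then show "um (s(r := flp p (s r))) = um s"
   using A by (auto simp: um_def cav.ov_fl)
 qed
 then have fl2: "cav.flip_inv 4 (%s. (um s)^2)" by (simp add: cav.flip_inv_def)
 have d2: "dep {..<4} (%s. (um s)^2)" 
 proof (rule depI)
  fix s s' :: "nat => nat => real" assume "!!i. i \<in> {..<4} ==> s i = s' i"
  then have "um s = um s'" by (intro depD[OF d]) auto
  then show "(um s)^2 = (um s')^2" by simp
 qed
 show "cavfun 4 (%g s. um s)" "cavfun 4 (%g s. (um s)^2)"
  using d d2 fl fl2 unfolding cavfun_def by (auto intro: grows_const)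
qed

lemma dl_eT: "dl s = cav.eT {0, 2} s - cav.eT {0, 3} s - cav.eT {1, 2} s + cav.eT {1, 3} s"
 by (simp add: dl_def cav.eT_def)

lemma nuN_dl: "nuN 4 (%g s. dl s * f s) = nuN 4 (%g s. cav.eT {0, 2} s * f s) - nuN 4 (%g s. cav.eT {0, 3} s * f s)
  - nuN 4 (%g s. cav.eT {1, 2} s * f s) + nuN 4 (%g s. cav.eT {1, 3} s * f s)"
 unfolding dl_eT distrib_right left_diff_distrib
 by (simp only: sk.gex_add[OF grows_const grows_const] sk.gex_diff[OF grows_const grows_const])

definition "cU1 = 16 * be^2 * lipcav be h 6 * 25 * (8 ^ 4 * sqrt (cD be h C0 8) * (4 * sqrt (sqrt (cD be h C0 8))))"

lemma dl_um: "\<bar>nuN 4 (%g s. dl s * um s) - be\<^sup>2 * (Qm 0 - 2 * Qm 2 + Qm 4) * n0 4 (%g s. (um s)^2)\<bar> <= cU1 / (real N * rtN N)"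
proof -
 define r where "r = (%l l'. n0 (4 + 2) (%g s. (cav.ov (s l) (s l') - q) * um s))"
 define SA where "SA = (\<Sum>l<4+2. \<Sum>l'\<in>{..<4+2} - {l}. cw1 4 l * cw2 4 l' * r l l')"
 define B where "B = (%k. \<Sum>l\<in>{..<4+2} - {k}. (cw1 4 l + cw2 4 l) * r k l)"
 let ?S = "%T. \<Sum>l<4+2. \<Sum>l'\<in>{..<4+2} - {l}. cw1 4 l * cw2 4 l' * (Qm (card (tog l (tog l' T))) * r l l')"
 let ?c = "4 * be^2 * lipcav be h (4 + 2) * (real (4 + 1))^2 * e2 (4 + 4) (%g s. um s)"
 have sym: "r l l' = r l' l" for l l'
 proof -
  have "cav.ov sm \<tau> = cav.ov \<tau> sm" for sm \<tau> by (simp add: ov_eq overlap_def mult.commute)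
  then show ?thesis by (simp add: r_def)
 qed
 have S: "?S {k, a} = Qm 4 * SA + (Qm 2 - Qm 4) * (B k + B a) + 2 * (Qm 0 - 2 * Qm 2 + Qm 4) * r k a" if "k < 4" "a < 4" "k ~= a" for k a
  unfolding SA_def B_def mult.assoc[symmetric, of "cw1 4 _ * cw2 4 _"]
  by (rule offdiag_pair[OF that]) (rule sym, rule tog_pair_poly[OF that(3)])
 have E: "\<bar>nuN 4 (%g s. cav.eT {k, a} s * um s) - Qm 2 * n0 4 (%g s. um s) - be\<^sup>2 / 2 * ?S {k, a}\<bar> <= ?c"
  if "k < 4" "a < 4" "k ~= a" for k a
 proof -
  have T: "{k, a} \<subseteq> {..<4}" and c: "card {k, a} = 2" using that by auto
  show ?thesis using E2[OF cavfun_um(1) T] unfolding c r_def .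
 qed
 have rr: "r 0 2 - r 0 3 - r 1 2 + r 1 3 = n0 4 (%g s. (um s)^2)"
 proof -
  have "r 0 2 - r 0 3 - r 1 2 + r 1 3 = n0 (4 + 2) (%g s. (cav.ov (s 0) (s 2) - q) * um s - (cav.ov (s 0) (s 3) - q) * um s
   - (cav.ov (s 1) (s 2) - q) * um s + (cav.ov (s 1) (s 3) - q) * um s)"
   unfolding r_def by (simp only: base.gex_add[OF grows_const grows_const] base.gex_diff[OF grows_const grows_const])
  also have "... = n0 (4 + 2) (%g s. (um s)^2)" by (simp add: um_def power2_eq_square algebra_simps)
  also have "... = n0 4 (%g s. (um s)^2)"
   by (rule base.gex_superset) (use cavfun_um(2) in \<open>auto simp: cavfun_def\<close>)
  finally show ?thesis .
 qed
 have e: "4 * ?c <= cU1 / (real N * rtN N)"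
 proof -
  have "e2 (4 + 4) (%g s. um s) <= real (4 + 4) ^ 4 * sqrt (cD be h C0 (4 + 4)) * (sqrt (n0 (4 + 4) (%g s. (um s)^2)) / real N)"
   by (rule e2_le[OF grows_const])
  also have "... <= real (4 + 4) ^ 4 * sqrt (cD be h C0 (4 + 4)) * (sqrt (4^2 * sqrt (cD be h C0 (4 + 4)) / real N) / real N)"
   using um2[of "4 + 4"] by (intro mult_left_mono divide_right_mono real_sqrt_le_mono) (auto simp: cD_nonneg)
  also have "sqrt (4^2 * sqrt (cD be h C0 (4 + 4)) / real N) = 4 * sqrt (sqrt (cD be h C0 (4 + 4))) / rtN N"
   by (simp only: real_sqrt_divide real_sqrt_mult real_sqrt_abs; simp?)
  finally have b: "e2 (4 + 4) (%g s. um s) <= 8 ^ 4 * sqrt (cD be h C0 8) * (4 * sqrt (sqrt (cD be h C0 8))) / (real N * rtN N)"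
   by (simp add: mult.commute)
  have "4 * ?c = 16 * be^2 * lipcav be h 6 * 25 * e2 (4 + 4) (%g s. um s)" by simp
  also have "... <= 16 * be^2 * lipcav be h 6 * 25 * (8 ^ 4 * sqrt (cD be h C0 8) * (4 * sqrt (sqrt (cD be h C0 8))) / (real N * rtN N))"
   using cav.lipcav_nonneg by (intro mult_left_mono b) auto
  finally show ?thesis by (simp only: cU1_def times_divide_eq_right)
 qed
 let ?E = "%k a. nuN 4 (%g s. cav.eT {k, a} s * um s)" and ?M = "Qm 2 * n0 4 (%g s. um s)"
 have four: "\<bar>x1 - x2 - x3 + x4 - b * (2 * w)\<bar> <= 4 * c"
  if "\<bar>x1 - M - b * S1\<bar> <= c" "\<bar>x2 - M - b * S2\<bar> <= c" "\<bar>x3 - M - b * S3\<bar> <= c" "\<bar>x4 - M - b * S4\<bar> <= c"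
   "S1 - S2 - S3 + S4 = 2 * w" for x1 x2 x3 x4 b M S1 S2 S3 S4 c w :: real
 proof -
  have "x1 - x2 - x3 + x4 - b * (2 * w) = (x1 - M - b * S1) - (x2 - M - b * S2) - (x3 - M - b * S3) + (x4 - M - b * S4)"
   unfolding that(5)[symmetric] by (simp add: algebra_simps)
  then show ?thesis using that(1-4) by linarith
 qed
 have "\<bar>?E 0 2 - ?E 0 3 - ?E 1 2 + ?E 1 3 - be\<^sup>2 / 2 * (2 * ((Qm 0 - 2 * Qm 2 + Qm 4) * n0 4 (%g s. (um s)^2)))\<bar> <= 4 * ?c"
 proof (rule four[OF E E E E])
  show "?S {0, 2} - ?S {0, 3} - ?S {1, 2} + ?S {1, 3} = 2 * ((Qm 0 - 2 * Qm 2 + Qm 4) * n0 4 (%g s. (um s)^2))"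
   unfolding rr[symmetric] by (subst S, simp, simp, simp)+ (simp add: algebra_simps)
 qed simp_all
 then show ?thesis unfolding nuN_dl using e by simp
qed

definition "cU2 = 2 * lipcav be h 4 * (36 * sqrt (sqrt (cD be h C0 6)) * (16 * sqrt (cD be h C0 6)))"

lemma um2_diff: "\<bar>nuN 4 (%g s. (um s)^2) - n0 4 (%g s. (um s)^2)\<bar> <= cU2 / (real N * rtN N)"
proof -
 have "\<bar>nuN 4 (%g s. cav.eT {} s * (um s)^2) - Qm (card ({}::nat set)) * n0 4 (%g s. (um s)^2)\<bar> <= 2 * lipcav be h 4 * e1 (4 + 2) (%g s. (um s)^2)"
  by (rule E1[OF cavfun_um(2)]) simp
 also have "... <= 2 * lipcav be h 4 * ((real (4 + 2))^2 * sqrt (sqrt (cD be h C0 (4 + 2))) * (sqrt (n0 (4 + 2) (%g s. ((um s)^2)^2)) / rtN N))"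
  using cav.lipcav_nonneg by (intro mult_left_mono e1_le grows_const) auto
 also have "... <= 2 * lipcav be h 4 * ((real (4 + 2))^2 * sqrt (sqrt (cD be h C0 (4 + 2))) * (sqrt (16^2 * cD be h C0 (4 + 2) / real N ^ 2) / rtN N))"
  using cav.lipcav_nonneg um4[of "4 + 2"] by (intro mult_left_mono divide_right_mono real_sqrt_le_mono mult_nonneg_nonneg) (auto simp: cD_nonneg)
 also have "sqrt (16^2 * cD be h C0 (4 + 2) / real N ^ 2) = 16 * sqrt (cD be h C0 6) / real N"
  by (simp only: real_sqrt_divide real_sqrt_mult real_sqrt_abs; simp?)
 also have "2 * lipcav be h 4 * ((real (4 + 2))^2 * sqrt (sqrt (cD be h C0 (4 + 2))) * (16 * sqrt (cD be h C0 6) / real N / rtN N)) = cU2 / (real N * rtN N)"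
  by (simp add: cU2_def)
 also have "Qm (card ({}::nat set)) = 1" using std_gauss.prob_space by (simp add: tmom_def)
 finally show ?thesis by (simp add: cav.eT_def)
qed

lemma dl_bound: "s \<in> PI 4 ==> \<bar>dl s\<bar> <= 4"
proof -
 assume s: "s \<in> PI 4"
 have "\<bar>s r p\<bar> = 1" if "r < 4" for r :: nat
  by (rule cav.abs_eps, rule PiE_mem[OF s]) (use that in simp)
 from this[of 0] this[of 1] this[of 2] this[of 3] show "\<bar>dl s\<bar> <= 4" unfolding dl_def by (auto simp: abs_if split: if_splits)
qed

lemma U2_diff: "\<bar>nuN 4 (%g s. (U s)^2) - nuN 4 (%g s. (um s)^2)\<bar> <= (32 * sqrt (sqrt (1 + C0)) + 16) / (real N * rtN N)"
proof -
 have "\<bar>nuN 4 (%g s. (U s)^2) - nuN 4 (%g s. (um s)^2)\<bar> = \<bar>nuN 4 (%g s. (U s)^2 - (um s)\<^sup>2)\<bar>"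
  by (simp only: sk.gex_diff[OF grows_const grows_const])
 also have "... <= nuN 4 (%g s. \<bar>(U s)^2 - (um s)\<^sup>2\<bar>)" by (rule sk.gex_abs_le[OF grows_const])
 also have "... <= nuN 4 (%g s. 8 / real N * (\<bar>U s\<bar> * \<bar>1\<bar>) + 16 / (real N)^2)"
 proof (intro sk.gex_mono grows_const)
  fix s assume s: "s \<in> PI 4"
  have "(U s)^2 - (um s)\<^sup>2 = 2 * U s * (dl s / real N) - (dl s / real N)\<^sup>2"
   unfolding U_um by (simp add: power2_eq_square algebra_simps)
  also have "\<bar>...\<bar> <= \<bar>2 * U s * (dl s / real N)\<bar> + (dl s / real N)^2" using abs_triangle_ineq4[of "2 * U s * (dl s / real N)" "(dl s / real N)^2"] by simp
  also have "\<bar>2 * U s * (dl s / real N)\<bar> = 2 * \<bar>U s\<bar> * (\<bar>dl s\<bar> / real N)" by (simp add: abs_mult)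
  also have "... <= 2 * \<bar>U s\<bar> * (4 / real N)" using dl_bound[OF s] by (intro mult_left_mono divide_right_mono) auto
  also have "(dl s / real N)^2 <= (4 / real N)^2" using divide_right_mono[OF dl_bound[OF s], of "real N"] by (intro abs_le_square_iff[THEN iffD1]) simp
  finally show "\<bar>(U s)^2 - (um s)\<^sup>2\<bar> <= 8 / real N * (\<bar>U s\<bar> * \<bar>1\<bar>) + 16 / (real N)^2" by (simp add: power_divide)
 qed
 also have "... = 8 / real N * nuN 4 (%g s. \<bar>U s\<bar> * \<bar>1\<bar>) + 16 / (real N)^2"
  by (simp only: sk.gex_add[OF grows_const grows_const] sk.gex_cmult sk.gex_const)
 also have "nuN 4 (%g s. \<bar>U s\<bar> * \<bar>1\<bar>) <= sqrt (nuN 4 (%g s. (U s)^2)) * sqrt (nuN 4 (%g s. 1^2))"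
  by (intro sk.gex_cauchy_schwarz grows_const)
 also have "... <= sqrt (4^2 * sqrt (1 + C0) / real N)" using U2 by (simp add: sk.gex_const)
 also have "... = 4 * sqrt (sqrt (1 + C0)) / rtN N" by (simp only: real_sqrt_divide real_sqrt_mult real_sqrt_abs; simp?)
 finally have 1: "\<bar>nuN 4 (%g s. (U s)^2) - nuN 4 (%g s. (um s)^2)\<bar> <= 8 / real N * (4 * sqrt (sqrt (1 + C0)) / rtN N) + 16 / (real N)^2"
  using N0 by (simp add: divide_right_mono)
 have "rtN N <= real N" using N0 by (simp add: real_le_lsqrt power2_eq_square)
 then have "real N * rtN N <= (real N)^2" using N0 by (simp add: power2_eq_square)
 then have "16 / (real N)^2 <= 16 / (real N * rtN N)" using N0 by (intro divide_left_mono) auto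
 then show ?thesis using 1 by (simp add: add_divide_distrib)
qed

lemma dl2: "\<bar>nuN 4 (%g s. (dl s)^2) - 4 * (Qm 0 - 2 * Qm 2 + Qm 4)\<bar> <= 12 * c1 4 / rtN N"
proof -
 have "nuN 4 (%g s. (dl s)^2) = nuN 4 (%g s. 4 * (1 - cav.eT {0, 1} s - cav.eT {2, 3} s + cav.eT {0, 1, 2, 3} s))"
 proof (rule sk.gex_cong)
  fix s assume s: "s \<in> PI 4"
  have "s r p * s r p = 1" if "r < 4" for r :: nat
  proof -
   have "\<bar>s r p\<bar> = 1" by (rule cav.abs_eps, rule PiE_mem[OF s]) (use that in simp)
   then show ?thesis by (metis abs_mult_self_eq mult_1)
  qed
  from this[of 0] this[of 1] this[of 2] this[of 3]
  show "(dl s)^2 = 4 * (1 - cav.eT {0, 1} s - cav.eT {2, 3} s + cav.eT {0, 1, 2, 3} s)"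
   unfolding dl_def cav.eT_def by simp algebra
 qed
 also have "... = 4 * (1 - nuN 4 (%g s. cav.eT {0, 1} s) - nuN 4 (%g s. cav.eT {2, 3} s) + nuN 4 (%g s. cav.eT {0, 1, 2, 3} s))"
  by (simp only: sk.gex_cmult sk.gex_add[OF grows_const grows_const] sk.gex_diff[OF grows_const grows_const] sk.gex_const)
 finally have e: "nuN 4 (%g s. (dl s)^2) = 4 * (1 - nuN 4 (%g s. cav.eT {0, 1} s) - nuN 4 (%g s. cav.eT {2, 3} s) + nuN 4 (%g s. cav.eT {0, 1, 2, 3} s))" .
 have s: "{0, 1} \<subseteq> {..<4::nat}" "{2, 3} \<subseteq> {..<4::nat}" "{0, 1, 2, 3} \<subseteq> {..<4::nat}" by auto
 have c: "card {0, 1::nat} = 2" "card {2, 3::nat} = 2" "card {0, 1, 2, 3::nat} = 4" by auto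
 have q0: "Qm 0 = 1" using std_gauss.prob_space by (simp add: tmom_def)
 have alg: "\<bar>4 * (1 - A - B + C) - 4 * (1 - 2 * x + z)\<bar> <= 12 * y"
  if "\<bar>A - x\<bar> <= y" "\<bar>B - x\<bar> <= y" "\<bar>C - z\<bar> <= y" for A B C x y z :: real
 proof -
  have "4 * (1 - A - B + C) - 4 * (1 - 2 * x + z) = 4 * (C - z) - 4 * (A - x) - 4 * (B - x)" by (simp add: algebra_simps)
  moreover have "\<bar>4 * (C - z) - 4 * (A - x) - 4 * (B - x)\<bar> <= \<bar>4 * (C - z)\<bar> + \<bar>4 * (A - x)\<bar> + \<bar>4 * (B - x)\<bar>"
   by linarith
  ultimately show ?thesis using that unfolding abs_mult by simp
 qed
 show ?thesis
  unfolding e q0 times_divide_eq_right[symmetric]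
  by (rule alg[OF site_moment[OF s(1), unfolded c] site_moment[OF s(2), unfolded c] site_moment[OF s(3), unfolded c]])
qed

text \<open>The alternating sum \<open>U\<close> is an average of \<open>dl\<close> over sites. In the second order expansion all terms cancel but
the one with both indices in the pair, which reproduces the variance of \<open>U\<close>.\<close>

lemma site_variance:
 "\<bar>nuN 4 (%g s. dl s * U s) - be\<^sup>2 * (Qm 0 - 2 * Qm 2 + Qm 4) * nuN 4 (%g s. (U s)^2) - 4 * (Qm 0 - 2 * Qm 2 + Qm 4) / real N\<bar>
  <= (cU1 + \<bar>be^2 * (Qm 0 - 2 * Qm 2 + Qm 4)\<bar> * (cU2 + (32 * sqrt (sqrt (1 + C0)) + 16)) + 12 * c1 4) / (real N * rtN N)"
proof -
 define a where "a = be^2 * (Qm 0 - 2 * Qm 2 + Qm 4)"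
 define W where "W = real N * rtN N"
 have "nuN 4 (%g s. dl s * U s) = nuN 4 (%g s. dl s * um s + 1 / real N * (dl s)^2)"
  unfolding U_um by (simp add: distrib_left power2_eq_square)
 also have "... = nuN 4 (%g s. dl s * um s) + 1 / real N * nuN 4 (%g s. (dl s)^2)"
  by (simp only: sk.gex_add[OF grows_const grows_const] sk.gex_cmult)
 finally have d: "nuN 4 (%g s. dl s * U s) = nuN 4 (%g s. dl s * um s) + 1 / real N * nuN 4 (%g s. (dl s)^2)" .
 have 3: "\<bar>1 / real N * (nuN 4 (%g s. (dl s)^2) - 4 * (Qm 0 - 2 * Qm 2 + Qm 4))\<bar> <= 12 * c1 4 / W"
  using mult_left_mono[OF dl2, of "1 / real N"] by (simp add: abs_mult W_def)
 have "\<bar>nuN 4 (%g s. (U s)^2) - n0 4 (%g s. (um s)^2)\<bar> <= cU2 / W + (32 * sqrt (sqrt (1 + C0)) + 16) / W"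
  using um2_diff U2_diff unfolding W_def by linarith
 then have "\<bar>a * (nuN 4 (%g s. (U s)^2) - n0 4 (%g s. (um s)^2))\<bar> <= \<bar>a\<bar> * (cU2 / W + (32 * sqrt (sqrt (1 + C0)) + 16) / W)"
  unfolding abs_mult by (rule mult_left_mono) simp
 then have 2: "\<bar>a * nuN 4 (%g s. (U s)^2) - a * n0 4 (%g s. (um s)^2)\<bar> <= (\<bar>a\<bar> * (cU2 + (32 * sqrt (sqrt (1 + C0)) + 16))) / W"
  by (simp only: right_diff_distrib add_divide_distrib[symmetric] times_divide_eq_right)
 have 1: "\<bar>nuN 4 (%g s. dl s * um s) - a * n0 4 (%g s. (um s)^2)\<bar> <= cU1 / W" using dl_um unfolding a_def W_def .
 have 4: "1 / real N * (nuN 4 (%g s. (dl s)^2) - 4 * (Qm 0 - 2 * Qm 2 + Qm 4)) = 1 / real N * nuN 4 (%g s. (dl s)^2) - 4 * (Qm 0 - 2 * Qm 2 + Qm 4) / real N"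
  by (simp add: right_diff_distrib)
 show ?thesis
  unfolding a_def[symmetric] W_def[symmetric] d add_divide_distrib using 1 2 3[unfolded 4] by linarith
qed

end

lemma nonpos_of_le_inverse_sqrt:
 fixes x D :: real
 assumes "!!N. 1 <= N ==> x <= D / rtN N"
 shows "x <= 0"
proof (rule LIMSEQ_le_const)
 show "(%N. D / rtN N) \<longlonglongrightarrow> 0" by real_asymp
 show "\<exists>M. \<forall>N\<ge>M. x <= D / rtN N" using assms by blast
qed

lemma tanh_square_bounds: "0 <= (tanh x)^2" "(tanh x)^2 < 1" for x :: real
 using abs_square_less_1[of "tanh x"] tanh_real_bounds[of x] by (auto simp: abs_less_iff)

lemma tmom_integrable:
 "integrable std_gauss (%z. tanh (be * (sqrt q * z) + be * h) ^ k)"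
proof (rule std_gauss.integrable_const_bound[of _ 1])
 show "AE z in std_gauss. norm (tanh (be * (sqrt q * z) + be * h) ^ k) <= 1"
  using tanh_real_bounds by (intro AE_I2) (auto simp: power_abs power_le_one abs_le_iff less_imp_le)
qed (simp add: measurable_cong_sets[OF sets_std_gauss refl])

lemma tmom_alpha2_pos: "0 < tmom be h q 0 - 2 * tmom be h q 2 + tmom be h q 4"
proof -
 let ?t = "%z. tanh (be * (sqrt q * z) + be * h)"
 note i = tmom_integrable[of be q h]
 have "(\<integral>z. 0 \<partial>std_gauss) < (\<integral>z. ?t z ^ 0 - 2 * ?t z ^ 2 + ?t z ^ 4 \<partial>std_gauss)"
 proof (rule std_gauss.integral_less_AE_space)
  show "integrable std_gauss (%z. ?t z ^ 0 - 2 * ?t z ^ 2 + ?t z ^ 4)"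
   by (intro Bochner_Integration.integrable_add Bochner_Integration.integrable_diff integrable_mult_right i)
  show "AE z in std_gauss. 0 < ?t z ^ 0 - 2 * ?t z ^ 2 + ?t z ^ 4"
  proof (rule AE_I2)
   fix z
   have "0 < (1 - (?t z)\<^sup>2) * (1 - (?t z)\<^sup>2)" using tanh_square_bounds(2)[of "be * (sqrt q * z) + be * h"] by (intro mult_pos_pos) auto
   also have "... = ?t z ^ 0 - 2 * ?t z ^ 2 + ?t z ^ 4" by (simp add: algebra_simps power2_eq_square power4_eq_xxxx)
   finally show "0 < ?t z ^ 0 - 2 * ?t z ^ 2 + ?t z ^ 4" .
  qed
 qed (simp_all add: std_gauss.emeasure_space_1[simplified])
 also have "... = tmom be h q 0 - 2 * tmom be h q 2 + tmom be h q 4"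
  unfolding tmom_def
  by (simp only: Bochner_Integration.integral_add Bochner_Integration.integral_diff integral_mult_right_zero
    Bochner_Integration.integrable_diff integrable_mult_right i)
 finally show ?thesis by simp
qed

context est
begin

lemma nuN_overlap_first: "\<bar>nuN 2 (%g s. overlap N (s 0) (s 1)) - q\<bar> <= sqrt (sqrt (1 + C0)) / rtN N"
proof -
 let ?d = "%s. overlap N (s 0) (s 1) - q"
 have cs: "nuN 2 (%g s. \<bar>f s\<bar> * \<bar>1\<bar>) <= sqrt (nuN 2 (%g s. (f s)^2)) * sqrt (nuN 2 (%g s. 1^2))" for f
  by (intro sk.gex_cauchy_schwarz grows_const)
 have "nuN 2 (%g s. (?d s)^2) <= sqrt (nuN 2 (%g s. ?d s ^ 4))"
  using cs[of "%s. (?d s)^2"] by (simp add: sk.gex_const)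
 also have "... <= sqrt ((1 + C0) / real N ^ 2)" by (intro real_sqrt_le_mono nuN_fourth) auto
 finally have 2: "nuN 2 (%g s. (?d s)^2) <= sqrt (1 + C0) / real N" by (simp add: real_sqrt_divide)
 have "nuN 2 (%g s. overlap N (s 0) (s 1)) - q = nuN 2 (%g s. ?d s)"
  by (simp only: sk.gex_diff[OF grows_const grows_const] sk.gex_const)
 then have "\<bar>nuN 2 (%g s. overlap N (s 0) (s 1)) - q\<bar> <= nuN 2 (%g s. \<bar>?d s\<bar>)"
  using sk.gex_abs_le[OF grows_const, of N be h 2 ?d] by simp
 also have "... <= sqrt (nuN 2 (%g s. (?d s)^2))" using cs[of ?d] by (simp add: sk.gex_const)
 also have "... <= sqrt (sqrt (1 + C0) / real N)" using 2 by (rule real_sqrt_le_mono)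
 finally show ?thesis by (simp add: real_sqrt_divide)
qed

end

locale hightemp_cond =
 fixes be h q C0 :: real
 assumes be: "0 <= be" and q: "0 <= q" "q <= 1" and C0: "0 <= C0"
  and ht: "!!N. 1 <= N ==> sk.gex N be h 2 (%g s. (overlap N (s 0) (s 1) - q) ^ 6) <= C0 / real N ^ 3"
begin

abbreviation "Q \<equiv> tmom be h q"

lemma est_unit: "1 <= p ==> p <= N ==> est N p be h q (%_ :: unit. 0) 1 C0"
 using be q C0 ht by unfold_locales (auto simp: bij_betw_def inj_on_def)

lemma average_bound:
 fixes v :: "nat => real"
 assumes "1 <= N" "!!p. 1 <= p ==> p <= N ==> \<bar>v p - b\<bar> <= c"
 shows "\<bar>1 / real N * (\<Sum>p=1..N. v p) - b\<bar> <= c"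
proof -
 have "\<bar>\<Sum>p=1..N. v p - b\<bar> <= (\<Sum>p=1..N. c)" by (rule order_trans[OF sum_abs sum_mono]) (use assms in auto)
 then have "\<bar>(\<Sum>p=1..N. v p) - real N * b\<bar> <= real N * c" by (simp add: sum_subtractf)
 moreover have "1 / real N * (\<Sum>p=1..N. v p) - b = 1 / real N * ((\<Sum>p=1..N. v p) - real N * b)"
  using assms(1) by (simp add: right_diff_distrib)
 moreover have "1 / real N * \<bar>(\<Sum>p=1..N. v p) - real N * b\<bar> <= 1 / real N * (real N * c)"
  by (intro mult_left_mono calculation(1)) simp
 ultimately show ?thesis using assms(1) by (simp add: abs_mult)
qed

text \<open>Expand the average of two spins at a site, and average over sites.\<close>

theorem fixed_point: "Q 2 = q"
proof -
 define C where "C = 2 * lipcav be h 2 * ((real (2 + 2))^2 * sqrt (sqrt (cD be h C0 (2 + 2))))"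
 have "\<bar>Q 2 - q\<bar> <= (C + sqrt (sqrt (1 + C0))) / rtN N" if N: "1 <= N" for N
 proof -
  have s: "\<bar>sk.gex N be h 2 (%g s. s 0 p * s 1 p) - Q 2\<bar> <= C / rtN N" if p: "1 <= p" "p <= N" for p
  proof -
   interpret e: est N p be h q "%_ :: unit. 0" 1 0 C0 by (rule est_unit[OF p])
   have T: "{0, 1} \<subseteq> {..<2::nat}" and c: "card {0, 1::nat} = 2" by auto
   have "e.cav.eT {0, 1} s = s 0 p * s 1 p" for s by (simp add: e.cav.eT_def)
   then show ?thesis using e.site_moment[OF T, unfolded c] by (simp add: e.c1_def C_def)
  qed
  interpret e: est N 1 be h q "%_ :: unit. 0" 1 0 C0 by (rule est_unit) (use N in auto)
  have "sk.gex N be h 2 (%g s. overlap N (s 0) (s 1)) = 1 / real N * (\<Sum>p=1..N. sk.gex N be h 2 (%g s. s 0 p * s 1 p))"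
   unfolding overlap_def sk.gex_cmult by (subst sk.gex_sum[OF grows_const]) rule
  then have "\<bar>sk.gex N be h 2 (%g s. overlap N (s 0) (s 1)) - Q 2\<bar> <= C / rtN N"
   using average_bound[OF N s] by simp
  then show ?thesis using e.nuN_overlap_first unfolding add_divide_distrib by linarith
 qed
 from nonpos_of_le_inverse_sqrt[OF this] show ?thesis by simp
qed

text \<open>If it failed, \<open>site_variance\<close> would bound a fixed positive number by \<open>O(1/sqrt N)\<close>.\<close>

theorem stability: "be^2 * (1 - 2 * q + Q 4) < 1"
proof (rule ccontr)
 define a where "a = Q 0 - 2 * Q 2 + Q 4"
 have a: "0 < a" unfolding a_def by (rule tmom_alpha2_pos)
 have "Q 0 = 1" using std_gauss.prob_space by (simp add: tmom_def)
 then have a': "a = 1 - 2 * q + Q 4" by (simp add: a_def fixed_point)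
 assume "\<not> be^2 * (1 - 2 * q + Q 4) < 1"
 then have x: "1 - be\<^sup>2 * a <= 0" by (simp add: a')
 define R where "R = (%N s. overlap N (s 0) (s 2) - overlap N (s 0) (s 3) - overlap N (s 1) (s 2) + overlap N (s 1) (s (3::nat)))"
 define D where "D = (%p s. s 0 p * s 2 p - s 0 p * s 3 p - s 1 p * s 2 p + s 1 p * s (3::nat) (p::nat) :: real)"
 define C where "C = (16 * be^2 * lipcav be h 6 * 25 * (8 ^ 4 * sqrt (cD be h C0 8) * (4 * sqrt (sqrt (cD be h C0 8)))) + \<bar>be^2 * a\<bar> *
  (2 * lipcav be h 4 * (36 * sqrt (sqrt (cD be h C0 6)) * (16 * sqrt (cD be h C0 6))) + (32 * sqrt (sqrt (1 + C0)) + 16))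
  + 12 * (2 * lipcav be h 4 * ((real (4 + 2))^2 * sqrt (sqrt (cD be h C0 (4 + 2))))))"
 have "4 * a <= C / rtN N" if N: "1 <= N" for N
 proof -
  let ?v = "sk.gex N be h 4 (%g s. (R N s)^2)"
  have s: "\<bar>sk.gex N be h 4 (%g s. D p s * R N s) - (be^2 * a * ?v + 4 * a / real N)\<bar> <= C / (real N * rtN N)" if p: "1 <= p" "p <= N" for p
  proof -
   interpret e: est N p be h q "%_ :: unit. 0" 1 0 C0 by (rule est_unit[OF p])
   have "e.U = R N" "e.dl = D p" by (simp_all add: fun_eq_iff e.U_def e.dl_def R_def D_def)
   then show ?thesis using e.site_variance unfolding e.cU1_def e.cU2_def e.c1_def a_def[symmetric] C_def[symmetric]
    by (simp add: diff_diff_eq)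
  qed
  have "R N s = 1 / real N * (\<Sum>p=1..N. D p s)" for s
   by (simp add: R_def D_def overlap_def sum.distrib sum_subtractf diff_divide_distrib add_divide_distrib)
  then have "(R N s)^2 = 1 / real N * (\<Sum>p=1..N. D p s * R N s)" for s
   by (simp only: power2_eq_square sum_distrib_right[symmetric] mult.assoc)
  then have "?v = 1 / real N * (\<Sum>p=1..N. sk.gex N be h 4 (%g s. D p s * R N s))"
   by (simp only: sk.gex_cmult sk.gex_sum[OF grows_const])
  then have "\<bar>?v - (be^2 * a * ?v + 4 * a / real N)\<bar> <= C / (real N * rtN N)"
   using average_bound[OF N s] by simp
  moreover have "(1 - be\<^sup>2 * a) * ?v <= 0"
   using x by (intro mult_nonpos_nonneg sk.gex_nonneg) auto
  ultimately have "4 * a / real N <= C / (real N * rtN N)" by (simp add: left_diff_distrib)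
  then have "real N * (4 * a / real N) <= real N * (C / (real N * rtN N))" by (rule mult_left_mono) simp
  then show ?thesis using N by simp
 qed
 from nonpos_of_le_inverse_sqrt[OF this] a show False by simp
qed

end

section \<open>Strict monotonicity of the Gaussian average in the field\<close>

lemma std_gauss_integral: "(\<integral>x. f x \<partial>std_gauss) = (\<integral>x. std_normal_density x * f x \<partial>lborel)"
 if "f \<in> borel_measurable borel" for f :: "real => real"
 unfolding std_gauss_def using that by (subst integral_density) auto

lemma std_gauss_shift:
 fixes g :: "real => real"
 assumes [measurable]: "g \<in> borel_measurable borel"
 shows "(\<integral>x. g (x + th) \<partial>std_gauss) = exp (- th\<^sup>2 / 2) * (\<integral>x. g x * exp (th * x) \<partial>std_gauss)"
proof -
 have "(\<integral>x. g x * exp (th * x) \<partial>std_gauss) = (\<integral>x. exp (th^2 / 2) * (normal_density th 1 x * g x) \<partial>lborel)"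
 proof (subst std_gauss_integral)
  have "std_normal_density x * (g x * exp (th * x)) = (std_normal_density x * exp (th * x)) * g x" for x
   by (simp only: mult_ac)
  then show "(\<integral>x. std_normal_density x * (g x * exp (th * x)) \<partial>lborel) = (\<integral>x. exp (th^2 / 2) * (normal_density th 1 x * g x) \<partial>lborel)"
   unfolding std_normal_density_exp_shift by (simp only: mult.assoc)
 qed measurable
 also have "... = exp (th^2 / 2) * (\<integral>x. normal_density th 1 x * g x \<partial>lborel)" by simp
 also have "(\<integral>x. normal_density th 1 x * g x \<partial>lborel) = (\<integral>x. normal_density th 1 (th + 1 * x) * g (th + 1 * x) \<partial>lborel)"
  by (subst lborel_integral_real_affine[of 1 _ th]) simp_all
 also have "... = (\<integral>x. g (x + th) \<partial>std_gauss)"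
  by (subst std_gauss_integral) (auto simp: normal_density_def add.commute)
 finally show ?thesis by (simp flip: exp_add mult.assoc)
qed

lemma std_gauss_reflect:
 fixes g :: "real => real"
 assumes [measurable]: "g \<in> borel_measurable borel"
 shows "(\<integral>x. g (- x) \<partial>std_gauss) = (\<integral>x. g x \<partial>std_gauss)"
proof -
 have "(\<integral>x. g x \<partial>std_gauss) = (\<integral>x. std_normal_density x * g x \<partial>lborel)" by (rule std_gauss_integral) simp
 also have "... = (\<integral>x. std_normal_density (0 + -1 * x) * g (0 + -1 * x) \<partial>lborel)"
  by (subst lborel_integral_real_affine[of "-1" _ 0]) simp_all
 also have "... = (\<integral>x. g (- x) \<partial>std_gauss)" by (subst std_gauss_integral) (simp_all add: normal_density_def)
 finally show ?thesis by simp
qed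

lemma tanh_square_less: "\<bar>x\<bar> < \<bar>y\<bar> ==> (tanh x)^2 < (tanh y)^2" for x y :: real
proof -
 assume xy: "\<bar>x\<bar> < \<bar>y\<bar>"
 have a: "\<bar>tanh t\<bar> = tanh \<bar>t\<bar>" for t :: real by (cases "t >= 0") (auto simp: abs_if)
 have "\<bar>tanh x\<bar> < \<bar>tanh y\<bar>" unfolding a using strict_monoD[OF tanh_real_strict_mono xy] .
 then show ?thesis using power_strict_mono[of "\<bar>tanh x\<bar>" "\<bar>tanh y\<bar>" 2] by simp
qed

text \<open>With \<open>c\<close> the midpoint and \<open>d\<close> half the length of \<open>[a, b]\<close>, the difference is the mean of the odd function
\<open>k\<close> at \<open>s z + c\<close>. A Gaussian shift turns this into the mean of \<open>k (s z) exp (th z)\<close>, and pairing \<open>z\<close> with \<open>-z\<close> leaves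
a positive integrand.\<close>

lemma tanh_square_mean_strict_mono:
 fixes s a b :: real
 assumes s: "0 <= s" and ab: "0 <= a" "a < b"
 shows "(\<integral>z. (tanh (s * z + a))^2 \<partial>std_gauss) < (\<integral>z. (tanh (s * z + b))^2 \<partial>std_gauss)"
proof -
 define c d where "c = (a + b) / 2" and "d = (b - a) / 2"
 have cd: "0 < c" "0 < d" "a = c - d" "b = c + d" using ab by (auto simp: c_def d_def field_simps)
 define k where "k = (%y. (tanh (y + d))^2 - (tanh (y - d))^2)"
 have tm[measurable]: "(tanh :: real => real) \<in> borel_measurable borel" by (rule borel_measurable_tanh_real)
 have km[measurable]: "k \<in> borel_measurable borel" unfolding k_def by measurable
 have k_odd: "k (- y) = - k y" for y
 proof -
  have "(tanh (- y + d))^2 = (tanh (y - d))^2" "(tanh (- y - d))^2 = (tanh (y + d))^2"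
   using tanh_minus[of "y - d"] tanh_minus[of "y + d"] by simp_all
  then show ?thesis by (simp add: k_def)
 qed
 have k_pos: "0 < k y" if "0 < y" for y
  unfolding k_def using tanh_square_less[of "y - d" "y + d"] that cd by auto
 have k_bd: "\<bar>k y\<bar> <= 1" for y
  unfolding k_def using tanh_square_bounds[of "y + d"] tanh_square_bounds[of "y - d"] by linarith
 have int: "integrable std_gauss (%z. (tanh (s * z + t))^2)" for t
  by (rule std_gauss.integrable_const_bound[of _ 1])
   (use tanh_square_bounds in \<open>auto simp: less_imp_le measurable_cong_sets[OF sets_std_gauss refl]\<close>)
 have "0 < (\<integral>z. k (s * z + c) \<partial>std_gauss)"
 proof (cases "s = 0")
  case True
  then show ?thesis using k_pos[OF cd(1)] std_gauss.prob_space by simp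
 next
  case False
  then have s: "0 < s" using s by simp
  define th where "th = c / s"
  have th: "0 < th" using cd s by (simp add: th_def)
  have ie: "integrable std_gauss (%z. k (s * z) * exp (t * z))" for t
   by (rule Bochner_Integration.integrable_bound[OF std_gauss_exp_linear(1)[of t]])
    (use k_bd in \<open>auto simp: abs_mult mult_left_le_one_le measurable_cong_sets[OF sets_std_gauss refl]\<close>)
  have "(\<integral>z. k (s * z) * exp (th * z) \<partial>std_gauss) = (\<integral>z. k (s * - z) * exp (th * - z) \<partial>std_gauss)"
   by (rule std_gauss_reflect[symmetric]) measurable
  also have "... = - (\<integral>z. k (s * z) * exp (- th * z) \<partial>std_gauss)" by (simp add: k_odd)
  finally have "2 * (\<integral>z. k (s * z) * exp (th * z) \<partial>std_gauss) = (\<integral>z. k (s * z) * exp (th * z) - k (s * z) * exp (- th * z) \<partial>std_gauss)"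
   unfolding Bochner_Integration.integral_diff[OF ie ie] by linarith
  also have "... > (\<integral>z. 0 \<partial>std_gauss)"
  proof (rule std_gauss.integral_less_AE_space)
   have "AE z in std_gauss. z ~= 0"
    unfolding std_gauss_def by (subst AE_density) (use AE_lborel_singleton[of "0::real"] in auto)
   then show "AE z in std_gauss. 0 < k (s * z) * exp (th * z) - k (s * z) * exp (- th * z)"
   proof (rule AE_mp, intro AE_I2 impI)
    fix z :: real assume z: "z ~= 0"
    have e: "k (s * z) * exp (th * z) - k (s * z) * exp (- th * z) = k (s * z) * (exp (th * z) - exp (- th * z))"
     by (simp only: right_diff_distrib)
    show "0 < k (s * z) * exp (th * z) - k (s * z) * exp (- th * z)"
    proof (cases "0 < z")
     case True
     have "0 < exp (th * z) - exp (- th * z)" using True th by (simp add: mult_pos_pos)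
     then show ?thesis unfolding e using k_pos[of "s * z"] True s by simp
    next
     case False
     then have z: "0 < - z" using z by simp
     have "th * z < 0" using th z by (simp add: mult_pos_neg)
     then have "exp (th * z) - exp (- th * z) < 0" by simp
     moreover have "k (s * z) < 0" using k_pos[of "s * - z"] k_odd[of "s * z"] mult_pos_neg[OF s, of z] z by simp
     ultimately show ?thesis unfolding e by (rule mult_neg_neg[rotated])
    qed
   qed
   show "integrable std_gauss (%z. k (s * z) * exp (th * z) - k (s * z) * exp (- th * z))"
    by (rule Bochner_Integration.integrable_diff[OF ie ie])
  qed (use std_gauss.emeasure_space_1 in simp_all)
  finally have J: "0 < (\<integral>z. k (s * z) * exp (th * z) \<partial>std_gauss)" by simp
  have "(\<integral>z. k (s * z + c) \<partial>std_gauss) = (\<integral>z. k (s * (z + th)) \<partial>std_gauss)"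
   using s by (simp add: th_def distrib_left)
  also have "... = exp (- th\<^sup>2 / 2) * (\<integral>z. k (s * z) * exp (th * z) \<partial>std_gauss)"
   by (rule std_gauss_shift[of "%z. k (s * z)"]) measurable
  finally show ?thesis using J by simp
 qed
 also have "(\<integral>z. k (s * z + c) \<partial>std_gauss) = (\<integral>z. (tanh (s * z + b))^2 \<partial>std_gauss) - (\<integral>z. (tanh (s * z + a))^2 \<partial>std_gauss)"
  unfolding k_def cd(3,4) using int[of "c + d"] int[of "c - d"] by (simp add: add.assoc add_diff_eq)
 finally show ?thesis by simp
qed

lemma tanh_square_mean_inj:
 fixes s a b :: real
 assumes s: "0 <= s" and eq: "(\<integral>z. (tanh (s * z + a))^2 \<partial>std_gauss) = (\<integral>z. (tanh (s * z + b))^2 \<partial>std_gauss)"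
 shows "\<bar>a\<bar> = \<bar>b\<bar>"
proof -
 have tm[measurable]: "(tanh :: real => real) \<in> borel_measurable borel" by (rule borel_measurable_tanh_real)
 have ev: "(\<integral>z. (tanh (s * z + \<bar>t\<bar>))^2 \<partial>std_gauss) = (\<integral>z. (tanh (s * z + t))^2 \<partial>std_gauss)" for t
 proof (cases "0 <= t")
  case False
  have "(\<integral>z. (tanh (s * z + t))^2 \<partial>std_gauss) = (\<integral>z. (tanh (s * - z + t))^2 \<partial>std_gauss)"
   by (rule std_gauss_reflect[symmetric]) measurable
  also have "... = (\<integral>z. (tanh (s * z + \<bar>t\<bar>))^2 \<partial>std_gauss)"
  proof (intro Bochner_Integration.integral_cong refl)
   fix z
   have "s * - z + t = - (s * z + \<bar>t\<bar>)" using False by simp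
   then show "(tanh (s * - z + t))^2 = (tanh (s * z + \<bar>t\<bar>))^2" by (simp only: tanh_minus power2_minus)
  qed
  finally show ?thesis by simp
 qed simp
 show ?thesis
 proof (rule ccontr)
  assume "\<bar>a\<bar> ~= \<bar>b\<bar>"
  then consider "\<bar>a\<bar> < \<bar>b\<bar>" | "\<bar>b\<bar> < \<bar>a\<bar>" by linarith
  then show False
   using tanh_square_mean_strict_mono[OF s, of "\<bar>a\<bar>" "\<bar>b\<bar>"] tanh_square_mean_strict_mono[OF s, of "\<bar>b\<bar>" "\<bar>a\<bar>"] eq
   by cases (auto simp: ev)
 qed
qed

section \<open>The covariance matrix\<close>

lemma tame_coordinate: "tame 1 (%x. 1 + \<bar>x $ k\<bar>) (%x :: real ^ 'm::finite. x $ k)"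
proof -
 have pd: "pd j (%x :: real ^ 'm. x $ k) x = axis j 1 $ k" for j x
  by (rule partial_derivI[OF bounded_linear.has_derivative[OF bounded_linear_vec_nth has_derivative_ident]])
 have pd1: "\<bar>pd j (%x :: real ^ 'm. x $ k) x\<bar> <= 1" for j x
  unfolding pd by (simp add: axis_def)
 have "1 + \<bar>y $ k\<bar> <= 2 * exp (2 * n1 (y - x)) * (1 + \<bar>x $ k\<bar>)" for x y :: "real ^ 'm"
 proof -
  let ?D = "n1 (y - x)"
  have D: "0 <= ?D" "\<bar>y $ k - x $ k\<bar> <= ?D" using n1_nonneg abs_le_n1[of "y - x" k] by auto
  have "1 + \<bar>y $ k\<bar> <= (1 + ?D) * (1 + \<bar>x $ k\<bar>)"
  proof -
   have "(1 + ?D) * (1 + \<bar>x $ k\<bar>) = 1 + \<bar>x $ k\<bar> + ?D + ?D * \<bar>x $ k\<bar>" by (simp add: algebra_simps)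
   then show ?thesis using D mult_nonneg_nonneg[OF D(1) abs_ge_zero[of "x $ k"]] by linarith
  qed
  also have "... <= (2 * exp (2 * ?D)) * (1 + \<bar>x $ k\<bar>)"
   using exp_ge_add_one_self[of "2 * ?D"] D(1) by (intro mult_right_mono) linarith+
  finally show ?thesis .
 qed
 moreover have "continuous_on UNIV (pd j (%x :: real ^ 'm. x $ k))" for j
  unfolding pd[abs_def] by (rule continuous_on_const)
 moreover have "0 <= n1 (y - x) * exp (2 * n1 (y - x)) * (1 + \<bar>x $ k\<bar>)" for x y :: "real ^ 'm"
  by (intro mult_nonneg_nonneg n1_nonneg) auto
 moreover have "(%x :: real ^ 'm. x $ k) differentiable (at x)" for x
  by (rule bounded_linear_imp_differentiable[OF bounded_linear_vec_nth])
 moreover have "\<bar>pd j (%x :: real ^ 'm. x $ k) x\<bar> <= 1 + \<bar>x $ k\<bar>" for j x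
  using pd1[of j x] by linarith
 ultimately show ?thesis
  unfolding tame_def by (simp add: pd continuous_intros)
qed

lemma zero_test: "(%x :: real ^ 'm::finite. 0) \<in> test_functions"
proof -
 have "grad (%x :: real ^ 'm. 0) = (%x. 0)"
  by (simp add: fun_eq_iff grad_def vec_eq_iff partial_derivI[OF has_derivative_const])
 then show ?thesis
  unfolding test_functions_def by (auto intro!: exI[of _ 0] lipschitz_onI)
qed

context hightemp
begin

lemma coordinate_appr: "appr (%N f. E N n (%g s. X N g s $ r * f (X N g s)))"
proof (cases r)
 case (Inl i)
 then show ?thesis using energy_appr[of i] by (simp add: X_def fluct_def)
next
 case (Inr i)
 then show ?thesis using magn_appr[of i] by (simp add: X_def fluct_def)
qed

lemma coordinate_expansion:
 obtains L C where "0 < C" "!!r N a K f. 1 <= N ==> tame a K f ==>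
  \<bar>E N n (%g s. X N g s $ r * f (X N g s)) - (\<Sum>k\<in>UNIV. L r k * Dk k N f)\<bar> <= C * w N a K"
proof -
 define S where "S = (%r u. small (%N p f. E N n (%g s. X N g s $ r * f (X N g s)) - (\<Sum>k\<in>UNIV. u k * Dk k N f)))"
 have "\<exists>u. S r u" for r unfolding S_def using coordinate_appr[of r] by (simp only: appr_def)
 then obtain L where L: "!!r. S r (L r)" using choice[of S] by blast
 define P where "P = (%r c. 0 <= c & (\<forall>N p a K f. 1 <= p --> p <= N --> tame a K f -->
  \<bar>E N n (%g s. X N g s $ r * f (X N g s)) - (\<Sum>k\<in>UNIV. L r k * Dk k N f)\<bar> <= c * w N a K))"
 have "\<exists>c. P r c" for r unfolding P_def by (rule smallD[OF L[unfolded S_def]])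
 then obtain c where P: "!!r. P r (c r)" using choice[of P] by blast
 have c: "0 <= c r" for r using P[of r] by (simp only: P_def)
 have c2: "\<bar>E N n (%g s. X N g s $ r * f (X N g s)) - (\<Sum>k\<in>UNIV. L r k * Dk k N f)\<bar> <= c r * w N a K"
  if "1 <= N" "tame a K f" for r N a K f
  using P[of r, unfolded P_def, THEN conjunct2, rule_format, OF order_refl that] .
 show ?thesis
 proof (rule that[of "1 + (\<Sum>r\<in>UNIV. c r)" L])
  show "0 < 1 + (\<Sum>r\<in>UNIV. c r)" using sum_nonneg[of UNIV c] c by (simp add: add_pos_nonneg)
  fix r and N :: nat and a K f assume N: "1 <= N" and f: "tame a K (f :: real ^ ('n + 'n) => real)"
  have "c r <= 1 + (\<Sum>r\<in>UNIV. c r)" using member_le_sum[of r UNIV c] c by simp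
  then have "c r * w N a K <= (1 + (\<Sum>r\<in>UNIV. c r)) * w N a K" by (rule mult_right_mono[OF _ w_nonneg[OF f]])
  then show "\<bar>E N n (%g s. X N g s $ r * f (X N g s)) - (\<Sum>k\<in>UNIV. L r k * Dk k N f)\<bar> <= (1 + (\<Sum>r\<in>UNIV. c r)) * w N a K"
   using c2[OF N f, of r] by linarith
 qed
qed

text \<open>Take coordinates as test functions. The bound involves the second moment itself, which is first shown to
stay bounded.\<close>

lemma second_moment_limit:
 fixes C :: real
 assumes C: "0 < C" and L: "!!r N a K f. 1 <= N ==> tame a K f ==>
  \<bar>E N n (%g s. X N g s $ r * f (X N g s)) - (\<Sum>k\<in>UNIV. L r k * Dk k N f)\<bar> <= C * w N a K"
 shows "(%N. E N n (%g s. X N g s $ r * X N g s $ k)) \<longlonglongrightarrow> L r k"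
proof -
 have pd: "pd j (%x :: real ^ ('n + 'n). x $ k) x = (if j = k then 1 else 0)" for j x
  using partial_derivI[OF bounded_linear.has_derivative[OF bounded_linear_vec_nth has_derivative_ident], of j k x] by (simp add: axis_def)
 have D: "Dk j N (%x. x $ k) = (if j = k then 1 else 0)" for j N
  by (simp add: Dk_def pd sk.gex_const)
 let ?S = "%N. E N n (%g s. X N g s $ k * X N g s $ k)"
 have S0: "0 <= ?S N" for N by (rule sk.gex_nonneg) simp
 have bd: "\<bar>E N n (%g s. X N g s $ r * X N g s $ k) - L r k\<bar> <= C * (2 + ?S N) / rtN N" if N: "1 <= N" for N r
 proof -
  note t = tame_coordinate[of k]
  note gX = X_grows(1)[OF t order_refl N]
  have "E N n (%g s. (1 + \<bar>X N g s $ k\<bar>)^2) <= E N n (%g s. 2 + 2 * (X N g s $ k * X N g s $ k))"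
  proof (rule sk.gex_mono)
   show "grows N n (%g s. (1 + \<bar>X N g s $ k\<bar>)^2)" "grows N n (%g s. 2 + 2 * (X N g s $ k * X N g s $ k))"
    by (intro grows_power grows_add grows_const grows_abs gX grows_mult)+
   show "(1 + \<bar>X N g s $ k\<bar>)^2 <= 2 + 2 * (X N g s $ k * X N g s $ k)" for g s
    using zero_le_power2[of "1 - \<bar>X N g s $ k\<bar>"] by (simp add: power2_eq_square algebra_simps flip: abs_mult)
  qed
  also have "... = 2 + 2 * ?S N"
   by (simp only: sk.gex_add[OF grows_const grows_mult[OF grows_const grows_mult[OF gX gX]]] sk.gex_cmult sk.gex_const)
  also have "... <= (2 + ?S N)^2" using S0[of N] by (simp add: power2_eq_square algebra_simps)
  finally have "sqrt (E N n (%g s. (1 + \<bar>X N g s $ k\<bar>)^2)) <= 2 + ?S N" using S0[of N] by (intro real_le_lsqrt) auto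
  then have "w N 1 (%x. 1 + \<bar>x $ k\<bar>) <= (2 + ?S N) / rtN N"
   unfolding w_def by (simp add: divide_right_mono)
  from mult_left_mono[OF this, of C] C L[OF N t, of r] show ?thesis
   by (simp add: D if_distrib cong: if_cong)
 qed
 have "(%N. C / rtN N) \<longlonglongrightarrow> 0" by real_asymp
 then have "\<forall>\<^sub>F N in sequentially. C / rtN N < 1 / 2" by (rule order_tendstoD) simp
 then have "\<forall>\<^sub>F N in sequentially. \<bar>E N n (%g s. X N g s $ r * X N g s $ k) - L r k\<bar> <= C * (4 + 2 * \<bar>L k k\<bar>) / rtN N"
  using eventually_ge_at_top[of 1]
 proof eventually_elim
  case (elim N)
  have "(C / rtN N) * (2 + ?S N) <= 1 / 2 * (2 + ?S N)"
   using S0[of N] elim(1) by (intro mult_right_mono) auto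
  moreover have "(C / rtN N) * (2 + ?S N) = C * (2 + ?S N) / rtN N" by simp
  moreover have "1 / 2 * (2 + ?S N) = 1 + ?S N / 2" by simp
  moreover have "?S N - \<bar>L k k\<bar> <= \<bar>?S N - L k k\<bar>" by linarith
  ultimately have "?S N <= 2 + 2 * \<bar>L k k\<bar>" using bd[OF elim(2), of k] by linarith
  then have "C * (2 + ?S N) / rtN N <= C * (4 + 2 * \<bar>L k k\<bar>) / rtN N"
   using C by (intro divide_right_mono mult_left_mono) auto
  with bd[OF elim(2), of r] show ?case by linarith
 qed
 note ev = this
 have lim0: "(%N. C * (4 + 2 * \<bar>L k k\<bar>) / rtN N) \<longlonglongrightarrow> 0" by real_asymp
 have "(%N. E N n (%g s. X N g s $ r * X N g s $ k) - L r k) \<longlonglongrightarrow> 0"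
  by (rule Lim_null_comparison[OF _ lim0]) (use ev in \<open>simp only: real_norm_def\<close>)
 then show ?thesis by (simp add: LIM_zero_iff)
qed

theorem tame_expansion:
 obtains Cov :: "real ^ ('n + 'n) ^ ('n + 'n)" and C where "pos_semidef Cov" "0 < C"
  "!!r N a K f. 1 <= N ==> tame a K f ==>
   \<bar>E N n (%g s. X N g s $ r * f (X N g s)) - (\<Sum>k\<in>UNIV. Cov $ r $ k * Dk k N f)\<bar> <= C * w N a K"
proof -
 obtain L C where C: "0 < C" and L: "!!r N a K f. 1 <= N ==> tame a K f ==>
  \<bar>E N n (%g s. X N g s $ r * f (X N g s)) - (\<Sum>k\<in>UNIV. L r k * Dk k N f)\<bar> <= C * w N a K"
  by (rule coordinate_expansion) blast
 note lim = second_moment_limit[OF C L]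
 define Cov :: "real ^ ('n + 'n) ^ ('n + 'n)" where "Cov = (\<chi> r k. L r k)"
 have sym: "L r k = L k r" for r k
 proof (rule LIMSEQ_unique[OF lim])
  show "(%N. E N n (%g s. X N g s $ r * X N g s $ k)) \<longlonglongrightarrow> L k r"
   using lim[of k r] by (simp add: mult.commute)
 qed
 have "0 <= v \<bullet> (Cov *v v)" for v
 proof -
  have "(%N. \<Sum>r\<in>UNIV. \<Sum>k\<in>UNIV. v $ r * v $ k * E N n (%g s. X N g s $ r * X N g s $ k)) \<longlonglongrightarrow> (\<Sum>r\<in>UNIV. \<Sum>k\<in>UNIV. v $ r * v $ k * L r k)"
   by (intro tendsto_sum tendsto_mult tendsto_const lim)
  moreover have "0 <= (\<Sum>r\<in>UNIV. \<Sum>k\<in>UNIV. v $ r * v $ k * E N n (%g s. X N g s $ r * X N g s $ k))" if N: "1 <= N" for N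
  proof -
   have gX: "grows N n (%g s. X N g s $ k)" for k by (rule X_grows(1)[OF tame_coordinate order_refl N])
   have "(\<Sum>r\<in>UNIV. \<Sum>k\<in>UNIV. v $ r * v $ k * E N n (%g s. X N g s $ r * X N g s $ k)) =
    E N n (%g s. \<Sum>r\<in>UNIV. \<Sum>k\<in>UNIV. v $ r * v $ k * (X N g s $ r * X N g s $ k))"
    by (simp only: sk.gex_sum[OF grows_sum[OF grows_mult[OF grows_const grows_mult[OF gX gX]]]]
     sk.gex_sum[OF grows_mult[OF grows_const grows_mult[OF gX gX]]] sk.gex_cmult)
   also have "... = E N n (%g s. (\<Sum>r\<in>UNIV. v $ r * X N g s $ r)^2)"
    by (simp add: power2_eq_square sum_product mult_ac)
   also have "... >= 0" by (rule sk.gex_nonneg) simp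
   finally show ?thesis .
  qed
  ultimately have "0 <= (\<Sum>r\<in>UNIV. \<Sum>k\<in>UNIV. v $ r * v $ k * L r k)" by (intro LIMSEQ_le_const) auto
  also have "... = v \<bullet> (Cov *v v)"
   by (simp add: inner_vec_def matrix_vector_mult_def Cov_def sum_distrib_left mult_ac)
  finally show ?thesis .
 qed
 then have "pos_semidef Cov" unfolding pos_semidef_def by (auto simp: Cov_def transpose_def vec_eq_iff sym)
 moreover have "L r k = Cov $ r $ k" for r k by (simp add: Cov_def)
 ultimately show ?thesis using that[of Cov C] C L by simp
qed

section \<open>Labelling the replicas\<close>

lemma nu_eq_E: "nu N be h UNIV Ph = E N n (%g s. Ph g (%i. s (io i)))" for Ph :: "_ => ('n => nat => real) => real"
 unfolding nu_eq sk.gex_def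
proof (intro Bochner_Integration.integral_cong refl gavg_reindex[symmetric])
 show "inj_on io UNIV" "io ` UNIV \<subseteq> {..<n}" using io by (auto simp: bij_betw_def)
 show "dep UNIV (Ph g)" for g by (simp add: dep_def flip: fun_eq_iff)
 show "(\<Sum>a\<in>configs N. gb (configs N) (Ham N be h g) a) = 1" for g
  by (rule gb_sum[OF finite_configs configs_nonempty])
qed simp

lemma nu_grad_component:
 assumes f: "tame a K f" and N: "1 <= N"
 shows "nu N be h UNIV (%g s. grad f (fluct N be q1 q g s)) $ k = Dk k N f"
proof -
 let ?Ph = "%g s. grad f (fluct N be q1 q g (s :: 'n => nat => real))"
 let ?r = "%k g. replica_avg N be h g UNIV (%s. ?Ph g s $ k)"
 have r: "?r k g = gavg (configs N) (gb (configs N) (Ham N be h g)) {..<n} (%s. pd k f (X N g s))" for k g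
 proof -
  have "gavg (configs N) (gb (configs N) (Ham N be h g)) {..<n} (%s. (%s. ?Ph g s $ k) (%i. s (io i))) =
   gavg (configs N) (gb (configs N) (Ham N be h g)) UNIV (%s. ?Ph g s $ k)"
  proof (rule gavg_reindex)
   show "inj_on io UNIV" "io ` UNIV \<subseteq> {..<n}" using io by (auto simp: bij_betw_def)
   show "dep UNIV (%s. ?Ph g s $ k)" by (simp add: dep_def flip: fun_eq_iff)
   show "(\<Sum>a\<in>configs N. gb (configs N) (Ham N be h g) a) = 1"
    by (rule gb_sum[OF finite_configs configs_nonempty])
  qed simp
  then show ?thesis unfolding replica_avg_eq_gavg by (simp add: X_def grad_def)
 qed
 have i: "integrable (couplings N) (?r k)" for k
  unfolding r couplings_def by (rule sk.gex_integrable[OF X_grows(2)[OF f order_refl N]])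
 have "replica_avg N be h g UNIV (?Ph g) = (\<Sum>k\<in>UNIV. ?r k g *\<^sub>R axis k 1)" for g
  by (simp add: vec_eq_iff replica_avg_def axis_def sum_component if_distrib cong: if_cong)
 then have "nu N be h UNIV ?Ph = (\<Sum>k\<in>UNIV. (\<integral>g. ?r k g \<partial>couplings N) *\<^sub>R axis k 1)"
  unfolding nu_def using i by simp
 then have "nu N be h UNIV ?Ph $ k = (\<integral>g. ?r k g \<partial>couplings N)"
  by (simp add: axis_def if_distrib cong: if_cong)
 then show ?thesis unfolding r Dk_def sk.gex_def couplings_def .
qed

lemma weight_le:
 assumes G: "real_polynomial_function G" "growth_const G d CG" and a: "0 <= a" and N: "1 <= N"
 shows "w N a (dsup G) <= a * (CG * sqrt (nu N be h UNIV (%g s. (1 + norm (fluct N be q1 q g (s :: 'n => nat => real))) ^ (2 * d)))) / rtN N"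
proof -
 have CG: "0 < CG" using G(2) by (simp add: growth_const_def)
 interpret e: est N 1 be h q io n q1 C0 by (rule N_est[OF N])
 have XX: "X N = e.Xf" by (simp add: fun_eq_iff X_def e.Xf_def)
 have b: "\<bar>1 + norm x\<bar> <= 1 * exp (2 * n1 x)" for x :: "real ^ ('n + 'n)"
 proof -
  have "\<bar>1 + norm x\<bar> = 1 + norm x" by simp
  then show ?thesis using exp_ge_add_one_self[of "2 * n1 x"] norm_le_n1[of x] n1_nonneg[of x] by linarith
 qed
 have gn: "grows N n (%g s. 1 + norm (X N g s))"
  unfolding XX by (rule e.grows_compose(2)[OF _ b order_refl]) (intro continuous_intros)
 have bs: "\<bar>dsup G x\<bar> <= CG * (1 + norm x) ^ d" for x
  using dsup_le[OF G, of x] dsup_nonneg[OF G, of x] by simp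
 have gd: "grows N n (%g s. dsup G (X N g s))"
  by (rule X_grows(3)[OF tame_product[OF zero_test G] order_refl N])
 have "E N n (%g s. (dsup G (X N g s))^2) <= E N n (%g s. CG^2 * (1 + norm (X N g s)) ^ (2 * d))"
 proof (rule sk.gex_mono)
  show "grows N n (%g s. (dsup G (X N g s))^2)" by (rule grows_power[OF gd])
  show "grows N n (%g s. CG^2 * (1 + norm (X N g s)) ^ (2 * d))" by (rule grows_mult[OF grows_const grows_power[OF gn]])
  fix g s
  have "(dsup G (X N g s))^2 <= (CG * (1 + norm (X N g s)) ^ d)^2"
   using bs[of "X N g s"] by (intro abs_le_square_iff[THEN iffD1]) simp
  then show "(dsup G (X N g s))^2 <= CG^2 * (1 + norm (X N g s)) ^ (2 * d)"
   by (simp add: power_mult_distrib power_mult[symmetric] mult.commute)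
 qed
 also have "... = CG^2 * nu N be h UNIV (%g s. (1 + norm (fluct N be q1 q g (s :: 'n => nat => real))) ^ (2 * d))"
  unfolding sk.gex_cmult nu_eq_E X_def ..
 finally have "sqrt (E N n (%g s. (dsup G (X N g s))^2)) <= CG * sqrt (nu N be h UNIV (%g s. (1 + norm (fluct N be q1 q g (s :: 'n => nat => real))) ^ (2 * d)))"
  using CG real_sqrt_le_mono by (fastforce simp: real_sqrt_mult)
 then show ?thesis unfolding w_def using a by (intro divide_right_mono mult_left_mono) auto
qed

end

lemma q_moment_tmom: "q_moment be (be * h) q k = tmom be h q k"
 by (simp add: q_moment_def tmom_def mult.assoc)

lemma high_temperature_sixth:
 "nu N be h {1, 2 :: nat} (%g s. (overlap N (s 1) (s 2) - q) ^ 6) = sk.gex N be h 2 (%g s. (overlap N (s 0) (s 1) - q) ^ 6)"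
 unfolding nu_eq sk.gex_def
proof (intro Bochner_Integration.integral_cong refl)
 fix g
 have "gavg (configs N) (gb (configs N) (Ham N be h g)) {1, 2::nat} (%s. (%s. (overlap N (s 0) (s 1) - q) ^ 6) (%j. s (Suc j))) =
  gavg (configs N) (gb (configs N) (Ham N be h g)) {..<2::nat} (%s. (overlap N (s 0) (s 1) - q) ^ 6)"
 proof (rule gavg_reindex)
  show "dep {..<2::nat} (%s. (overlap N (s 0) (s 1) - q) ^ 6)" by (rule depI) simp
  show "(\<Sum>a\<in>configs N. gb (configs N) (Ham N be h g) a) = 1"
   by (rule gb_sum[OF finite_configs configs_nonempty])
 qed auto
 then show "gavg (configs N) (gb (configs N) (Ham N be h g)) {1, 2::nat} (%s. (overlap N (s 1) (s 2) - q) ^ 6) =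
  gavg (configs N) (gb (configs N) (Ham N be h g)) {..<2::nat} (%s. (overlap N (s 0) (s 1) - q) ^ 6)"
  by (simp add: numeral_2_eq_2)
qed

lemma q_moment_square_bounds: "0 <= q_moment be h' q 2" "q_moment be h' q 2 <= 1"
proof -
 show "0 <= q_moment be h' q 2" unfolding q_moment_def by (rule integral_nonneg_AE) simp
 have "q_moment be h' q 2 <= (\<integral>z. 1 \<partial>std_gauss)"
  unfolding q_moment_def
 proof (rule integral_mono)
  show "integrable std_gauss (%z. (tanh (be * sqrt q * z + h'))^2)"
   by (rule std_gauss.integrable_const_bound[of _ 1])
    (use tanh_square_bounds in \<open>auto simp: less_imp_le measurable_cong_sets[OF sets_std_gauss refl]\<close>)
 qed (use tanh_square_bounds in \<open>auto simp: less_imp_le\<close>)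
 also have "... = 1" using std_gauss.prob_space by simp
 finally show "q_moment be h' q 2 <= 1" .
qed

theorem theorem1p6:
  fixes \<beta> h h' q2 :: real
  assumes "\<beta> \<ge> 0"
    and "h' = h \<or> h' = \<beta> * h"
    and "q2 = q_moment \<beta> h' q2 2"
    and "high_temperature \<beta> h q2"
    and "invertible_on (replica_pairs CARD('n::finite))
           (\<lambda>a b. id_matrix a b
              - \<beta>\<^sup>2 * replica_matrix CARD('n) q2 (q_moment \<beta> h' q2 4) a b)"
  defines "X \<equiv> \<lambda>N. fluct N \<beta> (q_moment \<beta> h' q2 1) q2 ::
             (nat \<times> nat \<Rightarrow> real) \<Rightarrow> ('n \<Rightarrow> nat \<Rightarrow> real) \<Rightarrow> real ^ ('n + 'n)"
  shows "\<exists>Cov :: real ^ ('n + 'n) ^ ('n + 'n). pos_semidef Cov \<and>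
    (\<exists>C>0. \<forall>F\<in>test_functions. \<forall>c. finite {a. c a \<noteq> 0} \<longrightarrow>
      (let G = poly_fun c; d = total_degree c; GF = (\<lambda>x. G x * F x) in
       \<forall>CG. growth_const G d CG \<longrightarrow> (\<forall>N\<ge>1. \<forall>i :: 'n.
         is_Er C N \<beta> h (X N) F d CG
           (nu N \<beta> h UNIV (\<lambda>g s. energy_fluct N \<beta> q2 g (s i) * GF (X N g s))
             - (Cov *v nu N \<beta> h UNIV (\<lambda>g s. grad GF (X N g s))) $ Inl i) \<and>
         is_Er C N \<beta> h (X N) F d CG
           (nu N \<beta> h UNIV (\<lambda>g s. magn_fluct N (q_moment \<beta> h' q2 1) (s i) * GF (X N g s))
             - (Cov *v nu N \<beta> h UNIV (\<lambda>g s. grad GF (X N g s))) $ Inr i))))"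
proof -
 define q1 where "q1 = q_moment \<beta> h' q2 1"
 have q: "0 <= q2" "q2 <= 1"
  using q_moment_square_bounds[of \<beta> h' q2] assms(3) by simp_all
 obtain C0 where C0: "0 < C0" "!!N. 1 <= N ==> sk.gex N \<beta> h 2 (%g s. (overlap N (s 0) (s 1) - q2) ^ 6) <= C0 / real N ^ 3"
  using assms(4) unfolding high_temperature_def high_temperature_sixth by blast
 interpret hc: hightemp_cond \<beta> h q2 C0
  using assms(1) q C0 by unfold_locales auto
 have h': "h' = \<beta> * h"
 proof (cases "h' = \<beta> * h")
  case False
  then have "h' = h" using assms(2) by simp
  then have "(\<integral>z. (tanh (\<beta> * sqrt q2 * z + h))\<^sup>2 \<partial>std_gauss) = (\<integral>z. (tanh (\<beta> * sqrt q2 * z + \<beta> * h))\<^sup>2 \<partial>std_gauss)"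
   using assms(3) hc.fixed_point unfolding q_moment_def tmom_def by (simp add: mult.assoc)
  then have "\<bar>h\<bar> = \<bar>\<beta> * h\<bar>" by (rule tanh_square_mean_inj[rotated]) (use assms(1) q in simp)
  then have "\<bar>h\<bar> = \<beta> * \<bar>h\<bar>" using assms(1) by (simp add: abs_mult)
  then have "\<beta> = 1 \<or> h = 0" by auto
  then show ?thesis using \<open>h' = h\<close> by auto
 qed simp
 obtain \<iota> :: "'n => nat" where \<iota>: "bij_betw \<iota> UNIV {..<CARD('n)}"
  using ex_bij_betw_finite_nat[of "UNIV :: 'n set"] unfolding atLeast0LessThan by auto
 interpret H: hightemp \<beta> h q2 \<iota> "CARD('n)" q1 C0
 proof
  show "tmom \<beta> h q2 1 = q1" unfolding q1_def h' q_moment_tmom ..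
 qed (use assms(1) q C0 \<iota> hc.fixed_point hc.stability in auto)
 have X: "X N = fluct N \<beta> q1 q2" for N unfolding X_def q1_def ..
 obtain Cov C where psd: "pos_semidef Cov" and C: "0 < C"
  and main: "!!r N a K f. 1 <= N ==> tame a K f ==>
   \<bar>H.E N CARD('n) (%g s. H.X N g s $ r * f (H.X N g s)) - (\<Sum>k\<in>UNIV. Cov $ r $ k * H.Dk k N f)\<bar> <= C * H.w N a K"
  by (rule H.tame_expansion) blast
 have Er: "is_Er (4 * C) N \<beta> h (X N) F d CG
   (nu N \<beta> h UNIV (%g s. X N g s $ r * (G (X N g s) * F (X N g s))) - (Cov *v nu N \<beta> h UNIV (%g s. grad (%x. G x * F x) (X N g s))) $ r)"
  if F: "F \<in> test_functions" and G: "real_polynomial_function G" and gr: "growth_const G d CG" and N: "1 <= N" for F G d CG N r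
 proof -
  let ?f = "%x. G x * F x"
  define b where "b = 1 + sup_norm F + sup_norm (grad F) + lip_const (grad F)"
  define B where "B = CG * sqrt (nu N \<beta> h UNIV (%g s. (1 + norm (X N g s)) ^ (2 * d)))"
  have t: "tame (4 * b) (dsup G) ?f" unfolding b_def by (rule tame_product[OF F G gr])
  have b: "0 <= 4 * b" by (rule tameD(1)[OF t])
  have "(Cov *v nu N \<beta> h UNIV (%g s. grad ?f (X N g s))) $ r = (\<Sum>k\<in>UNIV. Cov $ r $ k * H.Dk k N ?f)"
   unfolding X matrix_vector_mult_def by (simp add: H.nu_grad_component[OF t N])
  moreover have "nu N \<beta> h UNIV (%g s. X N g s $ r * ?f (X N g s)) = H.E N CARD('n) (%g s. H.X N g s $ r * ?f (H.X N g s))"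
   unfolding H.nu_eq_E X H.X_def ..
  ultimately have "\<bar>nu N \<beta> h UNIV (%g s. X N g s $ r * ?f (X N g s)) - (Cov *v nu N \<beta> h UNIV (%g s. grad ?f (X N g s))) $ r\<bar> <= C * H.w N (4 * b) (dsup G)"
   using main[OF N t, of r] by simp
  also have "... <= C * ((4 * b) * B / sqrt (real N))"
   unfolding B_def X using C by (intro mult_left_mono H.weight_le[OF G gr b N]) simp
  also have "... = b * B * (4 * C / sqrt (real N))" by simp
  also have "... <= b * (1 + B) * (4 * C / sqrt (real N))"
   using b C by (intro mult_right_mono mult_left_mono) auto
  finally show ?thesis unfolding is_Er_def b_def B_def .
 qed
 show ?thesis
  unfolding Let_def
 proof (intro exI[of _ Cov] exI[of _ "4 * C"] conjI psd ballI allI impI)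
  show "0 < 4 * C" using C by simp
  fix F :: "real ^ ('n + 'n) => real" and c :: "('n + 'n => nat) => real" and CG and N :: nat and i :: 'n
  assume F: "F \<in> test_functions" and c: "finite {a. c a ~= 0}" and gr: "growth_const (poly_fun c) (total_degree c) CG" and N: "1 <= N"
  note E = Er[OF F real_poly_poly_fun[OF c] gr N]
  show "is_Er (4 * C) N \<beta> h (X N) F (total_degree c) CG
      (nu N \<beta> h UNIV (%g s. energy_fluct N \<beta> q2 g (s i) * (poly_fun c (X N g s) * F (X N g s)))
       - (Cov *v nu N \<beta> h UNIV (%g s. grad (%x. poly_fun c x * F x) (X N g s))) $ Inl i)"
   using E[of "Inl i"] by (simp add: X fluct_def)
  show "is_Er (4 * C) N \<beta> h (X N) F (total_degree c) CG
      (nu N \<beta> h UNIV (%g s. magn_fluct N (q_moment \<beta> h' q2 1) (s i) * (poly_fun c (X N g s) * F (X N g s)))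
       - (Cov *v nu N \<beta> h UNIV (%g s. grad (%x. poly_fun c x * F x) (X N g s))) $ Inr i)"
   using E[of "Inr i"] by (simp add: X fluct_def q1_def)
 qed
qed

end
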